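(* Let assumptions (H1), (H2), (H3) stated in the context hold. Suppose that $(\hat u^0,\hat u)\in(\mathcal L^2_{\mathscr F^0}\times\mathcal L^2_{\mathscr F})(0,T)$ is a solution of problem (P) defined in the context, let $(\hat X^0,\hat X)\in(\mathcal S^2_{\mathscr F^0}\times\mathcal S^2_{\mathscr F})(0,T)$ be the corresponding state processes, and let $(\hat p^0,\hat q^0)\in(\mathcal S^2_{\mathscr F^0}\times\mathcal L^2_{\mathscr F^0})(0,T)$ and $(\hat p,\hat q,\hat{\tilde q})\in(\mathcal S^2_{\mathscr F}\times\mathcal L^2_{\mathscr F}\times\mathcal L^2_{\mathscr F})(0,T)$ be the adjoint processes defined as the solutions of $$d\hat p^0_t=-H^0_{x^0}(t,\hat X^0_t,\hat p^0_t,\hat q^0_t,\hat u^0_t,\mathcal L(\hat X_t|\mathscr F^0_t))dt+\hat q^0_tdW^0_t,\quad \hat p^0_T=g^0_{x^0}(\hat X^0_T,\mathcal L(\hat X_T|\mathscr F^0_T)),$$ $$d\hat p_t=-H_x(t,\hat X_t,\hat p_t,\hat q_t,\hat{\tilde q}_t,\hat u_t,\mathcal L(\hat X_t|\mathscr F^0_t),\hat X^0_t)dt+\hat q_tdW_t+\hat{\tilde q}_tdW^0_t,\quad \hat p_T=g_x(\hat X_T,\mathcal L(\hat X_T|\mathscr F^0_T),\hat X^0_T).$$ Then (as elements of $\mathcal L^2_{\mathscr F^0}(0,T)$ and $\mathcal L^2_{\mathscr F}(0,T)$ respectively) $$\hat u^0_t=\hat u^0(t,\hat X^0_t,\hat p^0_t,\hat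 q^0_t,\mathcal L(\hat X_t|\mathscr F^0_t)),\qquad \hat u_t=\hat u(t,\hat X_t,\hat p_t,\hat q_t,\hat{\tilde q}_t,\hat X^0_t),$$ where $\hat u^0(\cdot),\hat u(\cdot)$ on the right-hand sides are the minimizing functions of the context. That is, $(\hat X^0,\hat p^0,\hat q^0,\hat X,\hat p,\hat q,\hat{\tilde q})$ is a solution of the FBSDE system (F) of the context.
   Context: Setting. $T>0$; $(\Omega,\mathbb P)$ is a complete probability space carrying two independent one-dimensional Brownian motions $W^0,W$ and square-integrable real random variables $\xi^0,\xi$, with $\xi^0,\xi,W^0,W$ independent. $\mathscr F^0$ is the natural filtration of $(\xi^0,W^0)$ and $\mathscr F$ that of $(\xi^0,\xi,W^0,W)$, both augmented by the $\mathbb P$-null sets. $\mathcal L(\cdot|\mathscr F^0_t)$ is the conditional law given $\mathscr F^0_t$. For a filtration $\mathscr G$, $\mathcal L^2_{\mathscr G}(0,T)$ (resp. $\mathcal S^2_{\mathscr G}(0,T)$) is the set of $\mathscr G$-progressively measurable real processes $\alpha$ with $\mathbb E\int_0^T|\alpha_t|^2dt<\infty$ (resp. $\mathbb E[\sup_{0\le t\le T}|\alpha_t|^2]<\infty$). $\mathcal P_2(\mathbb R)$ is the space of Borel probability measures $m$ on $\mathbb R$ with $|m|_2:=(\int x^2dm(x))^{1/2}<\infty$, with the 2-Wasserstein distance $W_2$; Lipschitz continuity in $m$ is with respect to $W_2$. $\mathcal P^2_{\mathscr F^0}(0,T)$ is the set of $\mathscr F^0$-progressively measurable flows $m=(m_t)_{0\le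 t\le T}$ of probability measures with $\mathbb E[\sup_t|m_t|_2^2]<\infty$. Coefficients (measurable): $b^0,\sigma^0,b,\sigma,\tilde\sigma,f^0:[0,T]\times\mathbb R\times\mathbb R\times\mathcal P_2(\mathbb R)\to\mathbb R$, $f:[0,T]\times\mathbb R\times\mathbb R\times\mathcal P_2(\mathbb R)\times\mathbb R\to\mathbb R$, $g^0:\mathbb R\times\mathcal P_2(\mathbb R)\to\mathbb R$, $g:\mathbb R\times\mathcal P_2(\mathbb R)\times\mathbb R\to\mathbb R$. Constants: $L\ge1$ is used for all bounds and growth conditions below; $L_m,l_m,l_{x^0}\ge 0$ satisfy $\max\{L_m,l_m,l_{x^0}\}\le L$. "Grows linearly" (resp. "quadratic growth") in some arguments means bounded in absolute value by $L(1+\text{sum of the norms of the arguments})$ (resp. by $L(1+\text{sum of the squares of the norms})$), the norm of $m$ being $|m|_2$. (H1) For $\phi=b^0,\sigma^0,b,\sigma,\tilde\sigma$: $\phi(t,x,u,m)=\phi_0(t,m)+\phi_1(t)x+\phi_2(t)u$, where $\phi_0$ grows linearly in $m$ and $\phi_1,\phi_2$ are bounded by $L$. $b_0,\sigma_0,\tilde\sigma_0$ are $L_m$-Lipschitz in $m$; $b^0_0,\sigma^0_0$ are $l_m$-Lipschitz in $m$. (H2) $f^0(t,0,0,m)$ and $g^0(0,m)$ have quadratic growth in $m$. $f^0,g^0$ are differentiable in $(x^0,u^0)$, with derivatives growing linearly in $(x^0,u^0,m)$, $L$-Lipschitz in $(x^0,u^0)$ and $l_m$-Lipschitz in $m$.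 $f(t,0,0,m,x^0)$ and $g(0,m,x^0)$ have quadratic growth in $(m,x^0)$. $f(t,x,u,m,x^0)=f^1(t,x,u,x^0)+f^2(t,x,m,x^0)$. $f^1,f^2,g$ are differentiable in $(x,u)$, with derivatives growing linearly in $(x,u,m,x^0)$, $L$-Lipschitz in $(x,u,m)$ and $l_{x^0}$-Lipschitz in $x^0$. (H3) $g^0$ is convex in $x^0$, and for some $C_{f^0}\ge L^{-1}$, for all $t,m,x^0_1,x^0_2,u^0_1,u^0_2$: $f^0(t,x^0_2,u^0_2,m)-f^0(t,x^0_1,u^0_1,m)-(f^0_{x^0},f^0_{u^0})(t,x^0_1,u^0_1,m)\cdot(x^0_2-x^0_1,u^0_2-u^0_1)\ge C_{f^0}|u^0_2-u^0_1|^2$. $f^2,g$ are convex in $x$, and for some $C_f\ge L^{-1}$, for all $t,x^0,x_1,x_2,u_1,u_2$: $f^1(t,x_2,u_2,x^0)-f^1(t,x_1,u_1,x^0)-(f^1_x,f^1_u)(t,x_1,u_1,x^0)\cdot(x_2-x_1,u_2-u_1)\ge C_f|u_2-u_1|^2$. Problem (P). For $m\in\mathcal P^2_{\mathscr F^0}(0,T)$, $u^0\in\mathcal L^2_{\mathscr F^0}(0,T)$, $u\in\mathcal L^2_{\mathscr F}(0,T)$ let $X^{0,u^0}_t=\xi^0+\int_0^tb^0(s,X^{0,u^0}_s,u^0_s,m_s)ds+\int_0^t\sigma^0(s,X^{0,u^0}_s,u^0_s,m_s)dW^0_s$, $X^u_t=\xi+\int_0^tb(s,X^u_s,u_s,m_s)ds+\int_0^t\sigma(s,X^u_s,u_s,m_s)dW_s+\int_0^t\tilde\sigma(s,X^u_s,u_s,m_s)dW^0_s$,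 $J_0(u^0|m)=\mathbb E[\int_0^Tf^0(t,X^{0,u^0}_t,u^0_t,m_t)dt+g^0(X^{0,u^0}_T,m_T)]$, $J(u|\hat u^0,m)=\mathbb E[\int_0^Tf(t,X^u_t,u_t,m_t,X^{0,\hat u^0}_t)dt+g(X^u_T,m_T,X^{0,\hat u^0}_T)]$. A pair $(\hat u^0,\hat u)\in\mathcal L^2_{\mathscr F^0}(0,T)\times\mathcal L^2_{\mathscr F}(0,T)$ is a solution of (P) if, for some $m\in\mathcal P^2_{\mathscr F^0}(0,T)$, $\hat u^0$ minimizes $J_0(\cdot|m)$ over $\mathcal L^2_{\mathscr F^0}(0,T)$, $\hat u$ minimizes $J(\cdot|\hat u^0,m)$ over $\mathcal L^2_{\mathscr F}(0,T)$, and $m_t=\mathcal L(X^{\hat u}_t|\mathscr F^0_t)$ for all $t\in[0,T]$. The corresponding state processes are $\hat X^0=X^{0,\hat u^0}$ and $\hat X=X^{\hat u}$. Hamiltonians and minimizers. $H^0(t,x^0,p^0,q^0,u^0,m)=b^0(t,x^0,u^0,m)p^0+\sigma^0(t,x^0,u^0,m)q^0+f^0(t,x^0,u^0,m)$; $H(t,x,p,q,\tilde q,u,m,x^0)=b(t,x,u,m)p+\sigma(t,x,u,m)q+\tilde\sigma(t,x,u,m)\tilde q+f(t,x,u,m,x^0)$; $\hat u^0(t,x^0,p^0,q^0,m)=\arg\min_{u^0\in\mathbb R}H^0$; $\hat u(t,x,p,q,\tilde q,x^0)=\arg\min_{u\in\mathbb R}H$ (unique minimizers; $\hat u$ does not depend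 on $m$ because of the structure of $f$ and (H1)). System (F). With $m_t:=\mathcal L(X_t|\mathscr F^0_t)$, $\hat u^0_t:=\hat u^0(t,X^0_t,p^0_t,q^0_t,m_t)$, $\hat u_t:=\hat u(t,X_t,p_t,q_t,\tilde q_t,X^0_t)$: $dX^0_t=b^0(t,X^0_t,\hat u^0_t,m_t)dt+\sigma^0(t,X^0_t,\hat u^0_t,m_t)dW^0_t$, $X^0_0=\xi^0$; $dp^0_t=-H^0_{x^0}(t,X^0_t,p^0_t,q^0_t,\hat u^0_t,m_t)dt+q^0_tdW^0_t$, $p^0_T=g^0_{x^0}(X^0_T,m_T)$; $dX_t=b(t,X_t,\hat u_t,m_t)dt+\sigma(t,X_t,\hat u_t,m_t)dW_t+\tilde\sigma(t,X_t,\hat u_t,m_t)dW^0_t$, $X_0=\xi$; $dp_t=-H_x(t,X_t,p_t,q_t,\tilde q_t,\hat u_t,m_t,X^0_t)dt+q_tdW_t+\tilde q_tdW^0_t$, $p_T=g_x(X_T,m_T,X^0_T)$. *)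

theory Defs
  imports "HOL-Probability.Probability"
begin

section \<open>Probability measures with finite second moment\<close>

definition P2 :: "real measure set" where
  "P2 = {m \<in> space (prob_algebra borel). integrable m (\<lambda>x. x\<^sup>2)}"

text \<open>The trace on \<open>P2\<close> of the sigma-algebra generated by the evaluations \<open>m \<mapsto> m A\<close>; it is the
  Borel sigma-algebra of the distance \<open>W2\<close>.\<close>

definition P2_space :: "real measure measure" where
  "P2_space = restrict_space (prob_algebra borel) P2"

definition norm2 :: "real measure \<Rightarrow> real" where
  "norm2 m = sqrt (LINT x|m. x\<^sup>2)"

definition couplings :: "real measure \<Rightarrow> real measure \<Rightarrow> (real \<times> real) measure set" where
  "couplings m m' = {\<pi>. prob_space \<pi> \<and> sets \<pi> = sets (borel \<Otimes>\<^sub>M borel) \<and>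
     distr \<pi> borel fst = m \<and> distr \<pi> borel snd = m'}"

definition W2 :: "real measure \<Rightarrow> real measure \<Rightarrow> real" where
  "W2 m m' = sqrt (INF \<pi>\<in>couplings m m'. (LINT z|\<pi>. (fst z - snd z)\<^sup>2))"


section \<open>Filtrations, process spaces, Brownian motion\<close>

definition rv_generator :: "'a measure \<Rightarrow> ('a \<Rightarrow> real) set \<Rightarrow> 'a set set" where
  "rv_generator M V = {Z -` A \<inter> space M | Z A. Z \<in> V \<and> A \<in> sets borel}"

definition rv_events :: "'a measure \<Rightarrow> ('a \<Rightarrow> real) set \<Rightarrow> 'a set set" where
  "rv_events M V = sigma_sets (space M) (rv_generator M V)"

definition augmented_sigma :: "'a measure \<Rightarrow> ('a \<Rightarrow> real) set \<Rightarrow> 'a measure" where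
  "augmented_sigma M V = sigma (space M) (rv_generator M V \<union> null_sets M)"

definition progressive ::
    "real \<Rightarrow> (real \<Rightarrow> 'a measure) \<Rightarrow> 'b measure \<Rightarrow> (real \<Rightarrow> 'a \<Rightarrow> 'b) \<Rightarrow> bool" where
  "progressive T F N X \<longleftrightarrow>
     (\<forall>t\<in>{0..T}. (\<lambda>(s, \<omega>). X s \<omega>) \<in> measurable (restrict_space borel {0..t} \<Otimes>\<^sub>M F t) N)"

definition L2_proc ::
    "'a measure \<Rightarrow> real \<Rightarrow> (real \<Rightarrow> 'a measure) \<Rightarrow> (real \<Rightarrow> 'a \<Rightarrow> real) set" where
  "L2_proc M T F = {\<alpha>. progressive T F borel \<alpha> \<and>
     (\<integral>\<^sup>+\<omega>. (\<integral>\<^sup>+t\<in>{0..T}. ennreal ((\<alpha> t \<omega>)\<^sup>2) \<partial>lborel) \<partial>M) < \<infinity>}"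

definition S2_proc ::
    "'a measure \<Rightarrow> real \<Rightarrow> (real \<Rightarrow> 'a measure) \<Rightarrow> (real \<Rightarrow> 'a \<Rightarrow> real) set" where
  "S2_proc M T F = {\<alpha>. progressive T F borel \<alpha> \<and>
     (\<integral>\<^sup>+\<omega>. (SUP t\<in>{0..T}. ennreal ((\<alpha> t \<omega>)\<^sup>2)) \<partial>M) < \<infinity>}"

text \<open>Flows are required to be \<open>P2\<close>-valued everywhere, so that they can be inserted in the
  coefficients. Finiteness of the expectation already forces this outside a null set.\<close>

definition P2_flow ::
    "'a measure \<Rightarrow> real \<Rightarrow> (real \<Rightarrow> 'a measure) \<Rightarrow> (real \<Rightarrow> 'a \<Rightarrow> real measure) set" where
  "P2_flow M T F = {m. progressive T F P2_space m \<and>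
     (\<integral>\<^sup>+\<omega>. (SUP t\<in>{0..T}. ennreal ((norm2 (m t \<omega>))\<^sup>2)) \<partial>M) < \<infinity>}"

definition cond_law ::
    "'a measure \<Rightarrow> 'a measure \<Rightarrow> ('a \<Rightarrow> real) \<Rightarrow> ('a \<Rightarrow> real measure) \<Rightarrow> bool" where
  "cond_law M G Z \<mu> \<longleftrightarrow> \<mu> \<in> measurable G (prob_algebra borel) \<and>
     (\<forall>A\<in>sets borel. AE \<omega> in M.
        measure (\<mu> \<omega>) A = real_cond_exp M G (indicator (Z -` A \<inter> space M)) \<omega>)"

definition brownian_motion :: "'a measure \<Rightarrow> real \<Rightarrow> (real \<Rightarrow> 'a \<Rightarrow> real) \<Rightarrow> bool" where
  "brownian_motion M T W \<longleftrightarrow>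
     (\<forall>t\<in>{0..T}. W t \<in> borel_measurable M) \<and>
     (AE \<omega> in M. W 0 \<omega> = 0) \<and>
     (AE \<omega> in M. continuous_on {0..T} (\<lambda>t. W t \<omega>)) \<and>
     (\<forall>s t. 0 \<le> s \<and> s < t \<and> t \<le> T \<longrightarrow>
        distributed M lborel (\<lambda>\<omega>. W t \<omega> - W s \<omega>) (normal_density 0 (sqrt (t - s))) \<and>
        prob_space.indep_set M (rv_events M {\<lambda>\<omega>. W t \<omega> - W s \<omega>}) (rv_events M (W ` {0..s})))"


section \<open>Ito integral and Ito processes\<close>

text \<open>A triple \<open>(n, \<tau>, \<zeta>)\<close> encodes the simple integrand with value \<open>\<zeta> k\<close> on
  \<open>{\<tau> k <.. \<tau> (Suc k)}\<close> for \<open>k < n\<close>.\<close>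

type_synonym 'a simple_proc = "nat \<times> (nat \<Rightarrow> real) \<times> (nat \<Rightarrow> 'a \<Rightarrow> real)"

definition simple_integrand ::
    "'a measure \<Rightarrow> real \<Rightarrow> (real \<Rightarrow> 'a measure) \<Rightarrow> 'a simple_proc \<Rightarrow> bool" where
  "simple_integrand M T F S \<longleftrightarrow> (case S of (n, \<tau>, \<zeta>) \<Rightarrow>
     (\<forall>k\<le>n. \<tau> k \<in> {0..T}) \<and> (\<forall>k<n. \<tau> k \<le> \<tau> (Suc k)) \<and>
     (\<forall>k<n. \<zeta> k \<in> borel_measurable (F (\<tau> k)) \<and> (\<exists>C. \<forall>\<omega>\<in>space M. \<bar>\<zeta> k \<omega>\<bar> \<le> C)))"

definition simple_value :: "'a simple_proc \<Rightarrow> real \<Rightarrow> 'a \<Rightarrow> real" where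
  "simple_value S t \<omega> = (case S of (n, \<tau>, \<zeta>) \<Rightarrow>
     \<Sum>k<n. \<zeta> k \<omega> * indicator {\<tau> k <.. \<tau> (Suc k)} t)"

definition simple_ito ::
    "(real \<Rightarrow> 'a \<Rightarrow> real) \<Rightarrow> 'a simple_proc \<Rightarrow> real \<Rightarrow> 'a \<Rightarrow> real" where
  "simple_ito W S t \<omega> = (case S of (n, \<tau>, \<zeta>) \<Rightarrow>
     \<Sum>k<n. \<zeta> k \<omega> * (W (min (\<tau> (Suc k)) t) \<omega> - W (min (\<tau> k) t) \<omega>))"

text \<open>\<open>I\<close> is (a continuous version of) the process \<open>t \<mapsto> \<integral>\<^sub>0\<^sup>t H dW\<close>, determined up to
  indistinguishability.\<close>

definition ito_integral ::
    "'a measure \<Rightarrow> real \<Rightarrow> (real \<Rightarrow> 'a measure) \<Rightarrow> (real \<Rightarrow> 'a \<Rightarrow> real) \<Rightarrow>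
     (real \<Rightarrow> 'a \<Rightarrow> real) \<Rightarrow> (real \<Rightarrow> 'a \<Rightarrow> real) \<Rightarrow> bool" where
  "ito_integral M T F W H I \<longleftrightarrow>
     H \<in> L2_proc M T F \<and>
     (\<forall>t\<in>{0..T}. I t \<in> borel_measurable (F t)) \<and>
     (AE \<omega> in M. continuous_on {0..T} (\<lambda>t. I t \<omega>)) \<and>
     (\<exists>S. (\<forall>j. simple_integrand M T F (S j)) \<and>
        (\<lambda>j::nat. \<integral>\<^sup>+\<omega>. (\<integral>\<^sup>+t\<in>{0..T}. ennreal ((simple_value (S j) t \<omega> - H t \<omega>)\<^sup>2) \<partial>lborel) \<partial>M)
          \<longlonglongrightarrow> 0 \<and>
        (\<forall>t\<in>{0..T}.
          (\<lambda>j. \<integral>\<^sup>+\<omega>. ennreal ((simple_ito W (S j) t \<omega> - I t \<omega>)\<^sup>2) \<partial>M) \<longlonglongrightarrow> 0))"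

text \<open>\<open>dX = \<beta> dt + \<eta>\<^sub>1 dW\<^sub>1 + \<dots> + \<eta>\<^sub>k dW\<^sub>k\<close> on \<open>[0, T]\<close>, with \<open>noise = [(\<eta>\<^sub>1, W\<^sub>1), \<dots>, (\<eta>\<^sub>k, W\<^sub>k)]\<close>.\<close>

definition ito_process ::
    "'a measure \<Rightarrow> real \<Rightarrow> (real \<Rightarrow> 'a measure) \<Rightarrow> (real \<Rightarrow> 'a \<Rightarrow> real) \<Rightarrow> (real \<Rightarrow> 'a \<Rightarrow> real) \<Rightarrow>
     ((real \<Rightarrow> 'a \<Rightarrow> real) \<times> (real \<Rightarrow> 'a \<Rightarrow> real)) list \<Rightarrow> bool" where
  "ito_process M T F X \<beta> noise \<longleftrightarrow>
     (AE \<omega> in M. set_integrable lborel {0..T} (\<lambda>s. \<beta> s \<omega>)) \<and>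
     (\<exists>Is. list_all2 (\<lambda>(\<eta>, W) I. ito_integral M T F W \<eta> I) noise Is \<and>
        (AE \<omega> in M. \<forall>t\<in>{0..T}.
           X t \<omega> = X 0 \<omega> + (LINT s:{0..t}|lborel. \<beta> s \<omega>) + (\<Sum>I\<leftarrow>Is. I t \<omega>)))"


section \<open>The probabilistic setting\<close>

record 'a setting =
  bM :: "'a measure"
  bT :: real
  bxi0 :: "'a \<Rightarrow> real"
  bxi :: "'a \<Rightarrow> real"
  bW0 :: "real \<Rightarrow> 'a \<Rightarrow> real"
  bW :: "real \<Rightarrow> 'a \<Rightarrow> real"

definition valid_setting :: "'a setting \<Rightarrow> bool" where
  "valid_setting B \<longleftrightarrow>
     0 < bT B \<and> prob_space (bM B) \<and> complete_measure (bM B) \<and>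
     bxi0 B \<in> borel_measurable (bM B) \<and> integrable (bM B) (\<lambda>\<omega>. (bxi0 B \<omega>)\<^sup>2) \<and>
     bxi B \<in> borel_measurable (bM B) \<and> integrable (bM B) (\<lambda>\<omega>. (bxi B \<omega>)\<^sup>2) \<and>
     brownian_motion (bM B) (bT B) (bW0 B) \<and> brownian_motion (bM B) (bT B) (bW B) \<and>
     prob_space.indep_sets (bM B)
       ((!) [rv_events (bM B) {bxi0 B}, rv_events (bM B) {bxi B},
             rv_events (bM B) (bW0 B ` {0..bT B}), rv_events (bM B) (bW B ` {0..bT B})])
       {..<4}"

definition filt0 :: "'a setting \<Rightarrow> real \<Rightarrow> 'a measure" where
  "filt0 B t = augmented_sigma (bM B) ({bxi0 B} \<union> bW0 B ` {0..t})"

definition filt :: "'a setting \<Rightarrow> real \<Rightarrow> 'a measure" where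
  "filt B t = augmented_sigma (bM B) ({bxi0 B, bxi B} \<union> bW0 B ` {0..t} \<union> bW B ` {0..t})"

abbreviation L2_0 where "L2_0 B \<equiv> L2_proc (bM B) (bT B) (filt0 B)"
abbreviation S2_0 where "S2_0 B \<equiv> S2_proc (bM B) (bT B) (filt0 B)"
abbreviation L2_F where "L2_F B \<equiv> L2_proc (bM B) (bT B) (filt B)"
abbreviation S2_F where "S2_F B \<equiv> S2_proc (bM B) (bT B) (filt B)"

definition cond_law_flow ::
    "'a setting \<Rightarrow> (real \<Rightarrow> 'a \<Rightarrow> real) \<Rightarrow> (real \<Rightarrow> 'a \<Rightarrow> real measure) \<Rightarrow> bool" where
  "cond_law_flow B X m \<longleftrightarrow>
     m \<in> P2_flow (bM B) (bT B) (filt0 B) \<and>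
     (\<forall>t\<in>{0..bT B}. cond_law (bM B) (filt0 B t) (X t) (m t))"


section \<open>Coefficients and assumptions\<close>

text \<open>The fields \<open>cf1\<close>, \<open>cf2\<close> are the two parts of \<open>cf\<close>. Functions of \<open>(t, m)\<close> only matter for
  \<open>t \<in> [0, T]\<close> and \<open>m \<in> P2\<close>.\<close>

record coeffs =
  cb0 :: "real \<Rightarrow> real \<Rightarrow> real \<Rightarrow> real measure \<Rightarrow> real"
  cs0 :: "real \<Rightarrow> real \<Rightarrow> real \<Rightarrow> real measure \<Rightarrow> real"
  cb :: "real \<Rightarrow> real \<Rightarrow> real \<Rightarrow> real measure \<Rightarrow> real"
  cs :: "real \<Rightarrow> real \<Rightarrow> real \<Rightarrow> real measure \<Rightarrow> real"
  cst :: "real \<Rightarrow> real \<Rightarrow> real \<Rightarrow> real measure \<Rightarrow> real"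
  cf0 :: "real \<Rightarrow> real \<Rightarrow> real \<Rightarrow> real measure \<Rightarrow> real"
  cf :: "real \<Rightarrow> real \<Rightarrow> real \<Rightarrow> real measure \<Rightarrow> real \<Rightarrow> real"
  cf1 :: "real \<Rightarrow> real \<Rightarrow> real \<Rightarrow> real \<Rightarrow> real"
  cf2 :: "real \<Rightarrow> real \<Rightarrow> real measure \<Rightarrow> real \<Rightarrow> real"
  cg0 :: "real \<Rightarrow> real measure \<Rightarrow> real"
  cg :: "real \<Rightarrow> real measure \<Rightarrow> real \<Rightarrow> real"

definition measurable_coeffs :: "real \<Rightarrow> coeffs \<Rightarrow> bool" where
  "measurable_coeffs T D \<longleftrightarrow>
     (\<forall>\<phi>\<in>{cb0 D, cs0 D, cb D, cs D, cst D, cf0 D}.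
        (\<lambda>(t, x, u, m). \<phi> t x u m) \<in> borel_measurable
          (restrict_space borel {0..T} \<Otimes>\<^sub>M borel \<Otimes>\<^sub>M borel \<Otimes>\<^sub>M P2_space)) \<and>
     (\<lambda>(t, x, u, m, x0). cf D t x u m x0) \<in> borel_measurable
       (restrict_space borel {0..T} \<Otimes>\<^sub>M borel \<Otimes>\<^sub>M borel \<Otimes>\<^sub>M P2_space \<Otimes>\<^sub>M borel) \<and>
     (\<lambda>(x, m). cg0 D x m) \<in> borel_measurable (borel \<Otimes>\<^sub>M P2_space) \<and>
     (\<lambda>(x, m, x0). cg D x m x0) \<in> borel_measurable (borel \<Otimes>\<^sub>M P2_space \<Otimes>\<^sub>M borel)"

definition f0_x where "f0_x (D::coeffs) t x u m = deriv (\<lambda>y. cf0 D t y u m) x"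
definition f0_u where "f0_u (D::coeffs) t x u m = deriv (\<lambda>v. cf0 D t x v m) u"
definition f1_x where "f1_x (D::coeffs) t x u x0 = deriv (\<lambda>y. cf1 D t y u x0) x"
definition f1_u where "f1_u (D::coeffs) t x u x0 = deriv (\<lambda>v. cf1 D t x v x0) u"
definition f2_x where "f2_x (D::coeffs) t x m x0 = deriv (\<lambda>y. cf2 D t y m x0) x"
definition g0_x where "g0_x (D::coeffs) x m = deriv (\<lambda>y. cg0 D y m) x"
definition g_x where "g_x (D::coeffs) x m x0 = deriv (\<lambda>y. cg D y m x0) x"

definition affine_coeff ::
    "real \<Rightarrow> real \<Rightarrow> real \<Rightarrow> (real \<Rightarrow> real \<Rightarrow> real \<Rightarrow> real measure \<Rightarrow> real) \<Rightarrow> bool" where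
  "affine_coeff T L K \<phi> \<longleftrightarrow> (\<exists>\<phi>0 \<phi>1 \<phi>2. \<forall>t\<in>{0..T}.
     (\<forall>x u. \<forall>m\<in>P2. \<phi> t x u m = \<phi>0 t m + \<phi>1 t * x + \<phi>2 t * u) \<and>
     (\<forall>m\<in>P2. \<bar>\<phi>0 t m\<bar> \<le> L * (1 + norm2 m)) \<and>
     \<bar>\<phi>1 t\<bar> \<le> L \<and> \<bar>\<phi>2 t\<bar> \<le> L \<and>
     (\<forall>m\<in>P2. \<forall>m'\<in>P2. \<bar>\<phi>0 t m - \<phi>0 t m'\<bar> \<le> K * W2 m m'))"

definition H1 :: "real \<Rightarrow> real \<Rightarrow> real \<Rightarrow> real \<Rightarrow> coeffs \<Rightarrow> bool" where
  "H1 T L Lm lm D \<longleftrightarrow>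
     affine_coeff T L lm (cb0 D) \<and> affine_coeff T L lm (cs0 D) \<and>
     affine_coeff T L Lm (cb D) \<and> affine_coeff T L Lm (cs D) \<and> affine_coeff T L Lm (cst D)"

definition H2 :: "real \<Rightarrow> real \<Rightarrow> real \<Rightarrow> real \<Rightarrow> coeffs \<Rightarrow> bool" where
  "H2 T L lm lx0 D \<longleftrightarrow>
     (\<forall>t\<in>{0..T}. \<forall>m\<in>P2. \<bar>cf0 D t 0 0 m\<bar> \<le> L * (1 + (norm2 m)\<^sup>2)) \<and>
     (\<forall>m\<in>P2. \<bar>cg0 D 0 m\<bar> \<le> L * (1 + (norm2 m)\<^sup>2)) \<and>
     (\<forall>t\<in>{0..T}. \<forall>m\<in>P2. \<forall>z. (\<lambda>(x, u). cf0 D t x u m) differentiable (at z)) \<and>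
     (\<forall>m\<in>P2. \<forall>x. (\<lambda>x. cg0 D x m) differentiable (at x)) \<and>
     (\<forall>\<phi>\<in>{f0_x D, f0_u D}. \<forall>t\<in>{0..T}. \<forall>x u x' u'. \<forall>m\<in>P2. \<forall>m'\<in>P2.
        \<bar>\<phi> t x u m\<bar> \<le> L * (1 + \<bar>x\<bar> + \<bar>u\<bar> + norm2 m) \<and>
        \<bar>\<phi> t x u m - \<phi> t x' u' m\<bar> \<le> L * (\<bar>x - x'\<bar> + \<bar>u - u'\<bar>) \<and>
        \<bar>\<phi> t x u m - \<phi> t x u m'\<bar> \<le> lm * W2 m m') \<and>
     (\<forall>x x'. \<forall>m\<in>P2. \<forall>m'\<in>P2.
        \<bar>g0_x D x m\<bar> \<le> L * (1 + \<bar>x\<bar> + norm2 m) \<and>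
        \<bar>g0_x D x m - g0_x D x' m\<bar> \<le> L * \<bar>x - x'\<bar> \<and>
        \<bar>g0_x D x m - g0_x D x m'\<bar> \<le> lm * W2 m m') \<and>
     (\<forall>t\<in>{0..T}. \<forall>m\<in>P2. \<forall>x0. \<bar>cf D t 0 0 m x0\<bar> \<le> L * (1 + (norm2 m)\<^sup>2 + x0\<^sup>2)) \<and>
     (\<forall>m\<in>P2. \<forall>x0. \<bar>cg D 0 m x0\<bar> \<le> L * (1 + (norm2 m)\<^sup>2 + x0\<^sup>2)) \<and>
     (\<forall>t\<in>{0..T}. \<forall>x u x0. \<forall>m\<in>P2. cf D t x u m x0 = cf1 D t x u x0 + cf2 D t x m x0) \<and>
     (\<forall>t\<in>{0..T}. \<forall>x0 z. (\<lambda>(x, u). cf1 D t x u x0) differentiable (at z)) \<and>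
     (\<forall>t\<in>{0..T}. \<forall>m\<in>P2. \<forall>x0 x. (\<lambda>x. cf2 D t x m x0) differentiable (at x)) \<and>
     (\<forall>m\<in>P2. \<forall>x0 x. (\<lambda>x. cg D x m x0) differentiable (at x)) \<and>
     (\<forall>\<phi>\<in>{f1_x D, f1_u D}. \<forall>t\<in>{0..T}. \<forall>x u x0 x' u' x0'.
        \<bar>\<phi> t x u x0\<bar> \<le> L * (1 + \<bar>x\<bar> + \<bar>u\<bar> + \<bar>x0\<bar>) \<and>
        \<bar>\<phi> t x u x0 - \<phi> t x' u' x0\<bar> \<le> L * (\<bar>x - x'\<bar> + \<bar>u - u'\<bar>) \<and>
        \<bar>\<phi> t x u x0 - \<phi> t x u x0'\<bar> \<le> lx0 * \<bar>x0 - x0'\<bar>) \<and>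
     (\<forall>\<phi>\<in>insert (g_x D) (f2_x D ` {0..T}). \<forall>x x0 x' x0'. \<forall>m\<in>P2. \<forall>m'\<in>P2.
        \<bar>\<phi> x m x0\<bar> \<le> L * (1 + \<bar>x\<bar> + norm2 m + \<bar>x0\<bar>) \<and>
        \<bar>\<phi> x m x0 - \<phi> x' m' x0\<bar> \<le> L * (\<bar>x - x'\<bar> + W2 m m') \<and>
        \<bar>\<phi> x m x0 - \<phi> x m x0'\<bar> \<le> lx0 * \<bar>x0 - x0'\<bar>)"

definition H3 :: "real \<Rightarrow> real \<Rightarrow> coeffs \<Rightarrow> bool" where
  "H3 T L D \<longleftrightarrow>
     (\<forall>m\<in>P2. convex_on UNIV (\<lambda>x. cg0 D x m)) \<and>
     (\<exists>C\<ge>inverse L. \<forall>t\<in>{0..T}. \<forall>m\<in>P2. \<forall>x1 x2 u1 u2.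
        cf0 D t x2 u2 m - cf0 D t x1 u1 m
          - (f0_x D t x1 u1 m * (x2 - x1) + f0_u D t x1 u1 m * (u2 - u1)) \<ge> C * \<bar>u2 - u1\<bar>\<^sup>2) \<and>
     (\<forall>t\<in>{0..T}. \<forall>m\<in>P2. \<forall>x0. convex_on UNIV (\<lambda>x. cf2 D t x m x0)) \<and>
     (\<forall>m\<in>P2. \<forall>x0. convex_on UNIV (\<lambda>x. cg D x m x0)) \<and>
     (\<exists>C\<ge>inverse L. \<forall>t\<in>{0..T}. \<forall>x0 x1 x2 u1 u2.
        cf1 D t x2 u2 x0 - cf1 D t x1 u1 x0
          - (f1_x D t x1 u1 x0 * (x2 - x1) + f1_u D t x1 u1 x0 * (u2 - u1)) \<ge> C * \<bar>u2 - u1\<bar>\<^sup>2)"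


section \<open>Hamiltonians and their minimizers\<close>

definition ham0 ::
    "coeffs \<Rightarrow> real \<Rightarrow> real \<Rightarrow> real \<Rightarrow> real \<Rightarrow> real \<Rightarrow> real measure \<Rightarrow> real" where
  "ham0 D t x0 p0 q0 u0 m = cb0 D t x0 u0 m * p0 + cs0 D t x0 u0 m * q0 + cf0 D t x0 u0 m"

definition ham ::
    "coeffs \<Rightarrow> real \<Rightarrow> real \<Rightarrow> real \<Rightarrow> real \<Rightarrow> real \<Rightarrow> real \<Rightarrow> real measure \<Rightarrow> real \<Rightarrow> real" where
  "ham D t x p q qt u m x0 =
     cb D t x u m * p + cs D t x u m * q + cst D t x u m * qt + cf D t x u m x0"

definition ham0_x where
  "ham0_x D t x0 p0 q0 u0 m = deriv (\<lambda>y. ham0 D t y p0 q0 u0 m) x0"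

definition ham_x where
  "ham_x D t x p q qt u m x0 = deriv (\<lambda>y. ham D t y p q qt u m x0) x"

definition argmin0 :: "coeffs \<Rightarrow> real \<Rightarrow> real \<Rightarrow> real \<Rightarrow> real \<Rightarrow> real measure \<Rightarrow> real" where
  "argmin0 D t x0 p0 q0 m =
     (THE u0. is_arg_min (\<lambda>v. ham0 D t x0 p0 q0 v m) (\<lambda>_. True) u0)"

text \<open>The minimizer of \<open>ham\<close> in \<open>u\<close> is the same for all measure arguments, so it is
  specified as their common minimizer.\<close>

definition argminF :: "coeffs \<Rightarrow> real \<Rightarrow> real \<Rightarrow> real \<Rightarrow> real \<Rightarrow> real \<Rightarrow> real \<Rightarrow> real" where
  "argminF D t x p q qt x0 =
     (THE u. \<forall>m\<in>P2. is_arg_min (\<lambda>v. ham D t x p q qt v m x0) (\<lambda>_. True) u)"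


section \<open>State equations, costs, and problem (P)\<close>

definition state0 ::
    "'a setting \<Rightarrow> coeffs \<Rightarrow> (real \<Rightarrow> 'a \<Rightarrow> real) \<Rightarrow> (real \<Rightarrow> 'a \<Rightarrow> real measure) \<Rightarrow>
     (real \<Rightarrow> 'a \<Rightarrow> real) \<Rightarrow> bool" where
  "state0 B D u0 m X0 \<longleftrightarrow>
     X0 \<in> S2_0 B \<and> (AE \<omega> in bM B. X0 0 \<omega> = bxi0 B \<omega>) \<and>
     ito_process (bM B) (bT B) (filt0 B) X0
       (\<lambda>t \<omega>. cb0 D t (X0 t \<omega>) (u0 t \<omega>) (m t \<omega>))
       [(\<lambda>t \<omega>. cs0 D t (X0 t \<omega>) (u0 t \<omega>) (m t \<omega>), bW0 B)]"

definition state ::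
    "'a setting \<Rightarrow> coeffs \<Rightarrow> (real \<Rightarrow> 'a \<Rightarrow> real) \<Rightarrow> (real \<Rightarrow> 'a \<Rightarrow> real measure) \<Rightarrow>
     (real \<Rightarrow> 'a \<Rightarrow> real) \<Rightarrow> bool" where
  "state B D u m X \<longleftrightarrow>
     X \<in> S2_F B \<and> (AE \<omega> in bM B. X 0 \<omega> = bxi B \<omega>) \<and>
     ito_process (bM B) (bT B) (filt B) X
       (\<lambda>t \<omega>. cb D t (X t \<omega>) (u t \<omega>) (m t \<omega>))
       [(\<lambda>t \<omega>. cs D t (X t \<omega>) (u t \<omega>) (m t \<omega>), bW B),
        (\<lambda>t \<omega>. cst D t (X t \<omega>) (u t \<omega>) (m t \<omega>), bW0 B)]"

text \<open>In both costs \<open>Y\<close> is the state process of the control \<open>v\<close>.\<close>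

definition cost0 ::
    "'a setting \<Rightarrow> coeffs \<Rightarrow> (real \<Rightarrow> 'a \<Rightarrow> real measure) \<Rightarrow>
     (real \<Rightarrow> 'a \<Rightarrow> real) \<Rightarrow> (real \<Rightarrow> 'a \<Rightarrow> real) \<Rightarrow> real" where
  "cost0 B D m v Y = (LINT \<omega>|bM B.
     (LINT t:{0..bT B}|lborel. cf0 D t (Y t \<omega>) (v t \<omega>) (m t \<omega>))
     + cg0 D (Y (bT B) \<omega>) (m (bT B) \<omega>))"

definition cost ::
    "'a setting \<Rightarrow> coeffs \<Rightarrow> (real \<Rightarrow> 'a \<Rightarrow> real) \<Rightarrow> (real \<Rightarrow> 'a \<Rightarrow> real measure) \<Rightarrow>
     (real \<Rightarrow> 'a \<Rightarrow> real) \<Rightarrow> (real \<Rightarrow> 'a \<Rightarrow> real) \<Rightarrow> real" where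
  "cost B D X0 m v Y = (LINT \<omega>|bM B.
     (LINT t:{0..bT B}|lborel. cf D t (Y t \<omega>) (v t \<omega>) (m t \<omega>) (X0 t \<omega>))
     + cg D (Y (bT B) \<omega>) (m (bT B) \<omega>) (X0 (bT B) \<omega>))"

text \<open>\<open>(u0, u)\<close> solves problem (P), with witnessing flow \<open>m\<close> and corresponding state processes
  \<open>X0\<close>, \<open>X\<close>. Every admissible control has a state process, unique up to indistinguishability, so
  comparing with all pairs \<open>(v, Y)\<close> is minimization of the cost over \<open>v\<close>.\<close>

definition solves_P ::
    "'a setting \<Rightarrow> coeffs \<Rightarrow> (real \<Rightarrow> 'a \<Rightarrow> real) \<Rightarrow> (real \<Rightarrow> 'a \<Rightarrow> real) \<Rightarrow>
     (real \<Rightarrow> 'a \<Rightarrow> real measure) \<Rightarrow> (real \<Rightarrow> 'a \<Rightarrow> real) \<Rightarrow> (real \<Rightarrow> 'a \<Rightarrow> real) \<Rightarrow> bool" where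
  "solves_P B D u0 u m X0 X \<longleftrightarrow>
     u0 \<in> L2_0 B \<and> u \<in> L2_F B \<and> state0 B D u0 m X0 \<and> state B D u m X \<and>
     (\<forall>v\<in>L2_0 B. \<forall>Y. state0 B D v m Y \<longrightarrow> cost0 B D m u0 X0 \<le> cost0 B D m v Y) \<and>
     (\<forall>v\<in>L2_F B. \<forall>Y. state B D v m Y \<longrightarrow> cost B D X0 m u X \<le> cost B D X0 m v Y) \<and>
     cond_law_flow B X m"


section \<open>Adjoint equations and the FBSDE system\<close>

definition adjoint0 ::
    "'a setting \<Rightarrow> coeffs \<Rightarrow> (real \<Rightarrow> 'a \<Rightarrow> real) \<Rightarrow> (real \<Rightarrow> 'a \<Rightarrow> real measure) \<Rightarrow>
     (real \<Rightarrow> 'a \<Rightarrow> real) \<Rightarrow> (real \<Rightarrow> 'a \<Rightarrow> real) \<Rightarrow> (real \<Rightarrow> 'a \<Rightarrow> real) \<Rightarrow> bool" where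
  "adjoint0 B D u0 m X0 p0 q0 \<longleftrightarrow>
     p0 \<in> S2_0 B \<and> q0 \<in> L2_0 B \<and>
     ito_process (bM B) (bT B) (filt0 B) p0
       (\<lambda>t \<omega>. - ham0_x D t (X0 t \<omega>) (p0 t \<omega>) (q0 t \<omega>) (u0 t \<omega>) (m t \<omega>)) [(q0, bW0 B)] \<and>
     (AE \<omega> in bM B. p0 (bT B) \<omega> = g0_x D (X0 (bT B) \<omega>) (m (bT B) \<omega>))"

definition adjointF ::
    "'a setting \<Rightarrow> coeffs \<Rightarrow> (real \<Rightarrow> 'a \<Rightarrow> real) \<Rightarrow> (real \<Rightarrow> 'a \<Rightarrow> real measure) \<Rightarrow>
     (real \<Rightarrow> 'a \<Rightarrow> real) \<Rightarrow> (real \<Rightarrow> 'a \<Rightarrow> real) \<Rightarrow> (real \<Rightarrow> 'a \<Rightarrow> real) \<Rightarrow>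
     (real \<Rightarrow> 'a \<Rightarrow> real) \<Rightarrow> (real \<Rightarrow> 'a \<Rightarrow> real) \<Rightarrow> bool" where
  "adjointF B D u m X0 X p q qt \<longleftrightarrow>
     p \<in> S2_F B \<and> q \<in> L2_F B \<and> qt \<in> L2_F B \<and>
     ito_process (bM B) (bT B) (filt B) p
       (\<lambda>t \<omega>. - ham_x D t (X t \<omega>) (p t \<omega>) (q t \<omega>) (qt t \<omega>) (u t \<omega>) (m t \<omega>) (X0 t \<omega>))
       [(q, bW B), (qt, bW0 B)] \<and>
     (AE \<omega> in bM B. p (bT B) \<omega> = g_x D (X (bT B) \<omega>) (m (bT B) \<omega>) (X0 (bT B) \<omega>))"

definition feedback0 ::
    "coeffs \<Rightarrow> (real \<Rightarrow> 'a \<Rightarrow> real) \<Rightarrow> (real \<Rightarrow> 'a \<Rightarrow> real) \<Rightarrow> (real \<Rightarrow> 'a \<Rightarrow> real) \<Rightarrow>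
     (real \<Rightarrow> 'a \<Rightarrow> real measure) \<Rightarrow> real \<Rightarrow> 'a \<Rightarrow> real" where
  "feedback0 D X0 p0 q0 m t \<omega> = argmin0 D t (X0 t \<omega>) (p0 t \<omega>) (q0 t \<omega>) (m t \<omega>)"

definition feedback ::
    "coeffs \<Rightarrow> (real \<Rightarrow> 'a \<Rightarrow> real) \<Rightarrow> (real \<Rightarrow> 'a \<Rightarrow> real) \<Rightarrow> (real \<Rightarrow> 'a \<Rightarrow> real) \<Rightarrow>
     (real \<Rightarrow> 'a \<Rightarrow> real) \<Rightarrow> (real \<Rightarrow> 'a \<Rightarrow> real) \<Rightarrow> real \<Rightarrow> 'a \<Rightarrow> real" where
  "feedback D X p q qt X0 t \<omega> =
     argminF D t (X t \<omega>) (p t \<omega>) (q t \<omega>) (qt t \<omega>) (X0 t \<omega>)"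

text \<open>\<open>m\<close> is a progressively measurable version of the flow of conditional laws of \<open>X t\<close>.\<close>

definition solves_F ::
    "'a setting \<Rightarrow> coeffs \<Rightarrow> (real \<Rightarrow> 'a \<Rightarrow> real measure) \<Rightarrow>
     (real \<Rightarrow> 'a \<Rightarrow> real) \<Rightarrow> (real \<Rightarrow> 'a \<Rightarrow> real) \<Rightarrow> (real \<Rightarrow> 'a \<Rightarrow> real) \<Rightarrow>
     (real \<Rightarrow> 'a \<Rightarrow> real) \<Rightarrow> (real \<Rightarrow> 'a \<Rightarrow> real) \<Rightarrow> (real \<Rightarrow> 'a \<Rightarrow> real) \<Rightarrow>
     (real \<Rightarrow> 'a \<Rightarrow> real) \<Rightarrow> bool" where
  "solves_F B D m X0 p0 q0 X p q qt \<longleftrightarrow>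
     cond_law_flow B X m \<and>
     feedback0 D X0 p0 q0 m \<in> L2_0 B \<and> feedback D X p q qt X0 \<in> L2_F B \<and>
     state0 B D (feedback0 D X0 p0 q0 m) m X0 \<and>
     adjoint0 B D (feedback0 D X0 p0 q0 m) m X0 p0 q0 \<and>
     state B D (feedback D X p q qt X0) m X \<and>
     adjointF B D (feedback D X p q qt X0) m X0 X p q qt"

text \<open>Equality of processes as elements of the \<open>L2\<close> process spaces.\<close>

definition eq_ae :: "'a setting \<Rightarrow> (real \<Rightarrow> 'a \<Rightarrow> real) \<Rightarrow> (real \<Rightarrow> 'a \<Rightarrow> real) \<Rightarrow> bool" where
  "eq_ae B \<alpha> \<beta> \<longleftrightarrow>
     (AE z in restrict_space lborel {0..bT B} \<Otimes>\<^sub>M bM B. \<alpha> (fst z) (snd z) = \<beta> (fst z) (snd z))"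

end

theory Submission
  imports Defs
begin

text \<open>Both control problems are one problem with affine dynamics, a cost that is quadratically
  regular and strongly convex in the control, and \<open>d\<close> independent noises (\<open>d = 1\<close> for the major
  player, \<open>d = 2\<close> for the minor one). For an optimal pair \<open>(X, u)\<close> with adjoint \<open>(p, q)\<close>, let \<open>h\<close> be the
  derivative of the Hamiltonian in the control along the solution. The linearized state \<open>Z\<close> in the
  direction \<open>\<beta> = - h\<close> solves a linear equation, \<open>X + \<epsilon> Z\<close> is the state of the control \<open>u + \<epsilon> \<beta>\<close>, and
  duality of \<open>p\<close> and \<open>Z\<close> turns the first order condition \<open>0 \<le> dJ(u)\<beta>\<close> into \<open>0 \<le> - E \<integral> h\<^sup>2\<close>. Hence \<open>h = 0\<close>
  almost everywhere, and by strong convexity the optimal control minimizes the Hamiltonian.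

  The Ito formula is not needed: \<open>E [p\<^sub>T Z\<^sub>T]\<close> only involves the isometry, the martingale property and
  Fubini's theorem. Of a Brownian motion only the orthogonality of increments to the past and
  their conditional covariances are used.\<close>

section \<open>Square integrable functions\<close>

text \<open>The flow \<open>m\<close>, and for the minor player also the major state, are frozen
  data: each player then solves a control problem with random coefficients, and the consistency
  condition passes unchanged from (P) to (F). Controls range over the whole real line, so
  \<open>- h\<close> is an admissible direction once \<open>h\<close> is square integrable, and the
  first order condition becomes an equation. The slopes of the affine dynamics depend on time only,
  so \<open>X + \<epsilon> Z\<close> is the exact state of the perturbed control and only the
  existence of \<open>Z\<close> has to be supplied. Since an Ito integral is given through
  approximating simple integrands, this is most of the work: density of simple integrands, a
  continuous version by Doob's inequality, Picard iteration. The other obstacle is measurability.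
  Derivatives and minimizers come as \<open>deriv\<close> and \<open>THE\<close>, while (F) asks for
  a progressive feedback. Derivatives are limits of difference quotients along
  \<open>1 / real (Suc n)\<close>, and a sublevel set of the minimizer is cut out by countably many
  comparisons of values of the Hamiltonian.\<close>

abbreviation L2sq :: "'a measure \<Rightarrow> ('a \<Rightarrow> real) \<Rightarrow> ennreal" where
  "L2sq N f \<equiv> (\<integral>\<^sup>+x. ennreal ((f x)\<^sup>2) \<partial>N)"

definition square_integrable :: "'a measure \<Rightarrow> ('a \<Rightarrow> real) \<Rightarrow> bool" where
  "square_integrable M f \<longleftrightarrow> f \<in> borel_measurable M \<and> integrable M (\<lambda>x. (f x)\<^sup>2)"

lemma square_integrable_measurable: "square_integrable M f \<Longrightarrow> f \<in> borel_measurable M"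
  and square_integrable_integrable_power2: "square_integrable M f \<Longrightarrow> integrable M (\<lambda>x. (f x)\<^sup>2)"
  by (auto simp: square_integrable_def)

lemma square_integrable_iff_nn_integral:
  "square_integrable M f \<longleftrightarrow>
     f \<in> borel_measurable M \<and> L2sq M f < \<infinity>"
  by (auto simp: square_integrable_def integrable_iff_bounded)

lemma square_integrable_mult:
  assumes "square_integrable M f" "square_integrable M g"
  shows "integrable M (\<lambda>x. f x * g x)"
proof (rule Bochner_Integration.integrable_bound)
  show "integrable M (\<lambda>x. (f x)\<^sup>2 + (g x)\<^sup>2)"
    using assms by (auto simp: square_integrable_def)
  show "(\<lambda>x. f x * g x) \<in> borel_measurable M"
    using assms by (auto simp: square_integrable_def)
  have "\<bar>a * b\<bar> \<le> a\<^sup>2 + b\<^sup>2" for a b :: real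
  proof -
    have "0 \<le> (\<bar>a\<bar> - \<bar>b\<bar>)\<^sup>2" by simp
    then have "2 * (\<bar>a\<bar> * \<bar>b\<bar>) \<le> a\<^sup>2 + b\<^sup>2" by (simp add: power2_diff algebra_simps)
    moreover have "0 \<le> \<bar>a\<bar> * \<bar>b\<bar>" by simp
    ultimately show ?thesis unfolding abs_mult by linarith
  qed
  then show "AE x in M. norm (f x * g x) \<le> norm ((f x)\<^sup>2 + (g x)\<^sup>2)" by simp
qed

lemma square_integrable_add:
  assumes "square_integrable M f" "square_integrable M g"
  shows "square_integrable M (\<lambda>x. f x + g x)"
  using assms square_integrable_mult[OF assms]
  by (auto simp: square_integrable_def power2_sum mult.assoc)

lemma square_integrable_cmult:
  "square_integrable M f \<Longrightarrow> square_integrable M (\<lambda>x. c * f x)"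
  by (auto simp: square_integrable_def power_mult_distrib)

lemma square_integrable_diff:
  assumes "square_integrable M f" "square_integrable M g"
  shows "square_integrable M (\<lambda>x. f x - g x)"
  using square_integrable_add[OF assms(1) square_integrable_cmult[OF assms(2), of "-1"]] by simp

lemma square_integrable_zero [simp]: "square_integrable M (\<lambda>x. 0)"
  by (auto simp: square_integrable_def)

lemma square_integrable_sum:
  "(\<And>i. i \<in> A \<Longrightarrow> square_integrable M (f i)) \<Longrightarrow> square_integrable M (\<lambda>x. \<Sum>i\<in>A. f i x)"
  by (induction A rule: infinite_finite_induct) (auto intro: square_integrable_add)

lemma square_integrable_bound:
  assumes "square_integrable M g" "f \<in> borel_measurable M" "AE x in M. \<bar>f x\<bar> \<le> \<bar>g x\<bar>"
  shows "square_integrable M f"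
  unfolding square_integrable_def
proof
  show "integrable M (\<lambda>x. (f x)\<^sup>2)"
    using assms by (intro Bochner_Integration.integrable_bound[of M "\<lambda>x. (g x)\<^sup>2" "\<lambda>x. (f x)\<^sup>2"])
      (auto simp: square_integrable_def abs_le_square_iff elim!: eventually_mono)
qed fact

lemma square_integrable_mult_bounded:
  assumes "square_integrable M f" "c \<in> borel_measurable M" "\<And>x. x \<in> space M \<Longrightarrow> \<bar>c x\<bar> \<le> C"
  shows "square_integrable M (\<lambda>x. c x * f x)"
proof (rule square_integrable_bound)
  show "square_integrable M (\<lambda>x. C * f x)" by (rule square_integrable_cmult[OF assms(1)])
  have "\<bar>c x * f x\<bar> \<le> \<bar>C * f x\<bar>" if "x \<in> space M" for x
    unfolding abs_mult using assms(3)[OF that] by (intro mult_right_mono) auto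
  then show "AE x in M. \<bar>c x * f x\<bar> \<le> \<bar>C * f x\<bar>" by simp
qed (use assms in \<open>auto simp: square_integrable_def\<close>)

lemma square_integrable_cong_AE:
  assumes "f \<in> borel_measurable M" "AE x in M. f x = g x" "square_integrable M g"
  shows "square_integrable M f"
  by (rule square_integrable_bound[OF assms(3,1)]) (use assms(2) in auto)

lemma (in finite_measure) square_integrable_const [simp]: "square_integrable M (\<lambda>x. c)"
  by (auto simp: square_integrable_def)

lemma (in finite_measure) square_integrable_imp_integrable':
  "square_integrable M f \<Longrightarrow> integrable M f"
  using square_integrable_mult[of M f "\<lambda>_. 1"] by simp

text \<open>Inherited from the inequality for nonnegative integrals, applied to the absolute
  values.\<close>

lemma square_integrable_Cauchy_Schwarz:
  assumes "square_integrable M f" "square_integrable M g"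
  shows "\<bar>LINT x|M. f x * g x\<bar> \<le> sqrt (LINT x|M. (f x)\<^sup>2) * sqrt (LINT x|M. (g x)\<^sup>2)"
proof -
  have m[measurable]: "f \<in> borel_measurable M" "g \<in> borel_measurable M"
    using assms by (auto simp: square_integrable_def)
  have "integrable M (\<lambda>x. \<bar>f x\<bar> * \<bar>g x\<bar>)"
    using square_integrable_mult[OF assms] by (subst abs_mult[symmetric]) (rule integrable_abs)
  then have eq: "(\<integral>\<^sup>+x. ennreal \<bar>f x\<bar> * ennreal \<bar>g x\<bar> \<partial>M) = ennreal (LINT x|M. \<bar>f x\<bar> * \<bar>g x\<bar>)"
    by (subst nn_integral_eq_integral[symmetric]) (auto simp: ennreal_mult)
  have sq: "(\<integral>\<^sup>+x. (ennreal \<bar>h x\<bar>)\<^sup>2 \<partial>M) = ennreal (LINT x|M. (h x)\<^sup>2)"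
    if "square_integrable M h" for h
    using that by (subst nn_integral_eq_integral[symmetric])
      (auto simp: ennreal_power square_integrable_def)
  have "(ennreal (LINT x|M. \<bar>f x\<bar> * \<bar>g x\<bar>))\<^sup>2
      \<le> ennreal (LINT x|M. (f x)\<^sup>2) * ennreal (LINT x|M. (g x)\<^sup>2)"
    using Cauchy_Schwarz_nn_integral[of "\<lambda>x. ennreal \<bar>f x\<bar>" M "\<lambda>x. ennreal \<bar>g x\<bar>"] assms
    by (simp add: eq sq)
  then have "(LINT x|M. \<bar>f x\<bar> * \<bar>g x\<bar>)\<^sup>2 \<le> (LINT x|M. (f x)\<^sup>2) * (LINT x|M. (g x)\<^sup>2)"
    by (simp add: ennreal_power ennreal_mult[symmetric] ennreal_le_iff)
  then have "(LINT x|M. \<bar>f x\<bar> * \<bar>g x\<bar>) \<le> sqrt ((LINT x|M. (f x)\<^sup>2) * (LINT x|M. (g x)\<^sup>2))"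
    by (rule real_le_rsqrt)
  moreover have "\<bar>LINT x|M. f x * g x\<bar> \<le> (LINT x|M. \<bar>f x\<bar> * \<bar>g x\<bar>)"
    using integral_abs_bound[of M "\<lambda>x. f x * g x"] by (simp add: abs_mult)
  ultimately show ?thesis by (simp add: real_sqrt_mult)
qed

lemma L2_tendsto_iff:
  assumes "\<And>n. square_integrable M (f n)" "square_integrable M g"
  shows "(\<lambda>n. L2sq M (\<lambda>x. f n x - g x)) \<longlonglongrightarrow> 0 \<longleftrightarrow>
    (\<lambda>n. LINT x|M. (f n x - g x)\<^sup>2) \<longlonglongrightarrow> 0"
proof -
  have "L2sq M (\<lambda>x. f n x - g x) = ennreal (LINT x|M. (f n x - g x)\<^sup>2)" for n
    using square_integrable_diff[OF assms(1)[of n] assms(2)]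
    by (intro nn_integral_eq_integral) (auto simp: square_integrable_def)
  then show ?thesis
    using ennreal_tendsto_0_iff[of "\<lambda>n. LINT x|M. (f n x - g x)\<^sup>2"] by simp
qed

text \<open>Write \<open>f g - f' g'\<close> as
  \<open>(f - f') (g - g') + f' (g - g') + (f - f') g'\<close> and apply Cauchy-Schwarz to each
  term. This is the tool that carries the martingale property and the isometry from simple
  integrands to their limits.\<close>

lemma L2_tendsto_inner:
  assumes f: "\<And>n. square_integrable M (f n)" "square_integrable M f'"
    and g: "\<And>n. square_integrable M (g n)" "square_integrable M g'"
    and "(\<lambda>n. L2sq M (\<lambda>x. f n x - f' x)) \<longlonglongrightarrow> 0"
    and "(\<lambda>n. L2sq M (\<lambda>x. g n x - g' x)) \<longlonglongrightarrow> 0"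
  shows "(\<lambda>n. LINT x|M. f n x * g n x) \<longlonglongrightarrow> (LINT x|M. f' x * g' x)"
proof -
  define a where "a n = sqrt (LINT x|M. (f n x - f' x)\<^sup>2)" for n
  define b where "b n = sqrt (LINT x|M. (g n x - g' x)\<^sup>2)" for n
  have a0: "a \<longlonglongrightarrow> 0" and b0: "b \<longlonglongrightarrow> 0"
    unfolding a_def b_def using assms(5,6)[unfolded L2_tendsto_iff[OF f] L2_tendsto_iff[OF g]]
    by (auto dest: tendsto_real_sqrt)
  have "\<bar>(LINT x|M. f n x * g n x) - (LINT x|M. f' x * g' x)\<bar>
    \<le> a n * b n + sqrt (LINT x|M. (f' x)\<^sup>2) * b n + a n * sqrt (LINT x|M. (g' x)\<^sup>2)" for n
  proof -
    note d = square_integrable_diff[OF f(1)[of n] f(2)] square_integrable_diff[OF g(1)[of n] g(2)]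
    have "(LINT x|M. f n x * g n x) - (LINT x|M. f' x * g' x) =
      (LINT x|M. f n x * g n x - f' x * g' x)"
      using f g by (intro Bochner_Integration.integral_diff[symmetric] square_integrable_mult)
    also have "\<dots> = (LINT x|M. (f n x - f' x) * (g n x - g' x) + f' x * (g n x - g' x)
        + (f n x - f' x) * g' x)"
      by (intro Bochner_Integration.integral_cong) (auto simp: algebra_simps)
    also have "\<dots> = (LINT x|M. (f n x - f' x) * (g n x - g' x))
        + (LINT x|M. f' x * (g n x - g' x)) + (LINT x|M. (f n x - f' x) * g' x)"
      using square_integrable_mult[OF d] square_integrable_mult[OF f(2) d(2)]
        square_integrable_mult[OF d(1) g(2)] by simp
    finally show ?thesis
      using square_integrable_Cauchy_Schwarz[OF d] square_integrable_Cauchy_Schwarz[OF f(2) d(2)]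
        square_integrable_Cauchy_Schwarz[OF d(1) g(2)] unfolding a_def b_def by linarith
  qed
  moreover have "(\<lambda>n. a n * b n + sqrt (LINT x|M. (f' x)\<^sup>2) * b n
      + a n * sqrt (LINT x|M. (g' x)\<^sup>2)) \<longlonglongrightarrow> 0"
    using tendsto_add[OF tendsto_add[OF tendsto_mult[OF a0 b0]
        tendsto_mult_left[OF b0, of "sqrt (LINT x|M. (f' x)\<^sup>2)"]]
        tendsto_mult_right[OF a0, of "sqrt (LINT x|M. (g' x)\<^sup>2)"]] by simp
  ultimately have "(\<lambda>n. (LINT x|M. f n x * g n x) - (LINT x|M. f' x * g' x)) \<longlonglongrightarrow> 0"
    by - (rule Lim_null_comparison, rule always_eventually, rule allI, simp_all)
  then show ?thesis by (simp add: LIM_zero_iff)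
qed

section \<open>Geometric convergence in mean square and almost everywhere\<close>

lemma abs_le_of_sq: "(x::real)\<^sup>2 \<le> y\<^sup>2 \<Longrightarrow> 0 \<le> y \<Longrightarrow> \<bar>x\<bar> \<le> y"
  using abs_le_square_iff[of x y] by simp

text \<open>With the weights \<open>4^n\<close> the means sum to at most \<open>2 * c\<close>, so
  the weighted sum is finite almost everywhere, and its value is the bound \<open>K\<close>. The
  rate 1/8 in mean thus leaves 1/4 almost everywhere for squares, that is 1/2 for the functions
  themselves, which is still summable. This is why all approximations below run at rate 1/8.\<close>

lemma AE_geometric_bound:
  fixes u :: "nat \<Rightarrow> 'a \<Rightarrow> ennreal"
  assumes [measurable]: "\<And>n. u n \<in> borel_measurable M"
    and "\<And>n. (\<integral>\<^sup>+x. u n x \<partial>M) \<le> ennreal (c * (1/8)^n)" and "0 \<le> c"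
  shows "AE x in M. \<exists>K\<ge>0. \<forall>n. u n x \<le> ennreal (K * (1/4)^n)"
proof -
  have "(\<integral>\<^sup>+x. (\<Sum>n. ennreal (4^n) * u n x) \<partial>M) = (\<Sum>n. \<integral>\<^sup>+x. ennreal (4^n) * u n x \<partial>M)"
    by (rule nn_integral_suminf) simp
  also have "\<dots> \<le> (\<Sum>n. ennreal (c * (1/2)^n))"
  proof (intro suminf_le)
    fix n
    have "(\<integral>\<^sup>+x. ennreal (4^n) * u n x \<partial>M) = ennreal (4^n) * (\<integral>\<^sup>+x. u n x \<partial>M)"
      by (rule nn_integral_cmult) simp
    also have "\<dots> \<le> ennreal (4^n) * ennreal (c * (1/8)^n)"
      by (intro mult_left_mono assms) simp
    also have "\<dots> = ennreal (4^n * (c * (1/8)^n))"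
      using assms(3) by (simp add: ennreal_mult)
    also have "4^n * (c * (1/8)^n) = c * (1/2)^n"
      using power_mult_distrib[of "4::real" "1/8" n] by simp
    finally show "(\<integral>\<^sup>+x. ennreal (4^n) * u n x \<partial>M) \<le> ennreal (c * (1/2)^n)" .
  qed auto
  also have "\<dots> < \<infinity>"
    using assms(3) by (subst suminf_ennreal_eq[of _ "c * 2"])
      (auto intro!: sums_mult geometric_sums[of "1/2::real", simplified])
  finally have "AE x in M. (\<Sum>n. ennreal (4^n) * u n x) \<noteq> \<infinity>"
    by (intro nn_integral_PInf_AE) auto
  then show ?thesis
  proof (eventually_elim)
    case (elim x)
    define K where "K = enn2real (\<Sum>n. ennreal (4^n) * u n x)"
    have K: "ennreal K = (\<Sum>n. ennreal (4^n) * u n x)"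
      using elim by (simp add: K_def less_top)
    have "u n x \<le> ennreal (K * (1/4)^n)" for n
    proof -
      have "ennreal (4^n) * u n x \<le> ennreal K"
        unfolding K using sum_le_suminf[of "\<lambda>n. ennreal (4^n) * u n x" "{n}"] by simp
      then have "ennreal ((1/4)^n) * (ennreal (4^n) * u n x) \<le> ennreal ((1/4)^n) * ennreal K"
        by (intro mult_left_mono) auto
      moreover have "ennreal ((1/4)^n) * (ennreal (4^n) * u n x) = u n x"
        by (simp add: mult.assoc[symmetric] ennreal_mult[symmetric] flip: power_mult_distrib)
      ultimately show ?thesis by (simp add: ennreal_mult'' mult.commute K_def)
    qed
    then show ?case by (intro exI[of _ K]) (auto simp: K_def)
  qed
qed

lemma nn_integral_sq_add_le:
  assumes [measurable]: "f \<in> borel_measurable M" "g \<in> borel_measurable M"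
  shows "L2sq M (\<lambda>x. f x + g x)
    \<le> 2 * L2sq M f + 2 * L2sq M g"
proof -
  have "ennreal ((a + b)\<^sup>2) \<le> 2 * ennreal (a\<^sup>2) + 2 * ennreal (b\<^sup>2)" for a b :: real
  proof -
    have "(a + b)\<^sup>2 \<le> 2 * a\<^sup>2 + 2 * b\<^sup>2"
      using zero_le_power2[of "a - b"] by (simp add: power2_sum power2_diff)
    then have "ennreal ((a + b)\<^sup>2) \<le> ennreal (2 * a\<^sup>2 + 2 * b\<^sup>2)" by (rule ennreal_leI)
    then show ?thesis by (simp add: ennreal_mult)
  qed
  then have "L2sq M (\<lambda>x. f x + g x)
    \<le> (\<integral>\<^sup>+x. 2 * ennreal ((f x)\<^sup>2) + 2 * ennreal ((g x)\<^sup>2) \<partial>M)"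
    by (intro nn_integral_mono)
  then show ?thesis by (simp add: nn_integral_add nn_integral_cmult)
qed

text \<open>Split off the first increment and use
  \<open>(a + b)\<^sup>2 \<le> 2 a\<^sup>2 + 2 b\<^sup>2\<close>. The factor 4 reproduces itself,
  since 2 * 4/8 + 2 = 3.\<close>

lemma L2_geometric_Cauchy:
  fixes Y :: "nat \<Rightarrow> 'a \<Rightarrow> real"
  assumes [measurable]: "\<And>n. Y n \<in> borel_measurable M"
    and b: "\<And>n. L2sq M (\<lambda>x. Y (Suc n) x - Y n x) \<le> ennreal (c * (1/8)^n)" and "0 \<le> c"
  shows "L2sq M (\<lambda>x. Y (n + k) x - Y n x) \<le> ennreal (4 * c * (1/8)^n)"
proof (induction k arbitrary: n)
  case 0 then show ?case using assms(3) by simp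
next
  case (Suc k)
  have "L2sq M (\<lambda>x. Y (n + Suc k) x - Y n x)
    = L2sq M (\<lambda>x. (Y (Suc n + k) x - Y (Suc n) x) + (Y (Suc n) x - Y n x))" by simp
  also have "\<dots> \<le> 2 * L2sq M (\<lambda>x. Y (Suc n + k) x - Y (Suc n) x)
     + 2 * L2sq M (\<lambda>x. Y (Suc n) x - Y n x)"
    by (rule nn_integral_sq_add_le) auto
  also have "\<dots> \<le> 2 * ennreal (4 * c * (1/8)^Suc n) + 2 * ennreal (c * (1/8)^n)"
    by (intro add_mono mult_left_mono Suc.IH b) auto
  also have "\<dots> = ennreal (2 * (4 * c * (1/8)^Suc n) + 2 * (c * (1/8)^n))"
    using assms(3) ennreal_mult[of 2 "4 * c * (1/8)^Suc n"] ennreal_mult[of 2 "c * (1/8)^n"]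
    by (subst ennreal_plus) (auto simp del: ennreal_plus)
  also have "\<dots> \<le> ennreal (4 * c * (1/8)^n)"
    using assms(3) by (intro ennreal_leI) (auto simp: algebra_simps)
  finally show ?case .
qed

text \<open>The increments are almost everywhere dominated by a geometric series. The limit is
  written with the total function \<open>lim\<close>, so it stays measurable although it is
  meaningless on a null set.\<close>

lemma L2_geometric_complete:
  fixes Y :: "nat \<Rightarrow> 'a \<Rightarrow> real"
  assumes [measurable]: "\<And>n. Y n \<in> borel_measurable M"
    and b: "\<And>n. L2sq M (\<lambda>x. Y (Suc n) x - Y n x) \<le> ennreal (c * (1/8)^n)" and "0 \<le> c"
  shows "AE x in M. convergent (\<lambda>n. Y n x)"
    and "L2sq M (\<lambda>x. lim (\<lambda>n. Y n x) - Y n x) \<le> ennreal (4 * c * (1/8)^n)"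
proof -
  have "AE x in M. \<exists>K\<ge>0. \<forall>n. ennreal ((Y (Suc n) x - Y n x)\<^sup>2) \<le> ennreal (K * (1/4)^n)"
    by (rule AE_geometric_bound[OF _ b \<open>0 \<le> c\<close>]) simp
  then show cv: "AE x in M. convergent (\<lambda>n. Y n x)"
  proof (eventually_elim)
    case (elim x)
    then obtain K where K: "K \<ge> 0" "\<And>n. ennreal ((Y (Suc n) x - Y n x)\<^sup>2) \<le> ennreal (K * (1/4)^n)"
      by auto
    have "\<bar>Y (Suc n) x - Y n x\<bar> \<le> sqrt K * (1/2)^n" for n
    proof -
      have "(Y (Suc n) x - Y n x)\<^sup>2 \<le> K * (1/4)^n"
        using K by (subst (asm) ennreal_le_iff) auto
      also have "\<dots> = (sqrt K * (1/2)^n)\<^sup>2"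
        using K(1) power_mult_distrib[of "1/2::real" "1/2" n] by (simp add: power_mult_distrib power2_eq_square)
      finally show ?thesis using K(1) by (intro abs_le_of_sq) auto
    qed
    then have "summable (\<lambda>n. Y (Suc n) x - Y n x)"
      by (intro summable_comparison_test'[where N=0, OF summable_mult[OF summable_geometric[of "1/2::real"]]])
        auto
    then have "convergent (\<lambda>n. \<Sum>i<n. Y (Suc i) x - Y i x)"
      by (simp add: summable_iff_convergent)
    then have "convergent (\<lambda>n. (Y n x - Y 0 x) + Y 0 x)"
      unfolding sum_lessThan_telescope[of "\<lambda>n. Y n x"] by (rule convergent_add[OF _ convergent_const])
    then show ?case by simp
  qed
  \<comment> \<open>Fatou's lemma in \<open>k\<close> transfers the Cauchy estimate to the
    limit.\<close>
  have "L2sq M (\<lambda>x. lim (\<lambda>n. Y n x) - Y n x)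
    = (\<integral>\<^sup>+x. liminf (\<lambda>k. ennreal ((Y (n + k) x - Y n x)\<^sup>2)) \<partial>M)"
    using cv
  proof (intro nn_integral_cong_AE, eventually_elim)
    case (elim x)
    then have "(\<lambda>k. Y (k + n) x) \<longlonglongrightarrow> lim (\<lambda>n. Y n x)"
      by (intro LIMSEQ_ignore_initial_segment) (simp add: convergent_LIMSEQ_iff)
    then have "(\<lambda>k. ennreal ((Y (n + k) x - Y n x)\<^sup>2)) \<longlonglongrightarrow> ennreal ((lim (\<lambda>n. Y n x) - Y n x)\<^sup>2)"
      by (intro tendsto_ennrealI tendsto_power tendsto_diff tendsto_const) (simp add: add.commute)
    then show ?case by (rule lim_imp_Liminf[OF sequentially_bot, symmetric])
  qed
  also have "\<dots> \<le> liminf (\<lambda>k. L2sq M (\<lambda>x. Y (n + k) x - Y n x))"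
    by (rule nn_integral_liminf) simp
  also have "\<dots> \<le> ennreal (4 * c * (1/8)^n)"
    by (intro Liminf_le always_eventually allI L2_geometric_Cauchy[OF assms]) auto
  finally show "L2sq M (\<lambda>x. lim (\<lambda>n. Y n x) - Y n x) \<le> ennreal (4 * c * (1/8)^n)" .
qed

text \<open>A deterministic inequality behind Doob's: with \<open>S\<close> the running maximum of
  \<open>s\<close>, the two sides agree for \<open>n = 0\<close>. A step in which \<open>S\<close>
  stays put changes both equally, and a step to a new maximum lowers the left side, relative to the
  right, by twice the square of the jump of \<open>S\<close>.\<close>

lemma Doob_pathwise:
  fixes s S :: "nat \<Rightarrow> real"
  assumes "S 0 = s 0" "\<And>k. S (Suc k) = max (S k) (s (Suc k))"
  shows "2 * (S n)\<^sup>2 - 4 * S n * s n + 2 * (s 0)\<^sup>2 \<le> - 4 * (\<Sum>k<n. S k * (s (Suc k) - s k))"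
proof (induction n)
  case (Suc n)
  have "2 * (S (Suc n))\<^sup>2 - 4 * S (Suc n) * s (Suc n) - 2 * (S n)\<^sup>2 + 4 * S n * s (Suc n) \<le> 0"
  proof (cases "s (Suc n) \<le> S n")
    case True then show ?thesis by (simp add: assms max_def)
  next
    case False
    then have "S (Suc n) = s (Suc n)" using assms(2)[of n] by simp
    moreover have "0 \<le> (s (Suc n) - S n)\<^sup>2" by simp
    ultimately show ?thesis by (simp add: power2_eq_square algebra_simps)
  qed
  then show ?case using Suc by (simp add: algebra_simps)
qed (simp add: assms power2_eq_square)

section \<open>Filtrations and progressive processes\<close>

text \<open>All null sets belong to every \<open>F t\<close>, so a limit can be redefined on a null
  set without losing adaptedness; \<open>ito_integral_exists\<close> does this to make every path
  continuous.\<close>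

locale filtered_space = prob_space M for M :: "'a measure" +
  fixes T :: real and F :: "real \<Rightarrow> 'a measure"
  assumes T_pos: "0 < T"
    and space_F: "\<And>t. t \<in> {0..T} \<Longrightarrow> space (F t) = space M"
    and sets_F_mono: "\<And>s t. 0 \<le> s \<Longrightarrow> s \<le> t \<Longrightarrow> t \<le> T \<Longrightarrow> sets (F s) \<subseteq> sets (F t)"
    and sets_F_subset: "\<And>t. t \<in> {0..T} \<Longrightarrow> sets (F t) \<subseteq> sets M"
    and null_sets_F: "\<And>t. t \<in> {0..T} \<Longrightarrow> null_sets M \<subseteq> sets (F t)"

text \<open>A measure in its own right, so that processes live on the product with \<open>M\<close>
  and Fubini applies directly. For \<open>t < 0\<close> the space is empty and integrals vanish,
  which amounts to extending integrands by zero to negative times.\<close>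

abbreviation time :: "real \<Rightarrow> real measure" where
  "time t \<equiv> restrict_space lborel {0..t}"

abbreviation flat :: "(real \<Rightarrow> 'a \<Rightarrow> 'b) \<Rightarrow> real \<times> 'a \<Rightarrow> 'b" where
  "flat X \<equiv> (\<lambda>z. X (fst z) (snd z))"

lemma emeasure_time: "emeasure (time t) (space (time t)) = ennreal t"
  by (cases "0 \<le> t")
    (auto simp: emeasure_restrict_space space_restrict_space ennreal_neg)

lemma finite_measure_time: "finite_measure (time t)"
  by (rule finite_measureI) (simp only: emeasure_time ennreal_neq_top infinity_ennreal_def not_False_eq_True)

interpretation time: finite_measure "time t" for t
  by (rule finite_measure_time)

lemma sets_time [measurable_cong]: "sets (time t) = sets (restrict_space borel {0..t})"
  by (intro sets_restrict_space_cong) simp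

lemma set_integral_time: "(LINT s:{0..t}|lborel. f s) = (LINT s|time t. (f s :: real))"
  by (simp add: set_lebesgue_integral_def integral_restrict_space)

lemma set_integrable_time: "set_integrable lborel {0..t} (f :: real \<Rightarrow> real) \<longleftrightarrow> integrable (time t) f"
  by (simp add: set_integrable_def integrable_restrict_space)

text \<open>Cauchy-Schwarz against the constant 1. If the integral on the right is infinite,
  \<open>t\<close> must be positive and the bound is trivial.\<close>

lemma integral_sq_le_time:
  assumes [measurable]: "c \<in> borel_measurable (time t)"
  shows "ennreal ((LINT s|time t. c s)\<^sup>2) \<le> ennreal t * L2sq (time t) c"
proof (cases "L2sq (time t) c < \<infinity>")
  case True
  then have sq: "square_integrable (time t) c" by (simp add: square_integrable_iff_nn_integral)
  show ?thesis
  proof (cases "0 \<le> t")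
    case t: True
    have m: "measure (time t) (space (time t)) = t"
      using emeasure_time[of t] t by (simp add: measure_def)
    have "\<bar>LINT s|time t. c s * 1\<bar> \<le> sqrt (LINT s|time t. (c s)\<^sup>2) * sqrt (LINT s|time t. 1\<^sup>2)"
      by (intro square_integrable_Cauchy_Schwarz sq time.square_integrable_const)
    then have "\<bar>LINT s|time t. c s\<bar> \<le> sqrt (LINT s|time t. (c s)\<^sup>2) * sqrt t" using m by simp
    then have "(LINT s|time t. c s)\<^sup>2 \<le> (sqrt (LINT s|time t. (c s)\<^sup>2) * sqrt t)\<^sup>2"
      by (subst power2_abs[symmetric]) (intro power_mono, auto)
    also have "\<dots> = t * (LINT s|time t. (c s)\<^sup>2)"
      using t by (simp add: power_mult_distrib)
    finally show ?thesis
      using t sq by (subst nn_integral_eq_integral)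
        (auto simp: square_integrable_def ennreal_mult[symmetric] intro!: ennreal_leI)
  next
    case False
    then have "{0..t} = {}" by auto
    then have "(LINT s|time t. c s) = 0"
      by (intro integral_eq_zero_AE AE_I2) (simp add: space_restrict_space)
    then show ?thesis by simp
  qed
next
  case inf: False
  have "0 < t"
  proof (rule ccontr)
    assume "\<not> 0 < t"
    then have "emeasure (time t) (space (time t)) = 0" by (simp only: emeasure_time ennreal_neg not_less)
    then have "AE s in time t. False" by (intro AE_I[of _ _ "space (time t)"] sets.top) auto
    then have "L2sq (time t) c = (\<integral>\<^sup>+s. 0 \<partial>time t)"
      by (intro nn_integral_cong_AE) auto
    with inf show False by simp
  qed
  with inf show ?thesis by (simp add: ennreal_mult_top less_top[symmetric])
qed

context filtered_space
begin

abbreviation PM :: "(real \<times> 'a) measure" where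
  "PM \<equiv> time T \<Otimes>\<^sub>M M"

text \<open>The time horizon sits in an indicator, so that quantities for different \<open>t\<close>
  are integrals over the same product space.\<close>

abbreviation L2sq_upto :: "real \<Rightarrow> (real \<times> 'a \<Rightarrow> real) \<Rightarrow> ennreal" where
  "L2sq_upto t f \<equiv> (\<integral>\<^sup>+z. indicator {..t} (fst z) * ennreal ((f z)\<^sup>2) \<partial>PM)"

lemma fst_measurable_PM [measurable]: "fst \<in> borel_measurable PM"
  by (intro measurable_compose[OF measurable_fst] measurable_restrict_space1) simp

lemma ident_F: "t \<in> {0..T} \<Longrightarrow> (\<lambda>\<omega>. \<omega>) \<in> measurable M (F t)"
  using measurable_from_subalg[of M "F t" "\<lambda>\<omega>. \<omega>" "F t"]
  by (auto simp: subalgebra_def space_F sets_F_subset)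

lemma measurable_F_M: "f \<in> measurable (F t) N \<Longrightarrow> t \<in> {0..T} \<Longrightarrow> f \<in> measurable M N"
  using measurable_compose[OF ident_F] by auto

lemma measurable_F_mono:
  "f \<in> measurable (F s) N \<Longrightarrow> 0 \<le> s \<Longrightarrow> s \<le> t \<Longrightarrow> t \<le> T \<Longrightarrow> f \<in> measurable (F t) N"
  by (rule measurable_from_subalg[of "F t" "F s"]) (auto simp: subalgebra_def space_F sets_F_mono)

sublocale PM: pair_sigma_finite "time T" M
  by (intro pair_sigma_finite.intro time.sigma_finite_measure_axioms sigma_finite_measure_axioms)

sublocale PM: finite_measure PM
proof (rule finite_measureI)
  have "emeasure PM (space PM) = emeasure (time T) (space (time T)) * emeasure M (space M)"
    unfolding space_pair_measure by (intro emeasure_pair_measure_Times sets.top)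
  then show "emeasure PM (space PM) \<noteq> \<infinity>"
    by (simp only: emeasure_time emeasure_space_1) simp
qed

lemma space_PM: "space PM = {0..T} \<times> space M"
  by (simp add: space_pair_measure space_restrict_space)

section \<open>Operations on progressive processes\<close>

lemma progressive_measurable_PM:
  assumes "progressive T F N X"
  shows "flat X \<in> measurable PM N"
proof -
  have 1: "(\<lambda>(s, \<omega>). X s \<omega>) \<in> measurable (restrict_space borel {0..T} \<Otimes>\<^sub>M F T) N"
    using assms T_pos by (auto simp: progressive_def)
  have [measurable]: "(\<lambda>\<omega>. \<omega>) \<in> measurable M (F T)" using T_pos by (intro ident_F) auto
  have "(\<lambda>z. (fst z, snd z)) \<in> measurable PM (restrict_space borel {0..T} \<Otimes>\<^sub>M F T)"
    by (intro measurable_Pair measurable_compose[OF measurable_snd])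
      (auto intro: measurable_compose[OF measurable_fst] simp: measurable_cong_sets[OF sets_time refl])
  from measurable_compose[OF this 1] show ?thesis by simp
qed

lemma progressiveD:
  "progressive T F N X \<Longrightarrow> t \<in> {0..T} \<Longrightarrow>
    flat X \<in> measurable (restrict_space borel {0..t} \<Otimes>\<^sub>M F t) N"
  by (auto simp: progressive_def case_prod_beta')

lemma progressive_adapted:
  assumes "progressive T F N X" "t \<in> {0..T}"
  shows "X t \<in> measurable (F t) N"
proof -
  have "(\<lambda>\<omega>. (t, \<omega>)) \<in> measurable (F t) (restrict_space borel {0..t} \<Otimes>\<^sub>M F t)"
    using assms(2) by (intro measurable_Pair) (auto simp: space_restrict_space)
  from measurable_compose[OF this progressiveD[OF assms]] show ?thesis by simp
qed

lemma progressive_measurable_M: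
  "progressive T F N X \<Longrightarrow> t \<in> {0..T} \<Longrightarrow> X t \<in> measurable M N"
  using progressive_adapted measurable_F_M by blast

lemma progressive_path:
  assumes "progressive T F N X" "\<omega> \<in> space M"
  shows "(\<lambda>t. X t \<omega>) \<in> measurable (time T) N"
  using measurable_compose[OF measurable_Pair2'[OF assms(2)] progressive_measurable_PM[OF assms(1)]]
  by simp

lemma progressive_compose:
  assumes "progressive T F N X"
    and "\<And>t. t \<in> {0..T} \<Longrightarrow>
      (\<lambda>z. f (fst z) (snd z)) \<in> measurable (restrict_space borel {0..t} \<Otimes>\<^sub>M N) K"
  shows "progressive T F K (\<lambda>t \<omega>. f t (X t \<omega>))"
  unfolding progressive_def
proof
  fix t assume t: "t \<in> {0..T}"
  have [measurable]: "(\<lambda>(s, \<omega>). X s \<omega>) \<in> measurable (restrict_space borel {0..t} \<Otimes>\<^sub>M F t) N"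
    using assms(1) t by (auto simp: progressive_def)
  have "(\<lambda>z. (fst z, (\<lambda>(s, \<omega>). X s \<omega>) z)) \<in>
      measurable (restrict_space borel {0..t} \<Otimes>\<^sub>M F t) (restrict_space borel {0..t} \<Otimes>\<^sub>M N)"
    by measurable
  from measurable_compose[OF this assms(2)[OF t]]
  show "(\<lambda>(s, \<omega>). f s (X s \<omega>)) \<in> measurable (restrict_space borel {0..t} \<Otimes>\<^sub>M F t) K"
    by (simp add: case_prod_beta')
qed

lemma progressive_Pair:
  assumes "progressive T F N X" "progressive T F K Y"
  shows "progressive T F (N \<Otimes>\<^sub>M K) (\<lambda>t \<omega>. (X t \<omega>, Y t \<omega>))"
  using assms by (auto simp: progressive_def case_prod_beta' intro!: measurable_Pair)

lemma progressive_real_compose: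
  assumes "progressive T F borel X" "f \<in> borel_measurable borel"
  shows "progressive T F borel (\<lambda>t \<omega>. f (X t \<omega>))"
  using assms by (auto simp: progressive_def case_prod_beta' intro: measurable_compose)

lemma progressive_add [intro]:
  "progressive T F borel X \<Longrightarrow> progressive T F borel Y \<Longrightarrow>
    progressive T F borel (\<lambda>t \<omega>. X t \<omega> + Y t \<omega> :: real)"
  by (auto simp: progressive_def case_prod_beta' intro!: borel_measurable_add)

lemma progressive_diff [intro]:
  "progressive T F borel X \<Longrightarrow> progressive T F borel Y \<Longrightarrow>
    progressive T F borel (\<lambda>t \<omega>. X t \<omega> - Y t \<omega> :: real)"
  by (auto simp: progressive_def case_prod_beta' intro!: borel_measurable_diff)

lemma progressive_uminus [intro]:
  "progressive T F borel X \<Longrightarrow> progressive T F borel (\<lambda>t \<omega>. - X t \<omega> :: real)"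
  by (auto simp: progressive_def case_prod_beta' intro!: borel_measurable_uminus)

lemma progressive_mult [intro]:
  "progressive T F borel X \<Longrightarrow> progressive T F borel Y \<Longrightarrow>
    progressive T F borel (\<lambda>t \<omega>. X t \<omega> * Y t \<omega> :: real)"
  by (auto simp: progressive_def case_prod_beta' intro!: borel_measurable_times)

lemma progressive_deterministic:
  assumes "b \<in> borel_measurable borel"
  shows "progressive T F borel (\<lambda>t \<omega>. b t :: real)"
  unfolding progressive_def case_prod_beta'
  by (intro ballI measurable_compose[OF measurable_fst] measurable_restrict_space1 assms)

lemma progressive_const [intro]: "progressive T F borel (\<lambda>t \<omega>. c :: real)"
  by (auto simp: progressive_def)

lemma progressive_sum [intro]:
  "(\<And>i. i \<in> A \<Longrightarrow> progressive T F borel (X i)) \<Longrightarrow>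
    progressive T F borel (\<lambda>t \<omega>. (\<Sum>i\<in>A. X i t \<omega>) :: real)"
  by (induction A rule: infinite_finite_induct) auto

lemma progressive_limit:
  assumes "\<And>n. progressive T F borel (X n)"
  shows "progressive T F borel (\<lambda>t \<omega>. lim (\<lambda>n. X n t \<omega> :: real))"
  using assms by (auto simp: progressive_def case_prod_beta' intro!: borel_measurable_lim_metric)

text \<open>\<open>X\<close> is the pointwise limit of \<open>X\<close> evaluated at rounded times,
  and each of these takes its time argument from a countable set, where joint measurability reduces
  to adaptedness.\<close>

lemma continuous_adapted_progressive:
  assumes X: "\<And>t. t \<in> {0..T} \<Longrightarrow> X t \<in> borel_measurable (F t)"
    and cont: "\<And>\<omega>. \<omega> \<in> space M \<Longrightarrow> continuous_on {0..T} (\<lambda>t. X t \<omega> :: real)"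
  shows "progressive T F borel X"
  unfolding progressive_def
proof
  fix t assume t: "t \<in> {0..T}"
  let ?R = "restrict_space borel {0..t} \<Otimes>\<^sub>M F t"
  \<comment> \<open>Rounding goes up to the next multiple of \<open>1 / real (Suc n)\<close>; the
    cut at \<open>t\<close> keeps the rounded time inside \<open>{0..t}\<close>, hence the value
    measurable for \<open>F t\<close>.\<close>
  define g where "g n s = min t (max 0 (real_of_int \<lceil>s * real (Suc n)\<rceil> / real (Suc n)))" for n s
  have [measurable]: "fst \<in> borel_measurable ?R"
    by (intro measurable_compose[OF measurable_fst] measurable_restrict_space1) simp
  have meas: "(\<lambda>z. X (g n (fst z)) (snd z)) \<in> borel_measurable ?R" for n
  proof -
    have "(\<lambda>z. (\<lambda>k z. X (min t (max 0 (real_of_int k / real (Suc n)))) (snd z))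
        (\<lceil>fst z * real (Suc n)\<rceil>) z) \<in> borel_measurable ?R"
    proof (rule measurable_compose_countable[where g="\<lambda>z. \<lceil>fst z * real (Suc n)\<rceil>" and
          f="\<lambda>k z. X (min t (max 0 (real_of_int k / real (Suc n)))) (snd z)"])
      fix k :: int
      have "X (min t (max 0 (real_of_int k / real (Suc n)))) \<in> borel_measurable (F t)"
        using t by (intro measurable_F_mono[OF X]) auto
      then show "(\<lambda>z. X (min t (max 0 (real_of_int k / real (Suc n)))) (snd z)) \<in> borel_measurable ?R"
        by (rule measurable_compose[OF measurable_snd])
    qed measurable
    then show ?thesis by (simp add: g_def)
  qed
  have lim: "(\<lambda>n. X (g n (fst z)) (snd z)) \<longlonglongrightarrow> X (fst z) (snd z)" if z: "z \<in> space ?R" for z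
  proof -
    have s: "fst z \<in> {0..t}" and w: "snd z \<in> space M"
      using z t by (auto simp: space_pair_measure space_restrict_space space_F)
    have bnd: "\<bar>g n (fst z) - fst z\<bar> \<le> 1 / real (Suc n)" for n
    proof -
      let ?N = "real (Suc n)"
      have "x \<le> real_of_int \<lceil>x * N\<rceil> / N \<and> real_of_int \<lceil>x * N\<rceil> / N \<le> x + 1 / N"
        if "0 < N" for x N :: real
      proof -
        have "x * N \<le> real_of_int \<lceil>x * N\<rceil>" "real_of_int \<lceil>x * N\<rceil> \<le> x * N + 1"
          by linarith+
        then show ?thesis using that by (auto simp: field_simps)
      qed
      from this[of ?N "fst z"] have "fst z \<le> real_of_int \<lceil>fst z * ?N\<rceil> / ?N"
        "real_of_int \<lceil>fst z * ?N\<rceil> / ?N \<le> fst z + 1 / ?N"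
        by (auto simp del: of_nat_Suc)
      then show ?thesis using s unfolding g_def by auto
    qed
    have "(\<lambda>n. g n (fst z) - fst z) \<longlonglongrightarrow> 0"
      by (rule Lim_null_comparison[OF always_eventually[OF allI] LIMSEQ_Suc[OF lim_1_over_n]])
        (use bnd in auto)
    then have "(\<lambda>n. g n (fst z)) \<longlonglongrightarrow> fst z" by (simp add: LIM_zero_iff)
    moreover have "g n (fst z) \<in> {0..T}" for n using t by (auto simp: g_def)
    ultimately show ?thesis
      using s t by (intro continuous_on_tendsto_compose[OF cont[OF w]]) auto
  qed
  show "(\<lambda>(s, \<omega>). X s \<omega>) \<in> borel_measurable ?R"
    unfolding case_prod_beta' by (rule borel_measurable_LIMSEQ_real[OF lim meas])
qed

text \<open>The variable upper limit is moved into the integrand as a condition on a fixed interval,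
  after which measurability of parametrized integrals applies.\<close>

lemma progressive_integral:
  assumes c: "progressive T F borel c"
  shows "progressive T F borel (\<lambda>t \<omega>. LINT s|time t. (c s \<omega> :: real))"
  unfolding progressive_def
proof
  fix t assume t: "t \<in> {0..T}"
  let ?R = "restrict_space borel {0..t} \<Otimes>\<^sub>M F t"
  have [measurable]: "(\<lambda>z. fst (fst z)) \<in> borel_measurable (?R \<Otimes>\<^sub>M time t)"
    by (intro measurable_compose[OF measurable_fst] measurable_restrict_space1) simp
  have [measurable]: "(\<lambda>z. snd z) \<in> borel_measurable (?R \<Otimes>\<^sub>M time t)"
    by (intro measurable_compose[OF measurable_snd] measurable_restrict_space1) simp
  have "(\<lambda>z. (snd z, snd (fst z))) \<in> measurable (?R \<Otimes>\<^sub>M time t) ?R"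
    by (intro measurable_Pair measurable_compose[OF measurable_fst measurable_snd])
      (auto simp: measurable_cong_sets[OF refl sets_time[symmetric]])
  from measurable_compose[OF this progressiveD[OF c t]]
  have [measurable]: "(\<lambda>z. c (snd z) (snd (fst z))) \<in> borel_measurable (?R \<Otimes>\<^sub>M time t)"
    by simp
  have "(\<lambda>z. if 0 \<le> snd z \<and> snd z \<le> fst (fst z) then c (snd z) (snd (fst z)) else 0)
      \<in> borel_measurable (?R \<Otimes>\<^sub>M time t)" by measurable
  then have "(\<lambda>y. LINT r|time t. (if 0 \<le> r \<and> r \<le> fst y then c r (snd y) else 0)) \<in> borel_measurable ?R"
    by (intro time.borel_measurable_lebesgue_integral) (simp add: case_prod_beta')
  moreover have "(LINT r|time t. (if 0 \<le> r \<and> r \<le> fst y then c r (snd y) else 0)) =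
      (LINT r|time (fst y). c r (snd y))" if "y \<in> space ?R" for y
  proof -
    have "fst y \<in> {0..t}" using that by (auto simp: space_pair_measure space_restrict_space)
    then show ?thesis
      by (simp add: integral_restrict_space) (intro Bochner_Integration.integral_cong, auto split: split_indicator)
  qed
  ultimately show "(\<lambda>(s, \<omega>). LINT r|time s. c r \<omega>) \<in> borel_measurable ?R"
    unfolding case_prod_beta' by (rule measurable_cong[THEN iffD1, rotated])
qed

end

section \<open>Square integrable martingales\<close>

context filtered_space
begin

lemma flat_nn_integral:
  assumes "flat g \<in> borel_measurable PM"
  shows "(\<integral>\<^sup>+\<omega>. (\<integral>\<^sup>+t\<in>{0..T}. g t \<omega> \<partial>lborel) \<partial>M) = (\<integral>\<^sup>+z. flat g z \<partial>PM)"
proof -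
  have "(\<integral>\<^sup>+t\<in>{0..T}. g t \<omega> \<partial>lborel) = (\<integral>\<^sup>+t. g t \<omega> \<partial>time T)" for \<omega>
    by (simp add: nn_integral_restrict_space)
  then show ?thesis using PM.nn_integral_snd[OF assms] by simp
qed

lemma L2_proc_iff:
  "\<alpha> \<in> L2_proc M T F \<longleftrightarrow> progressive T F borel \<alpha> \<and> square_integrable PM (flat \<alpha>)"
  (is "?l \<longleftrightarrow> ?r")
proof (cases "progressive T F borel \<alpha>")
  case True
  note [measurable] = progressive_measurable_PM[OF True]
  have "(\<integral>\<^sup>+\<omega>. (\<integral>\<^sup>+t\<in>{0..T}. ennreal ((\<alpha> t \<omega>)\<^sup>2) \<partial>lborel) \<partial>M) = L2sq PM (\<lambda>z. flat \<alpha> z)"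
    by (rule flat_nn_integral) simp
  then show ?thesis using True by (simp add: L2_proc_def square_integrable_iff_nn_integral)
qed (simp add: L2_proc_def)

text \<open>The martingale property is stated as orthogonality of the increments to the past, which avoids
  conditional expectations.\<close>

definition L2_martingale :: "(real \<Rightarrow> 'a \<Rightarrow> real) \<Rightarrow> bool" where
  "L2_martingale Y \<longleftrightarrow>
     (\<forall>t\<in>{0..T}. Y t \<in> borel_measurable (F t) \<and> square_integrable M (Y t)) \<and>
     (\<forall>s t \<xi>. 0 \<le> s \<longrightarrow> s \<le> t \<longrightarrow> t \<le> T \<longrightarrow> \<xi> \<in> borel_measurable (F s) \<longrightarrow>
        square_integrable M \<xi> \<longrightarrow> (LINT \<omega>|M. \<xi> \<omega> * (Y t \<omega> - Y s \<omega>)) = 0)"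

lemma L2_martingaleD:
  assumes "L2_martingale Y"
  shows "t \<in> {0..T} \<Longrightarrow> Y t \<in> borel_measurable (F t)"
    and "t \<in> {0..T} \<Longrightarrow> square_integrable M (Y t)"
    and "0 \<le> s \<Longrightarrow> s \<le> t \<Longrightarrow> t \<le> T \<Longrightarrow> \<xi> \<in> borel_measurable (F s) \<Longrightarrow>
      square_integrable M \<xi> \<Longrightarrow> (LINT \<omega>|M. \<xi> \<omega> * (Y t \<omega> - Y s \<omega>)) = 0"
  using assms unfolding L2_martingale_def by blast+

lemma L2_martingale_eq:
  assumes "L2_martingale Y" "0 \<le> s" "s \<le> t" "t \<le> T" "\<xi> \<in> borel_measurable (F s)"
    "square_integrable M \<xi>"
  shows "(LINT \<omega>|M. \<xi> \<omega> * Y t \<omega>) = (LINT \<omega>|M. \<xi> \<omega> * Y s \<omega>)"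
proof -
  have "integrable M (\<lambda>\<omega>. \<xi> \<omega> * Y t \<omega>)" "integrable M (\<lambda>\<omega>. \<xi> \<omega> * Y s \<omega>)"
    using assms by (auto intro!: square_integrable_mult L2_martingaleD(2))
  then show ?thesis using L2_martingaleD(3)[OF assms] by (simp add: right_diff_distrib)
qed

lemma L2_martingale_add:
  assumes X: "L2_martingale X" and Y: "L2_martingale Y"
  shows "L2_martingale (\<lambda>t \<omega>. X t \<omega> + c * Y t \<omega>)"
  unfolding L2_martingale_def
proof (intro conjI ballI allI impI)
  fix t assume "t \<in> {0..T}"
  then show "(\<lambda>\<omega>. X t \<omega> + c * Y t \<omega>) \<in> borel_measurable (F t)"
    and "square_integrable M (\<lambda>\<omega>. X t \<omega> + c * Y t \<omega>)"
    using L2_martingaleD[OF X] L2_martingaleD[OF Y]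
    by (auto intro!: square_integrable_add square_integrable_cmult)
next
  fix s t \<xi> assume a: "0 \<le> s" "s \<le> t" "t \<le> T" "\<xi> \<in> borel_measurable (F s)" "square_integrable M \<xi>"
  have i: "integrable M (\<lambda>\<omega>. \<xi> \<omega> * (X t \<omega> - X s \<omega>))" "integrable M (\<lambda>\<omega>. \<xi> \<omega> * (Y t \<omega> - Y s \<omega>))"
    using a L2_martingaleD(2)[OF X] L2_martingaleD(2)[OF Y]
    by (auto intro!: square_integrable_mult square_integrable_diff)
  have "(LINT \<omega>|M. \<xi> \<omega> * (X t \<omega> + c * Y t \<omega> - (X s \<omega> + c * Y s \<omega>))) =
    (LINT \<omega>|M. \<xi> \<omega> * (X t \<omega> - X s \<omega>) + c * (\<xi> \<omega> * (Y t \<omega> - Y s \<omega>)))"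
    by (intro Bochner_Integration.integral_cong) (auto simp: algebra_simps)
  then show "(LINT \<omega>|M. \<xi> \<omega> * (X t \<omega> + c * Y t \<omega> - (X s \<omega> + c * Y s \<omega>))) = 0"
    using i L2_martingaleD(3)[OF X a] L2_martingaleD(3)[OF Y a] by simp
qed

lemma L2_martingale_zero: "L2_martingale (\<lambda>t \<omega>. 0)"
  by (auto simp: L2_martingale_def)

lemma L2_martingale_sum:
  "(\<And>i. i \<in> A \<Longrightarrow> L2_martingale (Y i)) \<Longrightarrow> L2_martingale (\<lambda>t \<omega>. \<Sum>i\<in>A. Y i t \<omega>)"
proof (induction A rule: infinite_finite_induct)
  case (insert i A)
  then show ?case using L2_martingale_add[of "Y i" "\<lambda>t \<omega>. \<Sum>i\<in>A. Y i t \<omega>" 1] by simp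
qed (auto simp: L2_martingale_zero)

text \<open>For a fixed test variable the martingale identity is an equality of inner products, and
  these are continuous in mean square.\<close>

lemma L2_martingale_limit:
  assumes Y: "\<And>j. L2_martingale (Y j)"
    and Z: "\<And>t. t \<in> {0..T} \<Longrightarrow> Z t \<in> borel_measurable (F t)"
    and lim: "\<And>t. t \<in> {0..T} \<Longrightarrow> (\<lambda>j::nat. L2sq M (\<lambda>\<omega>. Y j t \<omega> - Z t \<omega>)) \<longlonglongrightarrow> 0"
  shows "L2_martingale Z"
proof -
  have sqZ: "square_integrable M (Z t)" if t: "t \<in> {0..T}" for t
  proof -
    have ZM: "Z t \<in> borel_measurable M" by (rule measurable_F_M[OF Z[OF t] t])
    \<comment> \<open>One member at finite distance from the limit suffices to make the limit square
      integrable; 1 is an arbitrary choice.\<close>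
    have "\<forall>\<^sub>F j in sequentially. L2sq M (\<lambda>\<omega>. Y j t \<omega> - Z t \<omega>) < 1"
      using order_tendstoD(2)[OF lim[OF t], of 1] by simp
    then obtain j where "L2sq M (\<lambda>\<omega>. Y j t \<omega> - Z t \<omega>) < 1"
      by (auto simp: eventually_sequentially)
    then have "square_integrable M (\<lambda>\<omega>. Y j t \<omega> - Z t \<omega>)"
      using ZM square_integrable_measurable[OF L2_martingaleD(2)[OF Y t]]
      by (auto simp: square_integrable_iff_nn_integral intro: order.strict_trans2 less_imp_le)
    from square_integrable_diff[OF L2_martingaleD(2)[OF Y[of j] t] this]
    show ?thesis by simp
  qed
  show ?thesis
    unfolding L2_martingale_def
  proof (intro conjI ballI allI impI sqZ Z)
    fix s t \<xi> assume a: "0 \<le> s" "s \<le> t" "t \<le> T" "\<xi> \<in> borel_measurable (F s)" "square_integrable M \<xi>"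
    have st: "s \<in> {0..T}" "t \<in> {0..T}" using a by auto
    have l: "(\<lambda>j. LINT \<omega>|M. \<xi> \<omega> * Y j r \<omega>) \<longlonglongrightarrow> (LINT \<omega>|M. \<xi> \<omega> * Z r \<omega>)" if "r \<in> {0..T}" for r
      using that by (intro L2_tendsto_inner a sqZ L2_martingaleD(2)[OF Y] lim) auto
    have "(LINT \<omega>|M. \<xi> \<omega> * Z t \<omega>) = (LINT \<omega>|M. \<xi> \<omega> * Z s \<omega>)"
      by (rule LIMSEQ_unique[OF l[OF st(2)]]) (use l[OF st(1)] L2_martingale_eq[OF Y a] in simp)
    moreover have "integrable M (\<lambda>\<omega>. \<xi> \<omega> * Z t \<omega>)" "integrable M (\<lambda>\<omega>. \<xi> \<omega> * Z s \<omega>)"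
      using a st by (auto intro!: square_integrable_mult sqZ)
    ultimately show "(LINT \<omega>|M. \<xi> \<omega> * (Z t \<omega> - Z s \<omega>)) = 0"
      by (simp add: right_diff_distrib)
  qed
qed

text \<open>The increment is orthogonal to \<open>Y s\<close>, so its mean square is what the second
  moment gains from \<open>s\<close> to \<open>t\<close>.\<close>

lemma L2_martingale_sq_mono:
  assumes Y: "L2_martingale Y" and "0 \<le> s" "s \<le> t" "t \<le> T"
  shows "(LINT \<omega>|M. (Y s \<omega>)\<^sup>2) \<le> (LINT \<omega>|M. (Y t \<omega>)\<^sup>2)"
proof -
  have sq: "square_integrable M (Y s)" "square_integrable M (Y t)" and m: "Y s \<in> borel_measurable (F s)"
    using L2_martingaleD[OF Y] assms(2-) by auto
  have i: "integrable M (\<lambda>\<omega>. (Y s \<omega>)\<^sup>2)" "integrable M (\<lambda>\<omega>. (Y t \<omega>)\<^sup>2)"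
    "integrable M (\<lambda>\<omega>. Y s \<omega> * (Y t \<omega> - Y s \<omega>))"
    using sq by (auto simp: square_integrable_def intro!: square_integrable_mult square_integrable_diff)
  have "(LINT \<omega>|M. (Y s \<omega>)\<^sup>2) = (LINT \<omega>|M. (Y s \<omega>)\<^sup>2 + 2 * (Y s \<omega> * (Y t \<omega> - Y s \<omega>)))"
    using i L2_martingaleD(3)[OF Y assms(2-) m sq(1)] by simp
  also have "\<dots> \<le> (LINT \<omega>|M. (Y t \<omega>)\<^sup>2)"
  proof (rule integral_mono)
    fix \<omega>
    have "0 \<le> (Y t \<omega> - Y s \<omega>)\<^sup>2" by simp
    then show "(Y s \<omega>)\<^sup>2 + 2 * (Y s \<omega> * (Y t \<omega> - Y s \<omega>)) \<le> (Y t \<omega>)\<^sup>2"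
      by (simp add: power2_eq_square algebra_simps)
  qed (use i in auto)
  finally show ?thesis .
qed

section \<open>Doob's maximal inequality over dyadic times\<close>

definition grid :: "nat \<Rightarrow> real set" where
  "grid n = (\<lambda>k. T * real k / 2 ^ n) ` {..2 ^ n}"

text \<open>Countable, so that suprema over it are measurable, and a union of nested grids, so that
  monotone convergence applies to them.\<close>

definition dyadics :: "real set" where
  "dyadics = (\<Union>n. grid n)"

lemma countable_dyadics: "countable dyadics"
  unfolding dyadics_def grid_def by auto

lemma dyadics_subset: "dyadics \<subseteq> {0..T}"
  using T_pos by (auto simp: dyadics_def grid_def field_simps)

lemma grid_mono: "grid n \<subseteq> grid (Suc n)"
proof
  fix t assume "t \<in> grid n"
  then obtain k where "k \<le> 2 ^ n" "t = T * real k / 2 ^ n" by (auto simp: grid_def)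
  then show "t \<in> grid (Suc n)"
    by (auto simp: grid_def intro!: image_eqI[of _ _ "2 * k"])
qed

lemma dyadic_approx:
  assumes "t \<in> {0..T}"
  obtains d where "\<And>n. d n \<in> dyadics" "d \<longlonglongrightarrow> t"
proof
  define k where "k n = nat \<lfloor>t * 2 ^ n / T\<rfloor>" for n :: nat
  have k: "real (k n) \<le> t * 2 ^ n / T" "t * 2 ^ n / T < real (k n) + 1" for n
    using assms T_pos unfolding k_def by (auto simp: of_nat_nat)
  show "T * real (k n) / 2 ^ n \<in> dyadics" for n
  proof -
    have "t * 2 ^ n / T \<le> 2 ^ n" using assms T_pos by (auto simp: field_simps)
    then have "real (k n) \<le> real (2 ^ n)" using k(1)[of n] unfolding of_nat_power of_nat_numeral by linarith
    then have "k n \<le> 2 ^ n" by (simp only: of_nat_le_iff)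
    then show ?thesis by (auto simp: dyadics_def grid_def)
  qed
  have "\<bar>T * real (k n) / 2 ^ n - t\<bar> \<le> T * (1/2) ^ n" for n
  proof -
    have "T * real (k n) \<le> t * 2 ^ n" "t * 2 ^ n \<le> T * real (k n) + T"
      using k[of n] T_pos by (auto simp: field_simps)
    then have "T * real (k n) / 2 ^ n \<le> t" "t \<le> T * real (k n) / 2 ^ n + T * (1/2) ^ n"
      by (auto simp: field_simps power_divide)
    then show ?thesis by simp
  qed
  then have "(\<lambda>n. T * real (k n) / 2 ^ n - t) \<longlonglongrightarrow> 0"
    by (intro Lim_null_comparison[OF always_eventually[OF allI] tendsto_mult_right_zero[OF LIMSEQ_power_zero]])
      auto
  then show "(\<lambda>n. T * real (k n) / 2 ^ n) \<longlonglongrightarrow> t" by (simp add: LIM_zero_iff)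
qed

text \<open>Density and continuity. It replaces the uncountable supremum in \<open>S2_proc\<close>
  by a measurable one.\<close>

lemma SUP_dyadics:
  assumes "continuous_on {0..T} f"
  shows "(SUP t\<in>{0..T}. ennreal ((f t)\<^sup>2)) = (SUP t\<in>dyadics. ennreal ((f t)\<^sup>2))"
proof (rule antisym)
  show "(SUP t\<in>{0..T}. ennreal ((f t)\<^sup>2)) \<le> (SUP t\<in>dyadics. ennreal ((f t)\<^sup>2))"
  proof (rule SUP_least)
    fix t assume t: "t \<in> {0..T}"
    from dyadic_approx[OF t] obtain d where d: "\<And>n. d n \<in> dyadics" "d \<longlonglongrightarrow> t" by metis
    have dT: "d n \<in> {0..T}" for n using d(1)[of n] dyadics_subset by blast
    have "(\<lambda>n. f (d n)) \<longlonglongrightarrow> f t"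
      by (rule continuous_on_tendsto_compose[OF assms d(2) t always_eventually[OF allI[OF dT]]])
    then have "(\<lambda>n. ennreal ((f (d n))\<^sup>2)) \<longlonglongrightarrow> ennreal ((f t)\<^sup>2)"
      by (intro tendsto_ennrealI tendsto_power)
    then show "ennreal ((f t)\<^sup>2) \<le> (SUP t\<in>dyadics. ennreal ((f t)\<^sup>2))"
      by (rule LIMSEQ_le_const2) (auto intro!: SUP_upper d)
  qed
qed (intro SUP_subset_mono dyadics_subset order_refl)

text \<open>Integrate \<open>Doob_pathwise\<close> for the absolute values on the grid: the
  transform on its right has nonnegative mean because \<open>\<bar>Y\<bar>\<close> is a
  submartingale, tested here against the running maximum.\<close>

lemma Doob_grid:
  assumes Y: "L2_martingale Y"
  shows "(\<integral>\<^sup>+\<omega>. (SUP t\<in>grid n. ennreal ((Y t \<omega>)\<^sup>2)) \<partial>M) \<le> 4 * L2sq M (\<lambda>\<omega>. Y T \<omega>)"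
proof -
  define N :: nat where "N = 2 ^ n"
  define r where "r k = T * real k / real N" for k
  define y where "y k = Y (r k)" for k
  \<comment> \<open>The running maximum of \<open>\<bar>y\<bar>\<close>, as a recursion so that
    adaptedness and integrability follow by induction.\<close>
  define S where "S k \<omega> = rec_nat \<bar>y 0 \<omega>\<bar> (\<lambda>k s. max s \<bar>y (Suc k) \<omega>\<bar>) k" for k \<omega>
  have S0: "S 0 \<omega> = \<bar>y 0 \<omega>\<bar>" and SS: "S (Suc k) \<omega> = max (S k \<omega>) \<bar>y (Suc k) \<omega>\<bar>" for k \<omega>
    by (simp_all add: S_def)
  have N0: "N > 0" by (simp add: N_def)
  have r: "r k \<in> {0..T}" if "k \<le> N" for k
    using that T_pos N0 by (auto simp: r_def field_simps)
  have r_mono: "r k \<le> r (Suc k)" for k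
    unfolding r_def using T_pos by (intro divide_right_mono mult_left_mono) auto
  have rN: "r N = T" using N0 by (simp add: r_def)
  have y_sq: "square_integrable M (y k)" and y_m: "y k \<in> borel_measurable (F (r k))" if "k \<le> N" for k
    unfolding y_def using L2_martingaleD[OF Y] r[OF that] by auto
  have S_ge: "\<bar>y j \<omega>\<bar> \<le> S k \<omega>" if "j \<le> k" for j k \<omega>
    using that by (induction k) (auto simp: S0 SS le_Suc_eq max.coboundedI1)
  have S_pos: "0 \<le> S k \<omega>" for k \<omega>
    using S_ge[of 0 k \<omega>] by (meson abs_ge_zero order_trans zero_le)
  have S_m: "S k \<in> borel_measurable (F (r k))" if "k \<le> N" for k
    using that
  proof (induction k)
    case (Suc k)
    have "S k \<in> borel_measurable (F (r (Suc k)))"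
      using Suc r[of k] r[of "Suc k"] r_mono[of k] by (intro measurable_F_mono[OF Suc.IH]) auto
    then show ?case using y_m[OF Suc.prems] by (auto simp: SS[abs_def])
  qed (use y_m[of 0] in \<open>auto simp: S0[abs_def]\<close>)
  have S_sq: "square_integrable M (S k)" if "k \<le> N" for k
    using that
  proof (induction k)
    case 0
    have "S 0 \<in> borel_measurable M" using S_m[of 0] r[of 0] by (intro measurable_F_M) auto
    then have "square_integrable M (S 0)"
      by (rule square_integrable_bound[OF y_sq[OF le0]]) (simp add: S0)
    then show ?case .
  next
    case (Suc k)
    have a: "square_integrable M (\<lambda>\<omega>. \<bar>y (Suc k) \<omega>\<bar>)"
      using y_sq[OF Suc.prems] by (auto simp: square_integrable_def)
    show ?case
    proof (rule square_integrable_bound[OF square_integrable_add[OF Suc.IH a]])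
      show "S (Suc k) \<in> borel_measurable M"
        using S_m[OF Suc.prems] r[OF Suc.prems] by (rule measurable_F_M)
      show "AE \<omega> in M. \<bar>S (Suc k) \<omega>\<bar> \<le> \<bar>S k \<omega> + \<bar>y (Suc k) \<omega>\<bar>\<bar>"
        using S_pos by (intro AE_I2) (auto simp: SS max_def)
    qed (use Suc.prems in simp)
  qed
  have abs_sq: "square_integrable M (\<lambda>\<omega>. \<bar>y k \<omega>\<bar>)" if "k \<le> N" for k
    using y_sq[OF that] by (auto simp: square_integrable_def)
  have ortho: "0 \<le> (LINT \<omega>|M. S k \<omega> * (\<bar>y (Suc k) \<omega>\<bar> - \<bar>y k \<omega>\<bar>))" if "k < N" for k
  proof -
    have k: "k \<le> N" "Suc k \<le> N" using that by auto
    \<comment> \<open>The sign is what turns the martingale identity into a submartingale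
      inequality: \<open>sgn a * (b - a) \<le> \<bar>b\<bar> - \<bar>a\<bar>\<close>.\<close>
    define \<xi> where "\<xi> \<omega> = S k \<omega> * sgn (y k \<omega>)" for \<omega>
    have m: "\<xi> \<in> borel_measurable (F (r k))"
      unfolding \<xi>_def
      by (intro borel_measurable_times S_m[OF k(1)] measurable_compose[OF y_m[OF k(1)] borel_measurable_sgn])
    have sq: "square_integrable M \<xi>"
      by (rule square_integrable_bound[OF S_sq[OF k(1)] measurable_F_M[OF m r[OF k(1)]]])
        (auto simp: \<xi>_def abs_mult abs_sgn_eq)
    have "(LINT \<omega>|M. \<xi> \<omega> * (y (Suc k) \<omega> - y k \<omega>)) = 0"
      unfolding y_def using r[OF k(1)] r[OF k(2)] r_mono[of k]
      by (intro L2_martingaleD(3)[OF Y] m sq) auto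
    moreover have "(LINT \<omega>|M. \<xi> \<omega> * (y (Suc k) \<omega> - y k \<omega>)) \<le>
        (LINT \<omega>|M. S k \<omega> * (\<bar>y (Suc k) \<omega>\<bar> - \<bar>y k \<omega>\<bar>))"
    proof (rule integral_mono)
      show "integrable M (\<lambda>\<omega>. \<xi> \<omega> * (y (Suc k) \<omega> - y k \<omega>))"
        by (intro square_integrable_mult sq square_integrable_diff y_sq k)
      show "integrable M (\<lambda>\<omega>. S k \<omega> * (\<bar>y (Suc k) \<omega>\<bar> - \<bar>y k \<omega>\<bar>))"
        by (intro square_integrable_mult S_sq square_integrable_diff abs_sq k)
      fix \<omega>
      have "sgn a * (b - a) \<le> \<bar>b\<bar> - \<bar>a\<bar>" for a b :: real
        by (auto simp: sgn_if)
      then show "\<xi> \<omega> * (y (Suc k) \<omega> - y k \<omega>) \<le> S k \<omega> * (\<bar>y (Suc k) \<omega>\<bar> - \<bar>y k \<omega>\<bar>)"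
        using S_pos unfolding \<xi>_def mult.assoc by (intro mult_left_mono)
    qed
    ultimately show ?thesis by simp
  qed
  have S2: "integrable M (\<lambda>\<omega>. (S N \<omega>)\<^sup>2)" and y2: "integrable M (\<lambda>\<omega>. (y N \<omega>)\<^sup>2)"
    using S_sq[of N] y_sq[of N] by (auto simp: square_integrable_def)
  have i: "integrable M (\<lambda>\<omega>. S k \<omega> * (\<bar>y (Suc k) \<omega>\<bar> - \<bar>y k \<omega>\<bar>))" if "k < N" for k
    using that by (intro square_integrable_mult S_sq square_integrable_diff abs_sq) auto
  have "(LINT \<omega>|M. (S N \<omega>)\<^sup>2) \<le>
      (LINT \<omega>|M. 4 * (y N \<omega>)\<^sup>2 - 4 * (\<Sum>k<N. S k \<omega> * (\<bar>y (Suc k) \<omega>\<bar> - \<bar>y k \<omega>\<bar>)))"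
  proof (rule integral_mono[OF S2])
    show "integrable M (\<lambda>\<omega>. 4 * (y N \<omega>)\<^sup>2 - 4 * (\<Sum>k<N. S k \<omega> * (\<bar>y (Suc k) \<omega>\<bar> - \<bar>y k \<omega>\<bar>)))"
      using i y2 by (intro Bochner_Integration.integrable_diff integrable_mult_right integrable_sum) auto
    fix \<omega>
    have "2 * (S N \<omega>)\<^sup>2 - 4 * (S N \<omega> * \<bar>y N \<omega>\<bar>) + 2 * (y 0 \<omega>)\<^sup>2
        \<le> - 4 * (\<Sum>k<N. S k \<omega> * (\<bar>y (Suc k) \<omega>\<bar> - \<bar>y k \<omega>\<bar>))"
      using Doob_pathwise[of "\<lambda>k. S k \<omega>" "\<lambda>k. \<bar>y k \<omega>\<bar>" N] by (simp add: S0 SS mult.assoc)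
    \<comment> \<open>Young's inequality spends one of the two copies of the squared maximum on the
      cross term; the constant 4 of Doob's inequality comes from here.\<close>
    moreover have "4 * (S N \<omega> * \<bar>y N \<omega>\<bar>) \<le> (S N \<omega>)\<^sup>2 + 4 * (y N \<omega>)\<^sup>2"
      using zero_le_power2[of "S N \<omega> - 2 * \<bar>y N \<omega>\<bar>"] by (simp add: power2_diff power_mult_distrib mult.assoc)
    ultimately show "(S N \<omega>)\<^sup>2 \<le>
        4 * (y N \<omega>)\<^sup>2 - 4 * (\<Sum>k<N. S k \<omega> * (\<bar>y (Suc k) \<omega>\<bar> - \<bar>y k \<omega>\<bar>))"
      using zero_le_power2[of "y 0 \<omega>"] by linarith
  qed
  also have "\<dots> = 4 * (LINT \<omega>|M. (y N \<omega>)\<^sup>2)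
      - 4 * (\<Sum>k<N. LINT \<omega>|M. S k \<omega> * (\<bar>y (Suc k) \<omega>\<bar> - \<bar>y k \<omega>\<bar>))"
    using i y2 by (subst Bochner_Integration.integral_diff) (auto simp: Bochner_Integration.integral_sum)
  also have "\<dots> \<le> 4 * (LINT \<omega>|M. (y N \<omega>)\<^sup>2)"
    using ortho by (auto intro!: sum_nonneg)
  finally have le: "(LINT \<omega>|M. (S N \<omega>)\<^sup>2) \<le> 4 * (LINT \<omega>|M. (y N \<omega>)\<^sup>2)" .
  have "(\<integral>\<^sup>+\<omega>. (SUP t\<in>grid n. ennreal ((Y t \<omega>)\<^sup>2)) \<partial>M) \<le> L2sq M (\<lambda>\<omega>. S N \<omega>)"
  proof (intro nn_integral_mono SUP_least ennreal_leI)
    fix \<omega> t assume "t \<in> grid n"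
    then obtain k where k: "k \<le> N" "t = r k" by (auto simp: grid_def N_def r_def)
    have "\<bar>Y t \<omega>\<bar> \<le> S N \<omega>" using S_ge[OF k(1), of \<omega>] by (simp add: y_def k(2))
    then have "\<bar>Y t \<omega>\<bar>\<^sup>2 \<le> (S N \<omega>)\<^sup>2" by (intro power_mono) auto
    then show "(Y t \<omega>)\<^sup>2 \<le> (S N \<omega>)\<^sup>2" by simp
  qed
  also have "\<dots> = ennreal (LINT \<omega>|M. (S N \<omega>)\<^sup>2)" by (rule nn_integral_eq_integral[OF S2]) simp
  also have "\<dots> \<le> ennreal (4 * (LINT \<omega>|M. (y N \<omega>)\<^sup>2))" by (rule ennreal_leI[OF le])
  also have "\<dots> = 4 * L2sq M (\<lambda>\<omega>. Y T \<omega>)"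
    by (subst nn_integral_eq_integral) (use y2 in \<open>auto simp: y_def rN ennreal_mult\<close>)
  finally show ?thesis .
qed

text \<open>The grids increase to the dyadics and the bound on each grid is the same.\<close>

lemma Doob_L2:
  assumes Y: "L2_martingale Y"
  shows "(\<integral>\<^sup>+\<omega>. (SUP t\<in>dyadics. ennreal ((Y t \<omega>)\<^sup>2)) \<partial>M) \<le> 4 * L2sq M (\<lambda>\<omega>. Y T \<omega>)"
proof -
  have [measurable]: "(\<lambda>\<omega>. SUP t\<in>grid n. ennreal ((Y t \<omega>)\<^sup>2)) \<in> borel_measurable M" for n
  proof (rule borel_measurable_SUP)
    fix t assume "t \<in> grid n"
    then have t: "t \<in> {0..T}" using dyadics_subset unfolding dyadics_def by blast
    have "Y t \<in> borel_measurable M"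
      by (rule measurable_F_M[OF L2_martingaleD(1)[OF Y t] t])
    then show "(\<lambda>\<omega>. ennreal ((Y t \<omega>)\<^sup>2)) \<in> borel_measurable M" by simp
  qed (simp add: grid_def)
  have "(SUP t\<in>dyadics. ennreal ((Y t \<omega>)\<^sup>2)) = (SUP n. SUP t\<in>grid n. ennreal ((Y t \<omega>)\<^sup>2))" for \<omega>
    unfolding dyadics_def by (simp add: SUP_UNION)
  then have "(\<integral>\<^sup>+\<omega>. (SUP t\<in>dyadics. ennreal ((Y t \<omega>)\<^sup>2)) \<partial>M)
      = (SUP n. \<integral>\<^sup>+\<omega>. (SUP t\<in>grid n. ennreal ((Y t \<omega>)\<^sup>2)) \<partial>M)"
    by (simp, intro nn_integral_monotone_convergence_SUP)
      (auto intro!: incseq_SucI le_funI SUP_subset_mono grid_mono)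
  also have "\<dots> \<le> 4 * L2sq M (\<lambda>\<omega>. Y T \<omega>)"
    by (intro SUP_least Doob_grid[OF Y])
  finally show ?thesis .
qed

lemma borel_measurable_SUP_dyadics:
  assumes "\<And>t. t \<in> {0..T} \<Longrightarrow> Y t \<in> borel_measurable M"
  shows "(\<lambda>\<omega>. SUP t\<in>dyadics. ennreal ((Y t \<omega>)\<^sup>2)) \<in> borel_measurable M"
  using assms dyadics_subset countable_dyadics by (intro borel_measurable_SUP) auto

lemma S2_proc_iff:
  assumes "progressive T F borel Y" "AE \<omega> in M. continuous_on {0..T} (\<lambda>t. Y t \<omega>)"
  shows "Y \<in> S2_proc M T F \<longleftrightarrow> (\<integral>\<^sup>+\<omega>. (SUP t\<in>dyadics. ennreal ((Y t \<omega>)\<^sup>2)) \<partial>M) < \<infinity>"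
proof -
  have "(\<integral>\<^sup>+\<omega>. (SUP t\<in>{0..T}. ennreal ((Y t \<omega>)\<^sup>2)) \<partial>M) = (\<integral>\<^sup>+\<omega>. (SUP t\<in>dyadics. ennreal ((Y t \<omega>)\<^sup>2)) \<partial>M)"
    using assms(2) by (intro nn_integral_cong_AE) (auto elim!: eventually_mono intro!: SUP_dyadics)
  then show ?thesis using assms(1) by (simp add: S2_proc_def)
qed

end

section \<open>Simple integrals\<close>

text \<open>In \<open>W_bracket\<close> the test variable is bounded because the product of two
  increments is only integrable; this matches the bounded values of simple integrands. The locale is
  instantiated with \<open>d = 1\<close> for \<open>filt0\<close> and \<open>d = 2\<close> for
  \<open>filt\<close>.\<close>

locale brownian_basis = filtered_space M T F for M :: "'a measure" and T F +
  fixes d :: nat and W :: "nat \<Rightarrow> real \<Rightarrow> 'a \<Rightarrow> real"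
  assumes W_adapted: "\<And>i t. i < d \<Longrightarrow> t \<in> {0..T} \<Longrightarrow> W i t \<in> borel_measurable (F t)"
    and W_continuous: "\<And>i. i < d \<Longrightarrow> AE \<omega> in M. continuous_on {0..T} (\<lambda>t. W i t \<omega>)"
    and W_square_integrable: "\<And>i s t. i < d \<Longrightarrow> 0 \<le> s \<Longrightarrow> s \<le> t \<Longrightarrow> t \<le> T \<Longrightarrow>
      square_integrable M (\<lambda>\<omega>. W i t \<omega> - W i s \<omega>)"
    and W_martingale: "\<And>i s t \<xi>. i < d \<Longrightarrow> 0 \<le> s \<Longrightarrow> s \<le> t \<Longrightarrow> t \<le> T \<Longrightarrow>
      \<xi> \<in> borel_measurable (F s) \<Longrightarrow> square_integrable M \<xi> \<Longrightarrow>
      (LINT \<omega>|M. \<xi> \<omega> * (W i t \<omega> - W i s \<omega>)) = 0"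
    and W_bracket: "\<And>i j s t \<xi> C. i < d \<Longrightarrow> j < d \<Longrightarrow> 0 \<le> s \<Longrightarrow> s \<le> t \<Longrightarrow> t \<le> T \<Longrightarrow>
      \<xi> \<in> borel_measurable (F s) \<Longrightarrow> (\<And>\<omega>. \<omega> \<in> space M \<Longrightarrow> \<bar>\<xi> \<omega>\<bar> \<le> C) \<Longrightarrow>
      (LINT \<omega>|M. \<xi> \<omega> * ((W i t \<omega> - W i s \<omega>) * (W j t \<omega> - W j s \<omega>))) =
        (if i = j then (t - s) * (LINT \<omega>|M. \<xi> \<omega>) else 0)"
begin

lemma W_measurable_mono: "i < d \<Longrightarrow> 0 \<le> s \<Longrightarrow> s \<le> t \<Longrightarrow> t \<le> T \<Longrightarrow> W i s \<in> borel_measurable (F t)"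
  by (rule measurable_F_mono[OF W_adapted]) auto

lemma W_increment_measurable:
  "i < d \<Longrightarrow> 0 \<le> s \<Longrightarrow> s \<le> t \<Longrightarrow> t \<le> r \<Longrightarrow> r \<le> T \<Longrightarrow>
    (\<lambda>\<omega>. W i t \<omega> - W i s \<omega>) \<in> borel_measurable (F r)"
  using W_measurable_mono[of i s r] W_measurable_mono[of i t r] by auto

text \<open>Between \<open>s\<close> and \<open>t\<close> the process moves only on the intersection
  of \<open>{s..t}\<close> with \<open>{a..b}\<close>, and at the left end of that intersection both
  \<open>\<zeta>\<close> and the test variable are known.\<close>

lemma elementary_martingale:
  assumes i: "i < d" and ab: "0 \<le> a" "a \<le> b" "b \<le> T"
    and \<zeta>: "\<zeta> \<in> borel_measurable (F a)" "\<And>\<omega>. \<omega> \<in> space M \<Longrightarrow> \<bar>\<zeta> \<omega>\<bar> \<le> C"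
  shows "L2_martingale (\<lambda>t \<omega>. \<zeta> \<omega> * (W i (min b t) \<omega> - W i (min a t) \<omega>))"
  unfolding L2_martingale_def
proof (intro conjI ballI allI impI)
  have \<zeta>M: "\<zeta> \<in> borel_measurable M" using ab by (intro measurable_F_M[OF \<zeta>(1)]) auto
  fix t assume t: "t \<in> {0..T}"
  show "(\<lambda>\<omega>. \<zeta> \<omega> * (W i (min b t) \<omega> - W i (min a t) \<omega>)) \<in> borel_measurable (F t)"
  proof (cases "a \<le> t")
    case True
    have "\<zeta> \<in> borel_measurable (F t)" using True ab t by (intro measurable_F_mono[OF \<zeta>(1)]) auto
    moreover have "(\<lambda>\<omega>. W i (min b t) \<omega> - W i (min a t) \<omega>) \<in> borel_measurable (F t)"
      using True ab t by (intro W_increment_measurable i) auto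
    ultimately show ?thesis by simp
  qed (use ab in auto)
  show "square_integrable M (\<lambda>\<omega>. \<zeta> \<omega> * (W i (min b t) \<omega> - W i (min a t) \<omega>))"
    using ab t by (intro square_integrable_mult_bounded[OF _ \<zeta>M \<zeta>(2)] W_square_integrable i) auto
next
  fix s t \<xi> assume st: "0 \<le> s" "s \<le> t" "t \<le> T"
    and \<xi>: "\<xi> \<in> borel_measurable (F s)" "square_integrable M \<xi>"
  show "(LINT \<omega>|M. \<xi> \<omega> * (\<zeta> \<omega> * (W i (min b t) \<omega> - W i (min a t) \<omega>)
      - \<zeta> \<omega> * (W i (min b s) \<omega> - W i (min a s) \<omega>))) = 0"
  proof (cases "t \<le> a \<or> b \<le> s")
    case True
    then have "\<zeta> \<omega> * (W i (min b t) \<omega> - W i (min a t) \<omega>)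
      - \<zeta> \<omega> * (W i (min b s) \<omega> - W i (min a s) \<omega>) = 0" for \<omega>
      using st ab by (cases "a = b") (auto simp: min_def)
    then show ?thesis by (simp only: mult_zero_right Bochner_Integration.integral_zero)
  next
    case False
    define c where "c = max a s"
    define e where "e = min b t"
    have ce: "0 \<le> c" "c \<le> e" "e \<le> T" using False st ab by (auto simp: c_def e_def)
    have "\<zeta> \<omega> * (W i (min b t) \<omega> - W i (min a t) \<omega>)
      - \<zeta> \<omega> * (W i (min b s) \<omega> - W i (min a s) \<omega>) = \<zeta> \<omega> * (W i e \<omega> - W i c \<omega>)" for \<omega>
      using False st ab by (auto simp: c_def e_def min_def max_def algebra_simps)
    moreover have "(LINT \<omega>|M. (\<zeta> \<omega> * \<xi> \<omega>) * (W i e \<omega> - W i c \<omega>)) = 0"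
    proof (rule W_martingale[OF i ce])
      have "\<zeta> \<in> borel_measurable (F c)" "\<xi> \<in> borel_measurable (F c)"
        using ab st ce by (auto simp: c_def intro: measurable_F_mono[OF \<zeta>(1)] measurable_F_mono[OF \<xi>(1)])
      then show "(\<lambda>\<omega>. \<zeta> \<omega> * \<xi> \<omega>) \<in> borel_measurable (F c)" by simp
      have "\<zeta> \<in> borel_measurable M" using ab by (intro measurable_F_M[OF \<zeta>(1)]) auto
      then show "square_integrable M (\<lambda>\<omega>. \<zeta> \<omega> * \<xi> \<omega>)"
        by (rule square_integrable_mult_bounded[OF \<xi>(2) _ \<zeta>(2)])
    qed
    ultimately show ?thesis by (simp add: mult_ac)
  qed
qed

lemma simple_integrandE:
  assumes "simple_integrand M T F S"
  obtains n \<tau> \<zeta> C where "S = (n, \<tau>, \<zeta>)"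
    and "\<And>k. k < n \<Longrightarrow> 0 \<le> \<tau> k \<and> \<tau> k \<le> \<tau> (Suc k) \<and> \<tau> (Suc k) \<le> T"
    and "\<And>k. k < n \<Longrightarrow> \<zeta> k \<in> borel_measurable (F (\<tau> k))"
    and "\<And>k \<omega>. k < n \<Longrightarrow> \<omega> \<in> space M \<Longrightarrow> \<bar>\<zeta> k \<omega>\<bar> \<le> C k"
proof -
  obtain n \<tau> \<zeta> where S: "S = (n, \<tau>, \<zeta>)" by (cases S) auto
  have a: "\<forall>k\<le>n. \<tau> k \<in> {0..T}" "\<forall>k<n. \<tau> k \<le> \<tau> (Suc k)"
    "\<forall>k<n. \<zeta> k \<in> borel_measurable (F (\<tau> k)) \<and> (\<exists>C. \<forall>\<omega>\<in>space M. \<bar>\<zeta> k \<omega>\<bar> \<le> C)"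
    using assms by (auto simp: simple_integrand_def S)
  then obtain C where "\<forall>k<n. \<forall>\<omega>\<in>space M. \<bar>\<zeta> k \<omega>\<bar> \<le> C k" by metis
  with a show ?thesis by (intro that[OF S, of C]) auto
qed

lemma simple_ito_martingale:
  assumes i: "i < d" and S: "simple_integrand M T F S"
  shows "L2_martingale (simple_ito (W i) S)"
proof -
  obtain n \<tau> \<zeta> C where s: "S = (n, \<tau>, \<zeta>)"
    and t: "\<And>k. k < n \<Longrightarrow> 0 \<le> \<tau> k \<and> \<tau> k \<le> \<tau> (Suc k) \<and> \<tau> (Suc k) \<le> T"
    and z: "\<And>k. k < n \<Longrightarrow> \<zeta> k \<in> borel_measurable (F (\<tau> k))"
      "\<And>k \<omega>. k < n \<Longrightarrow> \<omega> \<in> space M \<Longrightarrow> \<bar>\<zeta> k \<omega>\<bar> \<le> C k"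
    using simple_integrandE[OF S] by metis
  have "L2_martingale (\<lambda>t \<omega>. \<Sum>k<n. \<zeta> k \<omega> * (W i (min (\<tau> (Suc k)) t) \<omega> - W i (min (\<tau> k) t) \<omega>))"
    by (intro L2_martingale_sum elementary_martingale[OF i _ _ _ _ z(2)]) (use t z in auto)
  then show ?thesis by (simp add: simple_ito_def[abs_def] s)
qed

lemma simple_ito_continuous:
  assumes i: "i < d" and S: "simple_integrand M T F S"
  shows "AE \<omega> in M. continuous_on {0..T} (\<lambda>t. simple_ito (W i) S t \<omega>)"
  using W_continuous[OF i]
proof eventually_elim
  case (elim \<omega>)
  obtain n \<tau> \<zeta> C where s: "S = (n, \<tau>, \<zeta>)"
    and t: "\<And>k. k < n \<Longrightarrow> 0 \<le> \<tau> k \<and> \<tau> k \<le> \<tau> (Suc k) \<and> \<tau> (Suc k) \<le> T"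
    using simple_integrandE[OF S] by metis
  have "continuous_on {0..T} (\<lambda>t. W i (min a t) \<omega>)" if "0 \<le> a" "a \<le> T" for a
    by (rule continuous_on_compose2[OF elim]) (use that in \<open>auto intro!: continuous_intros\<close>)
  then have "continuous_on {0..T} (\<lambda>t. \<Sum>k<n. \<zeta> k \<omega> * (W i (min (\<tau> (Suc k)) t) \<omega> - W i (min (\<tau> k) t) \<omega>))"
    using t by (intro continuous_on_sum continuous_on_mult continuous_on_const continuous_on_diff) force+
  then show ?case by (simp add: simple_ito_def s)
qed

lemma simple_value_square_integrable:
  assumes S: "simple_integrand M T F S"
  shows "square_integrable PM (flat (simple_value S))"
proof -
  obtain n \<tau> \<zeta> C where s: "S = (n, \<tau>, \<zeta>)"
    and t: "\<And>k. k < n \<Longrightarrow> 0 \<le> \<tau> k \<and> \<tau> k \<le> \<tau> (Suc k) \<and> \<tau> (Suc k) \<le> T"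
    and z: "\<And>k. k < n \<Longrightarrow> \<zeta> k \<in> borel_measurable (F (\<tau> k))"
      "\<And>k \<omega>. k < n \<Longrightarrow> \<omega> \<in> space M \<Longrightarrow> \<bar>\<zeta> k \<omega>\<bar> \<le> C k"
    using simple_integrandE[OF S] by metis
  have "square_integrable PM (\<lambda>z. \<zeta> k (snd z) * indicator {\<tau> k<..\<tau> (Suc k)} (fst z))" if k: "k < n" for k
  proof (rule square_integrable_mult_bounded)
    have m: "\<zeta> k \<in> borel_measurable M"
      using t[OF k] by (intro measurable_F_M[OF z(1)[OF k]]) auto
    then show "(\<lambda>z. \<zeta> k (snd z)) \<in> borel_measurable PM" by measurable
    show "\<bar>\<zeta> k (snd x)\<bar> \<le> C k" if "x \<in> space PM" for x
      using z(2)[OF k] that by (auto simp: space_PM)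
    have "(\<lambda>z. indicator {\<tau> k<..\<tau> (Suc k)} (fst z) :: real) \<in> borel_measurable PM"
      by measurable
    then show "square_integrable PM (\<lambda>z. indicator {\<tau> k<..\<tau> (Suc k)} (fst z) :: real)"
      by (rule square_integrable_bound[OF PM.square_integrable_const[of 1]]) (auto split: split_indicator)
  qed
  then have "square_integrable PM (\<lambda>z. \<Sum>k<n. \<zeta> k (snd z) * indicator {\<tau> k<..\<tau> (Suc k)} (fst z))"
    by (intro square_integrable_sum) auto
  then show ?thesis by (simp add: simple_value_def s)
qed

text \<open>Cut both increments at the ends of the overlap. The product of the two pieces over the
  overlap gives its length times the mean; every other product pairs an increment with a variable
  known when it starts, and so has mean zero.\<close>

lemma elementary_bracket_ordered:
  assumes ij: "i < d" "j < d" and ab: "0 \<le> a" "a \<le> b" "b \<le> T" and ce: "c \<le> e" "e \<le> T" and "a \<le> c"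
    and \<zeta>: "\<zeta> \<in> borel_measurable (F a)" "\<And>\<omega>. \<omega> \<in> space M \<Longrightarrow> \<bar>\<zeta> \<omega>\<bar> \<le> C"
    and \<zeta>': "\<zeta>' \<in> borel_measurable (F c)" "\<And>\<omega>. \<omega> \<in> space M \<Longrightarrow> \<bar>\<zeta>' \<omega>\<bar> \<le> C'"
  shows "(LINT \<omega>|M. (\<zeta> \<omega> * (W i b \<omega> - W i a \<omega>)) * (\<zeta>' \<omega> * (W j e \<omega> - W j c \<omega>))) =
    (if i = j then max 0 (min b e - max a c) * (LINT \<omega>|M. \<zeta> \<omega> * \<zeta>' \<omega>) else 0)"
proof -
  define \<eta> where "\<eta> \<omega> = \<zeta> \<omega> * \<zeta>' \<omega>" for \<omega>
  have \<eta>m: "\<eta> \<in> borel_measurable (F r)" if "c \<le> r" "r \<le> T" for r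
  proof -
    have "\<zeta> \<in> borel_measurable (F r)" "\<zeta>' \<in> borel_measurable (F r)"
      using that ab ce \<open>a \<le> c\<close> by (auto intro!: measurable_F_mono[OF \<zeta>(1)] measurable_F_mono[OF \<zeta>'(1)])
    then show ?thesis unfolding \<eta>_def by simp
  qed
  have \<eta>b: "\<bar>\<eta> \<omega>\<bar> \<le> C * C'" if "\<omega> \<in> space M" for \<omega>
    unfolding \<eta>_def abs_mult using \<zeta>(2)[OF that] \<zeta>'(2)[OF that] by (intro mult_mono) auto
  have \<eta>M: "\<eta> \<in> borel_measurable M"
    by (rule measurable_F_M[OF \<eta>m[of c]]) (use ab ce \<open>a \<le> c\<close> in auto)
  have inc: "(\<lambda>\<omega>. \<eta> \<omega> * (W k v \<omega> - W k u \<omega>)) \<in> borel_measurable (F r)"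
      "square_integrable M (\<lambda>\<omega>. \<eta> \<omega> * (W k v \<omega> - W k u \<omega>))"
    if "k < d" "0 \<le> u" "u \<le> v" "v \<le> r" "c \<le> r" "r \<le> T" for k u v r
  proof -
    show "(\<lambda>\<omega>. \<eta> \<omega> * (W k v \<omega> - W k u \<omega>)) \<in> borel_measurable (F r)"
      using \<eta>m[of r] W_increment_measurable[of k u v r] that by simp
    show "square_integrable M (\<lambda>\<omega>. \<eta> \<omega> * (W k v \<omega> - W k u \<omega>))"
      by (rule square_integrable_mult_bounded[OF _ \<eta>M \<eta>b]) (use that in \<open>auto intro: W_square_integrable\<close>)
  qed
  have ortho: "(LINT \<omega>|M. (\<eta> \<omega> * (W k v \<omega> - W k u \<omega>)) * (W l y \<omega> - W l x \<omega>)) = 0"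
    if "k < d" "l < d" "0 \<le> u" "u \<le> v" "v \<le> x" "c \<le> x" "x \<le> y" "y \<le> T" for k l u v x y
    using that inc[of k u v x] by (intro W_martingale) auto
  have int: "integrable M (\<lambda>\<omega>. (\<eta> \<omega> * (W k v \<omega> - W k u \<omega>)) * (W l y \<omega> - W l x \<omega>))"
    if "k < d" "l < d" "0 \<le> u" "u \<le> v" "v \<le> T" "0 \<le> x" "x \<le> y" "y \<le> T" for k l u v x y
    using that ce by (intro square_integrable_mult inc(2)[of k u v T] W_square_integrable) auto
  have eq: "(LINT \<omega>|M. (\<zeta> \<omega> * (W i b \<omega> - W i a \<omega>)) * (\<zeta>' \<omega> * (W j e \<omega> - W j c \<omega>))) =
      (LINT \<omega>|M. (\<eta> \<omega> * (W i b \<omega> - W i a \<omega>)) * (W j e \<omega> - W j c \<omega>))"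
    by (simp add: \<eta>_def mult_ac)
  show ?thesis
  proof (cases "b \<le> c")
    case True
    then have "(LINT \<omega>|M. (\<eta> \<omega> * (W i b \<omega> - W i a \<omega>)) * (W j e \<omega> - W j c \<omega>)) = 0"
      using ab ce by (intro ortho ij) auto
    moreover have "max 0 (min b e - max a c) = 0" using True by auto
    ultimately show ?thesis using eq by simp
  next
    case False
    \<comment> \<open>The right end of the overlap; beyond it at most one of the two intervals
      continues.\<close>
    define h where "h = min b e"
    have h: "c \<le> h" "h \<le> b" "h \<le> e" "h = b \<or> h = e" using False ce by (auto simp: h_def)
    have c0: "0 \<le> c" using ab \<open>a \<le> c\<close> by simp
    have "(LINT \<omega>|M. (\<eta> \<omega> * (W i b \<omega> - W i a \<omega>)) * (W j e \<omega> - W j c \<omega>)) =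
      (LINT \<omega>|M. (\<eta> \<omega> * (W i c \<omega> - W i a \<omega>)) * (W j e \<omega> - W j c \<omega>)
        + (\<eta> \<omega> * (W i h \<omega> - W i c \<omega>)) * (W j h \<omega> - W j c \<omega>)
        + (\<eta> \<omega> * (W i h \<omega> - W i c \<omega>)) * (W j e \<omega> - W j h \<omega>)
        + (\<eta> \<omega> * (W j e \<omega> - W j c \<omega>)) * (W i b \<omega> - W i h \<omega>))"
      by (intro Bochner_Integration.integral_cong) (auto simp: algebra_simps)
    also have "\<dots> = (LINT \<omega>|M. (\<eta> \<omega> * (W i c \<omega> - W i a \<omega>)) * (W j e \<omega> - W j c \<omega>))
        + (LINT \<omega>|M. (\<eta> \<omega> * (W i h \<omega> - W i c \<omega>)) * (W j h \<omega> - W j c \<omega>))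
        + (LINT \<omega>|M. (\<eta> \<omega> * (W i h \<omega> - W i c \<omega>)) * (W j e \<omega> - W j h \<omega>))
        + (LINT \<omega>|M. (\<eta> \<omega> * (W j e \<omega> - W j c \<omega>)) * (W i b \<omega> - W i h \<omega>))"
    proof -
      have "integrable M (\<lambda>\<omega>. (\<eta> \<omega> * (W i c \<omega> - W i a \<omega>)) * (W j e \<omega> - W j c \<omega>))"
        "integrable M (\<lambda>\<omega>. (\<eta> \<omega> * (W i h \<omega> - W i c \<omega>)) * (W j h \<omega> - W j c \<omega>))"
        "integrable M (\<lambda>\<omega>. (\<eta> \<omega> * (W i h \<omega> - W i c \<omega>)) * (W j e \<omega> - W j h \<omega>))"
        "integrable M (\<lambda>\<omega>. (\<eta> \<omega> * (W j e \<omega> - W j c \<omega>)) * (W i b \<omega> - W i h \<omega>))"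
        using ab ce \<open>a \<le> c\<close> h c0 by (auto intro!: int ij)
      then show ?thesis by simp
    qed
    also have "(LINT \<omega>|M. (\<eta> \<omega> * (W i c \<omega> - W i a \<omega>)) * (W j e \<omega> - W j c \<omega>)) = 0"
      using ab ce \<open>a \<le> c\<close> by (intro ortho ij) auto
    also have "(LINT \<omega>|M. (\<eta> \<omega> * (W i h \<omega> - W i c \<omega>)) * (W j e \<omega> - W j h \<omega>)) = 0"
      using ab ce h c0 by (intro ortho ij) auto
    \<comment> \<open>Either the first interval ends at \<open>h\<close> and the increment is zero,
      or the second does, and the first increment lies after everything else.\<close>
    also have "(LINT \<omega>|M. (\<eta> \<omega> * (W j e \<omega> - W j c \<omega>)) * (W i b \<omega> - W i h \<omega>)) = 0"
    proof (cases "h = b")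
      case False
      then have "h = e" using h by simp
      then show ?thesis using ab ce h c0 by (intro ortho ij) auto
    qed simp
    also have "(LINT \<omega>|M. (\<eta> \<omega> * (W i h \<omega> - W i c \<omega>)) * (W j h \<omega> - W j c \<omega>)) =
        (if i = j then (h - c) * (LINT \<omega>|M. \<eta> \<omega>) else 0)"
      unfolding mult.assoc using ce h c0 by (intro W_bracket[OF ij _ _ _ _ \<eta>b] \<eta>m) auto
    finally show ?thesis
      using eq h \<open>a \<le> c\<close> by (simp add: \<eta>_def[abs_def] h_def max_absorb2)
  qed
qed

text \<open>Measurability of the weights is asked for nondegenerate intervals only: stopping an
  interval that starts after \<open>t\<close> collapses it to the point \<open>t\<close>, where its
  weight is not yet known.\<close>

lemma elementary_bracket:
  assumes ij: "i < d" "j < d" and ab: "0 \<le> a" "a \<le> b" "b \<le> T" and ce: "0 \<le> c" "c \<le> e" "e \<le> T"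
    and \<zeta>: "a < b \<Longrightarrow> \<zeta> \<in> borel_measurable (F a)" "\<And>\<omega>. \<omega> \<in> space M \<Longrightarrow> \<bar>\<zeta> \<omega>\<bar> \<le> C"
    and \<zeta>': "c < e \<Longrightarrow> \<zeta>' \<in> borel_measurable (F c)" "\<And>\<omega>. \<omega> \<in> space M \<Longrightarrow> \<bar>\<zeta>' \<omega>\<bar> \<le> C'"
  shows "(LINT \<omega>|M. (\<zeta> \<omega> * (W i b \<omega> - W i a \<omega>)) * (\<zeta>' \<omega> * (W j e \<omega> - W j c \<omega>))) =
    (if i = j then max 0 (min b e - max a c) * (LINT \<omega>|M. \<zeta> \<omega> * \<zeta>' \<omega>) else 0)"
proof (cases "a = b \<or> c = e")
  case True
  then have "(LINT \<omega>|M. (\<zeta> \<omega> * (W i b \<omega> - W i a \<omega>)) * (\<zeta>' \<omega> * (W j e \<omega> - W j c \<omega>))) = 0" by auto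
  moreover have "max 0 (min b e - max a c) = 0" using True by auto
  ultimately show ?thesis by simp
next
  case False
  then have m: "\<zeta> \<in> borel_measurable (F a)" "\<zeta>' \<in> borel_measurable (F c)" using ab ce \<zeta> \<zeta>' by auto
  show ?thesis
  proof (cases "a \<le> c")
    case True
    show ?thesis by (rule elementary_bracket_ordered[OF ij ab ce(2,3) True m(1) \<zeta>(2) m(2) \<zeta>'(2)])
  next
    case False
    then have "c \<le> a" by simp
    from elementary_bracket_ordered[OF ij(2,1) ce ab(2,3) this m(2) \<zeta>'(2) m(1) \<zeta>(2)]
    show ?thesis by (simp add: mult.commute min.commute max.commute eq_commute[of i j])
  qed
qed

lemma integral_PM_times:
  fixes f :: "real \<Rightarrow> real" and g :: "'a \<Rightarrow> real"
  assumes f: "f \<in> borel_measurable (time T)" "\<And>s. \<bar>f s\<bar> \<le> C"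
    and g: "g \<in> borel_measurable M" "\<And>\<omega>. \<omega> \<in> space M \<Longrightarrow> \<bar>g \<omega>\<bar> \<le> D"
  shows "(LINT z|PM. f (fst z) * g (snd z)) = (LINT s|time T. f s) * (LINT \<omega>|M. g \<omega>)"
proof -
  note [measurable] = f(1) g(1)
  have "integrable PM (\<lambda>z. f (fst z) * g (snd z))"
  proof (rule PM.integrable_const_bound[of _ "C * D"])
    show "AE z in PM. norm (f (fst z) * g (snd z)) \<le> C * D"
      using f(2) g(2) by (intro AE_I2) (auto simp: space_PM abs_mult intro!: mult_mono order_trans[OF abs_ge_zero f(2)])
  qed measurable
  from PM.integral_fst'[OF this]
  show ?thesis by simp
qed

text \<open>Both sums are multiplied out over their own partitions. Each pair of intervals
  contributes the length of their overlap before \<open>t\<close>, which is also its contribution on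
  the product space.\<close>

lemma simple_ito_isometry:
  assumes ij: "i < d" "j < d" and S: "simple_integrand M T F S" and S': "simple_integrand M T F S'"
    and t: "t \<in> {0..T}"
  shows "(LINT \<omega>|M. simple_ito (W i) S t \<omega> * simple_ito (W j) S' t \<omega>) =
    (if i = j then LINT z|PM. indicator {..t} (fst z) *
      (flat (simple_value S) z * flat (simple_value S') z) else 0)"
proof -
  obtain n \<tau> \<zeta> C where s: "S = (n, \<tau>, \<zeta>)"
    and \<tau>: "\<And>k. k < n \<Longrightarrow> 0 \<le> \<tau> k \<and> \<tau> k \<le> \<tau> (Suc k) \<and> \<tau> (Suc k) \<le> T"
    and z: "\<And>k. k < n \<Longrightarrow> \<zeta> k \<in> borel_measurable (F (\<tau> k))"
      "\<And>k \<omega>. k < n \<Longrightarrow> \<omega> \<in> space M \<Longrightarrow> \<bar>\<zeta> k \<omega>\<bar> \<le> C k"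
    using simple_integrandE[OF S] by metis
  obtain n' \<tau>' \<zeta>' C' where s': "S' = (n', \<tau>', \<zeta>')"
    and \<tau>': "\<And>k. k < n' \<Longrightarrow> 0 \<le> \<tau>' k \<and> \<tau>' k \<le> \<tau>' (Suc k) \<and> \<tau>' (Suc k) \<le> T"
    and z': "\<And>k. k < n' \<Longrightarrow> \<zeta>' k \<in> borel_measurable (F (\<tau>' k))"
      "\<And>k \<omega>. k < n' \<Longrightarrow> \<omega> \<in> space M \<Longrightarrow> \<bar>\<zeta>' k \<omega>\<bar> \<le> C' k"
    using simple_integrandE[OF S'] by metis
  have zM: "\<zeta> k \<in> borel_measurable M" if "k < n" for k
    using \<tau>[OF that] by (intro measurable_F_M[OF z(1)[OF that]]) auto
  have zM': "\<zeta>' k \<in> borel_measurable M" if "k < n'" for k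
    using \<tau>'[OF that] by (intro measurable_F_M[OF z'(1)[OF that]]) auto
  define A where "A k \<omega> = \<zeta> k \<omega> * (W i (min (\<tau> (Suc k)) t) \<omega> - W i (min (\<tau> k) t) \<omega>)" for k \<omega>
  define B where "B k \<omega> = \<zeta>' k \<omega> * (W j (min (\<tau>' (Suc k)) t) \<omega> - W j (min (\<tau>' k) t) \<omega>)" for k \<omega>
  define V where "V k l z = indicator {..t} (fst z) * ((\<zeta> k (snd z) * indicator {\<tau> k<..\<tau> (Suc k)} (fst z))
      * (\<zeta>' l (snd z) * indicator {\<tau>' l<..\<tau>' (Suc l)} (fst z)))" for k l and z :: "real \<times> 'a"
  have AB: "(LINT \<omega>|M. A k \<omega> * B l \<omega>) = (if i = j then LINT z|PM. V k l z else 0)"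
    if k: "k < n" and l: "l < n'" for k l
  proof -
    let ?a = "min (\<tau> k) t" and ?b = "min (\<tau> (Suc k)) t" and ?c = "min (\<tau>' l) t" and ?e = "min (\<tau>' (Suc l)) t"
    have m1: "\<zeta> k \<in> borel_measurable (F ?a)" if "?a < ?b"
      using that \<tau>[OF k] z(1)[OF k] by (simp add: min_def split: if_splits)
    have m2: "\<zeta>' l \<in> borel_measurable (F ?c)" if "?c < ?e"
      using that \<tau>'[OF l] z'(1)[OF l] by (simp add: min_def split: if_splits)
    have "(LINT \<omega>|M. A k \<omega> * B l \<omega>) =
      (if i = j then max 0 (min ?b ?e - max ?a ?c) * (LINT \<omega>|M. \<zeta> k \<omega> * \<zeta>' l \<omega>) else 0)"
      unfolding A_def B_def using \<tau>[OF k] \<tau>'[OF l] t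
      by (intro elementary_bracket[OF ij _ _ _ _ _ _ m1 z(2)[OF k] m2 z'(2)[OF l]]) auto
    also have "max 0 (min ?b ?e - max ?a ?c) * (LINT \<omega>|M. \<zeta> k \<omega> * \<zeta>' l \<omega>) = (LINT z|PM. V k l z)"
    proof -
      \<comment> \<open>The time factor of \<open>V\<close>; its integral is the overlap length
        delivered by \<open>elementary_bracket\<close>.\<close>
      define f :: "real \<Rightarrow> real" where "f = indicator ({..t} \<inter> {\<tau> k<..\<tau> (Suc k)} \<inter> {\<tau>' l<..\<tau>' (Suc l)})"
      have fm: "f \<in> borel_measurable (time T)"
        unfolding f_def by (intro measurable_restrict_space1) simp
      have "(LINT z|PM. V k l z) = (LINT z|PM. f (fst z) * (\<zeta> k (snd z) * \<zeta>' l (snd z)))"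
        by (intro Bochner_Integration.integral_cong) (auto simp: V_def f_def split: split_indicator)
      also have "\<dots> = (LINT s|time T. f s) * (LINT \<omega>|M. \<zeta> k \<omega> * \<zeta>' l \<omega>)"
      proof (rule integral_PM_times[OF fm, of 1 "\<lambda>\<omega>. \<zeta> k \<omega> * \<zeta>' l \<omega>" "C k * C' l"])
        show "(\<lambda>\<omega>. \<zeta> k \<omega> * \<zeta>' l \<omega>) \<in> borel_measurable M" using zM[OF k] zM'[OF l] by simp
        show "\<bar>\<zeta> k \<omega> * \<zeta>' l \<omega>\<bar> \<le> C k * C' l" if "\<omega> \<in> space M" for \<omega>
          unfolding abs_mult using z(2)[OF k that] z'(2)[OF l that]
          by (intro mult_mono) auto
      qed (simp add: f_def split: split_indicator)
      also have "(LINT s|time T. f s) = (LINT s|lborel. indicator {max (\<tau> k) (\<tau>' l) <.. min t (min (\<tau> (Suc k)) (\<tau>' (Suc l)))} s)"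
        unfolding integral_restrict_space[of "{0..T}" lborel, simplified]
        using \<tau>[OF k] \<tau>'[OF l] t
        by (intro Bochner_Integration.integral_cong) (auto simp: f_def split: split_indicator)
      also have "\<dots> = max 0 (min ?b ?e - max ?a ?c)"
        by (auto simp: max_def min_def)
      finally show ?thesis ..
    qed
    finally show ?thesis .
  qed
  have intAB: "integrable M (\<lambda>\<omega>. A k \<omega> * B l \<omega>)" if k: "k < n" and l: "l < n'" for k l
    unfolding A_def B_def using \<tau>[OF k] \<tau>'[OF l] t
    by (intro square_integrable_mult square_integrable_mult_bounded[OF _ zM[OF k] z(2)[OF k]]
      square_integrable_mult_bounded[OF _ zM'[OF l] z'(2)[OF l]] W_square_integrable ij) auto
  have intV: "integrable PM (V k l)" if k: "k < n" and l: "l < n'" for k l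
  proof (rule PM.integrable_const_bound[of _ "C k * C' l"])
    show "AE z in PM. norm (V k l z) \<le> C k * C' l"
    proof (intro AE_I2)
      fix x assume "x \<in> space PM"
      then have w: "snd x \<in> space M" by (auto simp: space_PM)
      have "\<bar>\<zeta> k (snd x)\<bar> * \<bar>\<zeta>' l (snd x)\<bar> \<le> C k * C' l"
        using z(2)[OF k w] z'(2)[OF l w] by (intro mult_mono) auto
      moreover have "0 \<le> C k * C' l" using z(2)[OF k w] z'(2)[OF l w] by (intro mult_nonneg_nonneg) auto
      ultimately show "norm (V k l x) \<le> C k * C' l"
        unfolding V_def by (auto simp: abs_mult split: split_indicator)
    qed
    note [measurable] = zM[OF k] zM'[OF l]
    show "V k l \<in> borel_measurable PM" unfolding V_def by measurable
  qed
  have "(LINT \<omega>|M. simple_ito (W i) S t \<omega> * simple_ito (W j) S' t \<omega>) = (LINT \<omega>|M. (\<Sum>k<n. \<Sum>l<n'. A k \<omega> * B l \<omega>))"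
    by (simp add: simple_ito_def s s' A_def B_def sum_product)
  also have "\<dots> = (\<Sum>k<n. \<Sum>l<n'. LINT \<omega>|M. A k \<omega> * B l \<omega>)"
    using intAB by (subst Bochner_Integration.integral_sum) (auto intro!: sum.cong Bochner_Integration.integral_sum integrable_sum)
  also have "\<dots> = (if i = j then (\<Sum>k<n. \<Sum>l<n'. LINT z|PM. V k l z) else 0)"
    using AB by simp
  also have "(\<Sum>k<n. \<Sum>l<n'. LINT z|PM. V k l z) = (LINT z|PM. (\<Sum>k<n. \<Sum>l<n'. V k l z))"
    using intV by (subst Bochner_Integration.integral_sum) (auto intro!: sum.cong Bochner_Integration.integral_sum[symmetric] integrable_sum)
  also have "\<dots> = (LINT z|PM. indicator {..t} (fst z) * (flat (simple_value S) z * flat (simple_value S') z))"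
    by (simp only: simple_value_def s s' V_def prod.case sum_product) (simp only: sum_distrib_left)
  finally show ?thesis .
qed

end

section \<open>Density of simple integrands\<close>

lemma L2_triangle3:
  assumes [measurable]: "a \<in> borel_measurable N" "b \<in> borel_measurable N" "c \<in> borel_measurable N" "e \<in> borel_measurable N"
  shows "L2sq N (\<lambda>x. a x - e x) \<le> 4 * L2sq N (\<lambda>x. a x - b x)
    + 4 * L2sq N (\<lambda>x. b x - c x) + 2 * L2sq N (\<lambda>x. c x - e x)"
proof -
  have 1: "L2sq N (\<lambda>x. a x - e x)
      \<le> 2 * L2sq N (\<lambda>x. a x - c x) + 2 * L2sq N (\<lambda>x. c x - e x)"
    using nn_integral_sq_add_le[of "\<lambda>x. a x - c x" N "\<lambda>x. c x - e x"] by simp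
  have 2: "L2sq N (\<lambda>x. a x - c x)
      \<le> 2 * L2sq N (\<lambda>x. a x - b x) + 2 * L2sq N (\<lambda>x. b x - c x)"
    using nn_integral_sq_add_le[of "\<lambda>x. a x - b x" N "\<lambda>x. b x - c x"] by simp
  show ?thesis
    by (rule order_trans[OF 1], rule order_trans[OF add_right_mono[OF mult_left_mono[OF 2]]])
      (simp_all add: distrib_left mult.assoc[symmetric])
qed

text \<open>The notion \<open>measurable_on\<close> already carries continuous functions converging
  off a negligible set; truncation and dominated convergence turn this into convergence in mean
  square.\<close>

lemma continuous_approximation:
  fixes h :: "real \<Rightarrow> real"
  assumes h: "h \<in> borel_measurable (time T)" and b: "\<And>x. x \<in> {0..T} \<Longrightarrow> \<bar>h x\<bar> \<le> B" and "0 \<le> B"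
  obtains g where "\<And>n. continuous_on UNIV (g n :: real \<Rightarrow> real)" "\<And>n x. \<bar>g n x\<bar> \<le> B"
    "(\<lambda>n. L2sq (time T) (\<lambda>x. g n x - h x)) \<longlonglongrightarrow> 0"
proof -
  have "h \<in> borel_measurable (lebesgue_on {0..T})"
  proof -
    have "(\<lambda>x. indicator {0..T} x *\<^sub>R h x) \<in> borel_measurable lborel"
      using h by (subst (asm) borel_measurable_restrict_space_iff) auto
    then have "(\<lambda>x. indicator {0..T} x *\<^sub>R h x) \<in> borel_measurable lebesgue"
      by (rule measurable_completion)
    then show ?thesis by (subst borel_measurable_restrict_space_iff) auto
  qed
  then have "h measurable_on {0..T}"
    by (subst measurable_on_iff_borel_measurable) auto
  then obtain N g where N: "negligible N" and g: "\<And>n. continuous_on UNIV (g n)"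
    and lim: "\<And>x. x \<notin> N \<Longrightarrow> (\<lambda>n. g n x) \<longlonglongrightarrow> (if x \<in> {0..T} then h x else 0)"
    unfolding measurable_on_def by metis
  \<comment> \<open>Truncation at \<open>B\<close> does not disturb the limit, as \<open>h\<close>
    itself is bounded by \<open>B\<close>, and it provides the dominating constant.\<close>
  define G where "G n x = max (-B) (min B (g n x))" for n x
  have cont: "continuous_on UNIV (G n)" for n
    unfolding G_def[abs_def] by (intro continuous_intros g)
  have bnd: "\<bar>G n x\<bar> \<le> B" for n x using \<open>0 \<le> B\<close> by (auto simp: G_def)
  have Gm: "G n \<in> borel_measurable (time T)" for n
    by (intro measurable_restrict_space1 borel_measurable_continuous_onI cont[THEN continuous_on_subset])
      (simp add: borel_measurable_continuous_onI cont)
  have ae: "AE x in time T. (\<lambda>n. G n x) \<longlonglongrightarrow> h x"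
  proof -
    have "N \<in> null_sets lebesgue" using N by (simp add: negligible_iff_null_sets)
    then have "AE x in lebesgue. x \<notin> N" by (rule AE_not_in)
    then have "AE x in lborel. x \<notin> N" by (simp add: AE_completion_iff)
    then show ?thesis
    proof (subst AE_restrict_space_iff)
      show "AE x in lborel. x \<in> {0..T} \<longrightarrow> (\<lambda>n. G n x) \<longlonglongrightarrow> h x"
        using \<open>AE x in lborel. x \<notin> N\<close>
      proof eventually_elim
        case (elim x)
        show ?case
        proof
          assume x: "x \<in> {0..T}"
          then have "(\<lambda>n. g n x) \<longlonglongrightarrow> h x" using lim[OF elim] by simp
          then have "(\<lambda>n. G n x) \<longlonglongrightarrow> max (-B) (min B (h x))"
            unfolding G_def by (intro tendsto_max tendsto_min tendsto_const)
          moreover have "max (-B) (min B (h x)) = h x" using b[OF x] by auto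
          ultimately show "(\<lambda>n. G n x) \<longlonglongrightarrow> h x" by simp
        qed
      qed
    qed auto
  qed
  have "(\<lambda>n. L2sq (time T) (\<lambda>x. G n x - h x)) \<longlonglongrightarrow> (\<integral>\<^sup>+x. 0 \<partial>time T)"
  proof (rule nn_integral_dominated_convergence[where w="\<lambda>_. ennreal ((2 * B)\<^sup>2)"])
    show "AE x in time T. ennreal ((G n x - h x)\<^sup>2) \<le> ennreal ((2 * B)\<^sup>2)" for n
    proof (rule AE_I2)
      fix x assume "x \<in> space (time T)"
      then have "\<bar>h x\<bar> \<le> B" by (intro b) (simp add: space_restrict_space)
      then have "\<bar>G n x - h x\<bar> \<le> 2 * B" using bnd[of n x] by linarith
      then have "\<bar>G n x - h x\<bar>\<^sup>2 \<le> (2 * B)\<^sup>2" by (intro power_mono) auto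
      then show "ennreal ((G n x - h x)\<^sup>2) \<le> ennreal ((2 * B)\<^sup>2)" by (intro ennreal_leI) simp
    qed
    show "L2sq (time T) (\<lambda>x. 2 * B) < \<infinity>"
      unfolding nn_integral_const emeasure_time by (simp add: ennreal_mult_less_top)
    show "AE x in time T. (\<lambda>n. ennreal ((G n x - h x)\<^sup>2)) \<longlonglongrightarrow> 0"
      using ae
    proof eventually_elim
      case (elim x)
      then have "(\<lambda>n. (G n x - h x)\<^sup>2) \<longlonglongrightarrow> (h x - h x)\<^sup>2"
        by (intro tendsto_power tendsto_diff tendsto_const)
      then show ?case by (simp add: ennreal_tendsto_0_iff)
    qed
  qed (use Gm h in auto)
  then show ?thesis using cont bnd by (intro that[of G]) auto
qed

text \<open>The mean of \<open>h\<close> over the window of length \<open>\<delta>\<close> before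
  \<open>t\<close>, with \<open>h\<close> set to zero at negative times. Looking backward keeps it
  adapted, and the form as a difference of two primitives makes it continuous in
  \<open>t\<close>.\<close>

definition backward_average :: "real \<Rightarrow> (real \<Rightarrow> real) \<Rightarrow> real \<Rightarrow> real" where
  "backward_average \<delta> h t = (LINT s|time t. h s) / \<delta> - (LINT s|time (t - \<delta>). h s) / \<delta>"

lemma backward_average_eq:
  assumes h: "integrable (time T) h" and "0 < \<delta>" and t: "t \<in> {0..T}"
  shows "backward_average \<delta> h t = (LINT s|time T. (if t - \<delta> < s \<and> s \<le> t then h s else 0)) / \<delta>"
proof -
  have i: "(LINT s|time r. h s) = (LINT s|time T. (if s \<le> r then h s else 0))"
    and j: "integrable (time T) (\<lambda>s. if s \<le> r then h s else 0)" if "r \<le> T" for r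
  proof -
    show "(LINT s|time r. h s) = (LINT s|time T. (if s \<le> r then h s else 0))"
      unfolding integral_restrict_space[of "{0..T}" lborel, simplified]
        integral_restrict_space[of "{0..r}" lborel, simplified]
      using that by (intro Bochner_Integration.integral_cong) (auto split: split_indicator)
    have m: "(\<lambda>s. if s \<le> r then h s else 0) \<in> borel_measurable (time T)"
    proof -
      have [measurable]: "h \<in> borel_measurable (time T)" using h by simp
      have [measurable]: "(\<lambda>s. s) \<in> borel_measurable (time T)" by (intro measurable_restrict_space1) simp
      show ?thesis by measurable
    qed
    show "integrable (time T) (\<lambda>s. if s \<le> r then h s else 0)"
      by (rule Bochner_Integration.integrable_bound[OF h m]) auto
  qed
  have "backward_average \<delta> h t = ((LINT s|time T. (if s \<le> t then h s else 0))
      - (LINT s|time T. (if s \<le> t - \<delta> then h s else 0))) / \<delta>"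
    unfolding backward_average_def using t \<open>0 < \<delta>\<close> by (simp add: i diff_divide_distrib)
  also have "(LINT s|time T. (if s \<le> t then h s else 0)) - (LINT s|time T. (if s \<le> t - \<delta> then h s else 0)) =
    (LINT s|time T. (if s \<le> t then h s else 0) - (if s \<le> t - \<delta> then h s else 0))"
    using t \<open>0 < \<delta>\<close> by (intro Bochner_Integration.integral_diff[symmetric] j) auto
  also have "\<dots> = (LINT s|time T. (if t - \<delta> < s \<and> s \<le> t then h s else 0))"
    using \<open>0 < \<delta>\<close> by (intro Bochner_Integration.integral_cong) auto
  finally show ?thesis .
qed

text \<open>Cauchy-Schwarz within the window, then Fubini over window and time.\<close>

lemma backward_average_contraction:
  assumes h: "square_integrable (time T) h" and \<delta>: "0 < \<delta>"
    and m: "backward_average \<delta> h \<in> borel_measurable (time T)"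
  shows "L2sq (time T) (\<lambda>t. backward_average \<delta> h t) \<le> L2sq (time T) h"
proof -
  note [measurable] = square_integrable_measurable[OF h]
  have [measurable]: "(\<lambda>s. s) \<in> borel_measurable (time T)" by (intro measurable_restrict_space1) simp
  have hi: "integrable (time T) h" by (rule time.square_integrable_imp_integrable'[OF h])
  interpret tt: pair_sigma_finite "time T" "time T"
    by (intro pair_sigma_finite.intro time.sigma_finite_measure_axioms)
  define I where "I t s = (if t - \<delta> < s \<and> s \<le> t then 1 else 0 :: real)" for t s
  have [measurable]: "fst \<in> borel_measurable (time T \<Otimes>\<^sub>M time T)" "snd \<in> borel_measurable (time T \<Otimes>\<^sub>M time T)"
    by (auto intro!: measurable_compose[OF measurable_fst] measurable_compose[OF measurable_snd])
  have Im[measurable]: "(\<lambda>z. I (fst z) (snd z)) \<in> borel_measurable (time T \<Otimes>\<^sub>M time T)"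
    unfolding I_def by measurable
  have Im2[measurable]: "(\<lambda>z. I (snd z) (fst z)) \<in> borel_measurable (time T \<Otimes>\<^sub>M time T)"
    unfolding I_def by measurable
  have I1: "I t \<in> borel_measurable (time T)" "(\<lambda>t. I t s) \<in> borel_measurable (time T)" for t s
    unfolding I_def by measurable
  have Ile: "(\<integral>\<^sup>+s. ennreal (I t s) \<partial>time T) \<le> ennreal \<delta>" "(\<integral>\<^sup>+t. ennreal (I t s) \<partial>time T) \<le> ennreal \<delta>" for t s
  proof -
    have "(\<integral>\<^sup>+s. ennreal (I t s) \<partial>time T) \<le> (\<integral>\<^sup>+s. indicator {t - \<delta> <.. t} s \<partial>lborel)"
      by (subst nn_integral_restrict_space, simp, intro nn_integral_mono)
        (auto simp: I_def split: split_indicator)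
    then show "(\<integral>\<^sup>+s. ennreal (I t s) \<partial>time T) \<le> ennreal \<delta>" using \<delta> by simp
    have "(\<integral>\<^sup>+t. ennreal (I t s) \<partial>time T) \<le> (\<integral>\<^sup>+t. indicator {s ..< s + \<delta>} t \<partial>lborel)"
      by (subst nn_integral_restrict_space, simp, intro nn_integral_mono)
        (auto simp: I_def split: split_indicator)
    then show "(\<integral>\<^sup>+t. ennreal (I t s) \<partial>time T) \<le> ennreal \<delta>" using \<delta> by simp
  qed
  have pt: "ennreal ((backward_average \<delta> h t)\<^sup>2) \<le> (\<integral>\<^sup>+s. ennreal (I t s * (h s)\<^sup>2 / \<delta>) \<partial>time T)"
    if t: "t \<in> {0..T}" for t
  proof -
    note [measurable] = I1
    have Isq: "square_integrable (time T) (I t)"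
      by (rule square_integrable_bound[OF time.square_integrable_const[of T 1]]) (auto simp: I_def)
    have Ih: "square_integrable (time T) (\<lambda>s. I t s * h s)"
      by (rule square_integrable_mult_bounded[OF h, of _ 1]) (auto simp: I_def)
    \<comment> \<open>The indicator is used twice, \<open>I = I * I\<close>, so that one factor in
      Cauchy-Schwarz has square integral at most the window length \<open>\<delta>\<close>.\<close>
    have "(LINT s|time T. (if t - \<delta> < s \<and> s \<le> t then h s else 0)) = (LINT s|time T. I t s * (I t s * h s))"
      by (intro Bochner_Integration.integral_cong) (auto simp: I_def)
    then have "\<bar>backward_average \<delta> h t\<bar> = \<bar>LINT s|time T. I t s * (I t s * h s)\<bar> / \<delta>"
      using backward_average_eq[OF hi \<delta> t] \<delta> by (simp add: abs_div)
    also have "\<dots> \<le> (sqrt (LINT s|time T. (I t s)\<^sup>2) * sqrt (LINT s|time T. (I t s * h s)\<^sup>2)) / \<delta>"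
      using \<delta> by (intro divide_right_mono square_integrable_Cauchy_Schwarz Isq Ih) auto
    also have "(LINT s|time T. (I t s)\<^sup>2) \<le> \<delta>"
    proof -
      have "ennreal (LINT s|time T. (I t s)\<^sup>2) = L2sq (time T) (\<lambda>s. I t s)"
        using Isq by (intro nn_integral_eq_integral[symmetric]) (auto simp: square_integrable_def)
      also have "\<dots> = (\<integral>\<^sup>+s. ennreal (I t s) \<partial>time T)"
        by (intro nn_integral_cong) (auto simp: I_def)
      also have "\<dots> \<le> ennreal \<delta>" by (rule Ile)
      finally show ?thesis using \<delta> by (simp add: ennreal_le_iff)
    qed
    then have "(sqrt (LINT s|time T. (I t s)\<^sup>2) * sqrt (LINT s|time T. (I t s * h s)\<^sup>2)) / \<delta>
        \<le> (sqrt \<delta> * sqrt (LINT s|time T. (I t s * h s)\<^sup>2)) / \<delta>"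
      using \<delta> by (intro divide_right_mono mult_right_mono) auto
    finally have "\<bar>backward_average \<delta> h t\<bar>\<^sup>2 \<le> ((sqrt \<delta> * sqrt (LINT s|time T. (I t s * h s)\<^sup>2)) / \<delta>)\<^sup>2"
      by (intro power_mono) auto
    also have "\<dots> = (LINT s|time T. (I t s * h s)\<^sup>2) / \<delta>"
      using \<delta> by (simp add: power_divide power_mult_distrib) (simp add: power2_eq_square)
    also have "\<dots> = (LINT s|time T. I t s * (h s)\<^sup>2 / \<delta>)"
      by (subst integral_divide_zero[symmetric], intro Bochner_Integration.integral_cong) (auto simp: I_def)
    finally have "ennreal ((backward_average \<delta> h t)\<^sup>2) \<le> ennreal (LINT s|time T. I t s * (h s)\<^sup>2 / \<delta>)"
      by (intro ennreal_leI) simp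
    also have "\<dots> = (\<integral>\<^sup>+s. ennreal (I t s * (h s)\<^sup>2 / \<delta>) \<partial>time T)"
    proof (rule nn_integral_eq_integral[symmetric])
      have eq: "(\<lambda>s. I t s * (h s)\<^sup>2 / \<delta>) = (\<lambda>s. (I t s * h s)\<^sup>2 / \<delta>)"
        by (auto simp: I_def fun_eq_iff)
      show "integrable (time T) (\<lambda>s. I t s * (h s)\<^sup>2 / \<delta>)"
        unfolding eq using square_integrable_integrable_power2[OF Ih] by simp
    qed (use \<delta> in \<open>auto simp: I_def\<close>)
    finally show ?thesis .
  qed
  have "L2sq (time T) (\<lambda>t. backward_average \<delta> h t)
    \<le> (\<integral>\<^sup>+t. (\<integral>\<^sup>+s. ennreal (I t s * (h s)\<^sup>2 / \<delta>) \<partial>time T) \<partial>time T)"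
    using pt by (intro nn_integral_mono) (simp add: space_restrict_space)
  \<comment> \<open>In this order each \<open>s\<close> is seen only by the windows of
    \<open>t\<close> in \<open>{s ..< s + \<delta>}\<close>, whose total length cancels the factor
    \<open>1 / \<delta>\<close>.\<close>
  also have "\<dots> = (\<integral>\<^sup>+s. (\<integral>\<^sup>+t. ennreal (I t s * (h s)\<^sup>2 / \<delta>) \<partial>time T) \<partial>time T)"
    by (rule tt.Fubini') (simp add: case_prod_beta')
  also have "\<dots> \<le> L2sq (time T) h"
  proof (rule nn_integral_mono)
    fix s
    note [measurable] = I1
    have "(\<integral>\<^sup>+t. ennreal (I t s * (h s)\<^sup>2 / \<delta>) \<partial>time T) = (\<integral>\<^sup>+t. ennreal ((h s)\<^sup>2 / \<delta>) * ennreal (I t s) \<partial>time T)"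
      using \<delta> by (intro nn_integral_cong) (auto simp: I_def)
    also have "\<dots> = ennreal ((h s)\<^sup>2 / \<delta>) * (\<integral>\<^sup>+t. ennreal (I t s) \<partial>time T)"
      by (rule nn_integral_cmult) simp
    also have "\<dots> \<le> ennreal ((h s)\<^sup>2 / \<delta>) * ennreal \<delta>" by (intro mult_left_mono Ile) simp
    also have "\<dots> = ennreal ((h s)\<^sup>2)" using \<delta> by (simp add: ennreal_mult[symmetric])
    finally show "(\<integral>\<^sup>+t. ennreal (I t s * (h s)\<^sup>2 / \<delta>) \<partial>time T) \<le> ennreal ((h s)\<^sup>2)" .
  qed
  finally show ?thesis .
qed

lemma continuous_on_time_integral:
  assumes "integrable (time T) h"
  shows "continuous_on {0..T} (\<lambda>t. LINT s|time t. (h s :: real))"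
proof -
  have si: "set_integrable lborel {0..T} h" using assms by (simp add: set_integrable_time)
  have "(LINT s|time t. h s) = integral {0..t} h" if "t \<in> {0..T}" for t
  proof -
    have "set_integrable lborel {0..t} h"
      using that by (intro set_integrable_subset[OF si]) auto
    then show ?thesis using set_borel_integral_eq_integral(2)[of "{0..t}" h] by (simp add: set_integral_time)
  qed
  moreover have "continuous_on {0..T} (\<lambda>t. integral {0..t} h)"
    using set_borel_integral_eq_integral(1)[OF si] by (rule indefinite_integral_continuous_1)
  ultimately show ?thesis by (subst continuous_on_cong) auto
qed

lemma time_nonpos_integral: "t \<le> 0 \<Longrightarrow> (LINT s|time t. (h s :: real)) = 0"
proof -
  assume t: "t \<le> 0"
  have "(LINT s|time t. h s) = (LINT s|lborel. indicator {0..t} s * h s)"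
    by (simp add: integral_restrict_space)
  also have "\<dots> = 0"
  proof (rule integral_eq_zero_AE)
    have "AE s in lborel. s \<noteq> (0::real)" by (rule AE_lborel_singleton)
    then show "AE s in lborel. indicator {0..t} s * h s = 0"
      by eventually_elim (use t in \<open>auto split: split_indicator\<close>)
  qed
  finally show ?thesis .
qed

lemma backward_average_measurable:
  assumes h: "integrable (time T) h" and "0 < \<delta>"
  shows "continuous_on {0..T} (backward_average \<delta> h)"
    and "backward_average \<delta> h \<in> borel_measurable (time T)"
proof -
  have "continuous_on {0..T} (\<lambda>t. LINT s|time (max 0 (t - \<delta>)). h s)"
    by (rule continuous_on_compose2[OF continuous_on_time_integral[OF h]])
      (use assms(2) in \<open>auto intro!: continuous_intros\<close>)
  moreover have "(LINT s|time (max 0 r). h s) = (LINT s|time r. h s)" for r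
    using time_nonpos_integral[of r h] time_nonpos_integral[of 0 h] by (cases "r \<le> 0") auto
  ultimately have "continuous_on {0..T} (\<lambda>t. LINT s|time (t - \<delta>). h s)" by simp
  then show c: "continuous_on {0..T} (backward_average \<delta> h)"
    unfolding backward_average_def[abs_def]
    by (intro continuous_on_diff continuous_on_divide continuous_on_time_integral[OF h] continuous_on_const)
      (use assms(2) in auto)
  have "backward_average \<delta> h \<in> borel_measurable (restrict_space borel {0..T})"
    by (rule borel_measurable_continuous_on_restrict[OF c])
  then show "backward_average \<delta> h \<in> borel_measurable (time T)"
    by (simp add: measurable_cong_sets[OF sets_time refl])
qed

text \<open>The two-step choice of an approximation argument: first \<open>j\<close> makes
  \<open>r j\<close> small, then \<open>n\<close> is taken large for this \<open>j\<close>.\<close>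

lemma ennreal_tendsto_0_approx:
  fixes X :: "nat \<Rightarrow> ennreal"
  assumes le: "\<And>j n. X n \<le> r j + y j n" and r: "r \<longlonglongrightarrow> 0" and y: "\<And>j::nat. y j \<longlonglongrightarrow> 0"
  shows "X \<longlonglongrightarrow> 0"
proof (rule order_tendstoI)
  fix a :: ennreal assume "0 < a"
  then obtain j where j: "r j < a"
    using order_tendstoD(2)[OF r] by (auto simp: eventually_sequentially)
  have "(\<lambda>n. r j + y j n) \<longlonglongrightarrow> r j + 0" by (intro tendsto_add tendsto_const y)
  then have "\<forall>\<^sub>F n in sequentially. r j + y j n < a" using j by (intro order_tendstoD(2)) auto
  then show "\<forall>\<^sub>F n in sequentially. X n < a"
    by eventually_elim (use le in \<open>blast intro: le_less_trans\<close>)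
qed simp

lemma bounded_time_square_integrable:
  assumes "h \<in> borel_measurable (time T)" "\<And>x. x \<in> {0..T} \<Longrightarrow> \<bar>h x\<bar> \<le> B"
  shows "square_integrable (time T) h"
  by (rule square_integrable_bound[OF time.square_integrable_const[of T B] assms(1)])
    (use assms(2) in \<open>force simp: space_restrict_space\<close>)

lemma backward_average_bound:
  assumes h: "h \<in> borel_measurable (time T)" "\<And>x. x \<in> {0..T} \<Longrightarrow> \<bar>h x\<bar> \<le> B"
    and \<delta>: "0 < \<delta>" and t: "t \<in> {0..T}"
  shows "\<bar>backward_average \<delta> h t\<bar> \<le> B"
proof -
  have hi: "integrable (time T) h"
    by (intro time.square_integrable_imp_integrable' bounded_time_square_integrable[OF h])
  have B0: "0 \<le> B" using h(2)[OF t] by (meson abs_ge_zero order_trans)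
  define f where "f s = (if t - \<delta> < s \<and> s \<le> t then h s else 0)" for s
  have fm: "f \<in> borel_measurable (time T)"
  proof -
    note [measurable] = h(1)
    have [measurable]: "(\<lambda>s. s) \<in> borel_measurable (time T)" by (intro measurable_restrict_space1) simp
    show ?thesis unfolding f_def[abs_def] by measurable
  qed
  have fi: "integrable (time T) f"
    by (rule Bochner_Integration.integrable_bound[OF hi fm]) (auto simp: f_def)
  have "\<bar>LINT s|time T. f s\<bar> \<le> (LINT s|lborel. indicator {t - \<delta> <.. t} s * B)"
    unfolding integral_restrict_space[of "{0..T}" lborel, simplified] real_norm_def[symmetric]
      real_scaleR_def
  proof (rule Bochner_Integration.integral_norm_bound_integral)
    show "integrable lborel (\<lambda>s. indicator {0..T} s * f s)"
      using fi by (simp add: integrable_restrict_space)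
    show "integrable lborel (\<lambda>s. indicator {t - \<delta> <.. t} s * B)"
      using \<delta> by (intro integrable_mult_left integrable_real_indicator) auto
    show "norm (indicator {0..T} s * f s) \<le> indicator {t - \<delta><..t} s * B" for s
      using h(2)[of s] B0 by (auto simp: f_def split: split_indicator)
  qed
  also have "\<dots> = \<delta> * B" using \<delta> by simp
  finally show ?thesis
    using \<delta> unfolding backward_average_eq[OF hi \<delta> t] f_def by (simp add: field_simps)
qed

lemma backward_average_diff:
  assumes "integrable (time T) h" "integrable (time T) g" "0 < \<delta>" "t \<in> {0..T}"
  shows "backward_average \<delta> h t - backward_average \<delta> g t = backward_average \<delta> (\<lambda>s. h s - g s) t"
proof -
  have r: "integrable (time r) f" if "integrable (time T) f" "r \<le> T" for r and f :: "real \<Rightarrow> real"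
    using that unfolding set_integrable_time[symmetric]
    by - (rule set_integrable_subset[of lborel "{0..T}" f "{0..r}"], auto)
  have "(LINT s|time r. h s - g s) = (LINT s|time r. h s) - (LINT s|time r. g s)" if "r \<le> T" for r
    using r[OF assms(1) that] r[OF assms(2) that] by (rule Bochner_Integration.integral_diff)
  then show ?thesis using assms(3,4) by (simp add: backward_average_def diff_divide_distrib)
qed

text \<open>A left difference quotient of the primitive of \<open>g\<close>. At \<open>t = 0\<close>
  it would see only the zero extension, hence the positive times.\<close>

lemma backward_average_continuous_tendsto:
  assumes g: "continuous_on UNIV g" and t: "0 < t" "t \<le> T"
  shows "(\<lambda>n. backward_average (1 / real (Suc n)) g t) \<longlonglongrightarrow> g t"
proof -
  define K where "K x = integral {0..x} g" for x
  have K: "(LINT s|time r. g s) = K r" for r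
  proof -
    have "set_integrable lborel {0..r} g"
      by (intro borel_integrable_atLeastAtMost' continuous_on_subset[OF g]) auto
    then show ?thesis
      using set_borel_integral_eq_integral(2)[of "{0..r}" g] by (simp add: set_integral_time K_def)
  qed
  have "(K has_real_derivative g t) (at t within {0..T})"
    unfolding K_def using t by (intro integral_has_real_derivative continuous_on_subset[OF g]) auto
  then have "((\<lambda>y. (K y - K t) / (y - t)) \<longlongrightarrow> g t) (at t within {0..T})"
    by (simp add: has_field_derivative_iff)
  moreover have "filterlim (\<lambda>n. t - 1 / real (Suc n)) (at t within {0..T}) sequentially"
    unfolding filterlim_at
  proof
    have 0: "(\<lambda>n. 1 / real (Suc n)) \<longlonglongrightarrow> 0" by (rule LIMSEQ_Suc[OF lim_1_over_n])
    then show "(\<lambda>n. t - 1 / real (Suc n)) \<longlonglongrightarrow> t" using tendsto_diff[OF tendsto_const 0, of t] by simp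
    have "\<forall>\<^sub>F n in sequentially. 1 / real (Suc n) < t" using order_tendstoD(2)[OF 0 t(1)] .
    then show "\<forall>\<^sub>F n in sequentially. t - 1 / real (Suc n) \<in> {0..T} \<and> t - 1 / real (Suc n) \<noteq> t"
    proof eventually_elim
      case (elim n)
      have "0 < 1 / real (Suc n)" by simp
      then have "t - 1 / real (Suc n) \<le> T" "t - 1 / real (Suc n) \<noteq> t" using t by linarith+
      then show ?case using elim by (auto simp del: of_nat_Suc)
    qed
  qed
  ultimately have "(\<lambda>n. (K (t - 1 / real (Suc n)) - K t) / ((t - 1 / real (Suc n)) - t)) \<longlonglongrightarrow> g t"
    by (rule filterlim_compose)
  then show ?thesis
    by (simp add: backward_average_def K field_simps)
qed

text \<open>Because averaging is a contraction, convergence has to be checked only on the dense set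
  of continuous functions. In the bound, the contraction turns the first term of
  \<open>L2_triangle3\<close> into \<open>4 * r j\<close>, which together with
  \<open>2 * r j\<close> makes 6.\<close>

lemma backward_average_L2_tendsto:
  assumes h: "h \<in> borel_measurable (time T)" "\<And>x. x \<in> {0..T} \<Longrightarrow> \<bar>h x\<bar> \<le> B" and "0 \<le> B"
  shows "(\<lambda>n. L2sq (time T) (\<lambda>t. backward_average (1 / real (Suc n)) h t - h t)) \<longlonglongrightarrow> 0"
proof -
  from continuous_approximation[OF h \<open>0 \<le> B\<close>] obtain g :: "nat \<Rightarrow> real \<Rightarrow> real"
    where g: "\<And>n. continuous_on UNIV (g n)" "\<And>n x. \<bar>g n x\<bar> \<le> B"
      "(\<lambda>n. L2sq (time T) (\<lambda>x. g n x - h x)) \<longlonglongrightarrow> 0" by blast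
  let ?A = "\<lambda>n. backward_average (1 / real (Suc n))"
  have hsq: "square_integrable (time T) h" by (rule bounded_time_square_integrable[OF h])
  have gm[measurable]: "g j \<in> borel_measurable (time T)" for j
    by (intro measurable_restrict_space1) (simp add: borel_measurable_continuous_onI g)
  have gsq: "square_integrable (time T) (g j)" for j
    by (rule bounded_time_square_integrable[OF gm]) (rule g)
  have int: "integrable (time T) h" "integrable (time T) (g j)" "integrable (time T) (\<lambda>s. h s - g j s)" for j
    using time.square_integrable_imp_integrable'[OF hsq] time.square_integrable_imp_integrable'[OF gsq[of j]]
    by auto
  have Am: "?A n h \<in> borel_measurable (time T)" "?A n (g j) \<in> borel_measurable (time T)"
    "?A n (\<lambda>s. h s - g j s) \<in> borel_measurable (time T)" for n j
    by (auto intro!: backward_average_measurable int simp del: of_nat_Suc)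
  define r where "r j = L2sq (time T) (\<lambda>x. g j x - h x)" for j
  define y where "y j n = L2sq (time T) (\<lambda>x. ?A n (g j) x - g j x)" for j n
  show ?thesis
  proof (rule ennreal_tendsto_0_approx[where r="\<lambda>j. 6 * r j" and y="\<lambda>j n. 4 * y j n"])
    show "L2sq (time T) (\<lambda>t. ?A n h t - h t) \<le> 6 * r j + 4 * y j n" for j n
    proof -
      have "L2sq (time T) (\<lambda>t. ?A n h t - h t) \<le>
          4 * L2sq (time T) (\<lambda>t. ?A n h t - ?A n (g j) t) + 4 * y j n + 2 * r j"
        unfolding y_def r_def by (rule L2_triangle3[OF Am(1,2) gm h(1)])
      also have "L2sq (time T) (\<lambda>t. ?A n h t - ?A n (g j) t) =
          L2sq (time T) (\<lambda>t. ?A n (\<lambda>s. h s - g j s) t)"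
        using backward_average_diff[OF int(1,2)]
        by (intro nn_integral_cong) (simp add: space_restrict_space del: of_nat_Suc)
      also have "\<dots> \<le> L2sq (time T) (\<lambda>t. h t - g j t)"
        by (intro backward_average_contraction square_integrable_diff hsq gsq Am) simp
      also have "\<dots> = r j" by (simp add: r_def power2_commute)
      finally have "L2sq (time T) (\<lambda>t. ?A n h t - h t) \<le> 4 * r j + 4 * y j n + 2 * r j"
        by (simp add: add_mono mult_left_mono)
      also have "\<dots> = (4 * r j + 2 * r j) + 4 * y j n" by (simp add: ac_simps)
      also have "4 * r j + 2 * r j = 6 * r j" by (simp flip: distrib_right)
      finally show ?thesis .
    qed
    show "(\<lambda>j. 6 * r j) \<longlonglongrightarrow> 0"
      using ennreal_tendsto_cmult[of 6 r 0 sequentially] g(3) by (simp add: r_def[abs_def])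
    show "(\<lambda>n. 4 * y j n) \<longlonglongrightarrow> 0" for j
    proof -
      have "y j \<longlonglongrightarrow> (\<integral>\<^sup>+x. 0 \<partial>time T)"
        unfolding y_def
      proof (rule nn_integral_dominated_convergence[where w="\<lambda>_. ennreal ((2 * B)\<^sup>2)"])
        show "AE x in time T. ennreal ((?A n (g j) x - g j x)\<^sup>2) \<le> ennreal ((2 * B)\<^sup>2)" for n
        proof (rule AE_I2)
          fix x assume "x \<in> space (time T)"
          then have "\<bar>?A n (g j) x\<bar> \<le> B"
            by (intro backward_average_bound[OF gm] g) (auto simp: space_restrict_space simp del: of_nat_Suc)
          then have "\<bar>?A n (g j) x - g j x\<bar> \<le> 2 * B" using g(2)[of j x] by linarith
          then have "\<bar>?A n (g j) x - g j x\<bar>\<^sup>2 \<le> (2 * B)\<^sup>2" by (intro power_mono) auto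
          then show "ennreal ((?A n (g j) x - g j x)\<^sup>2) \<le> ennreal ((2 * B)\<^sup>2)" by (intro ennreal_leI) simp
        qed
        show "L2sq (time T) (\<lambda>x. 2 * B) < \<infinity>"
          unfolding nn_integral_const emeasure_time by (simp add: ennreal_mult_less_top)
        have "AE x in time T. x \<noteq> 0"
          by (subst AE_restrict_space_iff) (auto intro: AE_mp[OF AE_lborel_singleton[of 0]])
        then show "AE x in time T. (\<lambda>n. ennreal ((?A n (g j) x - g j x)\<^sup>2)) \<longlonglongrightarrow> 0"
        proof (rule AE_mp, intro AE_I2 impI)
          fix x assume "x \<in> space (time T)" "x \<noteq> 0"
          then have "0 < x" "x \<le> T" by (auto simp: space_restrict_space)
          then have "(\<lambda>n. (?A n (g j) x - g j x)\<^sup>2) \<longlonglongrightarrow> (g j x - g j x)\<^sup>2"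
            by (intro tendsto_power tendsto_diff tendsto_const backward_average_continuous_tendsto[OF g(1)])
          then show "(\<lambda>n. ennreal ((?A n (g j) x - g j x)\<^sup>2)) \<longlonglongrightarrow> 0" by (simp add: ennreal_tendsto_0_iff)
        qed
      qed (use Am in auto)
      then show ?thesis using ennreal_tendsto_cmult[of 4 "y j" 0 sequentially] by simp
    qed
  qed
qed

section \<open>Approximation of progressive processes by simple integrands\<close>

context filtered_space
begin

text \<open>Joint measurability of the simple integrands is recorded along with them, so that the
  limit argument can apply the triangle inequality to them directly.\<close>

definition simply_approximable :: "(real \<Rightarrow> 'a \<Rightarrow> real) \<Rightarrow> bool" where
  "simply_approximable H \<longleftrightarrow> (\<exists>S. (\<forall>j::nat. simple_integrand M T F (S j) \<and> flat (simple_value (S j)) \<in> borel_measurable PM) \<and>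
     (\<lambda>j. L2sq PM (\<lambda>z. flat (simple_value (S j)) z - flat H z)) \<longlonglongrightarrow> 0)"

text \<open>A diagonal choice: the \<open>j\<close>-th simple integrand is taken within
  \<open>(1/2) ^ j\<close> of \<open>H j\<close>.\<close>

lemma simply_approximable_limit:
  assumes H: "\<And>j. simply_approximable (H j)" "\<And>j. flat (H j) \<in> borel_measurable PM"
    and G: "flat G \<in> borel_measurable PM"
    and lim: "(\<lambda>j::nat. L2sq PM (\<lambda>z. flat (H j) z - flat G z)) \<longlonglongrightarrow> 0"
  shows "simply_approximable G"
proof -
  have "\<forall>j. \<exists>S. simple_integrand M T F S \<and> flat (simple_value S) \<in> borel_measurable PM \<and>
      L2sq PM (\<lambda>z. flat (simple_value S) z - flat (H j) z) \<le> ennreal ((1/2) ^ j)"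
  proof
    fix j
    obtain S where S: "\<forall>k::nat. simple_integrand M T F (S k) \<and> flat (simple_value (S k)) \<in> borel_measurable PM"
      "(\<lambda>k. L2sq PM (\<lambda>z. flat (simple_value (S k)) z - flat (H j) z)) \<longlonglongrightarrow> 0"
      using H(1)[of j] unfolding simply_approximable_def by blast
    from order_tendstoD(2)[OF S(2), of "ennreal ((1/2) ^ j)"] obtain k where
      "L2sq PM (\<lambda>z. flat (simple_value (S k)) z - flat (H j) z) < ennreal ((1/2) ^ j)"
      by (auto simp: eventually_sequentially)
    with S(1) show "\<exists>S. simple_integrand M T F S \<and> flat (simple_value S) \<in> borel_measurable PM \<and>
      L2sq PM (\<lambda>z. flat (simple_value S) z - flat (H j) z) \<le> ennreal ((1/2) ^ j)"
      by (intro exI[of _ "S k"]) (auto intro: less_imp_le)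
  qed
  from choice[OF this] obtain S where
    S: "\<And>j. simple_integrand M T F (S j)" "\<And>j. flat (simple_value (S j)) \<in> borel_measurable PM"
    "\<And>j. L2sq PM (\<lambda>z. flat (simple_value (S j)) z - flat (H j) z) \<le> ennreal ((1/2) ^ j)"
    by blast
  have "(\<lambda>j. L2sq PM (\<lambda>z. flat (simple_value (S j)) z - flat G z)) \<longlonglongrightarrow> 0"
  proof (rule tendsto_sandwich[OF always_eventually always_eventually tendsto_const], safe)
    fix j
    have "L2sq PM (\<lambda>z. flat (simple_value (S j)) z - flat G z)
      \<le> 2 * L2sq PM (\<lambda>z. flat (simple_value (S j)) z - flat (H j) z)
        + 2 * L2sq PM (\<lambda>z. flat (H j) z - flat G z)"
      using nn_integral_sq_add_le[of "\<lambda>z. flat (simple_value (S j)) z - flat (H j) z" PM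
          "\<lambda>z. flat (H j) z - flat G z"] S(2) H(2) G by simp
    also have "\<dots> \<le> 2 * ennreal ((1/2) ^ j) + 2 * L2sq PM (\<lambda>z. flat (H j) z - flat G z)"
      by (intro add_right_mono mult_left_mono S) simp
    finally show "L2sq PM (\<lambda>z. flat (simple_value (S j)) z - flat G z)
      \<le> 2 * ennreal ((1/2) ^ j) + 2 * L2sq PM (\<lambda>z. flat (H j) z - flat G z)" .
  next
    have "(\<lambda>j. ennreal ((1/2) ^ j)) \<longlonglongrightarrow> 0"
      by (simp add: ennreal_tendsto_0_iff LIMSEQ_power_zero)
    then show "(\<lambda>j. 2 * ennreal ((1/2) ^ j) + 2 * L2sq PM (\<lambda>z. flat (H j) z - flat G z)) \<longlonglongrightarrow> 0"
      using tendsto_add[OF ennreal_tendsto_cmult[of 2 "\<lambda>j. ennreal ((1/2) ^ j)" 0 sequentially]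
          ennreal_tendsto_cmult[OF _ lim, of 2]] by simp
  qed auto
  then show ?thesis using S(1,2) unfolding simply_approximable_def by blast
qed

text \<open>Freeze \<open>X\<close> at the left end of each cell of a uniform grid; continuity gives
  pointwise convergence and the bound \<open>B\<close> the domination.\<close>

lemma continuous_simply_approximable:
  assumes X: "\<And>t. t \<in> {0..T} \<Longrightarrow> X t \<in> borel_measurable (F t)"
    and cont: "\<And>\<omega>. \<omega> \<in> space M \<Longrightarrow> continuous_on {0..T} (\<lambda>t. X t \<omega>)"
    and bnd: "\<And>t \<omega>. t \<in> {0..T} \<Longrightarrow> \<omega> \<in> space M \<Longrightarrow> \<bar>X t \<omega>\<bar> \<le> B"
  shows "simply_approximable X"
proof -
  define \<tau> where "\<tau> n k = T * real k / real (Suc n)" for n k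
  define S where "S n = (Suc n, \<tau> n, \<lambda>k. X (\<tau> n k))" for n
  have \<tau>: "\<tau> n k \<in> {0..T}" if "k \<le> Suc n" for n k
    using that T_pos by (auto simp: \<tau>_def field_simps simp flip: of_nat_Suc)
  have \<tau>_mono: "\<tau> n k \<le> \<tau> n (Suc k)" for n k
    unfolding \<tau>_def using T_pos by (intro divide_right_mono mult_left_mono) auto
  have simple: "simple_integrand M T F (S n)" for n
    unfolding simple_integrand_def S_def using \<tau> \<tau>_mono X bnd by (auto intro!: exI[of _ B])
  have m: "flat (simple_value (S n)) \<in> borel_measurable PM" for n
  proof -
    have "(\<lambda>z. \<Sum>k<Suc n. X (\<tau> n k) (snd z) * indicator {\<tau> n k<..\<tau> n (Suc k)} (fst z)) \<in> borel_measurable PM"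
    proof (rule borel_measurable_sum)
      fix k assume "k \<in> {..<Suc n}"
      then have "\<tau> n k \<in> {0..T}" by (intro \<tau>) auto
      then have [measurable]: "X (\<tau> n k) \<in> borel_measurable M" using X measurable_F_M by blast
      show "(\<lambda>z. X (\<tau> n k) (snd z) * indicator {\<tau> n k<..\<tau> n (Suc k)} (fst z)) \<in> borel_measurable PM"
        by measurable
    qed
    then show ?thesis unfolding S_def simple_value_def prod.case .
  qed
  have val: "\<exists>k\<le>n. t - T / real (Suc n) \<le> \<tau> n k \<and> \<tau> n k < t \<and> simple_value (S n) t \<omega> = X (\<tau> n k) \<omega>"
    if t: "0 < t" "t \<le> T" for t n \<omega>
  proof -
    define N where "N = real (Suc n)"
    have N: "N > 0" by (simp add: N_def)
    \<comment> \<open>The cells are open on the left, so a grid point belongs to the cell that ends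
      there: the index is the ceiling minus one instead of the floor.\<close>
    define k where "k = nat (\<lceil>t * N / T\<rceil> - 1)"
    have p: "0 < t * N / T" using t N T_pos by simp
    then have k: "real k = of_int \<lceil>t * N / T\<rceil> - 1"
      unfolding k_def by (subst of_nat_nat) (auto simp: less_ceiling_iff)
    have kb: "real k < t * N / T" "t * N / T \<le> real k + 1" unfolding k by linarith+
    have "t * N / T \<le> N" using t N T_pos by (simp add: field_simps)
    then have "real k < real (Suc n)" using kb(1) unfolding N_def by linarith
    then have kn: "k < Suc n" by (simp only: of_nat_less_iff)
    have tk: "\<tau> n k < t" "t \<le> \<tau> n (Suc k)"
      using kb N T_pos unfolding \<tau>_def N_def[symmetric] by (auto simp: field_simps)
    have "simple_value (S n) t \<omega> = (\<Sum>l<Suc n. X (\<tau> n l) \<omega> * indicator {\<tau> n l<..\<tau> n (Suc l)} t)"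
      by (simp only: S_def simple_value_def prod.case)
    also have "\<dots> = (\<Sum>l\<in>{k}. X (\<tau> n l) \<omega> * indicator {\<tau> n l<..\<tau> n (Suc l)} t)"
    proof (rule sum.mono_neutral_right)
      show "\<forall>l\<in>{..<Suc n} - {k}. X (\<tau> n l) \<omega> * indicator {\<tau> n l<..\<tau> n (Suc l)} t = 0"
      proof
        fix l assume "l \<in> {..<Suc n} - {k}"
        then consider "Suc l \<le> k" | "Suc k \<le> l" by fastforce
        then have "\<tau> n (Suc l) \<le> \<tau> n k \<or> \<tau> n (Suc k) \<le> \<tau> n l"
          unfolding \<tau>_def using T_pos by cases (auto intro!: divide_right_mono mult_left_mono simp del: of_nat_Suc)
        then have "t \<notin> {\<tau> n l<..\<tau> n (Suc l)}" using tk by auto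
        then show "X (\<tau> n l) \<omega> * indicator {\<tau> n l<..\<tau> n (Suc l)} t = 0" by simp
      qed
    qed (use kn in auto)
    also have "\<dots> = X (\<tau> n k) \<omega>" using tk by simp
    finally have "simple_value (S n) t \<omega> = X (\<tau> n k) \<omega>" .
    moreover have "t - T / real (Suc n) \<le> \<tau> n k"
    proof -
      have "t * N \<le> T * real k + T" using kb(2) T_pos by (simp add: field_simps)
      then have "t \<le> (T * real k + T) / N" using N by (simp add: pos_le_divide_eq)
      then show ?thesis unfolding \<tau>_def N_def by (simp add: add_divide_distrib del: of_nat_Suc)
    qed
    ultimately show ?thesis using kn tk by (intro exI[of _ k]) auto
  qed
  have Xm: "flat X \<in> borel_measurable PM"
    by (rule progressive_measurable_PM[OF continuous_adapted_progressive[OF X cont]])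
  have "(\<lambda>n. L2sq PM (\<lambda>z. flat (simple_value (S n)) z - flat X z)) \<longlonglongrightarrow> (\<integral>\<^sup>+z. 0 \<partial>PM)"
  proof (rule nn_integral_dominated_convergence[where w="\<lambda>_. ennreal ((2 * B)\<^sup>2)"])
    \<comment> \<open>Time 0 lies in no left-open cell, so the simple value there is 0 whatever
      \<open>X 0\<close> is; it is discarded as a null set.\<close>
    have "AE x in time T. x \<noteq> 0"
      by (subst AE_restrict_space_iff) (auto intro: AE_mp[OF AE_lborel_singleton[of 0]])
    then have ae: "AE z in PM. 0 < fst z \<and> fst z \<le> T \<and> snd z \<in> space M"
    proof -
      have "AE z in PM. fst z \<noteq> 0"
        using \<open>AE x in time T. x \<noteq> 0\<close> by (intro PM.AE_pair_measure) (auto elim!: eventually_mono)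
      then show ?thesis by (rule AE_mp) (auto simp: space_PM intro!: AE_I2)
    qed
    show "AE z in PM. ennreal ((flat (simple_value (S n)) z - flat X z)\<^sup>2) \<le> ennreal ((2 * B)\<^sup>2)" for n
      using ae
    proof eventually_elim
      case (elim z)
      then obtain k where k: "k \<le> n" "simple_value (S n) (fst z) (snd z) = X (\<tau> n k) (snd z)"
        using val[of "fst z" n "snd z"] by auto
      have "\<bar>X (\<tau> n k) (snd z) - X (fst z) (snd z)\<bar> \<le> 2 * B"
        using bnd[OF \<tau>[of k n], of "snd z"] bnd[of "fst z" "snd z"] k(1) elim by auto
      then have "\<bar>X (\<tau> n k) (snd z) - X (fst z) (snd z)\<bar>\<^sup>2 \<le> (2 * B)\<^sup>2" by (intro power_mono) auto
      then show ?case unfolding k(2) by (intro ennreal_leI) simp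
    qed
    show "L2sq PM (\<lambda>z. 2 * B) < \<infinity>"
      unfolding nn_integral_const using PM.emeasure_finite[of "space PM"]
      by (auto simp: ennreal_mult_eq_top_iff less_top[symmetric])
    show "AE z in PM. (\<lambda>n. ennreal ((flat (simple_value (S n)) z - flat X z)\<^sup>2)) \<longlonglongrightarrow> 0"
      using ae
    proof eventually_elim
      case (elim z)
      have "\<forall>n. \<exists>k\<le>n. fst z - T / real (Suc n) \<le> \<tau> n k \<and> \<tau> n k < fst z
          \<and> simple_value (S n) (fst z) (snd z) = X (\<tau> n k) (snd z)"
        using val elim by auto
      then obtain k where k: "\<And>n. k n \<le> n" "\<And>n. fst z - T / real (Suc n) \<le> \<tau> n (k n)"
        "\<And>n. \<tau> n (k n) < fst z" "\<And>n. simple_value (S n) (fst z) (snd z) = X (\<tau> n (k n)) (snd z)"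
        by metis
      have l: "(\<lambda>n. fst z - T / real (Suc n)) \<longlonglongrightarrow> fst z"
        using tendsto_diff[OF tendsto_const tendsto_mult_right_zero[OF LIMSEQ_Suc[OF lim_1_over_n], of T], of "fst z"] by simp
      have "(\<lambda>n. \<tau> n (k n)) \<longlonglongrightarrow> fst z"
        by (rule tendsto_sandwich[OF always_eventually always_eventually l tendsto_const])
          (use k(2,3) in \<open>auto intro: less_imp_le simp del: of_nat_Suc\<close>)
      then have "(\<lambda>n. X (\<tau> n (k n)) (snd z)) \<longlonglongrightarrow> X (fst z) (snd z)"
        using elim
        by (intro continuous_on_tendsto_compose[OF cont] always_eventually allI \<tau> le_SucI[OF k(1)]) auto
      then have "(\<lambda>n. (flat (simple_value (S n)) z - flat X z)\<^sup>2) \<longlonglongrightarrow> (flat X z - flat X z)\<^sup>2"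
        unfolding k(4) by (intro tendsto_power tendsto_diff tendsto_const)
      then show ?case by (simp add: ennreal_tendsto_0_iff)
    qed
  qed (use m Xm in auto)
  then show ?thesis unfolding simply_approximable_def using simple m by auto
qed

text \<open>Backward averages of the paths are continuous, adapted and keep the bound
  \<open>B\<close>. They converge to \<open>H\<close> on each path, and dominated convergence in
  \<open>\<omega>\<close> gives convergence on the product.\<close>

lemma bounded_simply_approximable:
  assumes H: "progressive T F borel H" and bnd: "\<And>t \<omega>. \<bar>H t \<omega>\<bar> \<le> B"
  shows "simply_approximable H"
proof -
  have B0: "0 \<le> B" using bnd[of 0 undefined] by (meson abs_ge_zero order_trans)
  define \<delta> where "\<delta> n = 1 / real (Suc n)" for n
  have \<delta>: "0 < \<delta> n" for n by (simp add: \<delta>_def)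
  define A where "A n t \<omega> = backward_average (\<delta> n) (\<lambda>s. H s \<omega>) t" for n t \<omega>
  have Hm: "(\<lambda>s. H s \<omega>) \<in> borel_measurable (time T)" if "\<omega> \<in> space M" for \<omega>
    by (rule progressive_path[OF H that])
  have Hi: "integrable (time T) (\<lambda>s. H s \<omega>)" if "\<omega> \<in> space M" for \<omega>
    by (intro time.square_integrable_imp_integrable' bounded_time_square_integrable[OF Hm[OF that], of B] bnd)
  have ad: "A n t \<in> borel_measurable (F t)" if t: "t \<in> {0..T}" for n t
  proof -
    note K = progressive_adapted[OF progressive_integral[OF H]]
    have "(\<lambda>\<omega>. LINT s|time (t - \<delta> n). H s \<omega>) \<in> borel_measurable (F t)"
    proof (cases "t - \<delta> n \<le> 0")
      case False
      then show ?thesis using t \<delta>[of n] by (intro measurable_F_mono[OF K]) auto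
    qed (simp add: time_nonpos_integral)
    then show ?thesis unfolding A_def[abs_def] backward_average_def
      using K[OF t] by (intro borel_measurable_diff borel_measurable_divide borel_measurable_const)
  qed
  have cont: "continuous_on {0..T} (\<lambda>t. A n t \<omega>)" if "\<omega> \<in> space M" for n \<omega>
    unfolding A_def by (rule backward_average_measurable(1)[OF Hi[OF that] \<delta>])
  have ab: "\<bar>A n t \<omega>\<bar> \<le> B" if "t \<in> {0..T}" "\<omega> \<in> space M" for n t \<omega>
    unfolding A_def by (rule backward_average_bound[OF Hm[OF that(2)] bnd \<delta> that(1)])
  have Am: "flat (A n) \<in> borel_measurable PM" for n
    by (rule progressive_measurable_PM[OF continuous_adapted_progressive[OF ad cont]])
  have HM: "flat H \<in> borel_measurable PM" by (rule progressive_measurable_PM[OF H])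
  show ?thesis
  proof (rule simply_approximable_limit)
    show "simply_approximable (A n)" for n by (rule continuous_simply_approximable[OF ad cont ab])
    have "(\<lambda>n. \<integral>\<^sup>+\<omega>. L2sq (time T) (\<lambda>t. A n t \<omega> - H t \<omega>) \<partial>M) \<longlonglongrightarrow> (\<integral>\<^sup>+\<omega>. 0 \<partial>M)"
    proof (rule nn_integral_dominated_convergence[where w="\<lambda>_. ennreal ((2 * B)\<^sup>2) * ennreal T"])
      have [measurable]: "(\<lambda>(t, \<omega>). ennreal ((A n t \<omega> - H t \<omega>)\<^sup>2)) \<in> borel_measurable PM" for n
        using Am[of n] HM by (simp add: case_prod_beta')
      show "(\<lambda>\<omega>. L2sq (time T) (\<lambda>t. A n t \<omega> - H t \<omega>)) \<in> borel_measurable M" for n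
      proof -
        have "(\<lambda>(\<omega>, t). ennreal ((A n t \<omega> - H t \<omega>)\<^sup>2)) \<in> borel_measurable (M \<Otimes>\<^sub>M time T)"
          using measurable_pair_swap[OF \<open>(\<lambda>(t, \<omega>). ennreal ((A n t \<omega> - H t \<omega>)\<^sup>2)) \<in> borel_measurable PM\<close>]
          by (simp add: case_prod_beta')
        from time.borel_measurable_nn_integral[OF this] show ?thesis .
      qed
      show "AE \<omega> in M. L2sq (time T) (\<lambda>t. A n t \<omega> - H t \<omega>) \<le> ennreal ((2 * B)\<^sup>2) * ennreal T" for n
      proof (rule AE_I2)
        fix \<omega> assume w: "\<omega> \<in> space M"
        have "L2sq (time T) (\<lambda>t. A n t \<omega> - H t \<omega>) \<le> L2sq (time T) (\<lambda>t. 2 * B)"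
        proof (intro nn_integral_mono ennreal_leI)
          fix t assume "t \<in> space (time T)"
          then have "\<bar>A n t \<omega> - H t \<omega>\<bar> \<le> 2 * B"
            using ab[of t \<omega> n] bnd[of t \<omega>] w by (auto simp: space_restrict_space)
          then have "\<bar>A n t \<omega> - H t \<omega>\<bar>\<^sup>2 \<le> (2 * B)\<^sup>2" by (intro power_mono) auto
          then show "(A n t \<omega> - H t \<omega>)\<^sup>2 \<le> (2 * B)\<^sup>2" by simp
        qed
        then show "L2sq (time T) (\<lambda>t. A n t \<omega> - H t \<omega>) \<le> ennreal ((2 * B)\<^sup>2) * ennreal T"
          unfolding nn_integral_const emeasure_time .
      qed
      show "(\<integral>\<^sup>+\<omega>. ennreal ((2 * B)\<^sup>2) * ennreal T \<partial>M) < \<infinity>"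
        by (simp add: emeasure_space_1 ennreal_mult_less_top)
      show "AE \<omega> in M. (\<lambda>n. L2sq (time T) (\<lambda>t. A n t \<omega> - H t \<omega>)) \<longlonglongrightarrow> 0"
        unfolding A_def \<delta>_def by (intro AE_I2 backward_average_L2_tendsto[where B=B] Hm bnd B0)
    qed auto
    moreover have "(\<integral>\<^sup>+\<omega>. L2sq (time T) (\<lambda>t. A n t \<omega> - H t \<omega>) \<partial>M) =
        L2sq PM (\<lambda>z. flat (A n) z - flat H z)" for n
      using PM.nn_integral_snd[of "\<lambda>z. ennreal ((flat (A n) z - flat H z)\<^sup>2)"] Am HM by simp
    ultimately show "(\<lambda>n. L2sq PM (\<lambda>z. flat (A n) z - flat H z)) \<longlonglongrightarrow> 0" by simp
  qed (use Am HM in auto)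
qed

text \<open>Truncation at level \<open>n\<close> reduces to bounded integrands; the truncated
  process agrees with \<open>H\<close> once \<open>n\<close> exceeds the value, and the error never
  exceeds \<open>\<bar>H\<bar>\<close>.\<close>

lemma L2_simply_approximable:
  assumes H: "H \<in> L2_proc M T F"
  shows "simply_approximable H"
proof (rule simply_approximable_limit)
  have Hp: "progressive T F borel H" and Hs: "square_integrable PM (flat H)"
    using H by (auto simp: L2_proc_iff)
  define G where "G n t \<omega> = max (- real n) (min (real n) (H t \<omega>))" for n :: nat and t \<omega>
  have Gp: "progressive T F borel (G n)" for n
    unfolding G_def[abs_def] by (rule progressive_real_compose[OF Hp]) simp
  show "simply_approximable (G n)" for n
    by (rule bounded_simply_approximable[OF Gp, of _ "real n"]) (auto simp: G_def)
  show Gm: "flat (G n) \<in> borel_measurable PM" for n by (rule progressive_measurable_PM[OF Gp])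
  show Hm: "flat H \<in> borel_measurable PM" by (rule progressive_measurable_PM[OF Hp])
  have "(\<lambda>n. L2sq PM (\<lambda>z. flat (G n) z - flat H z)) \<longlonglongrightarrow> (\<integral>\<^sup>+z. 0 \<partial>PM)"
  proof (rule nn_integral_dominated_convergence[where w="\<lambda>z. ennreal ((flat H z)\<^sup>2)"])
    show "AE z in PM. ennreal ((flat (G n) z - flat H z)\<^sup>2) \<le> ennreal ((flat H z)\<^sup>2)" for n
    proof (intro AE_I2 ennreal_leI)
      fix z
      have "\<bar>flat (G n) z - flat H z\<bar> \<le> \<bar>flat H z\<bar>" by (auto simp: G_def)
      then show "(flat (G n) z - flat H z)\<^sup>2 \<le> (flat H z)\<^sup>2" by (simp only: abs_le_square_iff)
    qed
    show "L2sq PM (flat H) < \<infinity>"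
      using Hs by (simp add: square_integrable_iff_nn_integral)
    show "AE z in PM. (\<lambda>n. ennreal ((flat (G n) z - flat H z)\<^sup>2)) \<longlonglongrightarrow> 0"
    proof (rule AE_I2)
      fix z
      obtain N :: nat where N: "\<bar>flat H z\<bar> \<le> real N" using real_arch_simple by blast
      have "ennreal ((flat (G n) z - flat H z)\<^sup>2) = 0" if "n \<ge> N" for n
      proof -
        have "real N \<le> real n" using that by simp
        then show ?thesis using N by (auto simp: G_def)
      qed
      then show "(\<lambda>n. ennreal ((flat (G n) z - flat H z)\<^sup>2)) \<longlonglongrightarrow> 0"
        by (intro tendsto_eventually) (auto simp: eventually_sequentially)
    qed
  qed (use Gm Hm in auto)
  then show "(\<lambda>n. L2sq PM (\<lambda>z. flat (G n) z - flat H z)) \<longlonglongrightarrow> 0" by simp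
qed

end

section \<open>The Ito integral\<close>

context brownian_basis
begin

lemma ito_integralD:
  assumes "ito_integral M T F V H I"
  shows "H \<in> L2_proc M T F" "progressive T F borel H" "square_integrable PM (flat H)"
    and "\<And>t. t \<in> {0..T} \<Longrightarrow> I t \<in> borel_measurable (F t)"
    and "AE \<omega> in M. continuous_on {0..T} (\<lambda>t. I t \<omega>)"
  using assms unfolding ito_integral_def by (auto simp: L2_proc_iff)

lemma flat_diff_nn_integral:
  assumes "simple_integrand M T F S" "square_integrable PM (flat H)"
  shows "(\<integral>\<^sup>+\<omega>. (\<integral>\<^sup>+t\<in>{0..T}. ennreal ((simple_value S t \<omega> - H t \<omega>)\<^sup>2) \<partial>lborel) \<partial>M) =
    L2sq PM (\<lambda>z. flat (simple_value S) z - flat H z)"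
  using square_integrable_measurable[OF simple_value_square_integrable[OF assms(1)]]
    square_integrable_measurable[OF assms(2)]
  by (intro flat_nn_integral) simp

lemma ito_integral_approx:
  assumes "ito_integral M T F V H I"
  shows "\<exists>S. (\<forall>j::nat. simple_integrand M T F (S j)) \<and>
    (\<lambda>j. L2sq PM (\<lambda>z. flat (simple_value (S j)) z - flat H z)) \<longlonglongrightarrow> 0 \<and>
    (\<forall>t\<in>{0..T}. (\<lambda>j. L2sq M (\<lambda>\<omega>. simple_ito V (S j) t \<omega> - I t \<omega>)) \<longlonglongrightarrow> 0)"
proof -
  obtain S where S: "\<forall>j::nat. simple_integrand M T F (S j)"
    "(\<lambda>j. \<integral>\<^sup>+\<omega>. (\<integral>\<^sup>+t\<in>{0..T}. ennreal ((simple_value (S j) t \<omega> - H t \<omega>)\<^sup>2) \<partial>lborel) \<partial>M) \<longlonglongrightarrow> 0"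
    "\<forall>t\<in>{0..T}. (\<lambda>j. L2sq M (\<lambda>\<omega>. simple_ito V (S j) t \<omega> - I t \<omega>)) \<longlonglongrightarrow> 0"
    using assms unfolding ito_integral_def by blast
  from S(2) have "(\<lambda>j. L2sq PM (\<lambda>z. flat (simple_value (S j)) z - flat H z)) \<longlonglongrightarrow> 0"
    using S(1) ito_integralD(3)[OF assms] by (simp only: flat_diff_nn_integral)
  with S show ?thesis by (intro exI[of _ S] conjI)
qed

lemma ito_integral_martingale:
  assumes "i < d" "ito_integral M T F (W i) H I"
  shows "L2_martingale I"
proof -
  from ito_integral_approx[OF assms(2)] obtain S where S: "\<forall>j::nat. simple_integrand M T F (S j)"
    "(\<lambda>k. L2sq PM (\<lambda>z. flat (simple_value (S k)) z - flat H z)) \<longlonglongrightarrow> 0"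
    "\<forall>t\<in>{0..T}. (\<lambda>j. L2sq M (\<lambda>\<omega>. simple_ito (W i) (S j) t \<omega> - I t \<omega>)) \<longlonglongrightarrow> 0"
    by (elim exE conjE) blast
  note S = S[rule_format]
  show ?thesis
    by (rule L2_martingale_limit[of "\<lambda>j. simple_ito (W i) (S j)" I,
          OF simple_ito_martingale[OF assms(1) S(1)] ito_integralD(4)[OF assms(2)] S(3)])
qed

lemma square_integrable_indicator_PM:
  assumes "square_integrable PM f"
  shows "square_integrable PM (\<lambda>z. indicator {..t} (fst z) * f z)"
  by (rule square_integrable_mult_bounded[OF assms, of _ 1]) (auto split: split_indicator)

text \<open>Stated for a pair of integrals, possibly against different Brownian motions, because
  duality consumes exactly these mixed products.\<close>

lemma ito_isometry:
  assumes ij: "i < d" "j < d" and I: "ito_integral M T F (W i) H I" and I': "ito_integral M T F (W j) H' I'"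
    and t: "t \<in> {0..T}"
  shows "(LINT \<omega>|M. I t \<omega> * I' t \<omega>) =
    (if i = j then LINT z|PM. indicator {..t} (fst z) * (flat H z * flat H' z) else 0)"
proof -
  from ito_integral_approx[OF I] obtain S where S: "\<forall>k::nat. simple_integrand M T F (S k)"
    "(\<lambda>k. L2sq PM (\<lambda>z. flat (simple_value (S k)) z - flat H z)) \<longlonglongrightarrow> 0"
    "\<forall>t\<in>{0..T}. (\<lambda>k. L2sq M (\<lambda>\<omega>. simple_ito (W i) (S k) t \<omega> - I t \<omega>)) \<longlonglongrightarrow> 0"
    by (elim exE conjE) blast
  note S = S[rule_format]
  from ito_integral_approx[OF I'] obtain S' where S': "\<forall>k::nat. simple_integrand M T F (S' k)"
    "(\<lambda>k. L2sq PM (\<lambda>z. flat (simple_value (S' k)) z - flat H' z)) \<longlonglongrightarrow> 0"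
    "\<forall>t\<in>{0..T}. (\<lambda>k. L2sq M (\<lambda>\<omega>. simple_ito (W j) (S' k) t \<omega> - I' t \<omega>)) \<longlonglongrightarrow> 0"
    by (elim exE conjE) blast
  note S' = S'[rule_format]
  have "(\<lambda>k. LINT \<omega>|M. simple_ito (W i) (S k) t \<omega> * simple_ito (W j) (S' k) t \<omega>) \<longlonglongrightarrow> (LINT \<omega>|M. I t \<omega> * I' t \<omega>)"
    using t by (intro L2_tendsto_inner S(3) S'(3) L2_martingaleD(2)[OF simple_ito_martingale] S(1) S'(1) ij
        L2_martingaleD(2)[OF ito_integral_martingale[OF ij(1) I]]
        L2_martingaleD(2)[OF ito_integral_martingale[OF ij(2) I']])
  \<comment> \<open>The indicator is attached to one factor, so that the limit is again one of inner
    products.\<close>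
  moreover have "(\<lambda>k. LINT z|PM. (indicator {..t} (fst z) * flat (simple_value (S k)) z) * flat (simple_value (S' k)) z)
      \<longlonglongrightarrow> (LINT z|PM. (indicator {..t} (fst z) * flat H z) * flat H' z)"
  proof (intro L2_tendsto_inner square_integrable_indicator_PM simple_value_square_integrable S(1) S'(1) S'(2)
      ito_integralD(3)[OF I] ito_integralD(3)[OF I'])
    show "(\<lambda>k. L2sq PM (\<lambda>z. indicator {..t} (fst z) * flat (simple_value (S k)) z
        - indicator {..t} (fst z) * flat H z)) \<longlonglongrightarrow> 0"
      by (rule tendsto_sandwich[OF always_eventually always_eventually tendsto_const S(2)])
        (auto intro!: nn_integral_mono split: split_indicator)
  qed
  ultimately show ?thesis
    using simple_ito_isometry[OF ij S(1) S'(1) t]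
    by (cases "i = j") (auto simp: mult.assoc dest: LIMSEQ_unique LIMSEQ_const_iff[THEN iffD1])
qed

text \<open>\<open>I - c * I'\<close> is not yet known to be an Ito integral, so the square is
  expanded and the mixed isometry applied to each product.\<close>

lemma ito_isometry_diff:
  assumes "i < d" and I: "ito_integral M T F (W i) H I" and I': "ito_integral M T F (W i) H' I'"
    and t: "t \<in> {0..T}"
  shows "(LINT \<omega>|M. (I t \<omega> - c * I' t \<omega>)\<^sup>2) =
    (LINT z|PM. indicator {..t} (fst z) * (flat H z - c * flat H' z)\<^sup>2)"
proof -
  note sq = L2_martingaleD(2)[OF ito_integral_martingale[OF assms(1) I] t]
    L2_martingaleD(2)[OF ito_integral_martingale[OF assms(1) I'] t]
  note pq = ito_integralD(3)[OF I] ito_integralD(3)[OF I']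
  have i: "integrable PM (\<lambda>z. indicator {..t} (fst z) * (f z * g z))"
    if "square_integrable PM f" "square_integrable PM g" for f g
    using square_integrable_mult[OF square_integrable_indicator_PM[OF that(1)] that(2)] by (simp add: mult.assoc)
  have "(LINT \<omega>|M. (I t \<omega> - c * I' t \<omega>)\<^sup>2) =
    (LINT \<omega>|M. I t \<omega> * I t \<omega> - (2 * c) * (I t \<omega> * I' t \<omega>) + c\<^sup>2 * (I' t \<omega> * I' t \<omega>))"
    by (intro Bochner_Integration.integral_cong) (auto simp: power2_eq_square algebra_simps)
  also have "\<dots> = (LINT \<omega>|M. I t \<omega> * I t \<omega>) - (2 * c) * (LINT \<omega>|M. I t \<omega> * I' t \<omega>)
      + c\<^sup>2 * (LINT \<omega>|M. I' t \<omega> * I' t \<omega>)"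
    using square_integrable_mult[OF sq] square_integrable_mult[OF sq(1) sq(1)]
      square_integrable_mult[OF sq(2) sq(2)] by simp
  also have "\<dots> = (LINT z|PM. indicator {..t} (fst z) * (flat H z * flat H z)
      - (2 * c) * (indicator {..t} (fst z) * (flat H z * flat H' z))
      + c\<^sup>2 * (indicator {..t} (fst z) * (flat H' z * flat H' z)))"
    using i[OF pq] i[OF pq(1,1)] i[OF pq(2,2)]
    by (simp add: ito_isometry[OF assms(1,1) I I t] ito_isometry[OF assms(1,1) I I' t]
      ito_isometry[OF assms(1,1) I' I' t])
  also have "\<dots> = (LINT z|PM. indicator {..t} (fst z) * (flat H z - c * flat H' z)\<^sup>2)"
    by (intro Bochner_Integration.integral_cong) (auto simp: power2_eq_square algebra_simps)
  finally show ?thesis .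
qed

text \<open>The difference of two simple integrands on different partitions is not itself an encoded
  triple; expanding the square reduces the claim to products.\<close>

lemma simple_ito_isometry_diff:
  assumes i: "i < d" and S: "simple_integrand M T F S" and S': "simple_integrand M T F S'"
  shows "L2sq M (\<lambda>\<omega>. simple_ito (W i) S T \<omega> - simple_ito (W i) S' T \<omega>) =
    L2sq PM (\<lambda>z. flat (simple_value S) z - flat (simple_value S') z)"
proof -
  have T: "T \<in> {0..T}" using T_pos by simp
  let ?I = "simple_ito (W i) S T" and ?I' = "simple_ito (W i) S' T"
  let ?H = "flat (simple_value S)" and ?H' = "flat (simple_value S')"
  note sq = L2_martingaleD(2)[OF simple_ito_martingale[OF i S] T] L2_martingaleD(2)[OF simple_ito_martingale[OF i S'] T]
  note pq = simple_value_square_integrable[OF S] simple_value_square_integrable[OF S']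
  have iso: "(LINT \<omega>|M. simple_ito (W i) R T \<omega> * simple_ito (W i) R' T \<omega>) =
      (LINT z|PM. flat (simple_value R) z * flat (simple_value R') z)"
    if "simple_integrand M T F R" "simple_integrand M T F R'" for R R'
  proof -
    have "(LINT z|PM. indicator {..T} (fst z) * (flat (simple_value R) z * flat (simple_value R') z)) =
       (LINT z|PM. flat (simple_value R) z * flat (simple_value R') z)"
      by (intro Bochner_Integration.integral_cong) (auto simp: space_PM split: split_indicator)
    then show ?thesis using simple_ito_isometry[OF i i that T] by simp
  qed
  have "(LINT \<omega>|M. (?I \<omega> - ?I' \<omega>)\<^sup>2) = (LINT \<omega>|M. ?I \<omega> * ?I \<omega> - 2 * (?I \<omega> * ?I' \<omega>) + ?I' \<omega> * ?I' \<omega>)"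
    by (intro Bochner_Integration.integral_cong) (auto simp: power2_eq_square algebra_simps)
  also have "\<dots> = (LINT \<omega>|M. ?I \<omega> * ?I \<omega>) - 2 * (LINT \<omega>|M. ?I \<omega> * ?I' \<omega>) + (LINT \<omega>|M. ?I' \<omega> * ?I' \<omega>)"
    using square_integrable_mult[OF sq] square_integrable_mult[OF sq(1) sq(1)]
      square_integrable_mult[OF sq(2) sq(2)] by simp
  also have "\<dots> = (LINT z|PM. ?H z * ?H z) - 2 * (LINT z|PM. ?H z * ?H' z) + (LINT z|PM. ?H' z * ?H' z)"
    using S S' by (simp add: iso)
  also have "\<dots> = (LINT z|PM. ?H z * ?H z - 2 * (?H z * ?H' z) + ?H' z * ?H' z)"
    using square_integrable_mult[OF pq] square_integrable_mult[OF pq(1) pq(1)]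
      square_integrable_mult[OF pq(2) pq(2)] by simp
  also have "\<dots> = (LINT z|PM. (?H z - ?H' z)\<^sup>2)"
    by (intro Bochner_Integration.integral_cong) (auto simp: power2_eq_square algebra_simps)
  finally show ?thesis
    using square_integrable_diff[OF sq] square_integrable_diff[OF pq]
    by (subst (1 2) nn_integral_eq_integral) (auto simp: square_integrable_def)
qed

text \<open>Approximate at rate \<open>(1/8) ^ j\<close>. Isometry and Doob's inequality make the
  simple integrals converge uniformly off a null set, where the limit is set to zero. Hence all
  paths are continuous, as \<open>continuous_adapted_progressive\<close> will require.\<close>

lemma ito_integral_exists:
  assumes i: "i < d" and H: "H \<in> L2_proc M T F"
  obtains I where "ito_integral M T F (W i) H I"
    and "\<And>\<omega>. \<omega> \<in> space M \<Longrightarrow> continuous_on {0..T} (\<lambda>t. I t \<omega>)"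
proof -
  have Hs: "square_integrable PM (flat H)" using H by (simp add: L2_proc_iff)
  note [measurable] = square_integrable_measurable[OF Hs]
  have "\<forall>j. \<exists>S. simple_integrand M T F S \<and>
      L2sq PM (\<lambda>z. flat (simple_value S) z - flat H z) \<le> ennreal ((1/8) ^ j)"
  proof
    fix j
    obtain S where S: "\<forall>k::nat. simple_integrand M T F (S k)"
      "(\<lambda>k. L2sq PM (\<lambda>z. flat (simple_value (S k)) z - flat H z)) \<longlonglongrightarrow> 0"
      using L2_simply_approximable[OF H] unfolding simply_approximable_def by blast
    from order_tendstoD(2)[OF S(2), of "ennreal ((1/8) ^ j)"] obtain k where
      "L2sq PM (\<lambda>z. flat (simple_value (S k)) z - flat H z) < ennreal ((1/8) ^ j)"
      by (auto simp: eventually_sequentially)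
    with S(1) show "\<exists>S. simple_integrand M T F S \<and>
      L2sq PM (\<lambda>z. flat (simple_value S) z - flat H z) \<le> ennreal ((1/8) ^ j)"
      by (intro exI[of _ "S k"]) (auto intro: less_imp_le)
  qed
  from choice[OF this] obtain S where S: "\<And>j. simple_integrand M T F (S j)"
    and SH: "\<And>j. L2sq PM (\<lambda>z. flat (simple_value (S j)) z - flat H z) \<le> ennreal ((1/8) ^ j)"
    by blast
  note [measurable] = square_integrable_measurable[OF simple_value_square_integrable[OF S]]
  define Y where "Y j = simple_ito (W i) (S j)" for j
  have Ymart: "L2_martingale (Y j)" for j unfolding Y_def by (rule simple_ito_martingale[OF i S])
  have Dmart: "L2_martingale (\<lambda>t \<omega>. Y (Suc j) t \<omega> - Y j t \<omega>)" for j
    using L2_martingale_add[OF Ymart[of "Suc j"] Ymart[of j], of "-1"] by simp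
  \<comment> \<open>Consecutive approximations are compared through \<open>H\<close>; 2/8 + 2 is at
    most 4.\<close>
  have DT: "L2sq M (\<lambda>\<omega>. Y (Suc j) T \<omega> - Y j T \<omega>) \<le> ennreal (4 * (1/8) ^ j)" for j
  proof -
    have "L2sq M (\<lambda>\<omega>. Y (Suc j) T \<omega> - Y j T \<omega>) =
        L2sq PM (\<lambda>z. flat (simple_value (S (Suc j))) z - flat (simple_value (S j)) z)"
      unfolding Y_def by (rule simple_ito_isometry_diff[OF i S S])
    also have "\<dots> \<le> 2 * L2sq PM (\<lambda>z. flat (simple_value (S (Suc j))) z - flat H z)
        + 2 * L2sq PM (\<lambda>z. flat H z - flat (simple_value (S j)) z)"
      using nn_integral_sq_add_le[of "\<lambda>z. flat (simple_value (S (Suc j))) z - flat H z" PM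
          "\<lambda>z. flat H z - flat (simple_value (S j)) z"] by simp
    also have "\<dots> \<le> 2 * ennreal ((1/8) ^ Suc j) + 2 * ennreal ((1/8) ^ j)"
      using SH[of j] SH[of "Suc j"] by (intro add_mono mult_left_mono) (auto simp: power2_commute)
    also have "\<dots> = ennreal (2 * (1/8) ^ Suc j + 2 * (1/8) ^ j)"
      using ennreal_mult[of 2 "(1/8) ^ Suc j"] ennreal_mult[of 2 "(1/8) ^ j"]
      by (subst ennreal_plus) (auto simp del: ennreal_plus)
    also have "\<dots> \<le> ennreal (4 * (1/8) ^ j)" by (intro ennreal_leI) simp
    finally show ?thesis .
  qed
  have Dt: "L2sq M (\<lambda>\<omega>. Y (Suc j) t \<omega> - Y j t \<omega>) \<le> ennreal (4 * (1/8) ^ j)" if t: "t \<in> {0..T}" for j t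
  proof -
    have T: "T \<in> {0..T}" using T_pos by simp
    have eq: "L2sq M (\<lambda>\<omega>. Y (Suc j) r \<omega> - Y j r \<omega>) =
        ennreal (LINT \<omega>|M. (Y (Suc j) r \<omega> - Y j r \<omega>)\<^sup>2)" if "r \<in> {0..T}" for r
      using L2_martingaleD(2)[OF Dmart that]
      by (intro nn_integral_eq_integral) (auto simp: square_integrable_def)
    have "(LINT \<omega>|M. (Y (Suc j) t \<omega> - Y j t \<omega>)\<^sup>2) \<le> (LINT \<omega>|M. (Y (Suc j) T \<omega> - Y j T \<omega>)\<^sup>2)"
      using t by (intro L2_martingale_sq_mono[OF Dmart]) auto
    then show ?thesis using DT[of j] unfolding eq[OF t] eq[OF T] by (meson ennreal_leI order_trans)
  qed
  have YM: "Y j t \<in> borel_measurable M" if "t \<in> {0..T}" for j t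
    by (rule square_integrable_measurable[OF L2_martingaleD(2)[OF Ymart that]])
  define u where "u j \<omega> = (SUP t\<in>dyadics. ennreal ((Y (Suc j) t \<omega> - Y j t \<omega>)\<^sup>2))" for j \<omega>
  \<comment> \<open>The constant 16 is the 4 of \<open>DT\<close> times the 4 of Doob's
    inequality.\<close>
  have "AE \<omega> in M. \<exists>K\<ge>0. \<forall>j. u j \<omega> \<le> ennreal (K * (1/4) ^ j)"
  proof (rule AE_geometric_bound[where c=16])
    show "u j \<in> borel_measurable M" for j
      unfolding u_def[abs_def] using YM by (intro borel_measurable_SUP_dyadics borel_measurable_diff)
    show "(\<integral>\<^sup>+\<omega>. u j \<omega> \<partial>M) \<le> ennreal (16 * (1/8) ^ j)" for j
    proof -
      have "(\<integral>\<^sup>+\<omega>. u j \<omega> \<partial>M) \<le> 4 * L2sq M (\<lambda>\<omega>. Y (Suc j) T \<omega> - Y j T \<omega>)"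
        unfolding u_def by (rule Doob_L2[OF Dmart])
      also have "\<dots> \<le> 4 * ennreal (4 * (1/8) ^ j)" by (intro mult_left_mono DT) simp
      also have "\<dots> = ennreal (16 * (1/8) ^ j)"
        using ennreal_mult[of 4 "4 * (1/8) ^ j"] by simp
      finally show ?thesis .
    qed
  qed simp
  moreover have "AE \<omega> in M. \<forall>j. continuous_on {0..T} (\<lambda>t. Y j t \<omega>)"
    unfolding AE_all_countable Y_def by (intro allI simple_ito_continuous i S)
  ultimately have "AE \<omega> in M. (\<exists>K\<ge>0. \<forall>j. u j \<omega> \<le> ennreal (K * (1/4) ^ j)) \<and>
      (\<forall>j. continuous_on {0..T} (\<lambda>t. Y j t \<omega>))" (is "AE \<omega> in M. ?good \<omega>")
    by eventually_elim blast
  then obtain N where N: "N \<in> null_sets M" and good: "\<And>\<omega>. \<omega> \<in> space M - N \<Longrightarrow> ?good \<omega>"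
    unfolding eventually_ae_filter by blast
  \<comment> \<open>The set \<open>N\<close> belongs to every \<open>F t\<close>, so the case
    distinction does not spoil adaptedness.\<close>
  define I where "I t \<omega> = (if \<omega> \<in> space M - N then lim (\<lambda>j. Y j t \<omega>) else 0)" for t \<omega>
  have unif: "uniform_limit {0..T} (\<lambda>j t. Y j t \<omega>) (\<lambda>t. I t \<omega>) sequentially" if w: "\<omega> \<in> space M - N" for \<omega>
  proof -
    from good[OF w] obtain K where K: "K \<ge> 0" "\<And>j. u j \<omega> \<le> ennreal (K * (1/4) ^ j)"
      and c: "\<And>j. continuous_on {0..T} (\<lambda>t. Y j t \<omega>)" by blast
    have "norm (Y (Suc j) t \<omega> - Y j t \<omega>) \<le> sqrt K * (1/2) ^ j" if t: "t \<in> {0..T}" for j t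
    proof -
      have "ennreal ((Y (Suc j) t \<omega> - Y j t \<omega>)\<^sup>2) \<le> (SUP t\<in>{0..T}. ennreal ((Y (Suc j) t \<omega> - Y j t \<omega>)\<^sup>2))"
        by (rule SUP_upper[OF t])
      also have "\<dots> = u j \<omega>" unfolding u_def by (intro SUP_dyadics continuous_on_diff c)
      also have "\<dots> \<le> ennreal (K * (1/4) ^ j)" by (rule K(2))
      finally have "(Y (Suc j) t \<omega> - Y j t \<omega>)\<^sup>2 \<le> K * (1/4) ^ j"
        using K(1) by (subst (asm) ennreal_le_iff) auto
      also have "\<dots> = (sqrt K * (1/2) ^ j)\<^sup>2"
        using K(1) power_mult_distrib[of "1/2::real" "1/2" j] by (simp add: power_mult_distrib power2_eq_square)
      finally show ?thesis unfolding real_norm_def using K(1) by (intro abs_le_of_sq) auto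
    qed
    \<comment> \<open>The telescoping series of increments passes the Weierstrass test with
      \<open>sqrt K * (1/2) ^ j\<close>.\<close>
    then have "uniform_limit {0..T} (\<lambda>n t. \<Sum>j<n. Y (Suc j) t \<omega> - Y j t \<omega>)
        (\<lambda>t. \<Sum>j. Y (Suc j) t \<omega> - Y j t \<omega>) sequentially"
      by (rule Weierstrass_m_test) (auto intro!: summable_mult)
    then have "uniform_limit {0..T} (\<lambda>n t. Y 0 t \<omega> + (\<Sum>j<n. Y (Suc j) t \<omega> - Y j t \<omega>))
        (\<lambda>t. Y 0 t \<omega> + (\<Sum>j. Y (Suc j) t \<omega> - Y j t \<omega>)) sequentially"
      by (intro uniform_limit_add uniform_limit_const)
    moreover have "Y 0 t \<omega> + (\<Sum>j<n. Y (Suc j) t \<omega> - Y j t \<omega>) = Y n t \<omega>" for n t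
      by (induction n) auto
    ultimately have ul: "uniform_limit {0..T} (\<lambda>n t. Y n t \<omega>)
        (\<lambda>t. Y 0 t \<omega> + (\<Sum>j. Y (Suc j) t \<omega> - Y j t \<omega>)) sequentially" by simp
    have eq: "I t \<omega> = Y 0 t \<omega> + (\<Sum>j. Y (Suc j) t \<omega> - Y j t \<omega>)" if "t \<in> {0..T}" for t
      using limI[OF tendsto_uniform_limitI[OF ul that]] w by (simp add: I_def)
    have "(\<forall>x\<in>{0..T}. dist (Y n x \<omega>) (I x \<omega>) < e) =
      (\<forall>x\<in>{0..T}. dist (Y n x \<omega>) (Y 0 x \<omega> + (\<Sum>j. Y (Suc j) x \<omega> - Y j x \<omega>)) < e)" for n e
      by (rule ball_cong) (simp_all only: eq)
    then show ?thesis using ul unfolding uniform_limit_iff by (simp only:)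
  qed
  have cont: "continuous_on {0..T} (\<lambda>t. I t \<omega>)" if w: "\<omega> \<in> space M" for \<omega>
  proof (cases "\<omega> \<in> N")
    case False
    then have w: "\<omega> \<in> space M - N" using w by simp
    show ?thesis
      by (rule uniform_limit_theorem[OF _ unif[OF w]]) (use good[OF w] in auto)
  qed (simp add: I_def)
  have ad: "I t \<in> borel_measurable (F t)" if t: "t \<in> {0..T}" for t
  proof -
    have "N \<in> sets (F t)" using N null_sets_F[OF t] by auto
    then have "space M - N \<in> sets (F t)" using sets.compl_sets[of N "F t"] by (simp add: space_F[OF t])
    moreover have "(\<lambda>\<omega>. lim (\<lambda>j. Y j t \<omega>)) \<in> borel_measurable (F t)"
      by (intro borel_measurable_lim_metric L2_martingaleD(1)[OF Ymart t])
    ultimately show ?thesis unfolding I_def[abs_def] by (intro measurable_If_set) (simp_all add: space_F[OF t] Int_absorb2)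
  qed
  have conv: "(\<lambda>j. L2sq M (\<lambda>\<omega>. Y j t \<omega> - I t \<omega>)) \<longlonglongrightarrow> 0" if t: "t \<in> {0..T}" for t
  proof (rule tendsto_sandwich[OF always_eventually always_eventually tendsto_const], safe)
    fix j
    have "L2sq M (\<lambda>\<omega>. Y j t \<omega> - I t \<omega>) = L2sq M (\<lambda>\<omega>. lim (\<lambda>j. Y j t \<omega>) - Y j t \<omega>)"
    proof (rule nn_integral_cong_AE)
      show "AE \<omega> in M. ennreal ((Y j t \<omega> - I t \<omega>)\<^sup>2) = ennreal ((lim (\<lambda>j. Y j t \<omega>) - Y j t \<omega>)\<^sup>2)"
        using AE_not_in[OF N] AE_space by eventually_elim (simp add: I_def power2_commute)
    qed
    also have "\<dots> \<le> ennreal (4 * 4 * (1/8) ^ j)"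
      by (rule L2_geometric_complete(2)[OF YM[OF t] Dt[OF t]]) simp
    finally show "L2sq M (\<lambda>\<omega>. Y j t \<omega> - I t \<omega>) \<le> ennreal (4 * 4 * (1/8) ^ j)" .
  next
    show "(\<lambda>j. ennreal (4 * 4 * (1/8) ^ j)) \<longlonglongrightarrow> 0"
      using tendsto_mult_right_zero[OF LIMSEQ_power_zero[of "1/8::real"], of 16]
      by (simp add: ennreal_tendsto_0_iff)
  qed auto
  have convH: "(\<lambda>j. L2sq PM (\<lambda>z. flat (simple_value (S j)) z - flat H z)) \<longlonglongrightarrow> 0"
    by (rule tendsto_sandwich[OF always_eventually always_eventually tendsto_const, where h="\<lambda>j. ennreal ((1/8) ^ j)"])
      (auto simp: SH ennreal_tendsto_0_iff LIMSEQ_power_zero)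
  have "ito_integral M T F (W i) H I"
    unfolding ito_integral_def
  proof (intro conjI exI[of _ S] ballI allI H ad S)
    show "AE \<omega> in M. continuous_on {0..T} (\<lambda>t. I t \<omega>)" using cont by (intro AE_I2)
    show "(\<lambda>j. \<integral>\<^sup>+\<omega>. (\<integral>\<^sup>+t\<in>{0..T}. ennreal ((simple_value (S j) t \<omega> - H t \<omega>)\<^sup>2) \<partial>lborel) \<partial>M) \<longlonglongrightarrow> 0"
      using convH by (simp only: flat_diff_nn_integral[OF S Hs])
    show "(\<lambda>j. L2sq M (\<lambda>\<omega>. simple_ito (W i) (S j) t \<omega> - I t \<omega>)) \<longlonglongrightarrow> 0"
      if "t \<in> {0..T}" for t using conv[OF that] by (simp add: Y_def)
  qed
  then show ?thesis using cont by (rule that)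
qed

end

section \<open>Linear stochastic differential equations\<close>

context filtered_space
begin

lemma nn_integral_PM_indicator:
  assumes [measurable]: "g \<in> borel_measurable PM"
    and t: "t \<in> {0..T}"
  shows "(\<integral>\<^sup>+z. indicator {..t} (fst z) * g z \<partial>PM) = (\<integral>\<^sup>+s. (\<integral>\<^sup>+\<omega>. g (s, \<omega>) \<partial>M) \<partial>time t)"
    and "(\<integral>\<^sup>+z. indicator {..t} (fst z) * g z \<partial>PM) = (\<integral>\<^sup>+\<omega>. (\<integral>\<^sup>+s. g (s, \<omega>) \<partial>time t) \<partial>M)"
proof -
  have m: "(\<lambda>z. indicator {..t} (fst z) * g z) \<in> borel_measurable PM" by measurable
  have time: "(\<integral>\<^sup>+s. indicator {..t} s * f s \<partial>time T) = (\<integral>\<^sup>+s. f s \<partial>time t)" for f :: "real \<Rightarrow> ennreal"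
    using t by (simp add: nn_integral_restrict_space) (intro nn_integral_cong, auto split: split_indicator)
  show "(\<integral>\<^sup>+z. indicator {..t} (fst z) * g z \<partial>PM) = (\<integral>\<^sup>+s. (\<integral>\<^sup>+\<omega>. g (s, \<omega>) \<partial>M) \<partial>time t)"
  proof -
    have "(\<integral>\<^sup>+\<omega>. indicator {..t} s * g (s, \<omega>) \<partial>M) = indicator {..t} s * (\<integral>\<^sup>+\<omega>. g (s, \<omega>) \<partial>M)" for s
      by (cases "s \<le> t") auto
    then show ?thesis using nn_integral_fst[OF m] by (simp add: time)
  qed
  show "(\<integral>\<^sup>+z. indicator {..t} (fst z) * g z \<partial>PM) = (\<integral>\<^sup>+\<omega>. (\<integral>\<^sup>+s. g (s, \<omega>) \<partial>time t) \<partial>M)"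
    using PM.nn_integral_snd[OF m] by (simp add: time)
qed

lemma AE_PM_path:
  assumes "{z \<in> space PM. P (fst z) (snd z)} \<in> sets PM" "AE z in PM. P (fst z) (snd z)"
  shows "AE \<omega> in M. AE t in time T. P t \<omega>" and "AE t in time T. AE \<omega> in M. P t \<omega>"
  using PM.AE_commute[OF assms(1)] PM.AE_pair_iff[OF assms(1)] assms(2) by auto

lemma borel_measurable_nn_integral_path:
  assumes "g \<in> borel_measurable PM"
  shows "(\<lambda>\<omega>. \<integral>\<^sup>+t. g (t, \<omega>) \<partial>time T) \<in> borel_measurable M"
proof -
  have "(\<lambda>(\<omega>, t). g (t, \<omega>)) \<in> borel_measurable (M \<Otimes>\<^sub>M time T)"
    using measurable_pair_swap[OF assms] by (simp add: case_prod_beta')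
  from time.borel_measurable_nn_integral[OF this] show ?thesis .
qed

lemma path_square_integrable:
  assumes "square_integrable PM (flat X)"
  shows "AE \<omega> in M. square_integrable (time T) (\<lambda>t. X t \<omega>)"
proof -
  note [measurable] = square_integrable_measurable[OF assms]
  have "(\<integral>\<^sup>+\<omega>. L2sq (time T) (\<lambda>t. X t \<omega>) \<partial>M) = L2sq PM (flat X)"
    using PM.nn_integral_snd[of "\<lambda>z. ennreal ((flat X z)\<^sup>2)"] by simp
  then have fin: "(\<integral>\<^sup>+\<omega>. L2sq (time T) (\<lambda>t. X t \<omega>) \<partial>M) \<noteq> \<infinity>"
    using assms by (simp add: square_integrable_iff_nn_integral)
  have "(\<lambda>\<omega>. L2sq (time T) (\<lambda>t. X t \<omega>)) \<in> borel_measurable M"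
    using borel_measurable_nn_integral_path[of "\<lambda>z. ennreal ((flat X z)\<^sup>2)"] by simp
  from nn_integral_PInf_AE[OF this fin]
  have "AE \<omega> in M. L2sq (time T) (\<lambda>t. X t \<omega>) \<noteq> \<infinity>" .
  then show ?thesis
    using AE_space
  proof eventually_elim
    case (elim \<omega>)
    have "(\<lambda>t. X t \<omega>) \<in> borel_measurable (time T)"
      using measurable_compose[OF measurable_Pair2'[OF elim(2)] square_integrable_measurable[OF assms]] by simp
    then show ?case using elim(1) by (simp add: square_integrable_iff_nn_integral less_top)
  qed
qed

lemma path_integrable:
  assumes "square_integrable PM (flat X)"
  shows "AE \<omega> in M. integrable (time T) (\<lambda>t. X t \<omega>)"
  using path_square_integrable[OF assms]
  by eventually_elim (rule time.square_integrable_imp_integrable')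

lemma integrable_time_mono: "integrable (time T) (f :: real \<Rightarrow> real) \<Longrightarrow> t \<le> T \<Longrightarrow> integrable (time t) f"
  unfolding set_integrable_time[symmetric]
  by (rule set_integrable_subset[of lborel "{0..T}" f "{0..t}"]) auto

lemma progressive_path_time:
  assumes "progressive T F N X" "t \<in> {0..T}" "\<omega> \<in> space M"
  shows "(\<lambda>s. X s \<omega>) \<in> measurable (time t) N"
proof -
  have "\<omega> \<in> space (F t)" using assms(3) space_F[OF assms(2)] by simp
  from measurable_compose[OF measurable_Pair2'[OF this] progressiveD[OF assms(1,2)]]
  show ?thesis by (simp add: measurable_cong_sets[OF sets_time refl])
qed

text \<open>By Fubini almost every path agrees for almost all times, so one exceptional null set
  serves all \<open>t\<close> simultaneously.\<close>

lemma AE_eq_drift: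
  assumes p: "progressive T F borel c" "progressive T F borel c'" and ae: "AE z in PM. flat c z = flat c' z"
  shows "AE \<omega> in M. \<forall>t\<in>{0..T}. (LINT s|time t. c s \<omega>) = (LINT s|time t. (c' s \<omega> :: real))"
proof -
  note [measurable] = p[THEN progressive_measurable_PM]
  have "AE \<omega> in M. AE t in time T. c t \<omega> = c' t \<omega>"
    using ae by (intro AE_PM_path(1)) measurable
  then show ?thesis
    using AE_space
  proof eventually_elim
    case (elim \<omega>)
    show ?case
    proof
      fix t assume t: "t \<in> {0..T}"
      show "(LINT s|time t. c s \<omega>) = (LINT s|time t. c' s \<omega>)"
      proof (rule integral_cong_AE)
        show "AE s in time t. c s \<omega> = c' s \<omega>"
          using elim(1) t by (simp add: AE_restrict_space_iff) (auto elim!: eventually_mono)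
      qed (intro progressive_path_time p t elim)+
    qed
  qed
qed

lemma drift_nn_integral_le:
  assumes c: "progressive T F borel c" and t: "t \<in> {0..T}"
  shows "L2sq M (\<lambda>\<omega>. LINT s|time t. c s \<omega>) \<le>
    ennreal T * L2sq_upto t (flat c)"
proof -
  note [measurable] = progressive_measurable_PM[OF c]
  have "L2sq M (\<lambda>\<omega>. LINT s|time t. c s \<omega>) \<le>
      (\<integral>\<^sup>+\<omega>. ennreal T * L2sq (time t) (\<lambda>s. c s \<omega>) \<partial>M)"
  proof (rule nn_integral_mono)
    fix \<omega> assume w: "\<omega> \<in> space M"
    from integral_sq_le_time[OF progressive_path_time[OF c t w]]
    have "ennreal ((LINT s|time t. c s \<omega>)\<^sup>2) \<le> ennreal t * L2sq (time t) (\<lambda>s. c s \<omega>)" .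
    also have "\<dots> \<le> ennreal T * L2sq (time t) (\<lambda>s. c s \<omega>)"
      using t by (intro mult_right_mono ennreal_leI) auto
    finally show "ennreal ((LINT s|time t. c s \<omega>)\<^sup>2) \<le> ennreal T * L2sq (time t) (\<lambda>s. c s \<omega>)" .
  qed
  also have "\<dots> = ennreal T * (\<integral>\<^sup>+\<omega>. L2sq (time t) (\<lambda>s. c s \<omega>) \<partial>M)"
  proof (rule nn_integral_cmult)
    have "(\<lambda>\<omega>. \<integral>\<^sup>+s. indicator {..t} s * ennreal ((c s \<omega>)\<^sup>2) \<partial>time T) \<in> borel_measurable M"
    proof -
      show ?thesis
        using borel_measurable_nn_integral_path[of "\<lambda>z. indicator {..t} (fst z) * ennreal ((flat c z)\<^sup>2)"] by simp
    qed
    moreover have "(\<integral>\<^sup>+s. indicator {..t} s * f s \<partial>time T) = (\<integral>\<^sup>+s. f s \<partial>time t)" for f :: "real \<Rightarrow> ennreal"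
      using t by (simp add: nn_integral_restrict_space) (intro nn_integral_cong, auto split: split_indicator)
    ultimately show "(\<lambda>\<omega>. L2sq (time t) (\<lambda>s. c s \<omega>)) \<in> borel_measurable M" by simp
  qed
  also have "(\<integral>\<^sup>+\<omega>. L2sq (time t) (\<lambda>s. c s \<omega>) \<partial>M) =
      L2sq_upto t (flat c)"
    using nn_integral_PM_indicator(2)[of "\<lambda>z. ennreal ((flat c z)\<^sup>2)" t] t by simp
  finally show ?thesis .
qed

lemma drift_continuous:
  assumes "square_integrable PM (flat c)"
  shows "AE \<omega> in M. continuous_on {0..T} (\<lambda>t. LINT s|time t. c s \<omega>)"
  using path_integrable[OF assms] by eventually_elim (rule continuous_on_time_integral)

text \<open>The norm of \<open>S2_proc\<close>, with the supremum over a countable set so that it is measurable.\<close>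

definition sup_square_integrable :: "(real \<Rightarrow> 'a \<Rightarrow> real) \<Rightarrow> bool" where
  "sup_square_integrable X \<longleftrightarrow> (\<forall>t\<in>{0..T}. X t \<in> borel_measurable M) \<and>
     (\<integral>\<^sup>+\<omega>. (SUP t\<in>dyadics. ennreal ((X t \<omega>)\<^sup>2)) \<partial>M) < \<infinity>"

lemma sup_square_integrable_add:
  assumes "sup_square_integrable X" "sup_square_integrable Y"
  shows "sup_square_integrable (\<lambda>t \<omega>. X t \<omega> + c * Y t \<omega>)"
proof -
  have m: "X t \<in> borel_measurable M" "Y t \<in> borel_measurable M" if "t \<in> {0..T}" for t
    using assms that by (auto simp: sup_square_integrable_def)
  note [measurable] = borel_measurable_SUP_dyadics[of X, OF m(1)] borel_measurable_SUP_dyadics[of Y, OF m(2)]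
  have "(\<integral>\<^sup>+\<omega>. (SUP t\<in>dyadics. ennreal ((X t \<omega> + c * Y t \<omega>)\<^sup>2)) \<partial>M) \<le>
      (\<integral>\<^sup>+\<omega>. 2 * (SUP t\<in>dyadics. ennreal ((X t \<omega>)\<^sup>2)) + ennreal (2 * c\<^sup>2) * (SUP t\<in>dyadics. ennreal ((Y t \<omega>)\<^sup>2)) \<partial>M)"
  proof (intro nn_integral_mono SUP_least)
    fix \<omega> t assume t: "t \<in> dyadics"
    have "0 \<le> (X t \<omega> - c * Y t \<omega>)\<^sup>2" by simp
    then have "(X t \<omega> + c * Y t \<omega>)\<^sup>2 \<le> 2 * (X t \<omega>)\<^sup>2 + 2 * c\<^sup>2 * (Y t \<omega>)\<^sup>2"
      by (simp add: power2_sum power2_diff power_mult_distrib)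
    then have "ennreal ((X t \<omega> + c * Y t \<omega>)\<^sup>2) \<le> ennreal (2 * (X t \<omega>)\<^sup>2 + 2 * c\<^sup>2 * (Y t \<omega>)\<^sup>2)"
      by (rule ennreal_leI)
    also have "\<dots> = 2 * ennreal ((X t \<omega>)\<^sup>2) + ennreal (2 * c\<^sup>2) * ennreal ((Y t \<omega>)\<^sup>2)"
      using ennreal_mult[of 2 "(X t \<omega>)\<^sup>2"] ennreal_mult[of "2 * c\<^sup>2" "(Y t \<omega>)\<^sup>2"]
      by (subst ennreal_plus) auto
    also have "\<dots> \<le> 2 * (SUP t\<in>dyadics. ennreal ((X t \<omega>)\<^sup>2)) + ennreal (2 * c\<^sup>2) * (SUP t\<in>dyadics. ennreal ((Y t \<omega>)\<^sup>2))"
      by (intro add_mono mult_left_mono SUP_upper t) auto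
    finally show "ennreal ((X t \<omega> + c * Y t \<omega>)\<^sup>2) \<le> \<dots>" .
  qed
  also have "\<dots> = 2 * (\<integral>\<^sup>+\<omega>. (SUP t\<in>dyadics. ennreal ((X t \<omega>)\<^sup>2)) \<partial>M)
      + ennreal (2 * c\<^sup>2) * (\<integral>\<^sup>+\<omega>. (SUP t\<in>dyadics. ennreal ((Y t \<omega>)\<^sup>2)) \<partial>M)"
    by (simp add: nn_integral_add nn_integral_cmult)
  also have "\<dots> < \<infinity>"
    using assms by (auto simp: sup_square_integrable_def ennreal_mult_less_top)
  finally show ?thesis using m by (auto simp: sup_square_integrable_def)
qed

lemma sup_square_integrable_martingale:
  assumes "L2_martingale Y"
  shows "sup_square_integrable Y"
proof -
  have "square_integrable M (Y T)" using L2_martingaleD(2)[OF assms, of T] T_pos by auto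
  then have "4 * L2sq M (\<lambda>\<omega>. Y T \<omega>) < \<infinity>"
    by (simp add: square_integrable_iff_nn_integral ennreal_mult_less_top)
  then show ?thesis
    using le_less_trans[OF Doob_L2[OF assms]] square_integrable_measurable[OF L2_martingaleD(2)[OF assms]]
    by (auto simp: sup_square_integrable_def)
qed

lemma sup_square_integrable_sum:
  "(\<And>i. i \<in> A \<Longrightarrow> sup_square_integrable (Y i)) \<Longrightarrow> sup_square_integrable (\<lambda>t \<omega>. \<Sum>i\<in>A. Y i t \<omega>)"
proof (induction A rule: infinite_finite_induct)
  case (insert i A)
  then show ?case using sup_square_integrable_add[of "Y i" "\<lambda>t \<omega>. \<Sum>i\<in>A. Y i t \<omega>" 1] by simp
qed (simp_all add: sup_square_integrable_martingale[OF L2_martingale_zero])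

lemma sup_square_integrable_drift:
  assumes c: "c \<in> L2_proc M T F"
  shows "sup_square_integrable (\<lambda>t \<omega>. LINT s|time t. c s \<omega>)"
proof -
  have cp: "progressive T F borel c" and cs: "square_integrable PM (flat c)" using c by (auto simp: L2_proc_iff)
  note [measurable] = progressive_measurable_PM[OF cp]
  have "(\<integral>\<^sup>+\<omega>. (SUP t\<in>dyadics. ennreal ((LINT s|time t. c s \<omega>)\<^sup>2)) \<partial>M) \<le>
      (\<integral>\<^sup>+\<omega>. ennreal T * L2sq (time T) (\<lambda>s. c s \<omega>) \<partial>M)"
  proof (intro nn_integral_mono SUP_least)
    fix \<omega> t assume w: "\<omega> \<in> space M" and "t \<in> dyadics"
    then have t: "t \<in> {0..T}" using dyadics_subset by blast
    from integral_sq_le_time[OF progressive_path_time[OF cp t w]]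
    have "ennreal ((LINT s|time t. c s \<omega>)\<^sup>2) \<le> ennreal t * L2sq (time t) (\<lambda>s. c s \<omega>)" .
    also have "\<dots> \<le> ennreal T * L2sq (time T) (\<lambda>s. c s \<omega>)"
      using t by (intro mult_mono ennreal_leI)
        (auto simp: nn_integral_restrict_space intro!: nn_integral_mono split: split_indicator)
    finally show "ennreal ((LINT s|time t. c s \<omega>)\<^sup>2) \<le> ennreal T * L2sq (time T) (\<lambda>s. c s \<omega>)" .
  qed
  also have "\<dots> = ennreal T * L2sq PM (flat c)"
  proof -
    have "(\<lambda>\<omega>. L2sq (time T) (\<lambda>s. c s \<omega>)) \<in> borel_measurable M"
      using borel_measurable_nn_integral_path[of "\<lambda>z. ennreal ((flat c z)\<^sup>2)"] by simp
    then show ?thesis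
      using PM.nn_integral_snd[of "\<lambda>z. ennreal ((flat c z)\<^sup>2)"] by (subst nn_integral_cmult) auto
  qed
  also have "\<dots> < \<infinity>" using cs by (simp add: square_integrable_iff_nn_integral ennreal_mult_less_top)
  finally show ?thesis
    using progressive_measurable_M[OF progressive_integral[OF cp]] by (auto simp: sup_square_integrable_def)
qed

lemma S2_proc_iff_sup_square_integrable:
  assumes "progressive T F borel Y" "AE \<omega> in M. continuous_on {0..T} (\<lambda>t. Y t \<omega>)"
  shows "Y \<in> S2_proc M T F \<longleftrightarrow> sup_square_integrable Y"
  using S2_proc_iff[OF assms] progressive_measurable_M[OF assms(1)] by (auto simp: sup_square_integrable_def)

lemma S2_proc_square_integrable:
  assumes "Y \<in> S2_proc M T F"
  shows "t \<in> {0..T} \<Longrightarrow> square_integrable M (Y t)" and "Y \<in> L2_proc M T F"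
proof -
  have p: "progressive T F borel Y" and fin: "(\<integral>\<^sup>+\<omega>. (SUP t\<in>{0..T}. ennreal ((Y t \<omega>)\<^sup>2)) \<partial>M) < \<infinity>"
    using assms by (auto simp: S2_proc_def)
  have le: "L2sq M (\<lambda>\<omega>. Y t \<omega>) \<le> (\<integral>\<^sup>+\<omega>. (SUP t\<in>{0..T}. ennreal ((Y t \<omega>)\<^sup>2)) \<partial>M)" if "t \<in> {0..T}" for t
    by (intro nn_integral_mono SUP_upper that)
  then show "square_integrable M (Y t)" if "t \<in> {0..T}" for t
    using le[OF that] fin progressive_measurable_M[OF p that] unfolding square_integrable_iff_nn_integral
    by (auto intro: le_less_trans)
  note [measurable] = progressive_measurable_PM[OF p]
  have "L2sq PM (flat Y) = (\<integral>\<^sup>+t. L2sq M (\<lambda>\<omega>. Y t \<omega>) \<partial>time T)"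
    using nn_integral_fst[of "\<lambda>z. ennreal ((flat Y z)\<^sup>2)" "time T"] by simp
  also have "\<dots> \<le> (\<integral>\<^sup>+t. (\<integral>\<^sup>+\<omega>. (SUP t\<in>{0..T}. ennreal ((Y t \<omega>)\<^sup>2)) \<partial>M) \<partial>time T)"
    by (intro nn_integral_mono le) (simp add: space_restrict_space)
  also have "\<dots> < \<infinity>"
    unfolding nn_integral_const emeasure_time using fin by (simp add: ennreal_mult_less_top)
  finally show "Y \<in> L2_proc M T F"
    using p by (simp add: L2_proc_iff square_integrable_iff_nn_integral)
qed

lemma L2_proc_add: "X \<in> L2_proc M T F \<Longrightarrow> Y \<in> L2_proc M T F \<Longrightarrow> (\<lambda>t \<omega>. X t \<omega> + Y t \<omega>) \<in> L2_proc M T F"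
  by (auto simp: L2_proc_iff intro!: square_integrable_add)

lemma L2_proc_const: "(\<lambda>t \<omega>. c) \<in> L2_proc M T F"
  by (auto simp: L2_proc_iff)

lemma L2_proc_sum:
  "(\<And>i. i \<in> A \<Longrightarrow> X i \<in> L2_proc M T F) \<Longrightarrow> (\<lambda>t \<omega>. \<Sum>i\<in>A. X i t \<omega>) \<in> L2_proc M T F"
  by (auto simp: L2_proc_iff intro!: square_integrable_sum)

lemma L2_proc_mult_deterministic:
  assumes "X \<in> L2_proc M T F" "b \<in> borel_measurable borel" "\<And>t. \<bar>b t\<bar> \<le> L"
  shows "(\<lambda>t \<omega>. b t * X t \<omega>) \<in> L2_proc M T F"
  unfolding L2_proc_iff
proof
  have p: "progressive T F borel (\<lambda>t \<omega>. b t)" by (rule progressive_deterministic[OF assms(2)])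
  then show "progressive T F borel (\<lambda>t \<omega>. b t * X t \<omega>)" using assms(1) by (auto simp: L2_proc_iff)
  show "square_integrable PM (flat (\<lambda>t \<omega>. b t * X t \<omega>))"
    using square_integrable_mult_bounded[OF _ progressive_measurable_PM[OF p] assms(3)] assms(1)
    by (auto simp: L2_proc_iff)
qed

end

section \<open>Mean square estimates for Ito processes\<close>

context brownian_basis
begin

lemma ito_integral_zero: "ito_integral M T F V (\<lambda>t \<omega>. 0) (\<lambda>t \<omega>. 0)"
  unfolding ito_integral_def
proof (intro conjI exI[of _ "\<lambda>j. (0, \<lambda>_. 0, \<lambda>_ _. 0)"])
  show "(\<lambda>t \<omega>. 0) \<in> L2_proc M T F" by (rule L2_proc_const)
qed (use T_pos in \<open>auto simp: simple_integrand_def simple_value_def simple_ito_def\<close>)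

text \<open>The integrand enters only through its distance to the simple integrands, so the same
  approximating sequence serves both. This is how an optimal control is later exchanged for its
  feedback form.\<close>

lemma ito_integral_cong_AE:
  assumes I: "ito_integral M T F V H I" and H': "H' \<in> L2_proc M T F"
    and ae: "AE z in PM. flat H z = flat H' z"
  shows "ito_integral M T F V H' I"
proof -
  from ito_integral_approx[OF I] obtain S where S: "\<forall>k::nat. simple_integrand M T F (S k)"
    "(\<lambda>k. L2sq PM (\<lambda>z. flat (simple_value (S k)) z - flat H z)) \<longlonglongrightarrow> 0"
    "\<forall>t\<in>{0..T}. (\<lambda>k. L2sq M (\<lambda>\<omega>. simple_ito V (S k) t \<omega> - I t \<omega>)) \<longlonglongrightarrow> 0"
    by (elim exE conjE) blast
  have "L2sq PM (\<lambda>z. flat (simple_value (S k)) z - flat H z) =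
    L2sq PM (\<lambda>z. flat (simple_value (S k)) z - flat H' z)" for k
    using ae by (intro nn_integral_cong_AE) (auto elim!: eventually_mono)
  then have "(\<lambda>k. \<integral>\<^sup>+\<omega>. (\<integral>\<^sup>+t\<in>{0..T}. ennreal ((simple_value (S k) t \<omega> - H' t \<omega>)\<^sup>2) \<partial>lborel) \<partial>M) \<longlonglongrightarrow> 0"
    using S H' by (simp add: flat_diff_nn_integral L2_proc_iff)
  then show ?thesis
    using S(1,3) H' ito_integralD(4,5)[OF I] unfolding ito_integral_def by blast
qed

lemma sum_square_le:
  fixes x :: "nat \<Rightarrow> real"
  shows "(a + (\<Sum>i<n. x i))\<^sup>2 \<le> 2 * a\<^sup>2 + 2 * real n * (\<Sum>i<n. (x i)\<^sup>2)"
proof -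
  have "(\<Sum>i<n. x i)\<^sup>2 \<le> real n * (\<Sum>i<n. (x i)\<^sup>2)"
  proof -
    have "(\<Sum>i<n. 1 * x i)\<^sup>2 \<le> (\<Sum>i<n. 1\<^sup>2) * (\<Sum>i<n. (x i)\<^sup>2)"
      by (rule Cauchy_Schwarz_ineq_sum)
    then show ?thesis by simp
  qed
  moreover have "(a + b)\<^sup>2 \<le> 2 * a\<^sup>2 + 2 * b\<^sup>2" for b
    using zero_le_power2[of "a - b"] by (simp add: power2_sum power2_diff)
  ultimately show ?thesis using \<open>\<And>b. (a + b)\<^sup>2 \<le> 2 * a\<^sup>2 + 2 * b\<^sup>2\<close>[of "\<Sum>i<n. x i"] by linarith
qed

text \<open>The square of drift plus \<open>d\<close> martingales costs the factors 2 and
  \<open>2 * d\<close>; Cauchy-Schwarz in time gives \<open>T\<close> for the drift, the isometry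
  handles the rest. Besides the Picard estimate, the comparison with zero processes gives the
  initial value of the solution.\<close>

lemma ito_process_diff_bound:
  assumes c: "c \<in> L2_proc M T F" "c' \<in> L2_proc M T F"
    and I: "\<And>i. i < d \<Longrightarrow> ito_integral M T F (W i) (h i) (I i)" "\<And>i. i < d \<Longrightarrow> ito_integral M T F (W i) (h' i) (I' i)"
    and t: "t \<in> {0..T}"
  shows "L2sq M (\<lambda>\<omega>. ((LINT s|time t. c s \<omega>) + (\<Sum>i<d. I i t \<omega>))
      - ((LINT s|time t. c' s \<omega>) + (\<Sum>i<d. I' i t \<omega>))) \<le>
    ennreal (2 * T) * L2sq_upto t (\<lambda>z. flat c z - flat c' z)
    + ennreal (2 * d) * (\<Sum>i<d. \<integral>\<^sup>+z. indicator {..t} (fst z) * ennreal ((flat (h i) z - flat (h' i) z)\<^sup>2) \<partial>PM)"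
proof -
  define a where "a \<omega> = (LINT s|time t. c s \<omega> - c' s \<omega>)" for \<omega>
  define x where "x i \<omega> = I i t \<omega> - I' i t \<omega>" for i \<omega>
  have cp: "progressive T F borel (\<lambda>s \<omega>. c s \<omega> - c' s \<omega>)" and cs: "square_integrable PM (flat c)" "square_integrable PM (flat c')"
    using c by (auto simp: L2_proc_iff)
  have [measurable]: "a \<in> borel_measurable M"
    unfolding a_def[abs_def] by (rule progressive_measurable_M[OF progressive_integral[OF cp] t])
  have sqI: "square_integrable M (I i t)" "square_integrable M (I' i t)" if "i < d" for i
    using L2_martingaleD(2)[OF ito_integral_martingale[OF that I(1)[OF that]] t]
      L2_martingaleD(2)[OF ito_integral_martingale[OF that I(2)[OF that]] t] by auto
  have sqx: "square_integrable M (x i)" if "i < d" for i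
    unfolding x_def[abs_def] by (intro square_integrable_diff sqI that)
  have ai: "L2sq M a \<le> ennreal T * L2sq_upto t (\<lambda>z. flat c z - flat c' z)"
    unfolding a_def by (rule drift_nn_integral_le[OF cp t])
  have xi: "L2sq M (\<lambda>\<omega>. x i \<omega>) = L2sq_upto t (\<lambda>z. flat (h i) z - flat (h' i) z)"
    if i: "i < d" for i
  proof -
    have hs: "square_integrable PM (\<lambda>z. flat (h i) z - flat (h' i) z)"
      using ito_integralD(3)[OF I(1)[OF i]] ito_integralD(3)[OF I(2)[OF i]] by (rule square_integrable_diff)
    have "L2sq M (\<lambda>\<omega>. x i \<omega>) = ennreal (LINT \<omega>|M. (x i \<omega>)\<^sup>2)"
      using sqx[OF i] by (intro nn_integral_eq_integral) (auto simp: square_integrable_def)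
    also have "\<dots> = ennreal (LINT z|PM. indicator {..t} (fst z) * (flat (h i) z - flat (h' i) z)\<^sup>2)"
      using ito_isometry_diff[OF i I(1)[OF i] I(2)[OF i] t, of 1] by (simp add: x_def)
    also have "\<dots> = (\<integral>\<^sup>+z. ennreal (indicator {..t} (fst z) * (flat (h i) z - flat (h' i) z)\<^sup>2) \<partial>PM)"
    proof (rule nn_integral_eq_integral[symmetric])
      have "(\<lambda>z. (indicator {..t} (fst z) * (flat (h i) z - flat (h' i) z))\<^sup>2) =
        (\<lambda>z. indicator {..t} (fst z) * (flat (h i) z - flat (h' i) z)\<^sup>2)"
        by (auto simp: fun_eq_iff split: split_indicator)
      then show "integrable PM (\<lambda>z. indicator {..t} (fst z) * (flat (h i) z - flat (h' i) z)\<^sup>2)"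
        using square_integrable_integrable_power2[OF square_integrable_indicator_PM[OF hs, of t]] by simp
    qed simp
    also have "\<dots> = L2sq_upto t (\<lambda>z. flat (h i) z - flat (h' i) z)"
      by (intro nn_integral_cong) (auto split: split_indicator)
    finally show ?thesis .
  qed
  note [measurable] = square_integrable_measurable[OF sqx]
  have "L2sq M (\<lambda>\<omega>. ((LINT s|time t. c s \<omega>) + (\<Sum>i<d. I i t \<omega>))
      - ((LINT s|time t. c' s \<omega>) + (\<Sum>i<d. I' i t \<omega>))) = L2sq M (\<lambda>\<omega>. a \<omega> + (\<Sum>i<d. x i \<omega>))"
  proof (rule nn_integral_cong_AE)
    show "AE \<omega> in M. ennreal ((((LINT s|time t. c s \<omega>) + (\<Sum>i<d. I i t \<omega>))
      - ((LINT s|time t. c' s \<omega>) + (\<Sum>i<d. I' i t \<omega>)))\<^sup>2) = ennreal ((a \<omega> + (\<Sum>i<d. x i \<omega>))\<^sup>2)"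
      using path_integrable[OF cs(1)] path_integrable[OF cs(2)]
    proof eventually_elim
      case (elim \<omega>)
      have "a \<omega> = (LINT s|time t. c s \<omega>) - (LINT s|time t. c' s \<omega>)"
        unfolding a_def using t integrable_time_mono[OF elim(1)] integrable_time_mono[OF elim(2)]
        by (intro Bochner_Integration.integral_diff) auto
      then have "((LINT s|time t. c s \<omega>) + (\<Sum>i<d. I i t \<omega>)) - ((LINT s|time t. c' s \<omega>) + (\<Sum>i<d. I' i t \<omega>)) =
          a \<omega> + (\<Sum>i<d. x i \<omega>)"
        by (simp add: x_def sum_subtractf)
      then show ?case by (simp only:)
    qed
  qed
  also have "\<dots> \<le> (\<integral>\<^sup>+\<omega>. 2 * ennreal ((a \<omega>)\<^sup>2) + ennreal (2 * d) * (\<Sum>i<d. ennreal ((x i \<omega>)\<^sup>2)) \<partial>M)"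
  proof (rule nn_integral_mono)
    fix \<omega>
    have "ennreal ((a \<omega> + (\<Sum>i<d. x i \<omega>))\<^sup>2) \<le> ennreal (2 * (a \<omega>)\<^sup>2 + 2 * real d * (\<Sum>i<d. (x i \<omega>)\<^sup>2))"
      by (intro ennreal_leI sum_square_le)
    also have "\<dots> = 2 * ennreal ((a \<omega>)\<^sup>2) + ennreal (2 * d) * (\<Sum>i<d. ennreal ((x i \<omega>)\<^sup>2))"
    proof -
      have sn: "0 \<le> (\<Sum>i<d. (x i \<omega>)\<^sup>2)" by (intro sum_nonneg) simp
      then show ?thesis
        using ennreal_mult[of 2 "(a \<omega>)\<^sup>2"] ennreal_mult[OF _ sn, of "2 * real d"]
        by (subst ennreal_plus) (auto simp del: ennreal_plus)
    qed
    finally show "ennreal ((a \<omega> + (\<Sum>i<d. x i \<omega>))\<^sup>2) \<le> 2 * ennreal ((a \<omega>)\<^sup>2) + ennreal (2 * d) * (\<Sum>i<d. ennreal ((x i \<omega>)\<^sup>2))" .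
  qed
  also have "\<dots> = 2 * L2sq M a + ennreal (2 * d) * (\<Sum>i<d. L2sq M (\<lambda>\<omega>. x i \<omega>))"
  proof -
    have [measurable]: "(\<lambda>\<omega>. \<Sum>i<d. ennreal ((x i \<omega>)\<^sup>2)) \<in> borel_measurable M"
      by (intro borel_measurable_sum) auto
    have "(\<integral>\<^sup>+\<omega>. (\<Sum>i<d. ennreal ((x i \<omega>)\<^sup>2)) \<partial>M) = (\<Sum>i<d. L2sq M (\<lambda>\<omega>. x i \<omega>))"
      by (intro nn_integral_sum) auto
    then show ?thesis by (simp add: nn_integral_add nn_integral_cmult)
  qed
  also have "\<dots> \<le> 2 * (ennreal T * L2sq_upto t (\<lambda>z. flat c z - flat c' z))
    + ennreal (2 * d) * (\<Sum>i<d. \<integral>\<^sup>+z. indicator {..t} (fst z) * ennreal ((flat (h i) z - flat (h' i) z)\<^sup>2) \<partial>PM)"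
    using xi by (intro add_mono mult_left_mono ai) auto
  also have "2 * (ennreal T * L2sq_upto t (\<lambda>z. flat c z - flat c' z)) =
      ennreal (2 * T) * L2sq_upto t (\<lambda>z. flat c z - flat c' z)"
    using T_pos ennreal_mult[of 2 T] by (simp add: mult.assoc)
  finally show ?thesis .
qed

end

text \<open>The sequence \<open>(8 * x) ^ n / fact n\<close> tends to zero and is therefore bounded.
  It converts the factorial decay of Picard iterates into the rate required by
  \<open>L2_geometric_complete\<close>.\<close>

lemma power_over_fact_le_geometric:
  fixes x :: real
  assumes "0 \<le> x"
  obtains B where "0 \<le> B" "\<And>n. x ^ n / fact n \<le> B * (1/8) ^ n"
proof -
  have "(\<lambda>n. inverse (fact n) * (8 * x) ^ n) \<longlonglongrightarrow> 0"
    using summable_LIMSEQ_zero[OF summable_exp[of "8 * x"]] by simp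
  then have "Bseq (\<lambda>n. inverse (fact n) * (8 * x) ^ n)"
    by (intro convergent_imp_Bseq) (auto simp: convergent_def)
  then obtain B where B: "0 < B" "\<And>n. norm (inverse (fact n) * (8 * x) ^ n) \<le> B"
    by (auto elim: BseqE)
  have "x ^ n / fact n \<le> B * (1/8) ^ n" for n
  proof -
    have "x ^ n / fact n = (inverse (fact n) * (8 * x) ^ n) * (1/8) ^ n"
      using power_mult_distrib[of "8 * x" "1/8" n] by (simp add: field_simps)
    also have "\<dots> \<le> B * (1/8) ^ n"
      using B(2)[of n] by (intro mult_right_mono) (auto simp: abs_le_iff)
    finally show ?thesis .
  qed
  with B(1) show ?thesis by (intro that[of B]) auto
qed

text \<open>One step of iterating the integral inequality satisfied by the Picard
  increments.\<close>

lemma nn_integral_time_power: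
  assumes "0 \<le> C" "0 \<le> K" "0 \<le> t"
  shows "ennreal K * (\<integral>\<^sup>+s. ennreal (C * (K * s) ^ n / fact n) \<partial>time t) = ennreal (C * (K * t) ^ Suc n / fact (Suc n))"
proof -
  have "ennreal K * (\<integral>\<^sup>+s. ennreal (C * (K * s) ^ n / fact n) \<partial>time t) =
      (\<integral>\<^sup>+s. ennreal K * ennreal (C * (K * s) ^ n / fact n) \<partial>time t)"
    by (intro nn_integral_cmult[symmetric] measurable_restrict_space1) simp
  also have "\<dots> = (\<integral>\<^sup>+s. ennreal (K * (C * (K * s) ^ n / fact n)) * indicator {0..t} s \<partial>lborel)"
    using assms(2) by (subst nn_integral_restrict_space) (auto simp: ennreal_mult'[symmetric] intro!: nn_integral_cong)
  also have "\<dots> = C * (K * t) ^ Suc n / fact (Suc n) - C * (K * 0) ^ Suc n / fact (Suc n)"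
  proof (rule nn_integral_FTC_Icc)
    fix s :: real
    have "((\<lambda>s. C * (K * s) ^ Suc n / fact (Suc n)) has_real_derivative C * (real (Suc n) * (K * s) ^ n * K) / fact (Suc n)) (at s)"
      by (rule derivative_eq_intros refl | simp)+
    moreover have "C * (real (Suc n) * (K * s) ^ n * K) / fact (Suc n) = K * (C * (K * s) ^ n / fact n)"
      by (simp add: field_simps del: of_nat_Suc)
    ultimately show "((\<lambda>s. C * (K * s) ^ Suc n / fact (Suc n)) has_real_derivative K * (C * (K * s) ^ n / fact n)) (at s)"
      by (simp only:)
  qed (use assms in auto)
  finally show ?thesis by simp
qed

context brownian_basis
begin

text \<open>Picard iteration in the mean square norm on the product space. Successive increments
  decay like \<open>(K * t) ^ n / fact n\<close>; the limit is a fixed point up to a null set, and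
  one further application of the solution map yields a continuous version.\<close>

theorem linear_sde_exists:
  assumes b: "b1 \<in> borel_measurable borel" "b2 \<in> borel_measurable borel" "\<And>t. \<bar>b1 t\<bar> \<le> L" "\<And>t. \<bar>b2 t\<bar> \<le> L"
    and s: "\<And>i. s1 i \<in> borel_measurable borel" "\<And>i. s2 i \<in> borel_measurable borel"
      "\<And>i t. \<bar>s1 i t\<bar> \<le> L" "\<And>i t. \<bar>s2 i t\<bar> \<le> L"
    and \<beta>: "\<beta> \<in> L2_proc M T F"
  shows "\<exists>Z I. Z \<in> S2_proc M T F \<and> (AE \<omega> in M. Z 0 \<omega> = 0) \<and>
    (AE \<omega> in M. continuous_on {0..T} (\<lambda>t. Z t \<omega>)) \<and>
    (\<forall>i<d. ito_integral M T F (W i) (\<lambda>t \<omega>. s1 i t * Z t \<omega> + s2 i t * \<beta> t \<omega>) (I i)) \<and>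
    (AE \<omega> in M. \<forall>t\<in>{0..T}. Z t \<omega> =
      (LINT s|time t. b1 s * Z s \<omega> + b2 s * \<beta> s \<omega>) + (\<Sum>i<d. I i t \<omega>))"
proof -
  have L0: "0 \<le> L" using b(3)[of 0] by (meson abs_ge_zero order_trans)
  have T: "T \<in> {0..T}" "0 \<in> {0..T}" using T_pos by auto
  define c where "c Y = (\<lambda>t \<omega>. b1 t * Y t \<omega> + b2 t * \<beta> t \<omega>)" for Y :: "real \<Rightarrow> 'a \<Rightarrow> real"
  define h where "h i Y = (\<lambda>t \<omega>. s1 i t * Y t \<omega> + s2 i t * \<beta> t \<omega>)" for i and Y :: "real \<Rightarrow> 'a \<Rightarrow> real"
  have cL2: "c Y \<in> L2_proc M T F" and hL2: "h i Y \<in> L2_proc M T F" if "Y \<in> L2_proc M T F" for Y i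
    unfolding c_def h_def
    using L2_proc_mult_deterministic[OF that b(1,3)] L2_proc_mult_deterministic[OF \<beta> b(2,4)]
      L2_proc_mult_deterministic[OF that s(1,3)] L2_proc_mult_deterministic[OF \<beta> s(2,4)]
    by (auto intro: L2_proc_add)
  \<comment> \<open>A definite version of each integral, with every path continuous, is selected, so
    that the solution map \<open>G\<close> becomes a function with progressive values.\<close>
  define J where "J Y i = (SOME I. ito_integral M T F (W i) (h i Y) I \<and>
      (\<forall>\<omega>\<in>space M. continuous_on {0..T} (\<lambda>t. I t \<omega>)))" for Y i
  have J: "ito_integral M T F (W i) (h i Y) (J Y i) \<and> (\<forall>\<omega>\<in>space M. continuous_on {0..T} (\<lambda>t. J Y i t \<omega>))"
    if "Y \<in> L2_proc M T F" "i < d" for Y i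
  proof -
    from ito_integral_exists[OF that(2) hL2[OF that(1), of i]]
    have "\<exists>I. ito_integral M T F (W i) (h i Y) I \<and> (\<forall>\<omega>\<in>space M. continuous_on {0..T} (\<lambda>t. I t \<omega>))"
      by metis
    then show ?thesis unfolding J_def by (rule someI_ex)
  qed
  define G where "G Y t \<omega> = (LINT s|time t. c Y s \<omega>) + (\<Sum>i<d. J Y i t \<omega>)" for Y t \<omega>
  have Jp: "progressive T F borel (J Y i)" if "Y \<in> L2_proc M T F" "i < d" for Y i
    using J[OF that] ito_integralD(4) by (intro continuous_adapted_progressive) auto
  have G_S2: "G Y \<in> S2_proc M T F" and G_cont: "AE \<omega> in M. continuous_on {0..T} (\<lambda>t. G Y t \<omega>)"
    if Y: "Y \<in> L2_proc M T F" for Y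
  proof -
    have cY: "square_integrable PM (flat (c Y))" "progressive T F borel (c Y)" using cL2[OF Y] by (auto simp: L2_proc_iff)
    have p: "progressive T F borel (G Y)"
      unfolding G_def[abs_def] using Jp[OF Y] by (intro progressive_add progressive_integral cY progressive_sum) auto
    show co: "AE \<omega> in M. continuous_on {0..T} (\<lambda>t. G Y t \<omega>)"
      using drift_continuous[OF cY(1)] AE_space
    proof eventually_elim
      case (elim \<omega>)
      show ?case unfolding G_def
        using J[OF Y] elim by (intro continuous_on_add continuous_on_sum) auto
    qed
    have "sup_square_integrable (\<lambda>t \<omega>. (LINT s|time t. c Y s \<omega>) + 1 * (\<Sum>i<d. J Y i t \<omega>))"
      using J[OF Y] by (intro sup_square_integrable_add sup_square_integrable_drift cL2[OF Y]
        sup_square_integrable_sum sup_square_integrable_martingale ito_integral_martingale) auto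
    then have "sup_square_integrable (G Y)" by (simp add: G_def[abs_def])
    then show "G Y \<in> S2_proc M T F" by (simp add: S2_proc_iff_sup_square_integrable[OF p co])
  qed
  have G_L2: "G Y \<in> L2_proc M T F" if "Y \<in> L2_proc M T F" for Y
    by (rule S2_proc_square_integrable(2)[OF G_S2[OF that]])
  \<comment> \<open>The factors \<open>2 * T\<close> and \<open>2 * d\<close> of
    \<open>ito_process_diff_bound\<close>, each slope contributing at most \<open>L\<^sup>2\<close>,
    with \<open>d\<close> noise terms.\<close>
  define K where "K = 2 * T * L\<^sup>2 + 2 * real d * (real d * L\<^sup>2)"
  have K0: "0 \<le> K" unfolding K_def using T_pos by simp
  have G_diff: "L2sq M (\<lambda>\<omega>. G Y t \<omega> - G Y' t \<omega>) \<le>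
      ennreal K * L2sq_upto t (\<lambda>z. flat Y z - flat Y' z)"
    if Y: "Y \<in> L2_proc M T F" "Y' \<in> L2_proc M T F" and t: "t \<in> {0..T}" for Y Y' t
  proof -
    define R where "R = L2sq_upto t (\<lambda>z. flat Y z - flat Y' z)"
    have [measurable]: "flat Y \<in> borel_measurable PM" "flat Y' \<in> borel_measurable PM"
      using Y by (auto simp: L2_proc_iff square_integrable_def)
    have le: "L2sq_upto t (\<lambda>z. a (fst z) * (flat Y z - flat Y' z)) \<le> ennreal (L\<^sup>2) * R"
      if a: "\<And>t. \<bar>a t\<bar> \<le> L" for a
    proof -
      have "L2sq_upto t (\<lambda>z. a (fst z) * (flat Y z - flat Y' z)) \<le>
          (\<integral>\<^sup>+z. ennreal (L\<^sup>2) * (indicator {..t} (fst z) * ennreal ((flat Y z - flat Y' z)\<^sup>2)) \<partial>PM)"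
      proof (rule nn_integral_mono)
        fix z :: "real \<times> 'a"
        have "(a (fst z))\<^sup>2 \<le> L\<^sup>2" using power_mono[OF a abs_ge_zero, of "fst z" 2] by simp
        then have "(a (fst z) * (flat Y z - flat Y' z))\<^sup>2 \<le> L\<^sup>2 * (flat Y z - flat Y' z)\<^sup>2"
          unfolding power_mult_distrib by (rule mult_right_mono) simp
        then have "ennreal ((a (fst z) * (flat Y z - flat Y' z))\<^sup>2) \<le> ennreal (L\<^sup>2) * ennreal ((flat Y z - flat Y' z)\<^sup>2)"
          by (subst ennreal_mult[symmetric]) (auto intro: ennreal_leI)
        then show "indicator {..t} (fst z) * ennreal ((a (fst z) * (flat Y z - flat Y' z))\<^sup>2) \<le>
          ennreal (L\<^sup>2) * (indicator {..t} (fst z) * ennreal ((flat Y z - flat Y' z)\<^sup>2))"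
          by (auto split: split_indicator)
      qed
      also have "\<dots> = ennreal (L\<^sup>2) * R" unfolding R_def by (rule nn_integral_cmult) measurable
      finally show ?thesis .
    qed
    have "L2sq M (\<lambda>\<omega>. G Y t \<omega> - G Y' t \<omega>) \<le>
      ennreal (2 * T) * L2sq_upto t (\<lambda>z. flat (c Y) z - flat (c Y') z)
      + ennreal (2 * d) * (\<Sum>i<d. \<integral>\<^sup>+z. indicator {..t} (fst z) * ennreal ((flat (h i Y) z - flat (h i Y') z)\<^sup>2) \<partial>PM)"
      unfolding G_def using J[OF Y(1)] J[OF Y(2)] by (intro ito_process_diff_bound cL2 Y t) auto
    also have "\<dots> = ennreal (2 * T) * L2sq_upto t (\<lambda>z. b1 (fst z) * (flat Y z - flat Y' z))
      + ennreal (2 * d) * (\<Sum>i<d. \<integral>\<^sup>+z. indicator {..t} (fst z) * ennreal ((s1 i (fst z) * (flat Y z - flat Y' z))\<^sup>2) \<partial>PM)"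
      by (simp add: c_def h_def right_diff_distrib)
    also have "\<dots> \<le> ennreal (2 * T) * (ennreal (L\<^sup>2) * R) + ennreal (2 * d) * (\<Sum>i<d. ennreal (L\<^sup>2) * R)"
      by (intro add_mono mult_left_mono sum_mono le b s) auto
    also have "\<dots> = ennreal K * R"
    proof -
      have "ennreal K = ennreal (2 * T) * ennreal (L\<^sup>2) + ennreal (2 * real d) * (ennreal (real d) * ennreal (L\<^sup>2))"
        unfolding K_def using T_pos by (simp add: ennreal_mult[symmetric] flip: ennreal_plus)
      moreover have "(\<Sum>i<d. ennreal (L\<^sup>2) * R) = ennreal (real d) * (ennreal (L\<^sup>2) * R)"
        by (simp add: ennreal_of_nat_eq_real_of_nat)
      ultimately show ?thesis by (simp add: distrib_right mult.assoc)
    qed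
    finally show ?thesis unfolding R_def .
  qed
  define Y where "Y n = (G ^^ n) (\<lambda>_ _. 0)" for n
  have Y0: "Y 0 = (\<lambda>_ _. 0)" and YS: "Y (Suc n) = G (Y n)" for n by (simp_all add: Y_def)
  have Y_L2: "Y n \<in> L2_proc M T F" for n
    by (induction n) (auto simp: Y0 YS intro: L2_proc_const G_L2)
  have Ym[measurable]: "flat (Y n) \<in> borel_measurable PM" for n
    using Y_L2[of n] by (auto simp: L2_proc_iff square_integrable_def)
  obtain C where C: "0 \<le> C" "\<And>t. t \<in> {0..T} \<Longrightarrow> L2sq M (\<lambda>\<omega>. Y 1 t \<omega> - Y 0 t \<omega>) \<le> ennreal C"
  proof -
    have fin: "(\<integral>\<^sup>+\<omega>. (SUP t\<in>{0..T}. ennreal ((G (Y 0) t \<omega>)\<^sup>2)) \<partial>M) < \<infinity>"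
      using G_S2[OF Y_L2[of 0]] by (simp add: S2_proc_def)
    have "L2sq M (\<lambda>\<omega>. Y 1 t \<omega> - Y 0 t \<omega>) \<le> (\<integral>\<^sup>+\<omega>. (SUP t\<in>{0..T}. ennreal ((G (Y 0) t \<omega>)\<^sup>2)) \<partial>M)"
      if "t \<in> {0..T}" for t
      using YS[of 0] by (intro nn_integral_mono) (auto simp: Y0 intro!: SUP_upper2[OF that])
    then show ?thesis
      using fin by (intro that[of "enn2real (\<integral>\<^sup>+\<omega>. (SUP t\<in>{0..T}. ennreal ((G (Y 0) t \<omega>)\<^sup>2)) \<partial>M)"]) (auto simp: less_top)
  qed
  have a: "L2sq M (\<lambda>\<omega>. Y (Suc n) t \<omega> - Y n t \<omega>) \<le> ennreal (C * (K * t) ^ n / fact n)" if "t \<in> {0..T}" for n t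
    using that
  proof (induction n arbitrary: t)
    case 0 then show ?case using C(2)[of t] by simp
  next
    case (Suc n)
    have "L2sq M (\<lambda>\<omega>. Y (Suc (Suc n)) t \<omega> - Y (Suc n) t \<omega>) \<le>
        ennreal K * L2sq_upto t (\<lambda>z. flat (Y (Suc n)) z - flat (Y n) z)"
      using G_diff[OF Y_L2[of "Suc n"] Y_L2[of n] Suc.prems] by (simp only: YS)
    also have "L2sq_upto t (\<lambda>z. flat (Y (Suc n)) z - flat (Y n) z) =
        (\<integral>\<^sup>+s. L2sq M (\<lambda>\<omega>. Y (Suc n) s \<omega> - Y n s \<omega>) \<partial>time t)"
      using nn_integral_PM_indicator(1)[of "\<lambda>z. ennreal ((flat (Y (Suc n)) z - flat (Y n) z)\<^sup>2)" t] Suc.prems by simp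
    also have "\<dots> \<le> (\<integral>\<^sup>+s. ennreal (C * (K * s) ^ n / fact n) \<partial>time t)"
      using Suc.prems by (intro nn_integral_mono Suc.IH) (auto simp: space_restrict_space)
    also have "ennreal K * \<dots> = ennreal (C * (K * t) ^ Suc n / fact (Suc n))"
      using Suc.prems by (intro nn_integral_time_power C K0) auto
    finally show ?case by (simp add: mult_left_mono)
  qed
  obtain B where B: "0 \<le> B" "\<And>n. (K * T) ^ n / fact n \<le> B * (1/8) ^ n"
    using power_over_fact_le_geometric[of "K * T"] K0 T_pos by auto
  \<comment> \<open>\<open>C\<close> bounds the first increment, \<open>B\<close> converts the
    factorial decay, and \<open>T\<close> is the length of the time interval.\<close>
  define c0 where "c0 = C * B * T"
  have c00: "0 \<le> c0" unfolding c0_def using C B T_pos by simp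
  have geo: "L2sq PM (\<lambda>z. flat (Y (Suc n)) z - flat (Y n) z) \<le> ennreal (c0 * (1/8) ^ n)" for n
  proof -
    have "L2sq PM (\<lambda>z. flat (Y (Suc n)) z - flat (Y n) z) =
        (\<integral>\<^sup>+s. L2sq M (\<lambda>\<omega>. Y (Suc n) s \<omega> - Y n s \<omega>) \<partial>time T)"
      using nn_integral_fst[of "\<lambda>z. ennreal ((flat (Y (Suc n)) z - flat (Y n) z)\<^sup>2)" "time T"] by simp
    also have "\<dots> \<le> (\<integral>\<^sup>+s. ennreal (C * B * (1/8) ^ n) \<partial>time T)"
    proof (rule nn_integral_mono)
      fix s assume "s \<in> space (time T)"
      then have s: "s \<in> {0..T}" by (simp add: space_restrict_space)
      have "C * (K * s) ^ n / fact n \<le> C * ((K * T) ^ n / fact n)"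
        using s C K0 T_pos by (auto intro!: mult_left_mono divide_right_mono power_mono)
      also have "\<dots> \<le> C * (B * (1/8) ^ n)" by (intro mult_left_mono B C)
      finally show "L2sq M (\<lambda>\<omega>. Y (Suc n) s \<omega> - Y n s \<omega>) \<le> ennreal (C * B * (1/8) ^ n)"
        using a[OF s, of n] by (auto intro: order_trans ennreal_leI simp: mult.assoc)
    qed
    also have "\<dots> = ennreal (c0 * (1/8) ^ n)"
      unfolding nn_integral_const emeasure_time c0_def using C B T_pos
      by (subst ennreal_mult[symmetric]) (auto simp: mult_ac)
    finally show ?thesis .
  qed
  define X where "X t \<omega> = lim (\<lambda>n. Y n t \<omega>)" for t \<omega>
  have XY: "L2sq PM (\<lambda>z. flat X z - flat (Y n) z) \<le> ennreal (4 * c0 * (1/8) ^ n)" for n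
    unfolding X_def by (rule L2_geometric_complete(2)[OF Ym geo c00])
  have Xp: "progressive T F borel X"
    unfolding X_def[abs_def] using Y_L2 by (intro progressive_limit) (auto simp: L2_proc_iff)
  note [measurable] = progressive_measurable_PM[OF Xp]
  have X_L2: "X \<in> L2_proc M T F"
    using XY[of 0] Xp by (auto simp: L2_proc_iff square_integrable_iff_nn_integral Y0 intro: le_less_trans)
  \<comment> \<open>The limit \<open>X\<close> is only progressive. Its image has continuous paths
    and a square integrable supremum, and it agrees with \<open>X\<close> almost everywhere, which
    is enough to solve the equation.\<close>
  define Z where "Z = G X"
  have Z_L2: "Z \<in> L2_proc M T F" unfolding Z_def by (rule G_L2[OF X_L2])
  then have [measurable]: "flat Z \<in> borel_measurable PM" by (auto simp: L2_proc_iff square_integrable_def)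
  have "L2sq PM (\<lambda>z. flat Z z - flat X z) \<le> ennreal ((8 * K * T * c0 + c0) * (1/8) ^ n)" for n
  proof -
    have ZY: "L2sq PM (\<lambda>z. flat Z z - flat (Y (Suc n)) z) \<le> ennreal (K * (4 * c0 * (1/8) ^ n) * T)"
    proof -
      have "L2sq PM (\<lambda>z. flat Z z - flat (Y (Suc n)) z) =
          (\<integral>\<^sup>+s. L2sq M (\<lambda>\<omega>. Z s \<omega> - Y (Suc n) s \<omega>) \<partial>time T)"
        using nn_integral_fst[of "\<lambda>z. ennreal ((flat Z z - flat (Y (Suc n)) z)\<^sup>2)" "time T"] by simp
      also have "\<dots> \<le> (\<integral>\<^sup>+s. ennreal (K * (4 * c0 * (1/8) ^ n)) \<partial>time T)"
      proof (rule nn_integral_mono)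
        fix s assume "s \<in> space (time T)"
        then have s: "s \<in> {0..T}" by (simp add: space_restrict_space)
        have "L2sq M (\<lambda>\<omega>. Z s \<omega> - Y (Suc n) s \<omega>) \<le>
            ennreal K * L2sq_upto s (\<lambda>z. flat X z - flat (Y n) z)"
          unfolding Z_def YS by (rule G_diff[OF X_L2 Y_L2 s])
        also have "\<dots> \<le> ennreal K * L2sq PM (\<lambda>z. flat X z - flat (Y n) z)"
          by (intro mult_left_mono nn_integral_mono) (auto split: split_indicator)
        also have "\<dots> \<le> ennreal K * ennreal (4 * c0 * (1/8) ^ n)" by (intro mult_left_mono XY) simp
        also have "\<dots> = ennreal (K * (4 * c0 * (1/8) ^ n))" using K0 c00 by (simp add: ennreal_mult[symmetric])
        finally show "L2sq M (\<lambda>\<omega>. Z s \<omega> - Y (Suc n) s \<omega>) \<le> ennreal (K * (4 * c0 * (1/8) ^ n))" .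
      qed
      also have "\<dots> = ennreal (K * (4 * c0 * (1/8) ^ n) * T)"
        unfolding nn_integral_const emeasure_time using K0 c00 T_pos by (subst ennreal_mult[symmetric]) auto
      finally show ?thesis .
    qed
    have "L2sq PM (\<lambda>z. flat Z z - flat X z) \<le>
        2 * L2sq PM (\<lambda>z. flat Z z - flat (Y (Suc n)) z)
        + 2 * L2sq PM (\<lambda>z. flat (Y (Suc n)) z - flat X z)"
      using nn_integral_sq_add_le[of "\<lambda>z. flat Z z - flat (Y (Suc n)) z" PM "\<lambda>z. flat (Y (Suc n)) z - flat X z"] by simp
    also have "\<dots> \<le> 2 * ennreal (K * (4 * c0 * (1/8) ^ n) * T) + 2 * ennreal (4 * c0 * (1/8) ^ Suc n)"
      using XY[of "Suc n"] by (intro add_mono mult_left_mono ZY) (auto simp: power2_commute)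
    also have "\<dots> = ennreal (2 * (K * (4 * c0 * (1/8) ^ n) * T) + 2 * (4 * c0 * (1/8) ^ Suc n))"
      using ennreal_mult[of 2 "K * (4 * c0 * (1/8) ^ n) * T"] ennreal_mult[of 2 "4 * c0 * (1/8) ^ Suc n"] K0 c00 T_pos
      by (subst ennreal_plus) (auto simp del: ennreal_plus)
    also have "2 * (K * (4 * c0 * (1/8) ^ n) * T) + 2 * (4 * c0 * (1/8) ^ Suc n) = (8 * K * T * c0 + c0) * (1/8) ^ n"
      by (simp add: algebra_simps)
    finally show ?thesis .
  qed
  moreover have "(\<lambda>n. ennreal ((8 * K * T * c0 + c0) * (1/8) ^ n)) \<longlonglongrightarrow> 0"
    using tendsto_mult_right_zero[OF LIMSEQ_power_zero[of "1/8::real"], of "8 * K * T * c0 + c0"] K0 c00 T_pos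
    by (subst ennreal_tendsto_0_iff) auto
  ultimately have "L2sq PM (\<lambda>z. flat Z z - flat X z) \<le> 0"
    by (intro LIMSEQ_le_const) auto
  then have "L2sq PM (\<lambda>z. flat Z z - flat X z) = 0" by simp
  then have ae: "AE z in PM. flat Z z = flat X z"
    by (subst (asm) nn_integral_0_iff_AE) (auto elim!: eventually_mono)
  show ?thesis
  proof (intro exI[of _ Z] exI[of _ "J X"] conjI allI impI)
    show "Z \<in> S2_proc M T F" unfolding Z_def by (rule G_S2[OF X_L2])
    show "AE \<omega> in M. continuous_on {0..T} (\<lambda>t. Z t \<omega>)" unfolding Z_def by (rule G_cont[OF X_L2])
    have "AE z in PM. flat (h i X) z = flat (h i Z) z" for i
      using ae by eventually_elim (simp add: h_def)
    then show "ito_integral M T F (W i) (\<lambda>t \<omega>. s1 i t * Z t \<omega> + s2 i t * \<beta> t \<omega>) (J X i)" if "i < d" for i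
      using ito_integral_cong_AE[OF conjunct1[OF J[OF X_L2 that]] hL2[OF Z_L2]] by (simp add: h_def)
    have "AE z in PM. flat (c X) z = flat (c Z) z"
      using ae by eventually_elim (simp add: c_def)
    then have "AE \<omega> in M. \<forall>t\<in>{0..T}. (LINT s|time t. c X s \<omega>) = (LINT s|time t. c Z s \<omega>)"
      using cL2[OF X_L2] cL2[OF Z_L2] by (intro AE_eq_drift) (auto simp: L2_proc_iff)
    then show "AE \<omega> in M. \<forall>t\<in>{0..T}. Z t \<omega> =
      (LINT s|time t. b1 s * Z s \<omega> + b2 s * \<beta> s \<omega>) + (\<Sum>i<d. J X i t \<omega>)"
      by eventually_elim (simp add: Z_def G_def c_def)
    \<comment> \<open>Compare with the zero process at time 0: the right-hand side integrates over
      the null set \<open>{0}\<close> of times.\<close>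
    have "L2sq M (\<lambda>\<omega>. G X 0 \<omega>) \<le> 0"
    proof -
      have zero: "L2sq_upto 0 (\<lambda>z. flat f z - 0) = 0"
        if "square_integrable PM (flat f)" for f
      proof -
        have [measurable]: "flat f \<in> borel_measurable PM" using that by (simp add: square_integrable_def)
        have "L2sq_upto 0 (\<lambda>z. flat f z - 0) =
            (\<integral>\<^sup>+s. L2sq M (\<lambda>\<omega>. f s \<omega> - 0) \<partial>time 0)"
          using nn_integral_PM_indicator(1)[of "\<lambda>z. ennreal ((flat f z - 0)\<^sup>2)" 0] T by simp
        also have "\<dots> = (\<integral>\<^sup>+s. 0 \<partial>time 0)"
        proof (rule nn_integral_cong_AE)
          have "AE s in time 0. False"
          proof -
            have "emeasure (time 0) (space (time 0)) = 0" by (simp only: emeasure_time ennreal_0)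
            then show ?thesis by (intro AE_I[of _ _ "space (time 0)"] sets.top) auto
          qed
          then show "AE s in time 0. L2sq M (\<lambda>\<omega>. f s \<omega> - 0) = 0"
            by eventually_elim simp
        qed
        finally show ?thesis by simp
      qed
      have "L2sq M (\<lambda>\<omega>. ((LINT s|time 0. c X s \<omega>) + (\<Sum>i<d. J X i 0 \<omega>))
          - ((LINT s|time 0. 0) + (\<Sum>i<d. 0))) \<le>
        ennreal (2 * T) * L2sq_upto 0 (\<lambda>z. flat (c X) z - 0)
        + ennreal (2 * d) * (\<Sum>i<d. \<integral>\<^sup>+z. indicator {..0} (fst z) * ennreal ((flat (h i X) z - 0)\<^sup>2) \<partial>PM)"
        using J[OF X_L2] T
        by (intro ito_process_diff_bound[where c'="\<lambda>_ _. 0" and h'="\<lambda>_ _ _. 0" and I'="\<lambda>_ _ _. 0"]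
          cL2 X_L2 L2_proc_const ito_integral_zero) auto
      also have "\<dots> = 0"
        using zero[of "c X"] zero[of "h i X" for i] cL2[OF X_L2] hL2[OF X_L2] by (simp add: L2_proc_iff)
      finally show ?thesis by (simp add: G_def)
    qed
    then have "L2sq M (\<lambda>\<omega>. G X 0 \<omega>) = 0" by simp
    moreover have "G X 0 \<in> borel_measurable M"
      using square_integrable_measurable[OF S2_proc_square_integrable(1)[OF G_S2[OF X_L2] T(2)]] .
    ultimately show "AE \<omega> in M. Z 0 \<omega> = 0"
      unfolding Z_def by (subst (asm) nn_integral_0_iff_AE) (auto elim!: eventually_mono)
  qed
qed

end

section \<open>Duality and the maximum principle\<close>

text \<open>Integration by parts, obtained by cutting the square \<open>{0..T}\<close> times
  \<open>{0..T}\<close> along its diagonal and integrating each triangle in the suitable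
  order.\<close>

lemma product_integral_time:
  fixes f g :: "real \<Rightarrow> real"
  assumes f: "integrable (time T) f" and g: "integrable (time T) g"
  shows "(LINT s|time T. f s) * (LINT s|time T. g s) =
    (LINT s|time T. (LINT r|time s. f r) * g s + f s * (LINT r|time s. g r))"
proof -
  interpret tt: pair_sigma_finite "time T" "time T"
    by (intro pair_sigma_finite.intro time.sigma_finite_measure_axioms)
  note [measurable] = borel_measurable_integrable[OF f] borel_measurable_integrable[OF g]
  have idm[measurable]: "(\<lambda>r. r) \<in> borel_measurable (time T)" by (intro measurable_restrict_space1) simp
  have [measurable]: "fst \<in> borel_measurable (time T \<Otimes>\<^sub>M time T)" "snd \<in> borel_measurable (time T \<Otimes>\<^sub>M time T)"
    by (auto intro!: measurable_compose[OF measurable_fst] measurable_compose[OF measurable_snd])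
  have int: "integrable (time T \<Otimes>\<^sub>M time T) (\<lambda>z. f (fst z) * g (snd z))"
  proof (rule tt.Fubini_integrable)
    show "integrable (time T) (\<lambda>x. LINT y|time T. norm (f (fst (x, y)) * g (snd (x, y))))"
      using f by (simp add: abs_mult)
  qed (use g in auto)
  define L where "L z = (if fst z \<le> snd z then f (fst z) * g (snd z) else 0)" for z
  define U where "U z = (if snd z < fst z then f (fst z) * g (snd z) else 0)" for z
  have Li: "integrable (time T \<Otimes>\<^sub>M time T) L" and Ui: "integrable (time T \<Otimes>\<^sub>M time T) U"
  proof -
    have [measurable]: "L \<in> borel_measurable (time T \<Otimes>\<^sub>M time T)" "U \<in> borel_measurable (time T \<Otimes>\<^sub>M time T)"
      unfolding L_def[abs_def] U_def[abs_def] by measurable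
    show "integrable (time T \<Otimes>\<^sub>M time T) L" "integrable (time T \<Otimes>\<^sub>M time T) U"
      by (auto intro!: Bochner_Integration.integrable_bound[OF int] simp: L_def U_def)
  qed
  have sub: "(LINT r|time T. (if r \<le> s then k r else 0)) = (LINT r|time s. k r)" if "s \<in> {0..T}" for s and k :: "real \<Rightarrow> real"
    unfolding integral_restrict_space[of "{0..T}" lborel, simplified] integral_restrict_space[of "{0..s}" lborel, simplified]
    using that by (intro Bochner_Integration.integral_cong) (auto split: split_indicator)
  \<comment> \<open>The diagonal is assigned to \<open>L\<close>, so \<open>U\<close> has a strict
    inequality; the missing point is null.\<close>
  have sub': "(LINT r|time T. (if r < s then g r else 0)) = (LINT r|time s. g r)" if s: "s \<in> {0..T}" for s
    unfolding sub[OF s, symmetric]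
  proof (rule integral_cong_AE)
    show "(\<lambda>r. if r < s then g r else 0) \<in> borel_measurable (time T)" by measurable
    show "(\<lambda>r. if r \<le> s then g r else 0) \<in> borel_measurable (time T)" by measurable
    have "AE r in lborel. r \<noteq> s" by (rule AE_lborel_singleton)
    then show "AE r in time T. (if r < s then g r else 0) = (if r \<le> s then g r else 0)"
      by (simp add: AE_restrict_space_iff) (auto elim!: eventually_mono)
  qed
  have F: "(LINT s|time T. L (s, r)) = (LINT s|time r. f s) * g r" if "r \<in> {0..T}" for r
  proof -
    have "(LINT s|time T. L (s, r)) = (LINT s|time T. (if s \<le> r then f s else 0) * g r)"
      by (intro Bochner_Integration.integral_cong) (auto simp: L_def)
    then show ?thesis using sub[OF that, of f] by simp
  qed
  have G: "(LINT r|time T. U (s, r)) = f s * (LINT r|time s. g r)" if "s \<in> {0..T}" for s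
  proof -
    have "(LINT r|time T. U (s, r)) = (LINT r|time T. f s * (if r < s then g r else 0))"
      by (intro Bochner_Integration.integral_cong) (auto simp: U_def)
    then show ?thesis using sub'[OF that] by simp
  qed
  have FL: "integrable (time T) (\<lambda>r. LINT s|time T. L (s, r))" "(LINT z|(time T \<Otimes>\<^sub>M time T). L z) = (LINT r|time T. (LINT s|time T. L (s, r)))"
    using tt.integrable_snd[of "\<lambda>x y. L (x, y)"] tt.integral_snd[of "\<lambda>x y. L (x, y)"] Li by auto
  have GU: "integrable (time T) (\<lambda>s. LINT r|time T. U (s, r))" "(LINT z|(time T \<Otimes>\<^sub>M time T). U z) = (LINT s|time T. (LINT r|time T. U (s, r)))"
    using tt.integrable_fst'[OF Ui] tt.integral_fst'[OF Ui] by auto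
  have "(LINT s|time T. f s) * (LINT s|time T. g s) = (LINT z|(time T \<Otimes>\<^sub>M time T). f (fst z) * g (snd z))"
    using tt.integral_fst'[OF int] by simp
  also have "\<dots> = (LINT z|(time T \<Otimes>\<^sub>M time T). L z + U z)"
    by (intro Bochner_Integration.integral_cong) (auto simp: L_def U_def)
  also have "\<dots> = (LINT s|time T. (LINT r|time T. L (r, s)) + (LINT r|time T. U (s, r)))"
    using Li Ui FL GU by simp
  also have "\<dots> = (LINT s|time T. (LINT r|time s. f r) * g s + f s * (LINT r|time s. g r))"
    by (intro Bochner_Integration.integral_cong) (auto simp: F G space_restrict_space)
  finally show ?thesis .
qed

section \<open>Expectations of products of drifts and martingales\<close>

context filtered_space
begin

lemma square_integrable_PM_snd:
  assumes "square_integrable M Y"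
  shows "square_integrable PM (\<lambda>z. Y (snd z))"
proof -
  note [measurable] = square_integrable_measurable[OF assms]
  have "L2sq PM (\<lambda>z. Y (snd z)) = (\<integral>\<^sup>+t. L2sq M Y \<partial>time T)"
    using nn_integral_fst[of "\<lambda>z. ennreal ((Y (snd z))\<^sup>2)" "time T"] by simp
  also have "\<dots> < \<infinity>"
    unfolding nn_integral_const emeasure_time
    using assms by (simp add: square_integrable_iff_nn_integral ennreal_mult_less_top)
  finally show ?thesis by (simp add: square_integrable_iff_nn_integral)
qed

lemma drift_L2_proc:
  assumes "c \<in> L2_proc M T F"
  shows "(\<lambda>t \<omega>. LINT s|time t. c s \<omega>) \<in> L2_proc M T F"
proof (rule S2_proc_square_integrable(2))
  have "progressive T F borel c" "square_integrable PM (flat c)" using assms by (auto simp: L2_proc_iff)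
  then show "(\<lambda>t \<omega>. LINT s|time t. c s \<omega>) \<in> S2_proc M T F"
    using S2_proc_iff_sup_square_integrable[OF progressive_integral drift_continuous] sup_square_integrable_drift[OF assms]
    by blast
qed

lemma drift_square_integrable:
  assumes "c \<in> L2_proc M T F" "t \<in> {0..T}"
  shows "square_integrable M (\<lambda>\<omega>. LINT s|time t. c s \<omega>)"
proof -
  have "progressive T F borel c" "square_integrable PM (flat c)" using assms by (auto simp: L2_proc_iff)
  then have "(\<lambda>t \<omega>. LINT s|time t. c s \<omega>) \<in> S2_proc M T F"
    using S2_proc_iff_sup_square_integrable[OF progressive_integral drift_continuous] sup_square_integrable_drift[OF assms(1)]
    by blast
  from S2_proc_square_integrable(1)[OF this assms(2)] show ?thesis .
qed

lemma integral_PM_fst: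
  fixes f :: "real \<times> 'a \<Rightarrow> real"
  shows "integrable PM f \<Longrightarrow> (LINT t|time T. (LINT \<omega>|M. f (t, \<omega>))) = (LINT z|PM. f z)"
  by (rule PM.integral_fst')

lemma integral_PM_snd:
  fixes f :: "real \<times> 'a \<Rightarrow> real"
  assumes "integrable PM f"
  shows "(LINT \<omega>|M. (LINT t|time T. f (t, \<omega>))) = (LINT z|PM. f z)"
  using PM.integral_snd[of "\<lambda>x y. f (x, y)"] assms by simp

lemma expectation_drift_mult:
  assumes x: "x \<in> L2_proc M T F" and Y: "square_integrable M Y"
  shows "(LINT \<omega>|M. (LINT t|time T. x t \<omega>) * Y \<omega>) = (LINT z|PM. flat x z * Y (snd z))"
proof -
  have "integrable PM (\<lambda>z. flat x z * Y (snd z))"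
    using x by (intro square_integrable_mult square_integrable_PM_snd[OF Y]) (simp add: L2_proc_iff)
  from integral_PM_snd[OF this] show ?thesis by simp
qed

text \<open>By Fubini it suffices to replace \<open>Y T\<close> by \<open>Y t\<close> against each
  \<open>x t\<close>, which is the martingale property. \<open>R\<close> stands in for
  \<open>Y\<close> because \<open>Y\<close> is only measurable at each fixed time, whereas the
  product integral needs joint measurability.\<close>

lemma expectation_drift_martingale:
  assumes x: "x \<in> L2_proc M T F" and Y: "L2_martingale Y" and R: "square_integrable PM (flat R)"
    and eq: "\<And>t. t \<in> {0..T} \<Longrightarrow> AE \<omega> in M. R t \<omega> = Y t \<omega>"
  shows "(LINT \<omega>|M. (LINT t|time T. x t \<omega>) * Y T \<omega>) = (LINT z|PM. flat x z * flat R z)"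
proof -
  have xp: "progressive T F borel x" and xs: "square_integrable PM (flat x)" using x by (auto simp: L2_proc_iff)
  have YT: "square_integrable M (Y T)" using L2_martingaleD(2)[OF Y, of T] T_pos by auto
  have i1: "integrable PM (\<lambda>z. flat x z * Y T (snd z))"
    by (intro square_integrable_mult xs square_integrable_PM_snd YT)
  have i2: "integrable PM (\<lambda>z. flat x z * flat R z)"
    by (intro square_integrable_mult xs R)
  \<comment> \<open>Test variables of the martingale property must be square integrable, and
    \<open>x t\<close> is so only for almost every \<open>t\<close>.\<close>
  have "AE t in time T. square_integrable M (x t)"
  proof -
    note [measurable] = square_integrable_measurable[OF xs]
    have "(\<integral>\<^sup>+t. L2sq M (\<lambda>\<omega>. x t \<omega>) \<partial>time T) \<noteq> \<infinity>"
      using nn_integral_fst[of "\<lambda>z. ennreal ((flat x z)\<^sup>2)" "time T"] xs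
      by (simp add: square_integrable_iff_nn_integral)
    moreover have "(\<lambda>t. L2sq M (\<lambda>\<omega>. x t \<omega>)) \<in> borel_measurable (time T)"
      using borel_measurable_nn_integral_fst[of "\<lambda>z. ennreal ((flat x z)\<^sup>2)" "time T"] square_integrable_measurable[OF xs]
      by simp
    ultimately have "AE t in time T. L2sq M (\<lambda>\<omega>. x t \<omega>) \<noteq> \<infinity>"
      by (intro nn_integral_PInf_AE)
    then show ?thesis
      using AE_space
      by eventually_elim (auto simp: square_integrable_iff_nn_integral less_top space_restrict_space
        intro: progressive_measurable_M[OF xp])
  qed
  then have ae: "AE t in time T. (LINT \<omega>|M. x t \<omega> * Y T \<omega>) = (LINT \<omega>|M. x t \<omega> * R t \<omega>)"
    using AE_space
  proof eventually_elim
    case (elim t)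
    then have t: "t \<in> {0..T}" by (simp add: space_restrict_space)
    have "(LINT \<omega>|M. x t \<omega> * Y T \<omega>) = (LINT \<omega>|M. x t \<omega> * Y t \<omega>)"
      using t elim by (intro L2_martingale_eq[OF Y] progressive_adapted[OF xp]) auto
    also have "\<dots> = (LINT \<omega>|M. x t \<omega> * R t \<omega>)"
    proof (rule integral_cong_AE)
      have Rm: "R t \<in> borel_measurable M"
        using measurable_compose[OF measurable_Pair1'[of t "time T" M] square_integrable_measurable[OF R]] elim(2) by simp
      show "(\<lambda>\<omega>. x t \<omega> * Y t \<omega>) \<in> borel_measurable M" "(\<lambda>\<omega>. x t \<omega> * R t \<omega>) \<in> borel_measurable M"
        using progressive_measurable_M[OF xp t] square_integrable_measurable[OF L2_martingaleD(2)[OF Y t]] Rm by auto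
      show "AE \<omega> in M. x t \<omega> * Y t \<omega> = x t \<omega> * R t \<omega>"
        using eq[OF t] by eventually_elim simp
    qed
    finally show ?case .
  qed
  have "(LINT \<omega>|M. (LINT t|time T. x t \<omega>) * Y T \<omega>) = (LINT z|PM. flat x z * Y T (snd z))"
    by (rule expectation_drift_mult[OF x YT])
  also have "\<dots> = (LINT t|time T. (LINT \<omega>|M. x t \<omega> * Y T \<omega>))"
    using integral_PM_fst[OF i1] by simp
  also have "\<dots> = (LINT t|time T. (LINT \<omega>|M. x t \<omega> * R t \<omega>))"
    using ae borel_measurable_integrable[OF PM.integrable_fst'[OF i1]] borel_measurable_integrable[OF PM.integrable_fst'[OF i2]]
    by (intro integral_cong_AE) auto
  also have "\<dots> = (LINT z|PM. flat x z * flat R z)"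
    using integral_PM_fst[OF i2] by simp
  finally show ?thesis .
qed

text \<open>Pathwise integration by parts, followed by Fubini.\<close>

lemma expectation_drift_drift:
  assumes x: "x \<in> L2_proc M T F" and y: "y \<in> L2_proc M T F"
  shows "(LINT \<omega>|M. (LINT t|time T. x t \<omega>) * (LINT t|time T. y t \<omega>)) =
    (LINT z|PM. (LINT s|time (fst z). x s (snd z)) * flat y z + flat x z * (LINT s|time (fst z). y s (snd z)))"
proof -
  have xs: "square_integrable PM (flat x)" and ys: "square_integrable PM (flat y)"
    and Xs: "square_integrable PM (\<lambda>z. LINT s|time (fst z). x s (snd z))"
    and Ys: "square_integrable PM (\<lambda>z. LINT s|time (fst z). y s (snd z))"
    using x y drift_L2_proc[OF x] drift_L2_proc[OF y] by (auto simp: L2_proc_iff)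
  have i: "integrable PM (\<lambda>z. (LINT s|time (fst z). x s (snd z)) * flat y z + flat x z * (LINT s|time (fst z). y s (snd z)))"
    by (intro Bochner_Integration.integrable_add square_integrable_mult xs ys Xs Ys)
  have "(LINT \<omega>|M. (LINT t|time T. x t \<omega>) * (LINT t|time T. y t \<omega>)) =
      (LINT \<omega>|M. (LINT t|time T. (LINT s|time t. x s \<omega>) * y t \<omega> + x t \<omega> * (LINT s|time t. y s \<omega>)))"
  proof (rule integral_cong_AE)
    have T: "T \<in> {0..T}" using T_pos by simp
    show "(\<lambda>\<omega>. (LINT t|time T. x t \<omega>) * (LINT t|time T. y t \<omega>)) \<in> borel_measurable M"
      using square_integrable_measurable[OF drift_square_integrable[OF x T]]
        square_integrable_measurable[OF drift_square_integrable[OF y T]] by simp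
    show "(\<lambda>\<omega>. LINT t|time T. (LINT s|time t. x s \<omega>) * y t \<omega> + x t \<omega> * (LINT s|time t. y s \<omega>)) \<in> borel_measurable M"
      using PM.integrable_snd[of "\<lambda>a b. (LINT s|time a. x s b) * y a b + x a b * (LINT s|time a. y s b)"] i
      by (auto simp: case_prod_beta')
    show "AE \<omega> in M. (LINT t|time T. x t \<omega>) * (LINT t|time T. y t \<omega>) =
        (LINT t|time T. (LINT s|time t. x s \<omega>) * y t \<omega> + x t \<omega> * (LINT s|time t. y s \<omega>))"
      using path_integrable[OF xs] path_integrable[OF ys]
      by eventually_elim (rule product_integral_time)
  qed
  also have "\<dots> = (LINT z|PM. (LINT s|time (fst z). x s (snd z)) * flat y z + flat x z * (LINT s|time (fst z). y s (snd z)))"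
    using integral_PM_snd[OF i] by simp
  finally show ?thesis .
qed

end

context brownian_basis
begin

text \<open>The product rule in expectation. Decompose \<open>p T = p 0 + A + Y\<close> and
  \<open>Z T = C + X\<close> into drifts and martingales and treat the six products one by
  one.\<close>

theorem ito_duality:
  assumes p: "p \<in> S2_proc M T F" and Z: "Z \<in> S2_proc M T F" "AE \<omega> in M. Z 0 \<omega> = 0"
    and a: "a \<in> L2_proc M T F" and c: "c \<in> L2_proc M T F"
    and N: "\<And>i. i < d \<Longrightarrow> ito_integral M T F (W i) (q i) (N i)"
    and I: "\<And>i. i < d \<Longrightarrow> ito_integral M T F (W i) (e i) (I i)"
    and p_eq: "AE \<omega> in M. \<forall>t\<in>{0..T}. p t \<omega> = p 0 \<omega> + (LINT s|time t. a s \<omega>) + (\<Sum>i<d. N i t \<omega>)"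
    and Z_eq: "AE \<omega> in M. \<forall>t\<in>{0..T}. Z t \<omega> = (LINT s|time t. c s \<omega>) + (\<Sum>i<d. I i t \<omega>)"
  shows "(LINT \<omega>|M. p T \<omega> * Z T \<omega>) =
    (LINT z|PM. flat p z * flat c z + flat a z * flat Z z + (\<Sum>i<d. flat (q i) z * flat (e i) z))"
proof -
  have T: "T \<in> {0..T}" "0 \<in> {0..T}" using T_pos by auto
  define Y where "Y t \<omega> = (\<Sum>i<d. N i t \<omega>)" for t \<omega>
  define X where "X t \<omega> = (\<Sum>i<d. I i t \<omega>)" for t \<omega>
  define A where "A t \<omega> = (LINT s|time t. a s \<omega>)" for t \<omega>
  define C where "C t \<omega> = (LINT s|time t. c s \<omega>)" for t \<omega>
  have Y: "L2_martingale Y" and X: "L2_martingale X"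
    unfolding Y_def[abs_def] X_def[abs_def] using N I by (auto intro!: L2_martingale_sum ito_integral_martingale)
  have p0: "square_integrable M (p 0)" "p 0 \<in> borel_measurable (F 0)"
    using S2_proc_square_integrable(1)[OF p T(2)] progressive_adapted[of borel p 0] p T by (auto simp: S2_proc_def)
  have sq: "square_integrable M (A T)" "square_integrable M (C T)" "square_integrable M (X T)" "square_integrable M (Y T)"
    unfolding A_def C_def using drift_square_integrable[OF a T(1)] drift_square_integrable[OF c T(1)]
      L2_martingaleD(2)[OF X T(1)] L2_martingaleD(2)[OF Y T(1)] by auto
  have fs: "square_integrable PM (flat p)" "square_integrable PM (flat Z)" "square_integrable PM (flat a)"
    "square_integrable PM (flat c)" "square_integrable PM (flat A)" "square_integrable PM (flat C)"
    "square_integrable PM (\<lambda>z. p 0 (snd z))"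
    using S2_proc_square_integrable(2)[OF p] S2_proc_square_integrable(2)[OF Z(1)] a c drift_L2_proc[OF a] drift_L2_proc[OF c]
      square_integrable_PM_snd[OF p0(1)] unfolding L2_proc_iff A_def[abs_def] C_def[abs_def] by auto
  have XR: "AE \<omega> in M. Z t \<omega> - C t \<omega> = X t \<omega>" if "t \<in> {0..T}" for t
    using Z_eq by eventually_elim (use that in \<open>auto simp: X_def C_def\<close>)
  have YR: "AE \<omega> in M. p t \<omega> - p 0 \<omega> - A t \<omega> = Y t \<omega>" if t: "t \<in> {0..T}" for t
    using p_eq
  proof eventually_elim
    case (elim \<omega>)
    then have "p t \<omega> = p 0 \<omega> + A t \<omega> + Y t \<omega>" using t by (simp only: Y_def A_def)
    then show ?case by simp
  qed
  have "AE \<omega> in M. X 0 \<omega> = 0"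
  proof -
    have C0: "C 0 \<omega> = 0" for \<omega> unfolding C_def by (rule time_nonpos_integral) simp
    show ?thesis using XR[OF T(2)] Z(2) by eventually_elim (simp add: C0)
  qed
  \<comment> \<open>\<open>X\<close> is a martingale that starts at zero and \<open>p 0\<close> is
    known at time 0.\<close>
  then have pX: "(LINT \<omega>|M. p 0 \<omega> * X T \<omega>) = 0"
    using L2_martingale_eq[OF X _ _ _ p0(2,1), of T] T
    by (auto intro!: integral_eq_zero_AE elim!: eventually_mono)
  have pC: "(LINT \<omega>|M. p 0 \<omega> * C T \<omega>) = (LINT z|PM. flat c z * p 0 (snd z))"
    using expectation_drift_mult[OF c p0(1)] by (simp add: C_def mult.commute)
  have AX: "(LINT \<omega>|M. A T \<omega> * X T \<omega>) = (LINT z|PM. flat a z * (flat Z z - flat C z))"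
    unfolding A_def using fs by (intro expectation_drift_martingale[OF a X] XR square_integrable_diff)
  have YC: "(LINT \<omega>|M. Y T \<omega> * C T \<omega>) = (LINT z|PM. flat c z * (flat p z - p 0 (snd z) - flat A z))"
  proof -
    have "(LINT \<omega>|M. (LINT t|time T. c t \<omega>) * Y T \<omega>) = (LINT z|PM. flat c z * (flat p z - p 0 (snd z) - flat A z))"
      using fs by (intro expectation_drift_martingale[OF c Y] YR square_integrable_diff)
    then show ?thesis by (simp add: C_def mult.commute)
  qed
  have YX: "(LINT \<omega>|M. Y T \<omega> * X T \<omega>) = (LINT z|PM. (\<Sum>i<d. flat (q i) z * flat (e i) z))"
  proof -
    have sqN: "square_integrable M (N i T)" "square_integrable M (I i T)" if "i < d" for i
      using L2_martingaleD(2)[OF ito_integral_martingale[OF that N[OF that]] T(1)]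
        L2_martingaleD(2)[OF ito_integral_martingale[OF that I[OF that]] T(1)] by auto
    have iso: "(LINT \<omega>|M. N i T \<omega> * I j T \<omega>) = (if i = j then LINT z|PM. flat (q i) z * flat (e i) z else 0)"
      if "i < d" "j < d" for i j
    proof -
      have "(LINT z|PM. indicator {..T} (fst z) * (flat (q i) z * flat (e j) z)) = (LINT z|PM. flat (q i) z * flat (e j) z)"
        by (intro Bochner_Integration.integral_cong) (auto simp: space_PM split: split_indicator)
      then show ?thesis using ito_isometry[OF that N[OF that(1)] I[OF that(2)] T(1)] by auto
    qed
    have "(LINT \<omega>|M. Y T \<omega> * X T \<omega>) = (LINT \<omega>|M. (\<Sum>i<d. \<Sum>j<d. N i T \<omega> * I j T \<omega>))"
      by (simp add: Y_def X_def sum_product)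
    also have "\<dots> = (\<Sum>i<d. \<Sum>j<d. LINT \<omega>|M. N i T \<omega> * I j T \<omega>)"
      using square_integrable_mult[OF sqN(1) sqN(2)]
      by (subst Bochner_Integration.integral_sum)
        (auto intro!: sum.cong Bochner_Integration.integral_sum integrable_sum)
    also have "\<dots> = (\<Sum>i<d. LINT z|PM. flat (q i) z * flat (e i) z)"
      using iso by (intro sum.cong refl) (simp add: sum.delta)
    also have "\<dots> = (LINT z|PM. (\<Sum>i<d. flat (q i) z * flat (e i) z))"
      using ito_integralD(3)[OF N] ito_integralD(3)[OF I]
      by (intro Bochner_Integration.integral_sum[symmetric] square_integrable_mult) auto
    finally show ?thesis .
  qed
  have AC: "(LINT \<omega>|M. A T \<omega> * C T \<omega>) = (LINT z|PM. flat A z * flat c z + flat a z * flat C z)"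
    unfolding A_def C_def by (rule expectation_drift_drift[OF a c])
  note i = square_integrable_mult[of PM] and iM = square_integrable_mult[of M]
  have qe: "integrable PM (\<lambda>z. (\<Sum>i<d. flat (q i) z * flat (e i) z))"
    using ito_integralD(3)[OF N] ito_integralD(3)[OF I] by (intro Bochner_Integration.integrable_sum i) auto
  have "(LINT \<omega>|M. p T \<omega> * Z T \<omega>) = (LINT \<omega>|M. p 0 \<omega> * X T \<omega> + p 0 \<omega> * C T \<omega> + A T \<omega> * X T \<omega>
      + Y T \<omega> * C T \<omega> + Y T \<omega> * X T \<omega> + A T \<omega> * C T \<omega>)"
  proof (rule integral_cong_AE)
    show "(\<lambda>\<omega>. p T \<omega> * Z T \<omega>) \<in> borel_measurable M"
      using square_integrable_measurable[OF S2_proc_square_integrable(1)[OF p T(1)]]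
        square_integrable_measurable[OF S2_proc_square_integrable(1)[OF Z(1) T(1)]] by simp
    show "(\<lambda>\<omega>. p 0 \<omega> * X T \<omega> + p 0 \<omega> * C T \<omega> + A T \<omega> * X T \<omega>
      + Y T \<omega> * C T \<omega> + Y T \<omega> * X T \<omega> + A T \<omega> * C T \<omega>) \<in> borel_measurable M"
      using sq[THEN square_integrable_measurable] square_integrable_measurable[OF p0(1)] by simp
    show "AE \<omega> in M. p T \<omega> * Z T \<omega> = p 0 \<omega> * X T \<omega> + p 0 \<omega> * C T \<omega> + A T \<omega> * X T \<omega>
      + Y T \<omega> * C T \<omega> + Y T \<omega> * X T \<omega> + A T \<omega> * C T \<omega>"
      using XR[OF T(1)] YR[OF T(1)]
    proof eventually_elim
      case (elim \<omega>)
      then have "p T \<omega> = p 0 \<omega> + A T \<omega> + Y T \<omega>" "Z T \<omega> = C T \<omega> + X T \<omega>" by auto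
      then show ?case by (simp add: algebra_simps)
    qed
  qed
  also have "\<dots> = (LINT z|PM. flat c z * p 0 (snd z)) + (LINT z|PM. flat a z * (flat Z z - flat C z))
      + (LINT z|PM. flat c z * (flat p z - p 0 (snd z) - flat A z)) + (LINT z|PM. (\<Sum>i<d. flat (q i) z * flat (e i) z))
      + (LINT z|PM. flat A z * flat c z + flat a z * flat C z)"
    using sq p0(1) by (simp add: iM pX pC AX YC YX AC)
  also have "\<dots> = (LINT z|PM. flat c z * p 0 (snd z) + flat a z * (flat Z z - flat C z)
      + flat c z * (flat p z - p 0 (snd z) - flat A z) + (\<Sum>i<d. flat (q i) z * flat (e i) z)
      + (flat A z * flat c z + flat a z * flat C z))"
    using fs qe i[OF fs(4,7)] i[OF fs(3) square_integrable_diff[OF fs(2,6)]] i[OF fs(5,4)] i[OF fs(3,6)]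
      i[OF fs(4) square_integrable_diff[OF square_integrable_diff[OF fs(1,7)] fs(5)]]
    by (simp only: Bochner_Integration.integral_add Bochner_Integration.integrable_add)
  \<comment> \<open>The pieces reassemble pointwise: \<open>p 0 + (p - p 0 - A) + A = p\<close> in
    front of \<open>c\<close>, and \<open>(Z - C) + C = Z\<close> behind \<open>a\<close>.\<close>
  also have "\<dots> = (LINT z|PM. flat p z * flat c z + flat a z * flat Z z + (\<Sum>i<d. flat (q i) z * flat (e i) z))"
    by (intro Bochner_Integration.integral_cong) (auto simp: algebra_simps)
  finally show ?thesis .
qed

end

lemma integral_linear_combination:
  fixes \<phi> \<psi> :: "'a \<Rightarrow> real"
  assumes "integrable N \<phi>" "integrable N \<psi>"
  shows "(LINT z|N. a * \<phi> z + b * \<psi> z) = a * (LINT z|N. \<phi> z) + b * (LINT z|N. \<psi> z)"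
  using assms by simp

context brownian_basis
begin

text \<open>Costs enter through one-sided quadratic Taylor bounds along the optimal pair: these
  bound the cost of the perturbation from above, and optimality bounds it from below. The resulting
  \<open>0 \<le> \<epsilon> * A + \<epsilon>\<^sup>2 * B\<close> for all positive
  \<open>\<epsilon>\<close> forces \<open>0 \<le> A\<close>.\<close>

theorem stochastic_maximum_principle:
  fixes f :: "real \<Rightarrow> 'a \<Rightarrow> real \<Rightarrow> real \<Rightarrow> real" and g :: "'a \<Rightarrow> real \<Rightarrow> real"
  assumes b: "b1 \<in> borel_measurable borel" "b2 \<in> borel_measurable borel" "\<And>t. \<bar>b1 t\<bar> \<le> L" "\<And>t. \<bar>b2 t\<bar> \<le> L"
    and s: "\<And>i. s1 i \<in> borel_measurable borel" "\<And>i. s2 i \<in> borel_measurable borel"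
      "\<And>i t. \<bar>s1 i t\<bar> \<le> L" "\<And>i t. \<bar>s2 i t\<bar> \<le> L"
    and X: "X \<in> S2_proc M T F" and u: "u \<in> L2_proc M T F"
    and f_meas: "\<And>x v. progressive T F borel x \<Longrightarrow> progressive T F borel v \<Longrightarrow>
      flat (\<lambda>t \<omega>. f t \<omega> (x t \<omega>) (v t \<omega>)) \<in> borel_measurable PM"
    and g_meas: "\<And>x. x \<in> borel_measurable M \<Longrightarrow> (\<lambda>\<omega>. g \<omega> (x \<omega>)) \<in> borel_measurable M"
    and f_growth: "\<And>t \<omega> x v. t \<in> {0..T} \<Longrightarrow> \<omega> \<in> space M \<Longrightarrow> \<bar>f t \<omega> x v\<bar> \<le> C * (\<kappa> (t, \<omega>) + x\<^sup>2 + v\<^sup>2)"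
    and g_growth: "\<And>\<omega> x. \<omega> \<in> space M \<Longrightarrow> \<bar>g \<omega> x\<bar> \<le> C * (\<gamma> \<omega> + x\<^sup>2)"
    and \<kappa>: "integrable PM \<kappa>" and \<gamma>: "integrable M \<gamma>"
    and f_taylor: "\<And>t \<omega> y w. t \<in> {0..T} \<Longrightarrow> \<omega> \<in> space M \<Longrightarrow>
      f t \<omega> (X t \<omega> + y) (u t \<omega> + w) - f t \<omega> (X t \<omega>) (u t \<omega>) \<le> fx t \<omega> * y + fu t \<omega> * w + C * (y\<^sup>2 + w\<^sup>2)"
    and g_taylor: "\<And>\<omega> y. \<omega> \<in> space M \<Longrightarrow> g \<omega> (X T \<omega> + y) - g \<omega> (X T \<omega>) \<le> gx \<omega> * y + C * y\<^sup>2"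
    and fx: "fx \<in> L2_proc M T F" and fu: "fu \<in> L2_proc M T F" and gx: "square_integrable M gx"
    and minimal: "\<And>\<beta> Z I \<epsilon>. \<beta> \<in> L2_proc M T F \<Longrightarrow> Z \<in> S2_proc M T F \<Longrightarrow> AE \<omega> in M. Z 0 \<omega> = 0 \<Longrightarrow>
      AE \<omega> in M. continuous_on {0..T} (\<lambda>t. Z t \<omega>) \<Longrightarrow>
      (\<And>i. i < d \<Longrightarrow> ito_integral M T F (W i) (\<lambda>t \<omega>. s1 i t * Z t \<omega> + s2 i t * \<beta> t \<omega>) (I i)) \<Longrightarrow>
      AE \<omega> in M. \<forall>t\<in>{0..T}. Z t \<omega> = (LINT s|time t. b1 s * Z s \<omega> + b2 s * \<beta> s \<omega>) + (\<Sum>i<d. I i t \<omega>) \<Longrightarrow>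
      0 < \<epsilon> \<Longrightarrow>
      (LINT \<omega>|M. (LINT t:{0..T}|lborel. f t \<omega> (X t \<omega>) (u t \<omega>)) + g \<omega> (X T \<omega>)) \<le>
      (LINT \<omega>|M. (LINT t:{0..T}|lborel. f t \<omega> (X t \<omega> + \<epsilon> * Z t \<omega>) (u t \<omega> + \<epsilon> * \<beta> t \<omega>)) + g \<omega> (X T \<omega> + \<epsilon> * Z T \<omega>))"
    and p: "p \<in> S2_proc M T F"
    and N: "\<And>i. i < d \<Longrightarrow> ito_integral M T F (W i) (q i) (N i)"
    and p_eq: "AE \<omega> in M. \<forall>t\<in>{0..T}. p t \<omega> = p 0 \<omega>
      + (LINT s|time t. - (b1 s * p s \<omega> + (\<Sum>i<d. s1 i s * q i s \<omega>) + fx s \<omega>)) + (\<Sum>i<d. N i t \<omega>)"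
    and p_T: "AE \<omega> in M. p T \<omega> = gx \<omega>"
  shows "AE z in PM. b2 (fst z) * flat p z + (\<Sum>i<d. s2 i (fst z) * flat (q i) z) + flat fu z = 0"
proof -
  have T: "T \<in> {0..T}" using T_pos by simp
  have p_L2: "p \<in> L2_proc M T F" and X_L2: "X \<in> L2_proc M T F" using p X by (auto intro: S2_proc_square_integrable)
  have q_L2: "q i \<in> L2_proc M T F" if "i < d" for i by (rule ito_integralD(1)[OF N[OF that]])
  define h where "h t \<omega> = b2 t * p t \<omega> + (\<Sum>i<d. s2 i t * q i t \<omega>) + fu t \<omega>" for t \<omega>
  define a where "a t \<omega> = - 1 * (b1 t * p t \<omega> + (\<Sum>i<d. s1 i t * q i t \<omega>) + fx t \<omega>)" for t \<omega>
  have h: "h \<in> L2_proc M T F" unfolding h_def[abs_def]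
    using L2_proc_mult_deterministic[OF q_L2 s(2,4)]
    by (intro L2_proc_add L2_proc_sum L2_proc_mult_deterministic[OF p_L2 b(2,4)] fu) auto
  have a: "a \<in> L2_proc M T F" unfolding a_def[abs_def]
  proof (rule L2_proc_mult_deterministic[where L=1])
    show "(\<lambda>t \<omega>. b1 t * p t \<omega> + (\<Sum>i<d. s1 i t * q i t \<omega>) + fx t \<omega>) \<in> L2_proc M T F"
      using L2_proc_mult_deterministic[OF q_L2 s(1,3)]
      by (intro L2_proc_add L2_proc_sum L2_proc_mult_deterministic[OF p_L2 b(1,3)] fx) auto
  qed auto
  \<comment> \<open>Steepest descent for the Hamiltonian in the control. The factor -1 is spelled
    out so that \<open>L2_proc_mult_deterministic\<close> applies, as in \<open>a\<close>.\<close>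
  define \<beta> where "\<beta> t \<omega> = - 1 * h t \<omega>" for t \<omega>
  have \<beta>: "\<beta> \<in> L2_proc M T F" unfolding \<beta>_def[abs_def]
    by (rule L2_proc_mult_deterministic[OF h, of _ 1]) auto
  from linear_sde_exists[of b1 b2 L s1 s2 \<beta>, OF b s \<beta>] obtain Z I where
    Z: "Z \<in> S2_proc M T F" "AE \<omega> in M. Z 0 \<omega> = 0" "AE \<omega> in M. continuous_on {0..T} (\<lambda>t. Z t \<omega>)"
    and I: "\<forall>i<d. ito_integral M T F (W i) (\<lambda>t \<omega>. s1 i t * Z t \<omega> + s2 i t * \<beta> t \<omega>) (I i)"
    and Z_eq: "AE \<omega> in M. \<forall>t\<in>{0..T}. Z t \<omega> = (LINT s|time t. b1 s * Z s \<omega> + b2 s * \<beta> s \<omega>) + (\<Sum>i<d. I i t \<omega>)"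
    by (elim exE conjE) blast
  note I = I[rule_format]
  have Z_L2: "Z \<in> L2_proc M T F" by (rule S2_proc_square_integrable(2)[OF Z(1)])
  have c: "(\<lambda>t \<omega>. b1 t * Z t \<omega> + b2 t * \<beta> t \<omega>) \<in> L2_proc M T F"
    by (intro L2_proc_add L2_proc_mult_deterministic[OF Z_L2 b(1,3)] L2_proc_mult_deterministic[OF \<beta> b(2,4)])
  have sq: "square_integrable PM (flat Z)" "square_integrable PM (flat \<beta>)" "square_integrable PM (flat fx)"
    "square_integrable PM (flat fu)" "square_integrable PM (flat X)" "square_integrable PM (flat u)"
    "square_integrable PM (flat h)"
    using Z_L2 \<beta> fx fu X_L2 u h by (auto simp: L2_proc_iff)
  have pr: "progressive T F borel Z" "progressive T F borel \<beta>" "progressive T F borel X" "progressive T F borel u"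
    using Z_L2 \<beta> X_L2 u by (auto simp: L2_proc_iff)
  have sqT: "square_integrable M (X T)" "square_integrable M (Z T)"
    using S2_proc_square_integrable(1)[OF X T] S2_proc_square_integrable(1)[OF Z(1) T] by auto
  define J where "J x v = (LINT \<omega>|M. (LINT t:{0..T}|lborel. f t \<omega> (x t \<omega>) (v t \<omega>)) + g \<omega> (x T \<omega>))" for x v
  have fint: "integrable PM (flat (\<lambda>t \<omega>. f t \<omega> (x t \<omega>) (v t \<omega>)))"
    if "x \<in> L2_proc M T F" "v \<in> L2_proc M T F" for x v
  proof (rule Bochner_Integration.integrable_bound)
    show "integrable PM (\<lambda>z. C * (\<kappa> z + (flat x z)\<^sup>2 + (flat v z)\<^sup>2))"
      using that \<kappa> by (auto simp: L2_proc_iff square_integrable_def)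
    show "flat (\<lambda>t \<omega>. f t \<omega> (x t \<omega>) (v t \<omega>)) \<in> borel_measurable PM"
      using that by (intro f_meas) (auto simp: L2_proc_iff)
    show "AE z in PM. norm (flat (\<lambda>t \<omega>. f t \<omega> (x t \<omega>) (v t \<omega>)) z) \<le> norm (C * (\<kappa> z + (flat x z)\<^sup>2 + (flat v z)\<^sup>2))"
    proof (rule AE_I2)
      fix z assume "z \<in> space PM"
      then have "\<bar>f (fst z) (snd z) (flat x z) (flat v z)\<bar> \<le> C * (\<kappa> (fst z, snd z) + (flat x z)\<^sup>2 + (flat v z)\<^sup>2)"
        by (intro f_growth) (auto simp: space_PM)
      then show "norm (flat (\<lambda>t \<omega>. f t \<omega> (x t \<omega>) (v t \<omega>)) z) \<le> norm (C * (\<kappa> z + (flat x z)\<^sup>2 + (flat v z)\<^sup>2))"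
        by simp
    qed
  qed
  have gint: "integrable M (\<lambda>\<omega>. g \<omega> (x \<omega>))" if "square_integrable M x" for x
  proof (rule Bochner_Integration.integrable_bound)
    show "integrable M (\<lambda>\<omega>. C * (\<gamma> \<omega> + (x \<omega>)\<^sup>2))" using that \<gamma> by (auto simp: square_integrable_def)
    show "(\<lambda>\<omega>. g \<omega> (x \<omega>)) \<in> borel_measurable M" using that by (intro g_meas) (simp add: square_integrable_def)
    show "AE \<omega> in M. norm (g \<omega> (x \<omega>)) \<le> norm (C * (\<gamma> \<omega> + (x \<omega>)\<^sup>2))"
      using g_growth by (intro AE_I2) (force intro: order_trans[OF _ abs_ge_self])
  qed
  have J_eq: "J x v = (LINT z|PM. flat (\<lambda>t \<omega>. f t \<omega> (x t \<omega>) (v t \<omega>)) z) + (LINT \<omega>|M. g \<omega> (x T \<omega>))"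
    if "x \<in> L2_proc M T F" "v \<in> L2_proc M T F" "square_integrable M (x T)" for x v
  proof -
    have "integrable M (\<lambda>\<omega>. LINT t|time T. f t \<omega> (x t \<omega>) (v t \<omega>))"
      using PM.integrable_snd[of "\<lambda>t \<omega>. f t \<omega> (x t \<omega>) (v t \<omega>)"] fint[OF that(1,2)] by (simp add: case_prod_beta')
    then show ?thesis
      unfolding J_def set_integral_time
      using gint[OF that(3)] integral_PM_snd[OF fint[OF that(1,2)]] by simp
  qed
  define A where "A = (LINT z|PM. flat fx z * flat Z z + flat fu z * flat \<beta> z) + (LINT \<omega>|M. gx \<omega> * Z T \<omega>)"
  define B where "B = (LINT z|PM. C * ((flat Z z)\<^sup>2 + (flat \<beta> z)\<^sup>2)) + (LINT \<omega>|M. C * (Z T \<omega>)\<^sup>2)"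
  have var: "0 \<le> \<epsilon> * A + \<epsilon>\<^sup>2 * B" if \<epsilon>: "0 < \<epsilon>" for \<epsilon>
  proof -
    have XZ: "(\<lambda>t \<omega>. X t \<omega> + \<epsilon> * Z t \<omega>) \<in> L2_proc M T F" "(\<lambda>t \<omega>. u t \<omega> + \<epsilon> * \<beta> t \<omega>) \<in> L2_proc M T F"
      "square_integrable M (\<lambda>\<omega>. X T \<omega> + \<epsilon> * Z T \<omega>)"
      using L2_proc_mult_deterministic[OF Z_L2, of "\<lambda>_. \<epsilon>" "\<bar>\<epsilon>\<bar>"] L2_proc_mult_deterministic[OF \<beta>, of "\<lambda>_. \<epsilon>" "\<bar>\<epsilon>\<bar>"]
      by (auto intro!: L2_proc_add X_L2 u square_integrable_add square_integrable_cmult sqT)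
    have "J X u \<le> J (\<lambda>t \<omega>. X t \<omega> + \<epsilon> * Z t \<omega>) (\<lambda>t \<omega>. u t \<omega> + \<epsilon> * \<beta> t \<omega>)"
      unfolding J_def by (rule minimal[OF \<beta> Z I Z_eq \<epsilon>])
    then have "0 \<le> (LINT z|PM. flat (\<lambda>t \<omega>. f t \<omega> (X t \<omega> + \<epsilon> * Z t \<omega>) (u t \<omega> + \<epsilon> * \<beta> t \<omega>)) z)
        - (LINT z|PM. flat (\<lambda>t \<omega>. f t \<omega> (X t \<omega>) (u t \<omega>)) z)
        + ((LINT \<omega>|M. g \<omega> (X T \<omega> + \<epsilon> * Z T \<omega>)) - (LINT \<omega>|M. g \<omega> (X T \<omega>)))"
      using J_eq[OF X_L2 u sqT(1)] J_eq[OF XZ] by simp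
    also have "\<dots> = (LINT z|PM. flat (\<lambda>t \<omega>. f t \<omega> (X t \<omega> + \<epsilon> * Z t \<omega>) (u t \<omega> + \<epsilon> * \<beta> t \<omega>)) z
          - flat (\<lambda>t \<omega>. f t \<omega> (X t \<omega>) (u t \<omega>)) z)
        + (LINT \<omega>|M. g \<omega> (X T \<omega> + \<epsilon> * Z T \<omega>) - g \<omega> (X T \<omega>))"
      using fint[OF XZ(1,2)] fint[OF X_L2 u] gint[OF XZ(3)] gint[OF sqT(1)] by simp
    also have "\<dots> \<le> (LINT z|PM. \<epsilon> * (flat fx z * flat Z z + flat fu z * flat \<beta> z) + \<epsilon>\<^sup>2 * (C * ((flat Z z)\<^sup>2 + (flat \<beta> z)\<^sup>2)))
        + (LINT \<omega>|M. \<epsilon> * (gx \<omega> * Z T \<omega>) + \<epsilon>\<^sup>2 * (C * (Z T \<omega>)\<^sup>2))"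
    proof (intro add_mono integral_mono)
      show "integrable PM (\<lambda>z. flat (\<lambda>t \<omega>. f t \<omega> (X t \<omega> + \<epsilon> * Z t \<omega>) (u t \<omega> + \<epsilon> * \<beta> t \<omega>)) z
          - flat (\<lambda>t \<omega>. f t \<omega> (X t \<omega>) (u t \<omega>)) z)"
        using fint[OF XZ(1,2)] fint[OF X_L2 u] by (rule Bochner_Integration.integrable_diff)
      show "integrable PM (\<lambda>z. \<epsilon> * (flat fx z * flat Z z + flat fu z * flat \<beta> z) + \<epsilon>\<^sup>2 * (C * ((flat Z z)\<^sup>2 + (flat \<beta> z)\<^sup>2)))"
        using square_integrable_mult[OF sq(3,1)] square_integrable_mult[OF sq(4,2)]
          square_integrable_integrable_power2[OF sq(1)] square_integrable_integrable_power2[OF sq(2)]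
        by (intro Bochner_Integration.integrable_add integrable_mult_right)
      show "integrable M (\<lambda>\<omega>. g \<omega> (X T \<omega> + \<epsilon> * Z T \<omega>) - g \<omega> (X T \<omega>))"
        using gint[OF XZ(3)] gint[OF sqT(1)] by (rule Bochner_Integration.integrable_diff)
      show "integrable M (\<lambda>\<omega>. \<epsilon> * (gx \<omega> * Z T \<omega>) + \<epsilon>\<^sup>2 * (C * (Z T \<omega>)\<^sup>2))"
        using square_integrable_mult[OF gx sqT(2)] square_integrable_integrable_power2[OF sqT(2)]
        by (intro Bochner_Integration.integrable_add integrable_mult_right)
    next
      fix z assume "z \<in> space PM"
      then have "fst z \<in> {0..T}" "snd z \<in> space M" by (auto simp: space_PM)
      from f_taylor[OF this, of "\<epsilon> * flat Z z" "\<epsilon> * flat \<beta> z"]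
      show "flat (\<lambda>t \<omega>. f t \<omega> (X t \<omega> + \<epsilon> * Z t \<omega>) (u t \<omega> + \<epsilon> * \<beta> t \<omega>)) z - flat (\<lambda>t \<omega>. f t \<omega> (X t \<omega>) (u t \<omega>)) z
        \<le> \<epsilon> * (flat fx z * flat Z z + flat fu z * flat \<beta> z) + \<epsilon>\<^sup>2 * (C * ((flat Z z)\<^sup>2 + (flat \<beta> z)\<^sup>2))"
        by (simp add: power_mult_distrib algebra_simps)
    next
      fix \<omega> assume "\<omega> \<in> space M"
      from g_taylor[OF this, of "\<epsilon> * Z T \<omega>"]
      show "g \<omega> (X T \<omega> + \<epsilon> * Z T \<omega>) - g \<omega> (X T \<omega>) \<le> \<epsilon> * (gx \<omega> * Z T \<omega>) + \<epsilon>\<^sup>2 * (C * (Z T \<omega>)\<^sup>2)"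
        by (simp add: power_mult_distrib algebra_simps)
    qed
    also have "\<dots> = \<epsilon> * A + \<epsilon>\<^sup>2 * B"
    proof -
      have 1: "integrable PM (\<lambda>z. flat fx z * flat Z z + flat fu z * flat \<beta> z)"
        using square_integrable_mult[OF sq(3,1)] square_integrable_mult[OF sq(4,2)] by (rule Bochner_Integration.integrable_add)
      have 2: "integrable PM (\<lambda>z. C * ((flat Z z)\<^sup>2 + (flat \<beta> z)\<^sup>2))"
        using square_integrable_integrable_power2[OF sq(1)] square_integrable_integrable_power2[OF sq(2)]
        by (intro integrable_mult_right Bochner_Integration.integrable_add)
      have 3: "integrable M (\<lambda>\<omega>. gx \<omega> * Z T \<omega>)" by (rule square_integrable_mult[OF gx sqT(2)])
      have 4: "integrable M (\<lambda>\<omega>. C * (Z T \<omega>)\<^sup>2)"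
        by (intro integrable_mult_right square_integrable_integrable_power2[OF sqT(2)])
      show ?thesis unfolding A_def B_def integral_linear_combination[OF 1 2] integral_linear_combination[OF 3 4]
        by (simp only: distrib_left add_ac)
    qed
    finally show ?thesis .
  qed
  have A0: "0 \<le> A"
  proof (rule ccontr)
    assume "\<not> 0 \<le> A"
    \<comment> \<open>With this choice \<open>\<epsilon> * B \<le> - A / 2\<close>, so
      \<open>A + \<epsilon> * B\<close> would be at most \<open>A / 2\<close>, hence
      negative.\<close>
    define \<epsilon> where "\<epsilon> = - A / (2 * (\<bar>B\<bar> + 1))"
    have \<epsilon>: "0 < \<epsilon>" unfolding \<epsilon>_def using \<open>\<not> 0 \<le> A\<close> by (intro divide_pos_pos) auto
    have "0 \<le> \<epsilon> * (A + \<epsilon> * B)" using var[OF \<epsilon>] by (simp add: power2_eq_square algebra_simps)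
    then have "0 \<le> A + \<epsilon> * B" using \<epsilon> by (simp add: zero_le_mult_iff)
    moreover have "\<epsilon> * B \<le> \<epsilon> * (\<bar>B\<bar> + 1)" using \<epsilon> by (intro mult_left_mono) auto
    moreover have "\<epsilon> * (\<bar>B\<bar> + 1) = - A / 2" unfolding \<epsilon>_def by (simp add: field_simps)
    ultimately show False using \<open>\<not> 0 \<le> A\<close> by linarith
  qed
  have "(LINT \<omega>|M. gx \<omega> * Z T \<omega>) = (LINT \<omega>|M. p T \<omega> * Z T \<omega>)"
  proof (rule integral_cong_AE)
    show "(\<lambda>\<omega>. gx \<omega> * Z T \<omega>) \<in> borel_measurable M" "(\<lambda>\<omega>. p T \<omega> * Z T \<omega>) \<in> borel_measurable M"
      using gx[THEN square_integrable_measurable] sqT(2)[THEN square_integrable_measurable]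
        square_integrable_measurable[OF S2_proc_square_integrable(1)[OF p T]] by auto
    show "AE \<omega> in M. gx \<omega> * Z T \<omega> = p T \<omega> * Z T \<omega>" using p_T by eventually_elim simp
  qed
  also have "\<dots> = (LINT z|PM. flat p z * flat (\<lambda>t \<omega>. b1 t * Z t \<omega> + b2 t * \<beta> t \<omega>) z + flat a z * flat Z z
      + (\<Sum>i<d. flat (q i) z * flat (\<lambda>t \<omega>. s1 i t * Z t \<omega> + s2 i t * \<beta> t \<omega>) z))"
    using p_eq by (intro ito_duality[OF p Z(1,2) a c N I _ Z_eq]) (auto simp: a_def)
  finally have gxZ: "(LINT \<omega>|M. gx \<omega> * Z T \<omega>) = \<dots>" .
  have int: "integrable PM (\<lambda>z. flat p z * flat (\<lambda>t \<omega>. b1 t * Z t \<omega> + b2 t * \<beta> t \<omega>) z + flat a z * flat Z z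
      + (\<Sum>i<d. flat (q i) z * flat (\<lambda>t \<omega>. s1 i t * Z t \<omega> + s2 i t * \<beta> t \<omega>) z))"
    using p_L2 c a sq(1) q_L2 ito_integralD(3)[OF I]
    by (intro Bochner_Integration.integrable_add Bochner_Integration.integrable_sum square_integrable_mult)
      (auto simp: L2_proc_iff)
  have int': "integrable PM (\<lambda>z. flat fx z * flat Z z + flat fu z * flat \<beta> z)"
    using square_integrable_mult[OF sq(3,1)] square_integrable_mult[OF sq(4,2)] by (rule Bochner_Integration.integrable_add)
  have "A = (LINT z|PM. (flat fx z * flat Z z + flat fu z * flat \<beta> z)
      + (flat p z * flat (\<lambda>t \<omega>. b1 t * Z t \<omega> + b2 t * \<beta> t \<omega>) z + flat a z * flat Z z
      + (\<Sum>i<d. flat (q i) z * flat (\<lambda>t \<omega>. s1 i t * Z t \<omega> + s2 i t * \<beta> t \<omega>) z)))"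
    unfolding A_def gxZ using int' int by (rule Bochner_Integration.integral_add[symmetric])
  \<comment> \<open>The adjoint drift \<open>a\<close> cancels every term in \<open>Z\<close>; what
    is left is \<open>h * \<beta>\<close>, and \<open>\<beta> = - h\<close>.\<close>
  also have "\<dots> = (LINT z|PM. - (flat h z)\<^sup>2)"
  proof (rule Bochner_Integration.integral_cong[OF refl])
    fix z
    have "(\<Sum>i<d. flat (q i) z * (s1 i (fst z) * flat Z z + s2 i (fst z) * flat \<beta> z)) =
      (\<Sum>i<d. s1 i (fst z) * flat (q i) z) * flat Z z + (\<Sum>i<d. s2 i (fst z) * flat (q i) z) * flat \<beta> z"
      by (simp add: sum_distrib_left sum.distrib distrib_left mult_ac)
    then have "(flat fx z * flat Z z + flat fu z * flat \<beta> z)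
      + (flat p z * (b1 (fst z) * flat Z z + b2 (fst z) * flat \<beta> z) + flat a z * flat Z z
      + (\<Sum>i<d. flat (q i) z * (s1 i (fst z) * flat Z z + s2 i (fst z) * flat \<beta> z))) = flat h z * flat \<beta> z"
      by (simp add: h_def a_def algebra_simps)
    then show "(flat fx z * flat Z z + flat fu z * flat \<beta> z)
      + (flat p z * flat (\<lambda>t \<omega>. b1 t * Z t \<omega> + b2 t * \<beta> t \<omega>) z + flat a z * flat Z z
      + (\<Sum>i<d. flat (q i) z * flat (\<lambda>t \<omega>. s1 i t * Z t \<omega> + s2 i t * \<beta> t \<omega>) z)) = - (flat h z)\<^sup>2"
      by (simp add: \<beta>_def power2_eq_square)
  qed
  finally have "(LINT z|PM. (flat h z)\<^sup>2) \<le> 0" using A0 by simp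
  then have "(LINT z|PM. (flat h z)\<^sup>2) = 0" by (intro antisym) auto
  then have "AE z in PM. (flat h z)\<^sup>2 = 0"
    using integral_nonneg_eq_0_iff_AE[OF square_integrable_integrable_power2[OF sq(7)]] by simp
  then show ?thesis by eventually_elim (simp add: h_def)
qed

end

section \<open>Brownian motions of the setting\<close>

lemma rv_generator_subset: "rv_generator M V \<subseteq> Pow (space M)"
  by (auto simp: rv_generator_def)

lemma rv_events_subset_events:
  assumes "\<And>Z. Z \<in> V \<Longrightarrow> Z \<in> borel_measurable M"
  shows "rv_events M V \<subseteq> sets M"
  unfolding rv_events_def
  by (rule sets.sigma_sets_subset) (auto simp: rv_generator_def intro: measurable_sets assms)

lemma rv_events_mono: "V \<subseteq> V' \<Longrightarrow> rv_events M V \<subseteq> rv_events M V'"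
  unfolding rv_events_def by (rule sigma_sets_mono') (auto simp: rv_generator_def)

lemma sigma_algebra_rv_events: "sigma_algebra (space M) (rv_events M V)"
  unfolding rv_events_def by (rule sigma_algebra_sigma_sets[OF rv_generator_subset])

lemma rv_events_Int: "a \<in> rv_events M V \<Longrightarrow> b \<in> rv_events M V \<Longrightarrow> a \<inter> b \<in> rv_events M V"
  using sigma_algebra_rv_events[of M V] by (meson algebra.axioms(1) ring_of_sets.axioms(1) semiring_of_sets.Int sigma_algebra.axioms(1) sigma_algebra_iff algebra_iff_Int)

lemma space_in_rv_events: "space M \<in> rv_events M V"
  unfolding rv_events_def by (rule sigma_sets_top)

lemma rv_eventsI: "Z \<in> V \<Longrightarrow> A \<in> sets borel \<Longrightarrow> Z -` A \<inter> space M \<in> rv_events M V"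
  unfolding rv_events_def by (rule sigma_sets.Basic) (auto simp: rv_generator_def)

lemma rv_events_measurable:
  assumes "Z \<in> borel_measurable (sigma (space M) (rv_generator M V))"
  shows "rv_events M {Z} \<subseteq> rv_events M V"
proof -
  have sp: "space (sigma (space M) (rv_generator M V)) = space M"
    by (rule space_measure_of) (rule rv_generator_subset)
  have st: "sets (sigma (space M) (rv_generator M V)) = rv_events M V"
    unfolding rv_events_def by (rule sets_measure_of) (rule rv_generator_subset)
  have "rv_generator M {Z} \<subseteq> rv_events M V"
    using measurable_sets[OF assms, unfolded sp st] by (auto simp: rv_generator_def)
  then show ?thesis
    using sigma_algebra.sigma_sets_subset[OF sigma_algebra_rv_events] unfolding rv_events_def[of M "{Z}"] by metis
qed

lemma measurable_sigma_rv_generator: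
  assumes "Z \<in> V"
  shows "Z \<in> borel_measurable (sigma (space M) (rv_generator M V))"
proof (rule measurableI)
  have sp: "space (sigma (space M) (rv_generator M V)) = space M"
    by (rule space_measure_of) (rule rv_generator_subset)
  have st: "sets (sigma (space M) (rv_generator M V)) = rv_events M V"
    unfolding rv_events_def by (rule sets_measure_of) (rule rv_generator_subset)
  show "Z -` A \<inter> space (sigma (space M) (rv_generator M V)) \<in> sets (sigma (space M) (rv_generator M V))"
    if "A \<in> sets borel" for A
    unfolding sp st by (rule rv_eventsI[OF assms that])
qed simp

lemma space_augmented_sigma: "space (augmented_sigma M V) = space M"
  unfolding augmented_sigma_def
  by (rule space_measure_of) (use rv_generator_subset sets.sets_into_space in blast)

lemma sets_augmented_sigma: "sets (augmented_sigma M V) = sigma_sets (space M) (rv_generator M V \<union> null_sets M)"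
  unfolding augmented_sigma_def
  by (rule sets_measure_of) (use rv_generator_subset sets.sets_into_space in blast)

lemma sets_augmented_sigma_mono: "V \<subseteq> V' \<Longrightarrow> sets (augmented_sigma M V) \<subseteq> sets (augmented_sigma M V')"
  unfolding sets_augmented_sigma by (rule sigma_sets_mono') (auto simp: rv_generator_def)

lemma sets_augmented_sigma_subset:
  assumes "\<And>Z. Z \<in> V \<Longrightarrow> Z \<in> borel_measurable M"
  shows "sets (augmented_sigma M V) \<subseteq> sets M"
  unfolding sets_augmented_sigma
  by (rule sets.sigma_sets_subset) (auto simp: rv_generator_def intro: measurable_sets assms)

lemma null_sets_augmented_sigma: "null_sets M \<subseteq> sets (augmented_sigma M V)"
  unfolding sets_augmented_sigma by (auto intro: sigma_sets.Basic)

lemma measurable_augmented_sigma: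
  assumes "Z \<in> V"
  shows "Z \<in> borel_measurable (augmented_sigma M V)"
proof (rule measurableI)
  show "Z -` A \<inter> space (augmented_sigma M V) \<in> sets (augmented_sigma M V)" if "A \<in> sets borel" for A
    unfolding space_augmented_sigma sets_augmented_sigma using assms that
    by (intro sigma_sets.Basic) (auto simp: rv_generator_def)
qed simp

lemma measurable_augmented_sigma_mono:
  assumes "f \<in> measurable (augmented_sigma M V) N" "V \<subseteq> V'"
  shows "f \<in> measurable (augmented_sigma M V') N"
  by (rule measurable_from_subalg[OF _ assms(1)])
    (simp add: subalgebra_def space_augmented_sigma sets_augmented_sigma_mono assms(2))

text \<open>Augmentation changes events only by null sets; complements and countable unions preserve
  this.\<close>

lemma augmented_sigma_AE_eq:
  assumes "A \<in> sets (augmented_sigma M V)"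
  shows "\<exists>A'\<in>rv_events M V. AE \<omega> in M. \<omega> \<in> A \<longleftrightarrow> \<omega> \<in> A'"
  using assms unfolding sets_augmented_sigma
proof (induction rule: sigma_sets.induct)
  case (Basic A)
  show ?case
  proof (cases "A \<in> rv_generator M V")
    case True
    then show ?thesis by (intro bexI[of _ A]) (auto simp: rv_events_def)
  next
    case False
    then have "A \<in> null_sets M" using Basic by simp
    then have "AE \<omega> in M. \<omega> \<notin> A" by (rule AE_not_in)
    then show ?thesis by (intro bexI[of _ "{}"]) (auto simp: rv_events_def intro: sigma_sets.Empty)
  qed
next
  case Empty
  then show ?case by (intro bexI[of _ "{}"]) (auto simp: rv_events_def intro: sigma_sets.Empty)
next
  case (Compl A)
  then obtain A' where A': "A' \<in> rv_events M V" "AE \<omega> in M. \<omega> \<in> A \<longleftrightarrow> \<omega> \<in> A'" by blast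
  show ?case
  proof (rule bexI)
    show "AE \<omega> in M. \<omega> \<in> space M - A \<longleftrightarrow> \<omega> \<in> space M - A'" using A'(2) by eventually_elim simp
    show "space M - A' \<in> rv_events M V" using A'(1) unfolding rv_events_def by (rule sigma_sets.Compl)
  qed
next
  case (Union A)
  then have "\<forall>n. \<exists>A'\<in>rv_events M V. AE \<omega> in M. \<omega> \<in> A n \<longleftrightarrow> \<omega> \<in> A'" by blast
  then obtain A' where A': "\<And>n. A' n \<in> rv_events M V" "\<And>n. AE \<omega> in M. \<omega> \<in> A n \<longleftrightarrow> \<omega> \<in> A' n" by metis
  show ?case
  proof (rule bexI)
    have "AE \<omega> in M. \<forall>n. \<omega> \<in> A n \<longleftrightarrow> \<omega> \<in> A' n" using A'(2) by (simp add: AE_all_countable)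
    then show "AE \<omega> in M. \<omega> \<in> (\<Union>n. A n) \<longleftrightarrow> \<omega> \<in> (\<Union>n. A' n)" by eventually_elim simp
    show "(\<Union>n. A' n) \<in> rv_events M V" using A'(1) unfolding rv_events_def by (intro sigma_sets.Union)
  qed
qed

section \<open>Independence of Brownian increments from the past\<close>

context prob_space
begin

lemma indep_set_sigma:
  assumes "indep_set A B" "Int_stable A" "Int_stable B"
  shows "indep_set (sigma_sets (space M) A) (sigma_sets (space M) B)"
proof -
  have "indep_sets (\<lambda>i. sigma_sets (space M) (case_bool A B i)) UNIV"
    using assms unfolding indep_set_def by (intro indep_sets_sigma) (auto split: bool.split)
  then show ?thesis unfolding indep_set_def by (rule indep_sets_mono_sets) (auto split: bool.split)
qed

text \<open>Replace an augmented event by an almost surely equal one that is not augmented;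
  probabilities do not notice.\<close>

lemma indep_set_augmented_sigma:
  assumes i: "indep_set \<I> (rv_events M V)" and V: "\<And>Z. Z \<in> V \<Longrightarrow> Z \<in> borel_measurable M"
  shows "indep_set \<I> (sets (augmented_sigma M V))"
proof (rule indep_setI)
  show I: "\<I> \<subseteq> events" by (rule indep_setD_ev1[OF i])
  show S: "sets (augmented_sigma M V) \<subseteq> events" by (rule sets_augmented_sigma_subset[OF V])
  fix a b assume a: "a \<in> \<I>" and b: "b \<in> sets (augmented_sigma M V)"
  then obtain b' where b': "b' \<in> rv_events M V" "AE \<omega> in M. \<omega> \<in> b \<longleftrightarrow> \<omega> \<in> b'"
    using augmented_sigma_AE_eq by blast
  have ev: "a \<in> events" "b \<in> events" "b' \<in> events"
    using a b b'(1) I S rv_events_subset_events[OF V] by auto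
  have "prob b = prob b'" "prob (a \<inter> b) = prob (a \<inter> b')"
    using b'(2) ev by (auto intro!: finite_measure_eq_AE elim!: eventually_mono)
  then show "prob (a \<inter> b) = prob a * prob b" using indep_setD[OF i a b'(1)] by simp
qed

text \<open>Used with \<open>\<phi>\<close> the identity for the martingale property and with
  \<open>\<phi>\<close> the square for the bracket.\<close>

lemma indep_expectation_mult:
  fixes x \<xi> :: "'a \<Rightarrow> real" and \<phi> :: "real \<Rightarrow> real"
  assumes i: "indep_set (rv_events M {x}) (sets G)" and G: "sets G \<subseteq> events" "space G = space M"
    and x: "x \<in> borel_measurable M" and \<phi>: "\<phi> \<in> borel_measurable borel" "integrable M (\<lambda>\<omega>. \<phi> (x \<omega>))"
    and \<xi>: "\<xi> \<in> borel_measurable G" "integrable M \<xi>"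
  shows "expectation (\<lambda>\<omega>. \<xi> \<omega> * \<phi> (x \<omega>)) = expectation \<xi> * expectation (\<lambda>\<omega>. \<phi> (x \<omega>))"
proof -
  have \<xi>M: "\<xi> \<in> borel_measurable M"
    by (rule measurable_from_subalg[OF _ \<xi>(1)]) (simp add: subalgebra_def G)
  have "indep_var borel (\<lambda>\<omega>. \<phi> (x \<omega>)) borel \<xi>"
    unfolding indep_var_eq
  proof (intro conjI)
    show "(\<lambda>\<omega>. \<phi> (x \<omega>)) \<in> borel_measurable M" using x \<phi>(1) by simp
    show "\<xi> \<in> borel_measurable M" by (rule \<xi>M)
    have "sigma_sets (space M) {(\<lambda>\<omega>. \<phi> (x \<omega>)) -` A \<inter> space M | A. A \<in> sets borel} \<subseteq> rv_events M {x}"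
    proof (rule sigma_algebra.sigma_sets_subset[OF sigma_algebra_rv_events], safe)
      fix A :: "real set" assume "A \<in> sets borel"
      then have "\<phi> -` A \<in> sets borel" using measurable_sets[OF \<phi>(1)] by simp
      from rv_eventsI[OF singletonI this, of x M]
      show "(\<lambda>\<omega>. \<phi> (x \<omega>)) -` A \<inter> space M \<in> rv_events M {x}" by (simp add: vimage_def)
    qed
    moreover have "sigma_sets (space M) {\<xi> -` A \<inter> space M | A. A \<in> sets borel} \<subseteq> sets G"
      using measurable_sets[OF \<xi>(1)] unfolding G(2)[symmetric] by (intro sets.sigma_sets_subset) auto
    ultimately show "indep_set (sigma_sets (space M) {(\<lambda>\<omega>. \<phi> (x \<omega>)) -` A \<inter> space M | A. A \<in> sets borel})
        (sigma_sets (space M) {\<xi> -` A \<inter> space M | A. A \<in> sets borel})"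
      using indep_setD[OF i] indep_setD_ev1[OF i] G(1) by (intro indep_setI) blast+
  qed
  from indep_var_lebesgue_integral[OF this \<phi>(2) \<xi>(2)] show ?thesis by (simp add: mult.commute)
qed

text \<open>The increment of \<open>V\<close> after \<open>s\<close> is independent of the past of \<open>V\<close> together with the whole
  path of \<open>U\<close>; the latter gives the vanishing bracket of \<open>U\<close> and \<open>V\<close>.\<close>

lemma indep_increment:
  assumes ind: "\<And>a b c e. a \<in> rv_events M {x} \<Longrightarrow> b \<in> rv_events M {y} \<Longrightarrow> c \<in> rv_events M (U ` {0..T}) \<Longrightarrow>
      e \<in> rv_events M (V ` {0..T}) \<Longrightarrow> prob (a \<inter> b \<inter> c \<inter> e) = prob a * prob b * prob c * prob e"
    and m: "x \<in> borel_measurable M" "y \<in> borel_measurable M" "\<And>t. t \<in> {0..T} \<Longrightarrow> U t \<in> borel_measurable M"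
    and V: "brownian_motion M T V" and st: "0 \<le> s" "s < t" "t \<le> T"
  shows "indep_set (rv_events M {\<lambda>\<omega>. V t \<omega> - V s \<omega>}) (sets (augmented_sigma M ({x, y} \<union> U ` {0..T} \<union> V ` {0..s})))"
proof (rule indep_set_augmented_sigma)
  let ?\<I> = "rv_events M {\<lambda>\<omega>. V t \<omega> - V s \<omega>}" and ?H = "rv_events M (V ` {0..s})"
  have Vm: "V r \<in> borel_measurable M" if "r \<in> {0..T}" for r
    using V that by (auto simp: brownian_motion_def)
  have iH: "indep_set ?\<I> ?H" using V st by (auto simp: brownian_motion_def)
  show "\<And>Z. Z \<in> {x, y} \<union> U ` {0..T} \<union> V ` {0..s} \<Longrightarrow> Z \<in> borel_measurable M"
    using m Vm st by auto
  \<comment> \<open>Rectangles of events of the four sources: stable under intersection and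
    generating, so independence on them extends to the whole sigma-algebra.\<close>
  define \<G> where "\<G> = {a \<inter> b \<inter> c \<inter> h | a b c h. a \<in> rv_events M {x} \<and> b \<in> rv_events M {y} \<and>
    c \<in> rv_events M (U ` {0..T}) \<and> h \<in> ?H}"
  have HE: "?H \<subseteq> rv_events M (V ` {0..T})" using st by (intro rv_events_mono) auto
  \<comment> \<open>An increment event is an event of the full path of \<open>V\<close>. So in the
    fourfold product formula \<open>i \<inter> h\<close> counts as a single event of
    \<open>V\<close>, and its probability splits by the independence of \<open>V\<close>'s own
    increments.\<close>
  have IE: "?\<I> \<subseteq> rv_events M (V ` {0..T})"
  proof (rule rv_events_measurable)
    show "(\<lambda>\<omega>. V t \<omega> - V s \<omega>) \<in> borel_measurable (sigma (space M) (rv_generator M (V ` {0..T})))"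
      using st by (intro borel_measurable_diff measurable_sigma_rv_generator) auto
  qed
  have xe: "rv_events M {x} \<subseteq> events" and ye: "rv_events M {y} \<subseteq> events" and Ue: "rv_events M (U ` {0..T}) \<subseteq> events"
    and Ve: "rv_events M (V ` {0..T}) \<subseteq> events"
    using m Vm by (auto intro!: rv_events_subset_events)
  have "indep_set ?\<I> \<G>"
  proof (rule indep_setI)
    show "?\<I> \<subseteq> events" using IE Ve by blast
    show "\<G> \<subseteq> events" using xe ye Ue HE Ve unfolding \<G>_def by blast
    fix i g assume i: "i \<in> ?\<I>" and "g \<in> \<G>"
    then obtain a b c h where g: "g = a \<inter> b \<inter> c \<inter> h" "a \<in> rv_events M {x}" "b \<in> rv_events M {y}"
      "c \<in> rv_events M (U ` {0..T})" "h \<in> ?H" unfolding \<G>_def by blast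
    have "prob (i \<inter> g) = prob (a \<inter> b \<inter> c \<inter> (i \<inter> h))" unfolding g(1) by (simp add: Int_ac)
    also have "\<dots> = prob a * prob b * prob c * prob (i \<inter> h)"
      using g i IE HE by (intro ind rv_events_Int) auto
    also have "prob (i \<inter> h) = prob i * prob h" by (rule indep_setD[OF iH i g(5)])
    also have "prob a * prob b * prob c * (prob i * prob h) = prob i * (prob a * prob b * prob c * prob h)" by simp
    also have "prob a * prob b * prob c * prob h = prob g"
      unfolding g(1) using g HE by (intro ind[symmetric]) auto
    finally show "prob (i \<inter> g) = prob i * prob g" .
  qed
  moreover have "Int_stable \<G>"
  proof (rule Int_stableI)
    fix g g' assume "g \<in> \<G>" "g' \<in> \<G>"
    then obtain a b c h a' b' c' h' where g: "g = a \<inter> b \<inter> c \<inter> h" "a \<in> rv_events M {x}" "b \<in> rv_events M {y}"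
      "c \<in> rv_events M (U ` {0..T})" "h \<in> ?H"
      and g': "g' = a' \<inter> b' \<inter> c' \<inter> h'" "a' \<in> rv_events M {x}" "b' \<in> rv_events M {y}"
      "c' \<in> rv_events M (U ` {0..T})" "h' \<in> ?H" unfolding \<G>_def by blast
    have "g \<inter> g' = (a \<inter> a') \<inter> (b \<inter> b') \<inter> (c \<inter> c') \<inter> (h \<inter> h')" unfolding g(1) g'(1) by blast
    moreover have "a \<inter> a' \<in> rv_events M {x}" "b \<inter> b' \<in> rv_events M {y}"
      "c \<inter> c' \<in> rv_events M (U ` {0..T})" "h \<inter> h' \<in> ?H"
      by (intro rv_events_Int g g')+
    ultimately show "g \<inter> g' \<in> \<G>" unfolding \<G>_def by blast
  qed
  moreover have "Int_stable ?\<I>" by (rule Int_stableI) (rule rv_events_Int)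
  ultimately have *: "indep_set (sigma_sets (space M) ?\<I>) (sigma_sets (space M) \<G>)" by (intro indep_set_sigma)
  have "rv_events M ({x, y} \<union> U ` {0..T} \<union> V ` {0..s}) \<subseteq> sigma_sets (space M) \<G>"
  proof -
    have "\<G> \<subseteq> Pow (space M)" using xe sets.sets_into_space unfolding \<G>_def by blast
    then have sa: "sigma_algebra (space M) (sigma_sets (space M) \<G>)" by (rule sigma_algebra_sigma_sets)
    have sub: "a \<inter> b \<inter> c \<inter> h \<in> sigma_sets (space M) \<G>"
      if "a \<in> rv_events M {x}" "b \<in> rv_events M {y}" "c \<in> rv_events M (U ` {0..T})" "h \<in> ?H" for a b c h
      using that unfolding \<G>_def by (intro sigma_sets.Basic) blast
    note \<Omega> = space_in_rv_events[of M]
    have "rv_generator M ({x, y} \<union> U ` {0..T} \<union> V ` {0..s}) \<subseteq> sigma_sets (space M) \<G>"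
    proof
      fix e assume "e \<in> rv_generator M ({x, y} \<union> U ` {0..T} \<union> V ` {0..s})"
      then obtain Z A where Z: "e = Z -` A \<inter> space M" "A \<in> sets borel" "Z \<in> {x, y} \<union> U ` {0..T} \<union> V ` {0..s}"
        unfolding rv_generator_def by blast
      then consider "Z = x" | "Z = y" | "Z \<in> U ` {0..T}" | "Z \<in> V ` {0..s}" by blast
      then show "e \<in> sigma_sets (space M) \<G>"
      proof cases
        case 1
        then have "e \<in> rv_events M {x}" using Z by (auto intro: rv_eventsI)
        from sub[OF this \<Omega> \<Omega> \<Omega>] show ?thesis using Z by (simp add: Int_assoc)
      next
        case 2
        then have "e \<in> rv_events M {y}" using Z by (auto intro: rv_eventsI)
        from sub[OF \<Omega> this \<Omega> \<Omega>] show ?thesis using Z by (simp add: Int_ac)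
      next
        case 3
        then have "e \<in> rv_events M (U ` {0..T})" using Z by (auto intro: rv_eventsI)
        from sub[OF \<Omega> \<Omega> this \<Omega>] show ?thesis using Z by (simp add: Int_ac)
      next
        case 4
        then have "e \<in> rv_events M (V ` {0..s})" using Z by (auto intro: rv_eventsI)
        from sub[OF \<Omega> \<Omega> \<Omega> this] show ?thesis using Z by (simp add: Int_ac)
      qed
    qed
    then show ?thesis unfolding rv_events_def[of M "{x, y} \<union> U ` {0..T} \<union> V ` {0..s}"]
      by (rule sigma_algebra.sigma_sets_subset[OF sa])
  qed
  then show "indep_set ?\<I> (rv_events M ({x, y} \<union> U ` {0..T} \<union> V ` {0..s}))"
    using indep_setD[OF *] indep_setD_ev1[OF *] indep_setD_ev2[OF *]
    by (intro indep_setI) (auto intro: sigma_sets.Basic)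
qed

lemma brownian_increment_moments:
  assumes V: "brownian_motion M T V" and st: "0 \<le> s" "s < t" "t \<le> T"
  shows "integrable M (\<lambda>\<omega>. V t \<omega> - V s \<omega>)" "expectation (\<lambda>\<omega>. V t \<omega> - V s \<omega>) = 0"
    and "integrable M (\<lambda>\<omega>. (V t \<omega> - V s \<omega>)\<^sup>2)" "expectation (\<lambda>\<omega>. (V t \<omega> - V s \<omega>)\<^sup>2) = t - s"
proof -
  have D: "distributed M lborel (\<lambda>\<omega>. V t \<omega> - V s \<omega>) (normal_density 0 (sqrt (t - s)))"
    using V st by (auto simp: brownian_motion_def)
  have \<sigma>: "0 < sqrt (t - s)" using st by simp
  show "integrable M (\<lambda>\<omega>. V t \<omega> - V s \<omega>)"
    using integrable_normal_moment[OF \<sigma>, of 0 1] by (subst distributed_integrable[OF D, symmetric, of "\<lambda>x. x"]) auto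
  show "expectation (\<lambda>\<omega>. V t \<omega> - V s \<omega>) = 0"
    using integral_normal_moment_odd[OF \<sigma>, of 0 0] by (subst distributed_integral[OF D, symmetric, of "\<lambda>x. x"]) auto
  show "integrable M (\<lambda>\<omega>. (V t \<omega> - V s \<omega>)\<^sup>2)"
    using integrable_normal_moment[OF \<sigma>, of 0 2] by (subst distributed_integrable[OF D, symmetric, of "\<lambda>x. x\<^sup>2"]) auto
  show "expectation (\<lambda>\<omega>. (V t \<omega> - V s \<omega>)\<^sup>2) = t - s"
    using integral_normal_moment_even[OF \<sigma>, of 0 1] st
    by (subst distributed_integral[OF D, symmetric, of "\<lambda>x. x\<^sup>2"]) (auto simp: fact_numeral)
qed

end

text \<open>The first two moments of the normal increment, multiplied into the test variable by
  independence; the case \<open>s = t\<close> is trivial but outside the definition of Brownian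
  motion.\<close>

lemma (in prob_space) increment_expectation:
  assumes ind: "\<And>a b c e. a \<in> rv_events M {x} \<Longrightarrow> b \<in> rv_events M {y} \<Longrightarrow> c \<in> rv_events M (U ` {0..T}) \<Longrightarrow>
      e \<in> rv_events M (V ` {0..T}) \<Longrightarrow> prob (a \<inter> b \<inter> c \<inter> e) = prob a * prob b * prob c * prob e"
    and m: "x \<in> borel_measurable M" "y \<in> borel_measurable M" "\<And>t. t \<in> {0..T} \<Longrightarrow> U t \<in> borel_measurable M"
    and V: "brownian_motion M T V" and st: "0 \<le> s" "s \<le> t" "t \<le> T"
    and \<xi>: "\<xi> \<in> borel_measurable (augmented_sigma M ({x, y} \<union> U ` {0..T} \<union> V ` {0..s}))" "integrable M \<xi>"
  shows "expectation (\<lambda>\<omega>. \<xi> \<omega> * (V t \<omega> - V s \<omega>)) = 0"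
    and "expectation (\<lambda>\<omega>. \<xi> \<omega> * (V t \<omega> - V s \<omega>)\<^sup>2) = (t - s) * expectation \<xi>"
proof -
  have "expectation (\<lambda>\<omega>. \<xi> \<omega> * (V t \<omega> - V s \<omega>)) = 0 \<and>
    expectation (\<lambda>\<omega>. \<xi> \<omega> * (V t \<omega> - V s \<omega>)\<^sup>2) = (t - s) * expectation \<xi>"
  proof (cases "s = t")
    case False
    then have st': "s < t" using st by simp
    note i = indep_increment[OF ind m V st(1) st' st(3)]
    note mom = brownian_increment_moments[OF V st(1) st' st(3)]
    have Vm: "V r \<in> borel_measurable M" if "r \<in> {0..T}" for r
      using V that by (auto simp: brownian_motion_def)
    have ev: "sets (augmented_sigma M ({x, y} \<union> U ` {0..T} \<union> V ` {0..s})) \<subseteq> events"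
      using m Vm st by (intro sets_augmented_sigma_subset) auto
    have dV: "(\<lambda>\<omega>. V t \<omega> - V s \<omega>) \<in> borel_measurable M" using Vm st by auto
    from indep_expectation_mult[OF i ev space_augmented_sigma dV _ _ \<xi>, of "\<lambda>x. x"]
      indep_expectation_mult[OF i ev space_augmented_sigma dV _ _ \<xi>, of "\<lambda>x. x\<^sup>2"]
    show ?thesis using mom by simp
  qed simp
  then show "expectation (\<lambda>\<omega>. \<xi> \<omega> * (V t \<omega> - V s \<omega>)) = 0"
    and "expectation (\<lambda>\<omega>. \<xi> \<omega> * (V t \<omega> - V s \<omega>)\<^sup>2) = (t - s) * expectation \<xi>" by auto
qed

lemma brownian_increment_square_integrable:
  assumes "prob_space M" "brownian_motion M T V" "0 \<le> s" "s \<le> t" "t \<le> T"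
  shows "square_integrable M (\<lambda>\<omega>. V t \<omega> - V s \<omega>)"
proof (cases "s = t")
  case False
  then have "s < t" using assms by simp
  have "V t \<in> borel_measurable M" "V s \<in> borel_measurable M" using assms by (auto simp: brownian_motion_def)
  then show ?thesis
    using prob_space.brownian_increment_moments(3)[OF assms(1-3) \<open>s < t\<close> assms(5)]
    by (simp add: square_integrable_def)
qed simp

section \<open>The two filtrations of the game as Brownian bases\<close>

lemma valid_settingD:
  assumes "valid_setting B"
  shows "0 < bT B" "prob_space (bM B)" "bxi0 B \<in> borel_measurable (bM B)" "bxi B \<in> borel_measurable (bM B)"
    "brownian_motion (bM B) (bT B) (bW0 B)" "brownian_motion (bM B) (bT B) (bW B)"
    and "\<And>t. t \<in> {0..bT B} \<Longrightarrow> bW0 B t \<in> borel_measurable (bM B)"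
    and "\<And>t. t \<in> {0..bT B} \<Longrightarrow> bW B t \<in> borel_measurable (bM B)"
  using assms by (auto simp: valid_setting_def brownian_motion_def)

lemma valid_setting_indep:
  assumes B: "valid_setting B"
    and "a \<in> rv_events (bM B) {bxi0 B}" "b \<in> rv_events (bM B) {bxi B}"
      "c \<in> rv_events (bM B) (bW0 B ` {0..bT B})" "e \<in> rv_events (bM B) (bW B ` {0..bT B})"
  shows "measure (bM B) (a \<inter> b \<inter> c \<inter> e) =
    measure (bM B) a * measure (bM B) b * measure (bM B) c * measure (bM B) e"
proof -
  have four: "{..<4} = {0, 1, 2, 3::nat}" by auto
  have ind: "prob_space.indep_sets (bM B)
       ((!) [rv_events (bM B) {bxi0 B}, rv_events (bM B) {bxi B},
             rv_events (bM B) (bW0 B ` {0..bT B}), rv_events (bM B) (bW B ` {0..bT B})]) {..<4}"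
    using B by (simp add: valid_setting_def)
  have mem: "\<forall>j\<in>{..<4}. [a, b, c, e] ! j \<in> [rv_events (bM B) {bxi0 B}, rv_events (bM B) {bxi B},
             rv_events (bM B) (bW0 B ` {0..bT B}), rv_events (bM B) (bW B ` {0..bT B})] ! j"
    unfolding four using assms by simp
  have "measure (bM B) (\<Inter>j\<in>{..<4}. [a, b, c, e] ! j) = (\<Prod>j\<in>{..<4}. measure (bM B) ([a, b, c, e] ! j))"
    by (rule prob_space.indep_setsD[OF valid_settingD(2)[OF B] ind _ _ _ mem]) (auto simp: four)
  then show ?thesis unfolding four by (simp add: Int_ac mult_ac)
qed

lemma filtered_space_augmented:
  assumes "prob_space M" "0 < T" "\<And>t Z. t \<in> {0..T} \<Longrightarrow> Z \<in> V t \<Longrightarrow> Z \<in> borel_measurable M"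
    and "\<And>s t. 0 \<le> s \<Longrightarrow> s \<le> t \<Longrightarrow> t \<le> T \<Longrightarrow> V s \<subseteq> V t"
  shows "filtered_space M T (\<lambda>t. augmented_sigma M (V t))"
proof -
  interpret prob_space M by (rule assms)
  show ?thesis
  proof (unfold_locales, goal_cases)
    case (3 s t)
    then show ?case by (intro sets_augmented_sigma_mono assms)
  next
    case (4 t)
    then show ?case by (intro sets_augmented_sigma_subset assms)
  qed (simp_all add: assms space_augmented_sigma null_sets_augmented_sigma)
qed

lemma filtered_space_filt0: "valid_setting B \<Longrightarrow> filtered_space (bM B) (bT B) (filt0 B)"
  unfolding filt0_def[abs_def]
  by (rule filtered_space_augmented)
    (auto intro: valid_settingD(1,2) intro!: valid_settingD(3,4,7,8))

lemma filtered_space_filt: "valid_setting B \<Longrightarrow> filtered_space (bM B) (bT B) (filt B)"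
  unfolding filt_def[abs_def]
  by (rule filtered_space_augmented)
    (auto intro: valid_settingD(1,2) intro!: valid_settingD(3,4,7,8))

lemma filt0_measurable_filt: "f \<in> measurable (filt0 B t) N \<Longrightarrow> f \<in> measurable (filt B t) N"
  unfolding filt0_def filt_def by (erule measurable_augmented_sigma_mono) auto

context
  fixes B :: "'a setting"
  assumes B: "valid_setting B"
begin

text \<open>The test variable may depend on the whole path of the common noise.
  \<open>W0_increment_expectation\<close> is the same statement with the two Brownian motions
  exchanged.\<close>

lemma W_increment_expectation:
  assumes st: "0 \<le> s" "s \<le> t" "t \<le> bT B"
    and \<xi>: "\<xi> \<in> borel_measurable (augmented_sigma (bM B) ({bxi0 B, bxi B} \<union> bW0 B ` {0..bT B} \<union> bW B ` {0..s}))"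
      "integrable (bM B) \<xi>"
  shows "(LINT \<omega>|bM B. \<xi> \<omega> * (bW B t \<omega> - bW B s \<omega>)) = 0"
    and "(LINT \<omega>|bM B. \<xi> \<omega> * (bW B t \<omega> - bW B s \<omega>)\<^sup>2) = (t - s) * (LINT \<omega>|bM B. \<xi> \<omega>)"
  using prob_space.increment_expectation[OF valid_settingD(2)[OF B] valid_setting_indep[OF B]
      valid_settingD(3,4,7)[OF B] valid_settingD(6)[OF B] st \<xi>] by auto

lemma W0_increment_expectation:
  assumes st: "0 \<le> s" "s \<le> t" "t \<le> bT B"
    and \<xi>: "\<xi> \<in> borel_measurable (augmented_sigma (bM B) ({bxi0 B, bxi B} \<union> bW B ` {0..bT B} \<union> bW0 B ` {0..s}))"
      "integrable (bM B) \<xi>"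
  shows "(LINT \<omega>|bM B. \<xi> \<omega> * (bW0 B t \<omega> - bW0 B s \<omega>)) = 0"
    and "(LINT \<omega>|bM B. \<xi> \<omega> * (bW0 B t \<omega> - bW0 B s \<omega>)\<^sup>2) = (t - s) * (LINT \<omega>|bM B. \<xi> \<omega>)"
proof -
  have ind: "measure (bM B) (a \<inter> b \<inter> c \<inter> e) = measure (bM B) a * measure (bM B) b * measure (bM B) c * measure (bM B) e"
    if "a \<in> rv_events (bM B) {bxi0 B}" "b \<in> rv_events (bM B) {bxi B}"
      "c \<in> rv_events (bM B) (bW B ` {0..bT B})" "e \<in> rv_events (bM B) (bW0 B ` {0..bT B})" for a b c e
    using valid_setting_indep[OF B that(1,2,4,3)] by (simp add: Int_ac mult_ac)
  show "(LINT \<omega>|bM B. \<xi> \<omega> * (bW0 B t \<omega> - bW0 B s \<omega>)) = 0"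
    and "(LINT \<omega>|bM B. \<xi> \<omega> * (bW0 B t \<omega> - bW0 B s \<omega>)\<^sup>2) = (t - s) * (LINT \<omega>|bM B. \<xi> \<omega>)"
    using prob_space.increment_expectation[OF valid_settingD(2)[OF B] ind
      valid_settingD(3,4,8)[OF B] valid_settingD(5)[OF B] st \<xi>] by auto
qed

lemma filt_measurable_extend:
  assumes "\<xi> \<in> borel_measurable (filt B s)" "0 \<le> s" "s \<le> bT B"
  shows "\<xi> \<in> borel_measurable (augmented_sigma (bM B) ({bxi0 B, bxi B} \<union> bW0 B ` {0..bT B} \<union> bW B ` {0..s}))"
    and "\<xi> \<in> borel_measurable (augmented_sigma (bM B) ({bxi0 B, bxi B} \<union> bW B ` {0..bT B} \<union> bW0 B ` {0..s}))"
proof -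
  have sub: "{0..s} \<subseteq> {0..bT B}" using assms by auto
  show "\<xi> \<in> borel_measurable (augmented_sigma (bM B) ({bxi0 B, bxi B} \<union> bW0 B ` {0..bT B} \<union> bW B ` {0..s}))"
    and "\<xi> \<in> borel_measurable (augmented_sigma (bM B) ({bxi0 B, bxi B} \<union> bW B ` {0..bT B} \<union> bW0 B ` {0..s}))"
    using assms(1) image_mono[OF sub, of "bW0 B"] image_mono[OF sub, of "bW B"] unfolding filt_def
    by (blast intro: measurable_augmented_sigma_mono)+
qed

text \<open>Index 0 is the individual noise and index 1 the common one, the order in which
  \<open>state\<close> and \<open>adjointF\<close> list them.\<close>

lemma brownian_basis_filt:
  "brownian_basis (bM B) (bT B) (filt B) 2 (\<lambda>i. if i = 0 then bW B else bW0 B)"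
proof -
  interpret filtered_space "bM B" "bT B" "filt B" by (rule filtered_space_filt[OF B])
  note [simp] = less_2_cases_iff
  have sq: "square_integrable (bM B) (\<lambda>\<omega>. (if i = (0::nat) then bW B else bW0 B) t \<omega> - (if i = 0 then bW B else bW0 B) s \<omega>)"
    if "0 \<le> s" "s \<le> t" "t \<le> bT B" for i s t
    using brownian_increment_square_integrable[OF valid_settingD(2)[OF B] _ that] valid_settingD(5,6)[OF B] by simp
  show ?thesis
  proof (unfold_locales, goal_cases)
    case (1 i t)
    then show ?case
      unfolding filt_def by (auto intro!: measurable_augmented_sigma)
  next
    case (2 i)
    then show ?case using valid_settingD(5,6)[OF B] by (auto simp: brownian_motion_def)
  next
    case (3 i s t)
    then show ?case by (intro sq)
  next
    case (4 i s t \<xi>)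
    have "integrable (bM B) \<xi>" by (rule square_integrable_imp_integrable'[OF 4(6)])
    then show ?case
      using 4 W_increment_expectation(1)[OF 4(2-4) filt_measurable_extend(1)[OF 4(5)]]
        W0_increment_expectation(1)[OF 4(2-4) filt_measurable_extend(2)[OF 4(5)]] by auto
  next
    case (5 i j s t \<xi> C)
    have sT: "s \<in> {0..bT B}" "s \<le> bT B" using 5 by auto
    have \<xi>M: "\<xi> \<in> borel_measurable (bM B)" by (rule measurable_F_M[OF 5(6) sT(1)])
    have \<xi>i: "integrable (bM B) \<xi>"
      using 5(7) \<xi>M by (intro integrable_const_bound[of _ C]) auto
    \<comment> \<open>Once the full path of \<open>bW0 B\<close> is adjoined to the past of
      \<open>bW B\<close>, the common increment is part of the test variable, and the mixed product
      is a first moment.\<close>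
    have cross: "(LINT \<omega>|bM B. \<xi> \<omega> * ((bW B t \<omega> - bW B s \<omega>) * (bW0 B t \<omega> - bW0 B s \<omega>))) = 0"
    proof -
      have "(\<lambda>\<omega>. \<xi> \<omega> * (bW0 B t \<omega> - bW0 B s \<omega>)) \<in> borel_measurable
          (augmented_sigma (bM B) ({bxi0 B, bxi B} \<union> bW0 B ` {0..bT B} \<union> bW B ` {0..s}))"
        using 5(3-5) by (intro borel_measurable_times borel_measurable_diff measurable_augmented_sigma
          filt_measurable_extend(1)[OF 5(6)]) auto
      moreover have "integrable (bM B) (\<lambda>\<omega>. \<xi> \<omega> * (bW0 B t \<omega> - bW0 B s \<omega>))"
        using sq[OF 5(3-5), of 1] \<xi>M 5(7)
        by (intro square_integrable_imp_integrable' square_integrable_mult_bounded[of _ _ _ C]) auto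
      ultimately have "(LINT \<omega>|bM B. (\<xi> \<omega> * (bW0 B t \<omega> - bW0 B s \<omega>)) * (bW B t \<omega> - bW B s \<omega>)) = 0"
        by (rule W_increment_expectation(1)[OF 5(3-5)])
      then show ?thesis by (simp add: mult_ac)
    qed
    have cross': "(LINT \<omega>|bM B. \<xi> \<omega> * ((bW0 B t \<omega> - bW0 B s \<omega>) * (bW B t \<omega> - bW B s \<omega>))) = 0"
      using cross by (subst mult.commute[of "bW0 B t _ - bW0 B s _"])
    note d = W_increment_expectation(2)[OF 5(3-5) filt_measurable_extend(1)[OF 5(6,3) sT(2)] \<xi>i, unfolded power2_eq_square]
      W0_increment_expectation(2)[OF 5(3-5) filt_measurable_extend(2)[OF 5(6,3) sT(2)] \<xi>i, unfolded power2_eq_square]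
    consider "i = 0" "j = 0" | "i = 0" "j = 1" | "i = 1" "j = 0" | "i = 1" "j = 1"
      using 5(1,2) by auto
    then show ?case
      by cases (simp_all only: cross cross' d if_True if_False simp_thms zero_neq_one one_neq_zero)
  qed
qed

text \<open>Test variables for the smaller filtration are also test variables for
  \<open>filt\<close>, so the facts about \<open>bW0 B\<close> carry over.\<close>

lemma brownian_basis_filt0:
  "brownian_basis (bM B) (bT B) (filt0 B) 1 (\<lambda>i. bW0 B)"
proof -
  interpret filtered_space "bM B" "bT B" "filt0 B" by (rule filtered_space_filt0[OF B])
  have sq: "square_integrable (bM B) (\<lambda>\<omega>. bW0 B t \<omega> - bW0 B s \<omega>)" if "0 \<le> s" "s \<le> t" "t \<le> bT B" for s t
    by (rule brownian_increment_square_integrable[OF valid_settingD(2,5)[OF B] that])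
  show ?thesis
  proof (unfold_locales, goal_cases)
    case (1 i t)
    then show ?case
      unfolding filt0_def by (auto intro!: measurable_augmented_sigma)
  next
    case (2 i)
    then show ?case using valid_settingD(5)[OF B] by (auto simp: brownian_motion_def)
  next
    case (3 i s t)
    then show ?case by (intro sq)
  next
    case (4 i s t \<xi>)
    have "integrable (bM B) \<xi>" by (rule square_integrable_imp_integrable'[OF 4(6)])
    then show ?case
      using 4 by (intro W0_increment_expectation(1)[OF 4(2-4)] filt_measurable_extend(2)[OF filt0_measurable_filt]) auto
  next
    case (5 i j s t \<xi> C)
    have sT: "s \<in> {0..bT B}" "s \<le> bT B" using 5 by auto
    have \<xi>M: "\<xi> \<in> borel_measurable (bM B)" by (rule measurable_F_M[OF 5(6) sT(1)])
    have \<xi>i: "integrable (bM B) \<xi>"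
      using 5(7) \<xi>M by (intro integrable_const_bound[of _ C]) auto
    show ?case
      using 5(1,2) W0_increment_expectation(2)[OF 5(3-5) filt_measurable_extend(2)[OF filt0_measurable_filt[OF 5(6)] 5(3) sT(2)] \<xi>i]
      by (simp add: power2_eq_square)
  qed
qed

end

section \<open>Quadratically regular and strongly convex functions\<close>

text \<open>A mean value theorem indifferent to the sign of \<open>h\<close>, so that the estimates
  below need no case distinction.\<close>

lemma real_mvt:
  fixes f f' :: "real \<Rightarrow> real"
  assumes "\<And>y. (f has_real_derivative f' y) (at y)"
  obtains \<xi> where "\<bar>\<xi> - x\<bar> \<le> \<bar>h\<bar>" "f (x + h) - f x = f' \<xi> * h"
proof (cases h "0 :: real" rule: linorder_cases)
  case less
  then obtain \<xi> where "x + h < \<xi>" "\<xi> < x" "f x - f (x + h) = (x - (x + h)) * f' \<xi>"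
    using MVT2[of "x + h" x f f'] assms by auto
  then show ?thesis using less by (intro that[of \<xi>]) (auto simp: algebra_simps)
next
  case equal
  then show ?thesis by (intro that[of x]) auto
next
  case greater
  then obtain \<xi> where "x < \<xi>" "\<xi> < x + h" "f (x + h) - f x = ((x + h) - x) * f' \<xi>"
    using MVT2[of x "x + h" f f'] assms by auto
  then show ?thesis using greater by (intro that[of \<xi>]) (auto simp: algebra_simps)
qed

text \<open>The common form of the cost functions at fixed time and measure; \<open>R\<close> collects the
  norms of the remaining arguments.\<close>

definition quad_regular ::
    "real \<Rightarrow> real \<Rightarrow> (real \<Rightarrow> real \<Rightarrow> real) \<Rightarrow> (real \<Rightarrow> real \<Rightarrow> real) \<Rightarrow> (real \<Rightarrow> real \<Rightarrow> real) \<Rightarrow> bool" where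
  "quad_regular L R \<psi> \<psi>x \<psi>u \<longleftrightarrow> \<bar>\<psi> 0 0\<bar> \<le> L * (1 + R\<^sup>2) \<and>
     (\<forall>x u. ((\<lambda>y. \<psi> y u) has_real_derivative \<psi>x x u) (at x) \<and>
        ((\<lambda>v. \<psi> x v) has_real_derivative \<psi>u x u) (at u) \<and>
        \<bar>\<psi>x x u\<bar> \<le> L * (1 + \<bar>x\<bar> + \<bar>u\<bar> + R) \<and> \<bar>\<psi>u x u\<bar> \<le> L * (1 + \<bar>x\<bar> + \<bar>u\<bar> + R)) \<and>
     (\<forall>x u x' u'. \<bar>\<psi>x x u - \<psi>x x' u'\<bar> \<le> L * (\<bar>x - x'\<bar> + \<bar>u - u'\<bar>) \<and>
        \<bar>\<psi>u x u - \<psi>u x' u'\<bar> \<le> L * (\<bar>x - x'\<bar> + \<bar>u - u'\<bar>))"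

lemma mult_le_squares: "(a::real) * b \<le> (a\<^sup>2 + b\<^sup>2) / 2"
  using zero_le_power2[of "a - b"] by (simp add: power2_diff)

text \<open>Move first in the control, then in the state, with the mean value theorem; the Lipschitz
  bound controls the shift of each derivative. The products leave \<open>3/2 * L\<close>, rounded up
  to \<open>2 * L\<close>.\<close>

lemma quad_regular_taylor:
  assumes r: "quad_regular L R \<psi> \<psi>x \<psi>u" and "0 \<le> L"
  shows "\<psi> (x + y) (u + w) - \<psi> x u \<le> \<psi>x x u * y + \<psi>u x u * w + 2 * L * (y\<^sup>2 + w\<^sup>2)"
proof -
  have D: "((\<lambda>y. \<psi> y u) has_real_derivative \<psi>x x u) (at x)" "((\<lambda>v. \<psi> x v) has_real_derivative \<psi>u x u) (at u)" for x u
    using r by (auto simp: quad_regular_def)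
  obtain a where a: "\<bar>a - x\<bar> \<le> \<bar>y\<bar>" "\<psi> (x + y) (u + w) - \<psi> x (u + w) = \<psi>x a (u + w) * y"
    using real_mvt[of "\<lambda>y. \<psi> y (u + w)" "\<lambda>y. \<psi>x y (u + w)" x y] D by metis
  obtain b where b: "\<bar>b - u\<bar> \<le> \<bar>w\<bar>" "\<psi> x (u + w) - \<psi> x u = \<psi>u x b * w"
    using real_mvt[of "\<lambda>v. \<psi> x v" "\<lambda>v. \<psi>u x v" u w] D by metis
  have "\<bar>\<psi>x a (u + w) - \<psi>x x u\<bar> \<le> L * (\<bar>a - x\<bar> + \<bar>(u + w) - u\<bar>)" "\<bar>\<psi>u x b - \<psi>u x u\<bar> \<le> L * (\<bar>x - x\<bar> + \<bar>b - u\<bar>)"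
    using r unfolding quad_regular_def by blast+
  moreover have "L * (\<bar>a - x\<bar> + \<bar>(u + w) - u\<bar>) \<le> L * (\<bar>y\<bar> + \<bar>w\<bar>)" "L * (\<bar>x - x\<bar> + \<bar>b - u\<bar>) \<le> L * \<bar>w\<bar>"
    using a b \<open>0 \<le> L\<close> by (auto intro!: mult_left_mono)
  ultimately have 1: "\<bar>\<psi>x a (u + w) - \<psi>x x u\<bar> \<le> L * (\<bar>y\<bar> + \<bar>w\<bar>)" and 2: "\<bar>\<psi>u x b - \<psi>u x u\<bar> \<le> L * \<bar>w\<bar>" by linarith+
  have "(\<psi>x a (u + w) - \<psi>x x u) * y \<le> \<bar>\<psi>x a (u + w) - \<psi>x x u\<bar> * \<bar>y\<bar>" by (metis abs_ge_self abs_mult)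
  also have "\<dots> \<le> L * (\<bar>y\<bar> + \<bar>w\<bar>) * \<bar>y\<bar>" by (intro mult_right_mono 1) simp
  also have "\<dots> = L * (y\<^sup>2 + \<bar>w\<bar> * \<bar>y\<bar>)" by (simp add: algebra_simps power2_eq_square)
  also have "\<dots> \<le> L * (y\<^sup>2 + (w\<^sup>2 + y\<^sup>2) / 2)"
    using \<open>0 \<le> L\<close> mult_le_squares[of "\<bar>w\<bar>" "\<bar>y\<bar>"] by (intro mult_left_mono add_left_mono) auto
  finally have 3: "(\<psi>x a (u + w) - \<psi>x x u) * y \<le> L * (y\<^sup>2 + (w\<^sup>2 + y\<^sup>2) / 2)" .
  have "(\<psi>u x b - \<psi>u x u) * w \<le> \<bar>\<psi>u x b - \<psi>u x u\<bar> * \<bar>w\<bar>" by (metis abs_ge_self abs_mult)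
  also have "\<dots> \<le> L * \<bar>w\<bar> * \<bar>w\<bar>" by (intro mult_right_mono 2) simp
  also have "\<dots> = L * w\<^sup>2" by (simp add: power2_eq_square)
  finally have 4: "(\<psi>u x b - \<psi>u x u) * w \<le> L * w\<^sup>2" .
  have "\<psi> (x + y) (u + w) - \<psi> x u = \<psi>x a (u + w) * y + \<psi>u x b * w" using a(2) b(2) by linarith
  also have "\<dots> = \<psi>x x u * y + \<psi>u x u * w + ((\<psi>x a (u + w) - \<psi>x x u) * y + (\<psi>u x b - \<psi>u x u) * w)"
    by (simp add: algebra_simps)
  also have "\<dots> \<le> \<psi>x x u * y + \<psi>u x u * w + (L * (y\<^sup>2 + (w\<^sup>2 + y\<^sup>2) / 2) + L * w\<^sup>2)"
    using 3 4 by linarith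
  also have "L * (y\<^sup>2 + (w\<^sup>2 + y\<^sup>2) / 2) + L * w\<^sup>2 = 3 / 2 * L * (y\<^sup>2 + w\<^sup>2)" by (simp add: field_simps)
  also have "\<dots> \<le> 2 * L * (y\<^sup>2 + w\<^sup>2)"
    using \<open>0 \<le> L\<close> by (intro mult_right_mono) auto
  finally show ?thesis by simp
qed

text \<open>From \<open>(0, 0)\<close> by two mean value steps. The constant is 1 + 3 + 3: the value
  at the origin and at most 3 for each step.\<close>

lemma quad_regular_growth:
  assumes r: "quad_regular L R \<psi> \<psi>x \<psi>u" and "0 \<le> L" "0 \<le> R"
  shows "\<bar>\<psi> x u\<bar> \<le> 7 * L * (1 + R\<^sup>2 + x\<^sup>2 + u\<^sup>2)"
proof -
  have D: "((\<lambda>y. \<psi> y u) has_real_derivative \<psi>x x u) (at x)" "((\<lambda>v. \<psi> x v) has_real_derivative \<psi>u x u) (at u)"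
    "\<bar>\<psi>x x u\<bar> \<le> L * (1 + \<bar>x\<bar> + \<bar>u\<bar> + R)" "\<bar>\<psi>u x u\<bar> \<le> L * (1 + \<bar>x\<bar> + \<bar>u\<bar> + R)" for x u
    using r by (auto simp: quad_regular_def)
  have lin: "L * (1 + \<bar>y\<bar> + \<bar>v\<bar> + R) * \<bar>z\<bar> \<le> L * (3 * (1 + R\<^sup>2 + x\<^sup>2 + u\<^sup>2))"
    if "\<bar>y\<bar> \<le> \<bar>x\<bar>" "\<bar>v\<bar> \<le> \<bar>u\<bar>" "\<bar>z\<bar> = \<bar>x\<bar> \<or> \<bar>z\<bar> = \<bar>u\<bar>" for y v z
  proof -
    have "(1 + \<bar>y\<bar> + \<bar>v\<bar> + R) * \<bar>z\<bar> \<le> (1 + \<bar>x\<bar> + \<bar>u\<bar> + R) * \<bar>z\<bar>"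
      using that by (intro mult_right_mono) auto
    also have "\<dots> = 1 * \<bar>z\<bar> + \<bar>x\<bar> * \<bar>z\<bar> + \<bar>u\<bar> * \<bar>z\<bar> + R * \<bar>z\<bar>" by (simp add: algebra_simps)
    also have "\<dots> \<le> (1\<^sup>2 + z\<^sup>2) / 2 + (x\<^sup>2 + z\<^sup>2) / 2 + (u\<^sup>2 + z\<^sup>2) / 2 + (R\<^sup>2 + z\<^sup>2) / 2"
      using mult_le_squares[of 1 "\<bar>z\<bar>"] mult_le_squares[of "\<bar>x\<bar>" "\<bar>z\<bar>"] mult_le_squares[of "\<bar>u\<bar>" "\<bar>z\<bar>"]
        mult_le_squares[of R "\<bar>z\<bar>"] unfolding power2_abs by linarith
    also have "z\<^sup>2 \<le> x\<^sup>2 + u\<^sup>2"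
      using that(3) by (metis add_increasing add_increasing2 order_refl power2_abs zero_le_power2)
    then have "(1\<^sup>2 + z\<^sup>2) / 2 + (x\<^sup>2 + z\<^sup>2) / 2 + (u\<^sup>2 + z\<^sup>2) / 2 + (R\<^sup>2 + z\<^sup>2) / 2 \<le> 3 * (1 + R\<^sup>2 + x\<^sup>2 + u\<^sup>2)"
    proof -
      have "(1 + d) / 2 + (b + d) / 2 + (c + d) / 2 + (a + d) / 2 \<le> 3 * (1 + a + b + c)"
        if "0 \<le> a" "0 \<le> b" "0 \<le> c" "d \<le> b + c" for a b c d :: real
        using that by (simp add: field_simps)
      from this[of "R\<^sup>2" "x\<^sup>2" "u\<^sup>2" "z\<^sup>2"] show ?thesis using \<open>z\<^sup>2 \<le> x\<^sup>2 + u\<^sup>2\<close> by simp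
    qed
    finally have "(1 + \<bar>y\<bar> + \<bar>v\<bar> + R) * \<bar>z\<bar> \<le> 3 * (1 + R\<^sup>2 + x\<^sup>2 + u\<^sup>2)" .
    from mult_left_mono[OF this \<open>0 \<le> L\<close>] show ?thesis by (simp add: mult.assoc)
  qed
  obtain a where a: "\<bar>a - 0\<bar> \<le> \<bar>x\<bar>" "\<psi> (0 + x) u - \<psi> 0 u = \<psi>x a u * x"
    using real_mvt[of "\<lambda>y. \<psi> y u" "\<lambda>y. \<psi>x y u" 0 x] D by metis
  obtain b where b: "\<bar>b - 0\<bar> \<le> \<bar>u\<bar>" "\<psi> 0 (0 + u) - \<psi> 0 0 = \<psi>u 0 b * u"
    using real_mvt[of "\<lambda>v. \<psi> 0 v" "\<lambda>v. \<psi>u 0 v" 0 u] D by metis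
  have "\<bar>\<psi>x a u * x\<bar> \<le> L * (1 + \<bar>a\<bar> + \<bar>u\<bar> + R) * \<bar>x\<bar>" unfolding abs_mult by (intro mult_right_mono D) simp
  also have "\<dots> \<le> L * (3 * (1 + R\<^sup>2 + x\<^sup>2 + u\<^sup>2))" using a by (intro lin) auto
  finally have 1: "\<bar>\<psi>x a u * x\<bar> \<le> L * (3 * (1 + R\<^sup>2 + x\<^sup>2 + u\<^sup>2))" .
  have "\<bar>\<psi>u 0 b * u\<bar> \<le> L * (1 + \<bar>0\<bar> + \<bar>b\<bar> + R) * \<bar>u\<bar>" unfolding abs_mult by (intro mult_right_mono D) simp
  also have "\<dots> \<le> L * (3 * (1 + R\<^sup>2 + x\<^sup>2 + u\<^sup>2))" using b by (intro lin) auto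
  finally have 2: "\<bar>\<psi>u 0 b * u\<bar> \<le> L * (3 * (1 + R\<^sup>2 + x\<^sup>2 + u\<^sup>2))" .
  have "\<bar>\<psi> 0 0\<bar> \<le> L * (1 + R\<^sup>2)" using r by (simp add: quad_regular_def)
  also have "\<dots> \<le> L * (1 + R\<^sup>2 + x\<^sup>2 + u\<^sup>2)" using \<open>0 \<le> L\<close> by (intro mult_left_mono) auto
  finally have 3: "\<bar>\<psi> 0 0\<bar> \<le> L * (1 + R\<^sup>2 + x\<^sup>2 + u\<^sup>2)" .
  have "\<psi> x u = \<psi> 0 0 + \<psi>x a u * x + \<psi>u 0 b * u" using a(2) b(2) by simp
  then have "\<bar>\<psi> x u\<bar> \<le> L * (1 + R\<^sup>2 + x\<^sup>2 + u\<^sup>2) + L * (3 * (1 + R\<^sup>2 + x\<^sup>2 + u\<^sup>2)) + L * (3 * (1 + R\<^sup>2 + x\<^sup>2 + u\<^sup>2))"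
    using 1 2 3 by linarith
  then show ?thesis by (simp add: algebra_simps)
qed

text \<open>The derivative as the limit of one fixed sequence of quotients: this turns measurability
  of a cost into measurability of its derivatives.\<close>

lemma quad_regular_difference_quotient:
  assumes "quad_regular L R \<psi> \<psi>x \<psi>u"
  shows "(\<lambda>n. (\<psi> (x + 1 / real (Suc n)) u - \<psi> x u) * real (Suc n)) \<longlonglongrightarrow> \<psi>x x u"
    and "(\<lambda>n. (\<psi> x (u + 1 / real (Suc n)) - \<psi> x u) * real (Suc n)) \<longlonglongrightarrow> \<psi>u x u"
proof -
  have q: "(\<lambda>n. (f (x + 1 / real (Suc n)) - f x) * real (Suc n)) \<longlonglongrightarrow> D"
    if "(f has_real_derivative D) (at x)" for f :: "real \<Rightarrow> real" and D x
  proof -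
    have "((\<lambda>h. (f (x + h) - f x) / h) \<longlongrightarrow> D) (at 0)" using that by (simp add: DERIV_def)
    moreover have "filterlim (\<lambda>n. 1 / real (Suc n)) (at 0) sequentially"
      unfolding filterlim_at by (intro conjI LIMSEQ_Suc[OF lim_1_over_n] always_eventually) auto
    ultimately have "(\<lambda>n. (f (x + 1 / real (Suc n)) - f x) / (1 / real (Suc n))) \<longlonglongrightarrow> D"
      by (rule filterlim_compose)
    then show ?thesis by simp
  qed
  show "(\<lambda>n. (\<psi> (x + 1 / real (Suc n)) u - \<psi> x u) * real (Suc n)) \<longlonglongrightarrow> \<psi>x x u"
    and "(\<lambda>n. (\<psi> x (u + 1 / real (Suc n)) - \<psi> x u) * real (Suc n)) \<longlonglongrightarrow> \<psi>u x u"
  proof -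
    have D: "((\<lambda>y. \<psi> y u) has_real_derivative \<psi>x x u) (at x)" "((\<lambda>v. \<psi> x v) has_real_derivative \<psi>u x u) (at u)"
      using assms unfolding quad_regular_def by blast+
    show "(\<lambda>n. (\<psi> (x + 1 / real (Suc n)) u - \<psi> x u) * real (Suc n)) \<longlonglongrightarrow> \<psi>x x u"
      and "(\<lambda>n. (\<psi> x (u + 1 / real (Suc n)) - \<psi> x u) * real (Suc n)) \<longlonglongrightarrow> \<psi>u x u"
      using q[OF D(1)] q[OF D(2)] by auto
  qed
qed

text \<open>The first order form, which is what \<open>H3\<close> gives in the control when both
  states are equal.\<close>

definition strongly_convex :: "real \<Rightarrow> (real \<Rightarrow> real) \<Rightarrow> (real \<Rightarrow> real) \<Rightarrow> bool" where
  "strongly_convex C h h' \<longleftrightarrow> 0 < C \<and> (\<forall>v. (h has_real_derivative h' v) (at v)) \<and>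
     (\<forall>v w. h w - h v - h' v * (w - v) \<ge> C * (w - v)\<^sup>2)"

text \<open>Critical points are minimizers by convexity, and the quadratic gap makes them unique.
  Existence comes from growth at infinity.\<close>

lemma strongly_convex_minimizer:
  assumes h: "strongly_convex C h h'"
  shows "h' v = 0 \<Longrightarrow> is_arg_min h (\<lambda>_. True) v"
    and "is_arg_min h (\<lambda>_. True) v \<Longrightarrow> h' v = 0"
    and "is_arg_min h (\<lambda>_. True) v \<Longrightarrow> is_arg_min h (\<lambda>_. True) w \<Longrightarrow> v = w"
    and "\<exists>v. is_arg_min h (\<lambda>_. True) v"
proof -
  have C: "0 < C" and D: "(h has_real_derivative h' v) (at v)" and ineq: "h w - h v - h' v * (w - v) \<ge> C * (w - v)\<^sup>2" for v w
    using h by (auto simp: strongly_convex_def)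
  show 1: "is_arg_min h (\<lambda>_. True) v" if "h' v = 0" for v
  proof -
    have "h v \<le> h w" for w
    proof -
      have "0 \<le> C * (w - v)\<^sup>2" "C * (w - v)\<^sup>2 \<le> h w - h v" using ineq[of w v] that C by simp_all
      then show ?thesis by linarith
    qed
    then show ?thesis by (auto simp: is_arg_min_def not_less)
  qed
  show 2: "h' v = 0" if "is_arg_min h (\<lambda>_. True) v" for v
    by (rule DERIV_local_min[OF D, of 1]) (use that in \<open>auto simp: is_arg_min_def not_less\<close>)
  show "v = w" if "is_arg_min h (\<lambda>_. True) v" "is_arg_min h (\<lambda>_. True) w" for v w
  proof -
    have "h w \<le> h v" using that(2) by (auto simp: is_arg_min_def not_less)
    then have "C * (w - v)\<^sup>2 \<le> 0" using ineq[of w v] 2[OF that(1)] by simp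
    then show ?thesis using C by (simp add: mult_le_0_iff)
  qed
  show "\<exists>v. is_arg_min h (\<lambda>_. True) v"
  proof -
    \<comment> \<open>Outside \<open>{-R..R}\<close> the quadratic term beats the slope at 0, so
      values there are at least \<open>h 0\<close> and a minimum over the compact interval is
      global.\<close>
    define R where "R = \<bar>h' 0\<bar> / C"
    have R: "0 \<le> R" using C by (simp add: R_def)
    have "continuous_on {-R..R} h"
      using D by (intro DERIV_continuous_on) (auto intro: DERIV_subset)
    then obtain v where v: "v \<in> {-R..R}" "\<And>w. w \<in> {-R..R} \<Longrightarrow> h v \<le> h w"
      using continuous_attains_inf[of "{-R..R}" h] R by auto
    have "h v \<le> h w" for w
    proof (cases "w \<in> {-R..R}")
      case False
      then have "R \<le> \<bar>w\<bar>" by auto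
      then have "\<bar>h' 0\<bar> \<le> C * \<bar>w\<bar>" using C by (simp add: R_def field_simps)
      then have "\<bar>h' 0\<bar> * \<bar>w\<bar> \<le> C * \<bar>w\<bar> * \<bar>w\<bar>" by (rule mult_right_mono) simp
      also have "\<dots> = C * w\<^sup>2" by (simp add: power2_eq_square)
      finally have "- (h' 0 * w) \<le> C * w\<^sup>2"
        using abs_ge_minus_self[of "h' 0 * w"] by (simp add: abs_mult)
      then have "h 0 \<le> h w" using ineq[of w 0] by simp
      moreover have "h v \<le> h 0" using v(2)[of 0] R by simp
      ultimately show ?thesis by simp
    qed (use v in auto)
    then show ?thesis by (intro exI[of _ v]) (auto simp: is_arg_min_def not_less)
  qed
qed

lemma strongly_convex_the_minimizer:
  assumes h: "strongly_convex C h h'"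
  shows "is_arg_min h (\<lambda>_. True) (THE v. is_arg_min h (\<lambda>_. True) v)"
    and "h' v = 0 \<Longrightarrow> (THE v. is_arg_min h (\<lambda>_. True) v) = v"
proof -
  obtain v0 where v0: "is_arg_min h (\<lambda>_. True) v0" using strongly_convex_minimizer(4)[OF h] by blast
  show "is_arg_min h (\<lambda>_. True) (THE v. is_arg_min h (\<lambda>_. True) v)"
    by (rule theI[of "is_arg_min h (\<lambda>_. True)" v0, OF v0]) (rule strongly_convex_minimizer(3)[OF h _ v0])
  show "(THE v. is_arg_min h (\<lambda>_. True) v) = v" if "h' v = 0"
    by (rule the_equality[of "is_arg_min h (\<lambda>_. True)" v, OF strongly_convex_minimizer(1)[OF h that]])
      (rule strongly_convex_minimizer(3)[OF h _ strongly_convex_minimizer(1)[OF h that]])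
qed

text \<open>This turns measurability of a minimizer into measurability of the minimized function.\<close>

lemma strongly_convex_minimizer_le_iff:
  assumes h: "strongly_convex C h h'"
  shows "(THE v. is_arg_min h (\<lambda>_. True) v) \<le> c \<longleftrightarrow> (\<forall>n. h c \<le> h (c + 1 / real (Suc n)))"
proof -
  have C: "0 < C" and ineq: "h w - h v - h' v * (w - v) \<ge> C * (w - v)\<^sup>2" for v w
    using h by (auto simp: strongly_convex_def)
  define v where "v = (THE v. is_arg_min h (\<lambda>_. True) v)"
  have m: "is_arg_min h (\<lambda>_. True) v" unfolding v_def by (rule strongly_convex_the_minimizer(1)[OF h])
  then have hv: "h v \<le> h w" for w by (auto simp: is_arg_min_def not_less)
  have pos: "0 \<le> C * (a - b)\<^sup>2" for a b using C by simp
  show ?thesis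
    unfolding v_def[symmetric]
  proof
    assume vc: "v \<le> c"
    show "\<forall>n. h c \<le> h (c + 1 / real (Suc n))"
    proof
      fix n
      let ?w = "c + 1 / real (Suc n)"
      \<comment> \<open>If the minimizer lies strictly to the left of \<open>c\<close>, then the
        slope at \<open>c\<close> is nonnegative and \<open>h\<close> cannot drop to the right of
        \<open>c\<close>.\<close>
      have "h' c * (v - c) \<le> 0" using ineq[of v c] hv[of c] pos[of v c] by linarith
      then have "0 \<le> h' c \<or> v = c" using vc by (auto simp: mult_le_0_iff)
      then show "h c \<le> h ?w"
      proof
        assume "0 \<le> h' c"
        then have "0 \<le> h' c * (?w - c)" by (intro mult_nonneg_nonneg) auto
        then show ?thesis using ineq[of ?w c] pos[of ?w c] by linarith
      qed (use hv in simp)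
    qed
  next
    assume n: "\<forall>n. h c \<le> h (c + 1 / real (Suc n))"
    show "v \<le> c"
    proof (rule ccontr)
      assume "\<not> v \<le> c"
      \<comment> \<open>Some comparison point falls strictly between \<open>c\<close> and the
        minimizer, where \<open>h\<close> is still strictly decreasing.\<close>
      then obtain n where "1 / real (Suc n) < v - c"
        using nat_approx_posE[of "v - c"] by auto
      define w where "w = c + 1 / real (Suc n)"
      have w: "c < w" "w < v" using \<open>1 / real (Suc n) < v - c\<close> by (auto simp: w_def)
      have "C * (v - w)\<^sup>2 \<le> h v - h w - h' w * (v - w)" by (rule ineq)
      moreover have "0 < C * (v - w)\<^sup>2" using C w by simp
      ultimately have "h' w * (v - w) < 0" using hv[of w] by linarith
      then have "h' w < 0" using w by (simp add: mult_less_0_iff)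
      then have "0 < h' w * (c - w)" using w by (simp add: zero_less_mult_iff)
      then have "h w < h c" using ineq[of c w] pos[of c w] by linarith
      moreover have "h c \<le> h w" using n unfolding w_def by blast
      ultimately show False by simp
    qed
  qed
qed

section \<open>Perturbation of Ito processes\<close>

lemma sum_list_upt: "(\<Sum>i\<leftarrow>[0..<n]. f i) = (\<Sum>i<n. f i :: real)"
  by (simp add: interv_sum_list_conv_sum_set_nat atLeast0LessThan)

context filtered_space
begin

lemma progressive_cong:
  assumes "progressive T F N X" "\<And>t \<omega>. t \<in> {0..T} \<Longrightarrow> \<omega> \<in> space M \<Longrightarrow> X t \<omega> = Y t \<omega>"
  shows "progressive T F N Y"
  unfolding progressive_def case_prod_beta'
proof
  fix t assume t: "t \<in> {0..T}"
  have "flat X z = flat Y z" if "z \<in> space (restrict_space borel {0..t} \<Otimes>\<^sub>M F t)" for z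
    using that t by (intro assms(2)) (auto simp: space_pair_measure space_restrict_space space_F)
  then show "flat Y \<in> measurable (restrict_space borel {0..t} \<Otimes>\<^sub>M F t) N"
    using progressiveD[OF assms(1) t] by (simp cong: measurable_cong)
qed

lemma progressive_LIMSEQ:
  fixes X :: "nat \<Rightarrow> real \<Rightarrow> 'a \<Rightarrow> real"
  assumes "\<And>n. progressive T F borel (X n)"
    and "\<And>t \<omega>. t \<in> {0..T} \<Longrightarrow> \<omega> \<in> space M \<Longrightarrow> (\<lambda>n. X n t \<omega>) \<longlonglongrightarrow> Y t \<omega>"
  shows "progressive T F borel Y"
proof (rule progressive_cong[OF progressive_limit[OF assms(1)]])
  show "lim (\<lambda>n. X n t \<omega>) = Y t \<omega>" if "t \<in> {0..T}" "\<omega> \<in> space M" for t \<omega>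
    by (rule limI[OF assms(2)[OF that]])
qed

lemma L2_proc_AE_eq:
  assumes "X \<in> L2_proc M T F" "progressive T F borel Y" "AE z in PM. flat X z = flat Y z"
  shows "Y \<in> L2_proc M T F"
proof -
  have "AE z in PM. flat Y z = flat X z" using assms(3) by eventually_elim simp
  from square_integrable_cong_AE[OF progressive_measurable_PM[OF assms(2)] this] show ?thesis
    using assms(1,2) by (simp add: L2_proc_iff)
qed

lemma L2_proc_cong:
  assumes "X \<in> L2_proc M T F" "\<And>t \<omega>. t \<in> {0..T} \<Longrightarrow> \<omega> \<in> space M \<Longrightarrow> X t \<omega> = Y t \<omega>"
  shows "Y \<in> L2_proc M T F"
proof (rule L2_proc_AE_eq[OF assms(1)])
  have "progressive T F borel X" using assms(1) by (simp add: L2_proc_iff)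
  then show "progressive T F borel Y" by (rule progressive_cong) (rule assms(2))
  show "AE z in PM. flat X z = flat Y z"
    by (rule AE_I2) (auto simp: space_PM intro!: assms(2))
qed

end

context brownian_basis
begin

abbreviation noise :: "(nat \<Rightarrow> real \<Rightarrow> 'a \<Rightarrow> real) \<Rightarrow> ((real \<Rightarrow> 'a \<Rightarrow> real) \<times> (real \<Rightarrow> 'a \<Rightarrow> real)) list" where
  "noise h \<equiv> map (\<lambda>i. (h i, W i)) [0..<d]"

text \<open>From the list of noises in the definition to a family indexed by \<open>i < d\<close>,
  the form used by the calculus above.\<close>

lemma ito_process_iff:
  "ito_process M T F X c (noise h) \<longleftrightarrow>
     (AE \<omega> in M. integrable (time T) (\<lambda>s. c s \<omega>)) \<and>
     (\<exists>I. (\<forall>i<d. ito_integral M T F (W i) (h i) (I i)) \<and>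
       (AE \<omega> in M. \<forall>t\<in>{0..T}. X t \<omega> = X 0 \<omega> + (LINT s|time t. c s \<omega>) + (\<Sum>i<d. I i t \<omega>)))"
  (is "_ \<longleftrightarrow> ?int \<and> ?ex")
proof -
  have "(\<exists>Is. list_all2 (\<lambda>(\<eta>, W) I. ito_integral M T F W \<eta> I) (noise h) Is \<and>
      (AE \<omega> in M. \<forall>t\<in>{0..T}. X t \<omega> = X 0 \<omega> + (LINT s|time t. c s \<omega>) + (\<Sum>I\<leftarrow>Is. I t \<omega>))) \<longleftrightarrow> ?ex" (is "?ex' \<longleftrightarrow> _")
  proof
    assume ?ex'
    then obtain Is where Is: "list_all2 (\<lambda>(\<eta>, W) I. ito_integral M T F W \<eta> I) (noise h) Is"
      "AE \<omega> in M. \<forall>t\<in>{0..T}. X t \<omega> = X 0 \<omega> + (LINT s|time t. c s \<omega>) + (\<Sum>I\<leftarrow>Is. I t \<omega>)" by blast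
    then have len: "length Is = d" and "\<forall>i<d. ito_integral M T F (W i) (h i) (Is ! i)"
      by (auto simp: list_all2_conv_all_nth)
    moreover have "(\<Sum>I\<leftarrow>Is. I t \<omega>) = (\<Sum>i<d. (Is ! i) t \<omega>)" for t \<omega>
      using len by (simp add: sum_list_sum_nth atLeast0LessThan)
    ultimately show ?ex using Is(2) by (intro exI[of _ "\<lambda>i. Is ! i"]) simp
  next
    assume ?ex
    then obtain I where I: "\<forall>i<d. ito_integral M T F (W i) (h i) (I i)"
      "AE \<omega> in M. \<forall>t\<in>{0..T}. X t \<omega> = X 0 \<omega> + (LINT s|time t. c s \<omega>) + (\<Sum>i<d. I i t \<omega>)" by blast
    have "(\<Sum>J\<leftarrow>map I [0..<d]. J t \<omega>) = (\<Sum>i<d. I i t \<omega>)" for t \<omega>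
      by (simp add: comp_def sum_list_upt)
    then show ?ex'
      using I by (intro exI[of _ "map I [0..<d]"]) (auto simp: list_all2_conv_all_nth)
  qed
  then show ?thesis
    unfolding ito_process_def set_integrable_time set_integral_time by (rule conj_cong[OF refl])
qed

text \<open>Adding the approximating sequences would require merging their partitions. Instead an
  integral \<open>J\<close> of the combined integrand is taken, the isometry shows that it equals
  the combination of the integrals, and its approximating sequence is reused.\<close>

lemma ito_integral_add:
  assumes i: "i < d" and I: "ito_integral M T F (W i) H I" and I': "ito_integral M T F (W i) H' I'"
  shows "ito_integral M T F (W i) (\<lambda>t \<omega>. H t \<omega> + c * H' t \<omega>) (\<lambda>t \<omega>. I t \<omega> + c * I' t \<omega>)"
proof -
  define G where "G t \<omega> = H t \<omega> + c * H' t \<omega>" for t \<omega>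
  have "(\<lambda>t \<omega>. c * H' t \<omega>) \<in> L2_proc M T F"
    using L2_proc_mult_deterministic[OF ito_integralD(1)[OF I'], of "\<lambda>_. c" "\<bar>c\<bar>"] by simp
  then have G: "G \<in> L2_proc M T F"
    unfolding G_def[abs_def] by (intro L2_proc_add ito_integralD(1)[OF I])
  obtain J where J: "ito_integral M T F (W i) G J" using ito_integral_exists[OF i G] by metis
  have eq: "AE \<omega> in M. J t \<omega> = I t \<omega> + c * I' t \<omega>" if t: "t \<in> {0..T}" for t
  proof -
    note sq = L2_martingaleD(2)[OF ito_integral_martingale[OF i J] t] L2_martingaleD(2)[OF ito_integral_martingale[OF i I] t]
      L2_martingaleD(2)[OF ito_integral_martingale[OF i I'] t]
    have "square_integrable M (\<lambda>\<omega>. J t \<omega> - (I t \<omega> + c * I' t \<omega>))"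
      by (intro square_integrable_diff square_integrable_add square_integrable_cmult sq)
    then have int: "integrable M (\<lambda>\<omega>. (J t \<omega> - (I t \<omega> + c * I' t \<omega>))\<^sup>2)" by (rule square_integrable_integrable_power2)
    \<comment> \<open>The inner product of integrands up to \<open>t\<close>; expanded in it, the
      mean square of the difference is the squared norm of \<open>G - H - c H'\<close>, which is
      zero.\<close>
    define R where "R f g = (LINT z|PM. indicator {..t} (fst z) * (flat f z * flat g z))" for f g :: "real \<Rightarrow> 'a \<Rightarrow> real"
    note iso = ito_isometry[OF i i _ _ t, simplified, folded R_def]
    have ri: "integrable PM (\<lambda>z. indicator {..t} (fst z) * (flat f z * flat g z))"
      if "square_integrable PM (flat f)" "square_integrable PM (flat g)" for f g
      using square_integrable_mult[OF square_integrable_indicator_PM[OF that(1)] that(2)] by (simp add: mult.assoc)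
    have R_G: "R G f = R H f + c * R H' f" if "square_integrable PM (flat f)" for f
    proof -
      have "R G f = (LINT z|PM. indicator {..t} (fst z) * (flat H z * flat f z) + c * (indicator {..t} (fst z) * (flat H' z * flat f z)))"
        unfolding R_def by (intro Bochner_Integration.integral_cong) (auto simp: G_def algebra_simps)
      then show ?thesis
        using ri[OF ito_integralD(3)[OF I] that] ri[OF ito_integralD(3)[OF I'] that] unfolding R_def by simp
    qed
    have R_sym: "R f g = R g f" for f g by (simp add: R_def mult_ac)
    have "(LINT \<omega>|M. (J t \<omega> - (I t \<omega> + c * I' t \<omega>))\<^sup>2) =
      (LINT \<omega>|M. J t \<omega> * J t \<omega> + I t \<omega> * I t \<omega> + c\<^sup>2 * (I' t \<omega> * I' t \<omega>) - 2 * (J t \<omega> * I t \<omega>)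
        - (2 * c) * (J t \<omega> * I' t \<omega>) + (2 * c) * (I t \<omega> * I' t \<omega>))"
      by (intro Bochner_Integration.integral_cong) (auto simp: power2_eq_square algebra_simps)
    also have "\<dots> = R G G + R H H + c\<^sup>2 * R H' H' - 2 * R G H - (2 * c) * R G H' + (2 * c) * R H H'"
      using square_integrable_mult[OF sq(1,1)] square_integrable_mult[OF sq(2,2)] square_integrable_mult[OF sq(3,3)]
        square_integrable_mult[OF sq(1,2)] square_integrable_mult[OF sq(1,3)] square_integrable_mult[OF sq(2,3)]
      by (simp add: iso[OF J J] iso[OF I I] iso[OF I' I'] iso[OF J I] iso[OF J I'] iso[OF I I'])
    also have "\<dots> = 0"
      using R_G[OF ito_integralD(3)[OF J]] R_G[OF ito_integralD(3)[OF I]] R_G[OF ito_integralD(3)[OF I']]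
      by (simp add: R_sym[of H G] R_sym[of H' G] R_sym[of H' H] power2_eq_square algebra_simps)
    finally have "AE \<omega> in M. (J t \<omega> - (I t \<omega> + c * I' t \<omega>))\<^sup>2 = 0"
      using integral_nonneg_eq_0_iff_AE[OF int] by simp
    then show ?thesis by eventually_elim simp
  qed
  from ito_integral_approx[OF J] obtain S where S: "\<forall>k::nat. simple_integrand M T F (S k)"
    "(\<lambda>k. L2sq PM (\<lambda>z. flat (simple_value (S k)) z - flat G z)) \<longlonglongrightarrow> 0"
    "\<forall>t\<in>{0..T}. (\<lambda>k. L2sq M (\<lambda>\<omega>. simple_ito (W i) (S k) t \<omega> - J t \<omega>)) \<longlonglongrightarrow> 0"
    by (elim exE conjE) blast
  have "ito_integral M T F (W i) G (\<lambda>t \<omega>. I t \<omega> + c * I' t \<omega>)"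
    unfolding ito_integral_def
  proof (intro conjI exI[of _ S] G ballI S(1))
    fix t assume t: "t \<in> {0..T}"
    show "(\<lambda>\<omega>. I t \<omega> + c * I' t \<omega>) \<in> borel_measurable (F t)"
      using ito_integralD(4)[OF I t] ito_integralD(4)[OF I' t] by simp
    have "L2sq M (\<lambda>\<omega>. simple_ito (W i) (S k) t \<omega> - (I t \<omega> + c * I' t \<omega>)) =
        L2sq M (\<lambda>\<omega>. simple_ito (W i) (S k) t \<omega> - J t \<omega>)" for k
      using eq[OF t] by (intro nn_integral_cong_AE) (auto elim!: eventually_mono)
    then show "(\<lambda>k. L2sq M (\<lambda>\<omega>. simple_ito (W i) (S k) t \<omega> - (I t \<omega> + c * I' t \<omega>))) \<longlonglongrightarrow> 0"
      using S(3) t by simp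
  next
    show "AE \<omega> in M. continuous_on {0..T} (\<lambda>t. I t \<omega> + c * I' t \<omega>)"
      using ito_integralD(5)[OF I] ito_integralD(5)[OF I']
      by eventually_elim (intro continuous_on_add continuous_on_mult continuous_on_const)
    show "(\<lambda>j. \<integral>\<^sup>+\<omega>. (\<integral>\<^sup>+t\<in>{0..T}. ennreal ((simple_value (S j) t \<omega> - G t \<omega>)\<^sup>2) \<partial>lborel) \<partial>M) \<longlonglongrightarrow> 0"
      using S(1,2) G by (simp add: flat_diff_nn_integral L2_proc_iff)
  qed
  then show ?thesis by (simp add: G_def[abs_def])
qed

lemma ito_process_continuous:
  assumes "ito_process M T F X c (noise h)"
  shows "AE \<omega> in M. continuous_on {0..T} (\<lambda>t. X t \<omega>)"
proof -
  obtain I where int: "AE \<omega> in M. integrable (time T) (\<lambda>s. c s \<omega>)" and I: "\<forall>i<d. ito_integral M T F (W i) (h i) (I i)"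
    and eq: "AE \<omega> in M. \<forall>t\<in>{0..T}. X t \<omega> = X 0 \<omega> + (LINT s|time t. c s \<omega>) + (\<Sum>i<d. I i t \<omega>)"
    using assms unfolding ito_process_iff by blast
  have "AE \<omega> in M. \<forall>i. i < d \<longrightarrow> continuous_on {0..T} (\<lambda>t. I i t \<omega>)"
    unfolding AE_all_countable using I ito_integralD(5) by (auto intro: AE_impI)
  then show ?thesis
    using int eq
  proof eventually_elim
    case (elim \<omega>)
    have "continuous_on {0..T} (\<lambda>t. X 0 \<omega> + (LINT s|time t. c s \<omega>) + (\<Sum>i<d. I i t \<omega>))"
      using elim(1) by (intro continuous_on_add[OF continuous_on_add[OF continuous_on_const continuous_on_time_integral[OF elim(2)]] continuous_on_sum]) auto
    then show ?case by (rule continuous_on_eq) (rule bspec[OF elim(3), symmetric])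
  qed
qed

text \<open>The paths of \<open>X\<close> stay the same; only the coefficients are exchanged on a
  null set of the product space.\<close>

lemma ito_process_cong_AE:
  assumes X: "ito_process M T F X c (noise h)"
    and c: "progressive T F borel c" "progressive T F borel c'" "AE z in PM. flat c z = flat c' z"
    and h: "\<And>i. i < d \<Longrightarrow> h' i \<in> L2_proc M T F" "\<And>i. i < d \<Longrightarrow> AE z in PM. flat (h i) z = flat (h' i) z"
  shows "ito_process M T F X c' (noise h')"
proof -
  obtain I where int: "AE \<omega> in M. integrable (time T) (\<lambda>s. c s \<omega>)" and I: "\<forall>i<d. ito_integral M T F (W i) (h i) (I i)"
    and eq: "AE \<omega> in M. \<forall>t\<in>{0..T}. X t \<omega> = X 0 \<omega> + (LINT s|time t. c s \<omega>) + (\<Sum>i<d. I i t \<omega>)"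
    using X unfolding ito_process_iff by blast
  note [measurable] = c(1,2)[THEN progressive_measurable_PM]
  have "AE \<omega> in M. AE t in time T. c t \<omega> = c' t \<omega>"
    using c(3) by (intro AE_PM_path(1)) measurable
  then have "AE \<omega> in M. integrable (time T) (\<lambda>s. c' s \<omega>)"
    using int AE_space
  proof eventually_elim
    case (elim \<omega>)
    show ?case
      by (rule integrable_cong_AE_imp[OF elim(2) progressive_path[OF c(2) elim(3)] elim(1)])
  qed
  moreover have "AE \<omega> in M. \<forall>t\<in>{0..T}. X t \<omega> = X 0 \<omega> + (LINT s|time t. c' s \<omega>) + (\<Sum>i<d. I i t \<omega>)"
    using eq AE_eq_drift[OF c] by eventually_elim metis
  moreover have "\<forall>i<d. ito_integral M T F (W i) (h' i) (I i)"
    using I h by (auto intro: ito_integral_cong_AE)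
  ultimately show ?thesis unfolding ito_process_iff by blast
qed

text \<open>Linearity of both integrals. The hypotheses on \<open>c'\<close> and \<open>h'\<close>
  are exact identities, which affine coefficients satisfy for every
  \<open>\<epsilon>\<close>.\<close>

lemma ito_process_perturb:
  assumes X: "ito_process M T F X c (noise h)"
    and a: "a \<in> L2_proc M T F" and I: "\<And>i. i < d \<Longrightarrow> ito_integral M T F (W i) (k i) (I i)"
    and Z: "AE \<omega> in M. \<forall>t\<in>{0..T}. Z t \<omega> = (LINT s|time t. a s \<omega>) + (\<Sum>i<d. I i t \<omega>)" "AE \<omega> in M. Z 0 \<omega> = 0"
    and c': "\<And>t \<omega>. t \<in> {0..T} \<Longrightarrow> \<omega> \<in> space M \<Longrightarrow> c' t \<omega> = c t \<omega> + \<epsilon> * a t \<omega>"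
    and h': "\<And>i t \<omega>. i < d \<Longrightarrow> t \<in> {0..T} \<Longrightarrow> \<omega> \<in> space M \<Longrightarrow> h' i t \<omega> = h i t \<omega> + \<epsilon> * k i t \<omega>"
  shows "ito_process M T F (\<lambda>t \<omega>. X t \<omega> + \<epsilon> * Z t \<omega>) c' (noise h')"
proof -
  obtain N where int: "AE \<omega> in M. integrable (time T) (\<lambda>s. c s \<omega>)" and N: "\<forall>i<d. ito_integral M T F (W i) (h i) (N i)"
    and eq: "AE \<omega> in M. \<forall>t\<in>{0..T}. X t \<omega> = X 0 \<omega> + (LINT s|time t. c s \<omega>) + (\<Sum>i<d. N i t \<omega>)"
    using X unfolding ito_process_iff by blast
  have as: "square_integrable PM (flat a)" using a by (simp add: L2_proc_iff)
  have "\<forall>i<d. ito_integral M T F (W i) (h' i) (\<lambda>t \<omega>. N i t \<omega> + \<epsilon> * I i t \<omega>)"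
  proof (intro allI impI)
    fix i assume i: "i < d"
    have s: "ito_integral M T F (W i) (\<lambda>t \<omega>. h i t \<omega> + \<epsilon> * k i t \<omega>) (\<lambda>t \<omega>. N i t \<omega> + \<epsilon> * I i t \<omega>)"
      using N i by (intro ito_integral_add I) auto
    show "ito_integral M T F (W i) (h' i) (\<lambda>t \<omega>. N i t \<omega> + \<epsilon> * I i t \<omega>)"
    proof (rule ito_integral_cong_AE[OF s])
      show "h' i \<in> L2_proc M T F" by (rule L2_proc_cong[OF ito_integralD(1)[OF s]]) (simp add: h'[OF i])
      show "AE z in PM. flat (\<lambda>t \<omega>. h i t \<omega> + \<epsilon> * k i t \<omega>) z = flat (h' i) z"
        by (rule AE_I2) (auto simp: space_PM h'[OF i])
    qed
  qed
  moreover have "AE \<omega> in M. integrable (time T) (\<lambda>s. c' s \<omega>)"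
    using int path_integrable[OF as] AE_space
  proof eventually_elim
    case (elim \<omega>)
    have "integrable (time T) (\<lambda>s. c s \<omega> + \<epsilon> * a s \<omega>)" using elim by auto
    then show ?case
      by (rule Bochner_Integration.integrable_cong[OF refl, THEN iffD1, rotated]) (use elim in \<open>auto simp: c' space_restrict_space\<close>)
  qed
  moreover have "AE \<omega> in M. \<forall>t\<in>{0..T}. X t \<omega> + \<epsilon> * Z t \<omega> =
      X 0 \<omega> + \<epsilon> * Z 0 \<omega> + (LINT s|time t. c' s \<omega>) + (\<Sum>i<d. N i t \<omega> + \<epsilon> * I i t \<omega>)"
    using eq Z int path_integrable[OF as] AE_space
  proof eventually_elim
    case (elim \<omega>)
    show ?case
    proof
      fix t assume t: "t \<in> {0..T}"
      have "(LINT s|time t. c' s \<omega>) = (LINT s|time t. c s \<omega> + \<epsilon> * a s \<omega>)"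
        using t elim by (intro Bochner_Integration.integral_cong) (auto simp: c' space_restrict_space)
      also have "\<dots> = (LINT s|time t. c s \<omega>) + \<epsilon> * (LINT s|time t. a s \<omega>)"
        using t integrable_time_mono[OF elim(4), of t] integrable_time_mono[OF elim(5), of t] by simp
      finally have "(LINT s|time t. c' s \<omega>) = (LINT s|time t. c s \<omega>) + \<epsilon> * (LINT s|time t. a s \<omega>)" .
      moreover have "X t \<omega> = X 0 \<omega> + (LINT s|time t. c s \<omega>) + (\<Sum>i<d. N i t \<omega>)"
        "Z t \<omega> = (LINT s|time t. a s \<omega>) + (\<Sum>i<d. I i t \<omega>)"
        using elim(1,2) t by blast+
      ultimately show "X t \<omega> + \<epsilon> * Z t \<omega> =
          X 0 \<omega> + \<epsilon> * Z 0 \<omega> + (LINT s|time t. c' s \<omega>) + (\<Sum>i<d. N i t \<omega> + \<epsilon> * I i t \<omega>)"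
        using elim(3) by (simp add: sum.distrib sum_distrib_left[symmetric] algebra_simps)
    qed
  qed
  ultimately show ?thesis
    unfolding ito_process_iff by (intro conjI exI[of _ "\<lambda>i t \<omega>. N i t \<omega> + \<epsilon> * I i t \<omega>"])
qed

text \<open>Continuity of both paths allows passing to dyadic suprema, whose measurability is used
  when the two norms are added.\<close>

lemma S2_proc_perturb:
  assumes X: "X \<in> S2_proc M T F" "AE \<omega> in M. continuous_on {0..T} (\<lambda>t. X t \<omega>)"
    and Z: "Z \<in> S2_proc M T F" "AE \<omega> in M. continuous_on {0..T} (\<lambda>t. Z t \<omega>)"
  shows "(\<lambda>t \<omega>. X t \<omega> + \<epsilon> * Z t \<omega>) \<in> S2_proc M T F"
proof -
  have p: "progressive T F borel X" "progressive T F borel Z" using X Z by (auto simp: S2_proc_def)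
  have "AE \<omega> in M. continuous_on {0..T} (\<lambda>t. X t \<omega> + \<epsilon> * Z t \<omega>)"
    using X(2) Z(2) by eventually_elim (intro continuous_on_add continuous_on_mult continuous_on_const)
  moreover have "progressive T F borel (\<lambda>t \<omega>. X t \<omega> + \<epsilon> * Z t \<omega>)"
    by (intro progressive_add progressive_mult progressive_const p)
  ultimately show ?thesis
    using sup_square_integrable_add[of X Z \<epsilon>] X Z S2_proc_iff_sup_square_integrable[OF p(1) X(2)]
      S2_proc_iff_sup_square_integrable[OF p(2) Z(2)] by (simp add: S2_proc_iff_sup_square_integrable)
qed

end

section \<open>Affine control problems\<close>

lemma strongly_convex_add_affine:
  assumes h: "strongly_convex C h h'" and k: "\<And>v. k v = h v + (a + b * v)"
  shows "strongly_convex C k (\<lambda>v. b + h' v)"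
proof -
  have "(k has_real_derivative b + h' v) (at v)" for v
    unfolding k[abs_def] using h unfolding strongly_convex_def
    by (auto intro!: derivative_eq_intros)
  then show ?thesis using h unfolding strongly_convex_def k by (auto simp: algebra_simps)
qed

definition hamiltonian ::
    "nat \<Rightarrow> (real \<Rightarrow> 'a \<Rightarrow> real \<Rightarrow> real \<Rightarrow> real) \<Rightarrow> (nat \<Rightarrow> real \<Rightarrow> 'a \<Rightarrow> real \<Rightarrow> real \<Rightarrow> real) \<Rightarrow>
     (real \<Rightarrow> 'a \<Rightarrow> real \<Rightarrow> real \<Rightarrow> real) \<Rightarrow> real \<Rightarrow> 'a \<Rightarrow> real \<Rightarrow> (nat \<Rightarrow> real) \<Rightarrow> real \<Rightarrow> real \<Rightarrow> real" where
  "hamiltonian d c s f t \<omega> P Q x v = c t \<omega> x v * P + (\<Sum>i<d. s i t \<omega> x v * Q i) + f t \<omega> x v"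

text \<open>Flow, opponent's state and measure arguments are absorbed into the dependence on
  \<open>\<omega>\<close>; \<open>R\<close> keeps their norms for the growth bounds. The slopes are
  deterministic, as \<open>linear_sde_exists\<close> requires, and bounded at all real
  times.\<close>

locale affine_control = brownian_basis M T F d W
  for M :: "'a measure" and T F d W +
  fixes c f fx fu :: "real \<Rightarrow> 'a \<Rightarrow> real \<Rightarrow> real \<Rightarrow> real" and s :: "nat \<Rightarrow> real \<Rightarrow> 'a \<Rightarrow> real \<Rightarrow> real \<Rightarrow> real"
    and b1 b2 :: "real \<Rightarrow> real" and s1 s2 :: "nat \<Rightarrow> real \<Rightarrow> real"
    and g gx :: "'a \<Rightarrow> real \<Rightarrow> real" and R :: "real \<Rightarrow> 'a \<Rightarrow> real" and L C :: real
  assumes slopes: "b1 \<in> borel_measurable borel" "b2 \<in> borel_measurable borel"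
      "\<And>i. s1 i \<in> borel_measurable borel" "\<And>i. s2 i \<in> borel_measurable borel"
      "\<And>t. \<bar>b1 t\<bar> \<le> L" "\<And>t. \<bar>b2 t\<bar> \<le> L" "\<And>i t. \<bar>s1 i t\<bar> \<le> L" "\<And>i t. \<bar>s2 i t\<bar> \<le> L"
    and c_affine: "\<And>t \<omega> x v. t \<in> {0..T} \<Longrightarrow> \<omega> \<in> space M \<Longrightarrow> c t \<omega> x v = c t \<omega> 0 0 + b1 t * x + b2 t * v"
    and s_affine: "\<And>i t \<omega> x v. i < d \<Longrightarrow> t \<in> {0..T} \<Longrightarrow> \<omega> \<in> space M \<Longrightarrow>
      s i t \<omega> x v = s i t \<omega> 0 0 + s1 i t * x + s2 i t * v"
    and progressive_c: "\<And>x v. progressive T F borel x \<Longrightarrow> progressive T F borel v \<Longrightarrow>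
      progressive T F borel (\<lambda>t \<omega>. c t \<omega> (x t \<omega>) (v t \<omega>))"
    and progressive_s: "\<And>i x v. i < d \<Longrightarrow> progressive T F borel x \<Longrightarrow> progressive T F borel v \<Longrightarrow>
      progressive T F borel (\<lambda>t \<omega>. s i t \<omega> (x t \<omega>) (v t \<omega>))"
    and progressive_f: "\<And>x v. progressive T F borel x \<Longrightarrow> progressive T F borel v \<Longrightarrow>
      progressive T F borel (\<lambda>t \<omega>. f t \<omega> (x t \<omega>) (v t \<omega>))"
    and measurable_g: "\<And>x. x \<in> borel_measurable M \<Longrightarrow> (\<lambda>\<omega>. g \<omega> (x \<omega>)) \<in> borel_measurable M"
    and R: "square_integrable PM (flat R)" "square_integrable M (R T)" "\<And>t \<omega>. 0 \<le> R t \<omega>"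
    and L: "0 \<le> L"
    and f: "\<And>t \<omega>. t \<in> {0..T} \<Longrightarrow> \<omega> \<in> space M \<Longrightarrow> quad_regular L (R t \<omega>) (f t \<omega>) (fx t \<omega>) (fu t \<omega>)"
    and g: "\<And>\<omega>. \<omega> \<in> space M \<Longrightarrow> quad_regular L (R T \<omega>) (\<lambda>x v. g \<omega> x) (\<lambda>x v. gx \<omega> x) (\<lambda>x v. 0)"
    and convex: "\<And>t \<omega> x. t \<in> {0..T} \<Longrightarrow> \<omega> \<in> space M \<Longrightarrow> strongly_convex C (f t \<omega> x) (fu t \<omega> x)"
begin

abbreviation H where "H \<equiv> hamiltonian d c s f"

definition cost_functional :: "(real \<Rightarrow> 'a \<Rightarrow> real) \<Rightarrow> (real \<Rightarrow> 'a \<Rightarrow> real) \<Rightarrow> real" where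
  "cost_functional X u = (LINT \<omega>|M. (LINT t:{0..T}|lborel. f t \<omega> (X t \<omega>) (u t \<omega>)) + g \<omega> (X T \<omega>))"

definition controlled :: "(real \<Rightarrow> 'a \<Rightarrow> real) \<Rightarrow> (real \<Rightarrow> 'a \<Rightarrow> real) \<Rightarrow> bool" where
  "controlled X u \<longleftrightarrow> ito_process M T F X (\<lambda>t \<omega>. c t \<omega> (X t \<omega>) (u t \<omega>)) (noise (\<lambda>i t \<omega>. s i t \<omega> (X t \<omega>) (u t \<omega>)))"

lemma hamiltonian_affine:
  assumes "t \<in> {0..T}" "\<omega> \<in> space M"
  shows "H t \<omega> P Q x v = f t \<omega> x v + ((c t \<omega> 0 0 * P + (\<Sum>i<d. s i t \<omega> 0 0 * Q i))
    + (b1 t * P + (\<Sum>i<d. s1 i t * Q i)) * x + (b2 t * P + (\<Sum>i<d. s2 i t * Q i)) * v)"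
proof -
  have "(\<Sum>i<d. s i t \<omega> x v * Q i) = (\<Sum>i<d. s i t \<omega> 0 0 * Q i + s1 i t * Q i * x + s2 i t * Q i * v)"
    by (intro sum.cong refl, subst s_affine) (use assms in \<open>auto simp: algebra_simps\<close>)
  also have "\<dots> = (\<Sum>i<d. s i t \<omega> 0 0 * Q i) + (\<Sum>i<d. s1 i t * Q i) * x + (\<Sum>i<d. s2 i t * Q i) * v"
    by (simp add: sum.distrib sum_distrib_right)
  finally show ?thesis
    unfolding hamiltonian_def by (subst c_affine[OF assms]) (simp add: algebra_simps)
qed

lemma hamiltonian_strongly_convex:
  assumes "t \<in> {0..T}" "\<omega> \<in> space M"
  shows "strongly_convex C (H t \<omega> P Q x) (\<lambda>v. (b2 t * P + (\<Sum>i<d. s2 i t * Q i)) + fu t \<omega> x v)"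
  by (rule strongly_convex_add_affine[OF convex[OF assms, of x],
      of _ "(c t \<omega> 0 0 * P + (\<Sum>i<d. s i t \<omega> 0 0 * Q i)) + (b1 t * P + (\<Sum>i<d. s1 i t * Q i)) * x"])
    (simp add: hamiltonian_affine[OF assms])

lemma deriv_hamiltonian:
  assumes "t \<in> {0..T}" "\<omega> \<in> space M"
  shows "deriv (\<lambda>y. H t \<omega> P Q y v) x = b1 t * P + (\<Sum>i<d. s1 i t * Q i) + fx t \<omega> x v"
proof (rule DERIV_imp_deriv)
  have "((\<lambda>y. f t \<omega> y v) has_real_derivative fx t \<omega> x v) (at x)"
    using f[OF assms] by (auto simp: quad_regular_def)
  then show "((\<lambda>y. H t \<omega> P Q y v) has_real_derivative b1 t * P + (\<Sum>i<d. s1 i t * Q i) + fx t \<omega> x v) (at x)"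
    unfolding hamiltonian_affine[OF assms] by (auto intro!: derivative_eq_intros)
qed

lemma progressive_fx:
  assumes "progressive T F borel x" "progressive T F borel v"
  shows "progressive T F borel (\<lambda>t \<omega>. fx t \<omega> (x t \<omega>) (v t \<omega>))"
proof (rule progressive_LIMSEQ)
  show "progressive T F borel (\<lambda>t \<omega>. (f t \<omega> (x t \<omega> + 1 / real (Suc n)) (v t \<omega>) - f t \<omega> (x t \<omega>) (v t \<omega>)) * real (Suc n))" for n
    by (intro progressive_mult progressive_diff progressive_f progressive_add progressive_const assms)
  show "(\<lambda>n. (f t \<omega> (x t \<omega> + 1 / real (Suc n)) (v t \<omega>) - f t \<omega> (x t \<omega>) (v t \<omega>)) * real (Suc n))
      \<longlonglongrightarrow> fx t \<omega> (x t \<omega>) (v t \<omega>)" if "t \<in> {0..T}" "\<omega> \<in> space M" for t \<omega>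
    by (rule quad_regular_difference_quotient(1)[OF f[OF that]])
qed

lemma progressive_fu:
  assumes "progressive T F borel x" "progressive T F borel v"
  shows "progressive T F borel (\<lambda>t \<omega>. fu t \<omega> (x t \<omega>) (v t \<omega>))"
proof (rule progressive_LIMSEQ)
  show "progressive T F borel (\<lambda>t \<omega>. (f t \<omega> (x t \<omega>) (v t \<omega> + 1 / real (Suc n)) - f t \<omega> (x t \<omega>) (v t \<omega>)) * real (Suc n))" for n
    by (intro progressive_mult progressive_diff progressive_f progressive_add progressive_const assms)
  show "(\<lambda>n. (f t \<omega> (x t \<omega>) (v t \<omega> + 1 / real (Suc n)) - f t \<omega> (x t \<omega>) (v t \<omega>)) * real (Suc n))
      \<longlonglongrightarrow> fu t \<omega> (x t \<omega>) (v t \<omega>)" if "t \<in> {0..T}" "\<omega> \<in> space M" for t \<omega>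
    by (rule quad_regular_difference_quotient(2)[OF f[OF that]])
qed

text \<open>Linear growth in square integrable data; applied to the two derivatives of
  \<open>f\<close> along the optimal pair.\<close>

lemma linear_growth_L2:
  assumes "x \<in> L2_proc M T F" "v \<in> L2_proc M T F" "progressive T F borel k"
    and k: "\<And>t \<omega>. t \<in> {0..T} \<Longrightarrow> \<omega> \<in> space M \<Longrightarrow> \<bar>k t \<omega>\<bar> \<le> L * (1 + \<bar>x t \<omega>\<bar> + \<bar>v t \<omega>\<bar> + R t \<omega>)"
  shows "k \<in> L2_proc M T F"
proof -
  have abs: "square_integrable PM (\<lambda>z. \<bar>y z\<bar>)" if "square_integrable PM y" for y
    using that by (auto simp: square_integrable_def)
  have one: "square_integrable PM (\<lambda>z. 1)" using L2_proc_const[of 1] by (simp add: L2_proc_iff)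
  have "square_integrable PM (\<lambda>z. L * (1 + \<bar>flat x z\<bar> + \<bar>flat v z\<bar> + flat R z))"
    using assms(1,2) by (intro square_integrable_cmult square_integrable_add abs R one) (auto simp: L2_proc_iff)
  moreover have "AE z in PM. \<bar>flat k z\<bar> \<le> \<bar>L * (1 + \<bar>flat x z\<bar> + \<bar>flat v z\<bar> + flat R z)\<bar>"
    by (rule AE_I2, rule order_trans[OF k abs_ge_self]) (auto simp: space_PM)
  ultimately have "square_integrable PM (flat k)"
    by (rule square_integrable_bound[OF _ progressive_measurable_PM[OF assms(3)]])
  then show ?thesis using assms(3) by (simp add: L2_proc_iff)
qed

lemma square_integrable_gx:
  assumes "square_integrable M x"
  shows "square_integrable M (\<lambda>\<omega>. gx \<omega> (x \<omega>))"
proof -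
  have [measurable]: "x \<in> borel_measurable M" by (rule square_integrable_measurable[OF assms])
  have meas: "(\<lambda>\<omega>. gx \<omega> (x \<omega>)) \<in> borel_measurable M"
  proof (rule borel_measurable_LIMSEQ_metric)
    show "(\<lambda>\<omega>. (g \<omega> (x \<omega> + 1 / real (Suc n)) - g \<omega> (x \<omega>)) * real (Suc n)) \<in> borel_measurable M" for n
      by (intro borel_measurable_times borel_measurable_diff measurable_g) auto
    show "(\<lambda>n. (g \<omega> (x \<omega> + 1 / real (Suc n)) - g \<omega> (x \<omega>)) * real (Suc n)) \<longlonglongrightarrow> gx \<omega> (x \<omega>)"
      if "\<omega> \<in> space M" for \<omega>
      by (rule quad_regular_difference_quotient(1)[OF g[OF that]])
  qed
  have "square_integrable M (\<lambda>\<omega>. L * (1 + \<bar>x \<omega>\<bar> + \<bar>0\<bar> + R T \<omega>))"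
    using assms by (intro square_integrable_cmult square_integrable_add R square_integrable_const)
      (auto simp: square_integrable_def)
  moreover have "AE \<omega> in M. \<bar>gx \<omega> (x \<omega>)\<bar> \<le> \<bar>L * (1 + \<bar>x \<omega>\<bar> + \<bar>0\<bar> + R T \<omega>)\<bar>"
  proof (rule AE_I2, rule order_trans[OF _ abs_ge_self])
    show "\<bar>gx \<omega> (x \<omega>)\<bar> \<le> L * (1 + \<bar>x \<omega>\<bar> + \<bar>0\<bar> + R T \<omega>)" if "\<omega> \<in> space M" for \<omega>
      using g[OF that] unfolding quad_regular_def by blast
  qed
  ultimately show ?thesis by (rule square_integrable_bound[OF _ meas])
qed

text \<open>By \<open>strongly_convex_minimizer_le_iff\<close> a sublevel set of the minimizer is a
  countable intersection of sets comparing two values of the Hamiltonian at constant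
  controls.\<close>

lemma progressive_minimizer:
  assumes x: "progressive T F borel x" and P: "progressive T F borel P"
    and Q: "\<And>i. i < d \<Longrightarrow> progressive T F borel (Q i)"
  shows "progressive T F borel (\<lambda>t \<omega>. THE v. is_arg_min (H t \<omega> (P t \<omega>) (\<lambda>i. Q i t \<omega>) (x t \<omega>)) (\<lambda>_. True) v)"
    (is "progressive T F borel ?v")
  unfolding progressive_def case_prod_beta'
proof
  fix t assume t: "t \<in> {0..T}"
  define N where "N = restrict_space borel {0..t} \<Otimes>\<^sub>M F t"
  define h where "h a t \<omega> = H t \<omega> (P t \<omega>) (\<lambda>i. Q i t \<omega>) (x t \<omega>) a" for a t \<omega>
  have "progressive T F borel (h a)" for a
    unfolding h_def[abs_def] hamiltonian_def
    by (intro progressive_add progressive_mult progressive_sum progressive_c progressive_s progressive_f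
        progressive_const x P Q) auto
  then have [measurable]: "flat (h a) \<in> borel_measurable N" for a
    unfolding N_def by (rule progressiveD[OF _ t])
  show "flat ?v \<in> borel_measurable N"
  proof (rule borel_measurableI_le)
    fix a
    have "flat ?v z \<le> a \<longleftrightarrow> (\<forall>n. flat (h a) z \<le> flat (h (a + 1 / real (Suc n))) z)" if "z \<in> space N" for z
    proof -
      have "fst z \<in> {0..T}" "snd z \<in> space M"
        using that t by (auto simp: N_def space_pair_measure space_restrict_space space_F)
      from strongly_convex_minimizer_le_iff[OF hamiltonian_strongly_convex[OF this]] show ?thesis
        unfolding h_def .
    qed
    then have "{z \<in> space N. flat ?v z \<le> a} = {z \<in> space N. \<forall>n. flat (h a) z \<le> flat (h (a + 1 / real (Suc n))) z}"
      by blast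
    also have "\<dots> \<in> sets N" by measurable
    finally show "{z \<in> space N. flat ?v z \<le> a} \<in> sets N" .
  qed
qed

text \<open>The vanishing derivative identifies \<open>u\<close> with the pointwise minimizer
  \<open>\<alpha>\<close>. Besides this equality, the forward and backward equations are rewritten
  with \<open>\<alpha>\<close> in place of \<open>u\<close>, as system (F) demands.\<close>

theorem necessary_condition:
  assumes X: "X \<in> S2_proc M T F" and u: "u \<in> L2_proc M T F" and Xu: "controlled X u"
    and minimal: "\<And>v Y. v \<in> L2_proc M T F \<Longrightarrow> Y \<in> S2_proc M T F \<Longrightarrow> AE \<omega> in M. Y 0 \<omega> = X 0 \<omega> \<Longrightarrow>
      controlled Y v \<Longrightarrow> cost_functional X u \<le> cost_functional Y v"
    and p: "p \<in> S2_proc M T F" and q: "\<And>i. i < d \<Longrightarrow> q i \<in> L2_proc M T F"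
    and p_eq: "ito_process M T F p (\<lambda>t \<omega>. - deriv (\<lambda>y. H t \<omega> (p t \<omega>) (\<lambda>i. q i t \<omega>) y (u t \<omega>)) (X t \<omega>)) (noise q)"
    and p_T: "AE \<omega> in M. p T \<omega> = deriv (g \<omega>) (X T \<omega>)"
    and \<alpha>: "\<And>t \<omega>. t \<in> {0..T} \<Longrightarrow> \<omega> \<in> space M \<Longrightarrow>
      \<alpha> t \<omega> = (THE v. is_arg_min (H t \<omega> (p t \<omega>) (\<lambda>i. q i t \<omega>) (X t \<omega>)) (\<lambda>_. True) v)"
  shows "AE z in PM. flat u z = flat \<alpha> z" and "\<alpha> \<in> L2_proc M T F" and "controlled X \<alpha>"
    and "ito_process M T F p (\<lambda>t \<omega>. - deriv (\<lambda>y. H t \<omega> (p t \<omega>) (\<lambda>i. q i t \<omega>) y (\<alpha> t \<omega>)) (X t \<omega>)) (noise q)"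
proof -
  have T: "T \<in> {0..T}" using T_pos by simp
  have L2: "X \<in> L2_proc M T F" "p \<in> L2_proc M T F" using X p by (auto intro: S2_proc_square_integrable)
  have prog: "progressive T F borel X" "progressive T F borel u" "progressive T F borel p"
      "\<And>i. i < d \<Longrightarrow> progressive T F borel (q i)"
    using X u p q by (auto simp: S2_proc_def L2_proc_def)
  have gx: "gx \<omega> x = deriv (g \<omega>) x" if "\<omega> \<in> space M" for \<omega> x
    using g[OF that] by (auto simp: quad_regular_def intro!: DERIV_imp_deriv[symmetric])
  have drift: "- deriv (\<lambda>y. H t \<omega> (p t \<omega>) (\<lambda>i. q i t \<omega>) y (v t \<omega>)) (X t \<omega>) =
      - (b1 t * p t \<omega> + (\<Sum>i<d. s1 i t * q i t \<omega>) + fx t \<omega> (X t \<omega>) (v t \<omega>))"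
    if "t \<in> {0..T}" "\<omega> \<in> space M" for v t \<omega> by (simp add: deriv_hamiltonian[OF that])
  have prog_drift: "progressive T F borel (\<lambda>t \<omega>. - deriv (\<lambda>y. H t \<omega> (p t \<omega>) (\<lambda>i. q i t \<omega>) y (v t \<omega>)) (X t \<omega>))"
    if "progressive T F borel v" for v
  proof (rule progressive_cong[OF _ drift[symmetric]])
    show "progressive T F borel (\<lambda>t \<omega>. - (b1 t * p t \<omega> + (\<Sum>i<d. s1 i t * q i t \<omega>) + fx t \<omega> (X t \<omega>) (v t \<omega>)))"
      using slopes by (intro progressive_uminus progressive_add progressive_mult progressive_sum progressive_fx
          progressive_deterministic prog that) auto
  qed
  obtain N where N: "\<forall>i<d. ito_integral M T F (W i) (q i) (N i)"
    and p_path: "AE \<omega> in M. \<forall>t\<in>{0..T}. p t \<omega> = p 0 \<omega>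
      + (LINT s|time t. - deriv (\<lambda>y. H s \<omega> (p s \<omega>) (\<lambda>i. q i s \<omega>) y (u s \<omega>)) (X s \<omega>)) + (\<Sum>i<d. N i t \<omega>)"
    using p_eq unfolding ito_process_iff by blast
  have hu: "AE z in PM. b2 (fst z) * flat p z + (\<Sum>i<d. s2 i (fst z) * flat (q i) z)
      + flat (\<lambda>t \<omega>. fu t \<omega> (X t \<omega>) (u t \<omega>)) z = 0"
  \<comment> \<open>One constant \<open>C\<close> serves growth and Taylor bounds;
    \<open>7 * L\<close> comes from \<open>quad_regular_growth\<close> and dominates the
    \<open>2 * L\<close> of the Taylor estimate.\<close>
  proof (rule stochastic_maximum_principle[where f=f and g=g and C="7 * L" and L=L
      and \<kappa>="\<lambda>z. 1 + (flat R z)\<^sup>2" and \<gamma>="\<lambda>\<omega>. 1 + (R T \<omega>)\<^sup>2" and X=X and u=u and p=p and q=q and N=N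
      and fx="\<lambda>t \<omega>. fx t \<omega> (X t \<omega>) (u t \<omega>)" and gx="\<lambda>\<omega>. gx \<omega> (X T \<omega>)" and ?b1.0=b1 and ?b2.0=b2 and ?s1.0=s1 and ?s2.0=s2])
    show "flat (\<lambda>t \<omega>. f t \<omega> (x t \<omega>) (v t \<omega>)) \<in> borel_measurable PM"
      if "progressive T F borel x" "progressive T F borel v" for x v
      by (rule progressive_measurable_PM[OF progressive_f[OF that]])
    show "\<bar>f t \<omega> x v\<bar> \<le> 7 * L * (1 + (flat R (t, \<omega>))\<^sup>2 + x\<^sup>2 + v\<^sup>2)" if "t \<in> {0..T}" "\<omega> \<in> space M" for t \<omega> x v
      using quad_regular_growth[OF f[OF that] L R(3)] by simp
    show "\<bar>g \<omega> x\<bar> \<le> 7 * L * (1 + (R T \<omega>)\<^sup>2 + x\<^sup>2)" if "\<omega> \<in> space M" for \<omega> x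
      using quad_regular_growth[OF g[OF that] L R(3), of x 0] by simp
    show "integrable PM (\<lambda>z. 1 + (flat R z)\<^sup>2)"
      using square_integrable_integrable_power2[OF R(1)] L2_proc_const[of 1]
      by (intro Bochner_Integration.integrable_add) (auto simp: L2_proc_iff square_integrable_def)
    show "integrable M (\<lambda>\<omega>. 1 + (R T \<omega>)\<^sup>2)"
      using square_integrable_integrable_power2[OF R(2)] by simp
    show "f t \<omega> (X t \<omega> + y) (u t \<omega> + w) - f t \<omega> (X t \<omega>) (u t \<omega>)
        \<le> fx t \<omega> (X t \<omega>) (u t \<omega>) * y + fu t \<omega> (X t \<omega>) (u t \<omega>) * w + 7 * L * (y\<^sup>2 + w\<^sup>2)"
      if "t \<in> {0..T}" "\<omega> \<in> space M" for t \<omega> y w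
    proof -
      have "2 * L * (y\<^sup>2 + w\<^sup>2) \<le> 7 * L * (y\<^sup>2 + w\<^sup>2)" using L by (intro mult_right_mono) auto
      then show ?thesis using quad_regular_taylor[OF f[OF that] L, of "X t \<omega>" y "u t \<omega>" w] by linarith
    qed
    show "g \<omega> (X T \<omega> + y) - g \<omega> (X T \<omega>) \<le> gx \<omega> (X T \<omega>) * y + 7 * L * y\<^sup>2" if "\<omega> \<in> space M" for \<omega> y
    proof -
      have "2 * L * y\<^sup>2 \<le> 7 * L * y\<^sup>2" using L by (intro mult_right_mono) auto
      then show ?thesis using quad_regular_taylor[OF g[OF that] L, of "X T \<omega>" y 0] by simp
    qed
    show "(\<lambda>t \<omega>. fx t \<omega> (X t \<omega>) (u t \<omega>)) \<in> L2_proc M T F" "(\<lambda>t \<omega>. fu t \<omega> (X t \<omega>) (u t \<omega>)) \<in> L2_proc M T F"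
      by (rule linear_growth_L2[OF L2(1) u], intro progressive_fx progressive_fu prog,
        use f in \<open>auto simp: quad_regular_def\<close>)+
    show "square_integrable M (\<lambda>\<omega>. gx \<omega> (X T \<omega>))"
      by (rule square_integrable_gx[OF S2_proc_square_integrable(1)[OF X T]])
    show "AE \<omega> in M. p T \<omega> = gx \<omega> (X T \<omega>)"
      using p_T AE_space by eventually_elim (simp add: gx)
    show "AE \<omega> in M. \<forall>t\<in>{0..T}. p t \<omega> = p 0 \<omega>
      + (LINT s|time t. - (b1 s * p s \<omega> + (\<Sum>i<d. s1 i s * q i s \<omega>) + fx s \<omega> (X s \<omega>) (u s \<omega>))) + (\<Sum>i<d. N i t \<omega>)"
      using p_path AE_space
    proof eventually_elim
      case (elim \<omega>)
      have drift_eq: "(LINT s|time t. - deriv (\<lambda>y. H s \<omega> (p s \<omega>) (\<lambda>i. q i s \<omega>) y (u s \<omega>)) (X s \<omega>)) =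
        (LINT s|time t. - (b1 s * p s \<omega> + (\<Sum>i<d. s1 i s * q i s \<omega>) + fx s \<omega> (X s \<omega>) (u s \<omega>)))"
        if "t \<in> {0..T}" for t
        using that elim(2) by (intro Bochner_Integration.integral_cong refl drift) (auto simp: space_restrict_space)
      show ?case
      proof
        fix t assume t: "t \<in> {0..T}"
        show "p t \<omega> = p 0 \<omega> + (LINT s|time t. - (b1 s * p s \<omega> + (\<Sum>i<d. s1 i s * q i s \<omega>) + fx s \<omega> (X s \<omega>) (u s \<omega>)))
            + (\<Sum>i<d. N i t \<omega>)"
          unfolding drift_eq[OF t, symmetric] by (rule bspec[OF elim(1) t])
      qed
    qed
    fix \<beta> Z I \<epsilon>
    assume \<beta>: "\<beta> \<in> L2_proc M T F" and Z: "Z \<in> S2_proc M T F" "AE \<omega> in M. Z 0 \<omega> = 0"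
      "AE \<omega> in M. continuous_on {0..T} (\<lambda>t. Z t \<omega>)"
      and I: "\<And>i. i < d \<Longrightarrow> ito_integral M T F (W i) (\<lambda>t \<omega>. s1 i t * Z t \<omega> + s2 i t * \<beta> t \<omega>) (I i)"
      and Z_eq: "AE \<omega> in M. \<forall>t\<in>{0..T}. Z t \<omega> = (LINT s|time t. b1 s * Z s \<omega> + b2 s * \<beta> s \<omega>) + (\<Sum>i<d. I i t \<omega>)"
    \<comment> \<open>The competitor for this direction: affinity of \<open>c\<close> and
      \<open>s\<close> makes \<open>Y\<close> the state of \<open>v\<close>, and it starts where
      \<open>X\<close> does because \<open>Z\<close> starts at zero.\<close>
    define Y where "Y t \<omega> = X t \<omega> + \<epsilon> * Z t \<omega>" for t \<omega>
    define v where "v t \<omega> = u t \<omega> + \<epsilon> * \<beta> t \<omega>" for t \<omega>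
    note Z_L2 = S2_proc_square_integrable(2)[OF Z(1)]
    have "controlled Y v"
      unfolding controlled_def Y_def[abs_def]
    proof (rule ito_process_perturb[OF Xu[unfolded controlled_def] _ I Z_eq Z(2)])
      show "(\<lambda>t \<omega>. b1 t * Z t \<omega> + b2 t * \<beta> t \<omega>) \<in> L2_proc M T F"
        by (intro L2_proc_add L2_proc_mult_deterministic[OF Z_L2 slopes(1,5)] L2_proc_mult_deterministic[OF \<beta> slopes(2,6)])
      fix t \<omega> assume t: "t \<in> {0..T}" "\<omega> \<in> space M"
      show "c t \<omega> (X t \<omega> + \<epsilon> * Z t \<omega>) (v t \<omega>) = c t \<omega> (X t \<omega>) (u t \<omega>) + \<epsilon> * (b1 t * Z t \<omega> + b2 t * \<beta> t \<omega>)"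
        by (subst (1 2) c_affine[OF t]) (simp add: v_def algebra_simps)
      show "s i t \<omega> (X t \<omega> + \<epsilon> * Z t \<omega>) (v t \<omega>) = s i t \<omega> (X t \<omega>) (u t \<omega>) + \<epsilon> * (s1 i t * Z t \<omega> + s2 i t * \<beta> t \<omega>)"
        if "i < d" for i
        by (subst (1 2) s_affine[OF that t]) (simp add: v_def algebra_simps)
    qed
    moreover have "v \<in> L2_proc M T F"
      unfolding v_def[abs_def] by (intro L2_proc_add u L2_proc_mult_deterministic[OF \<beta>, of "\<lambda>_. \<epsilon>"]) auto
    moreover have "Y \<in> S2_proc M T F"
      unfolding Y_def[abs_def]
      by (rule S2_proc_perturb[OF X ito_process_continuous[OF Xu[unfolded controlled_def]] Z(1,3)])
    moreover have "AE \<omega> in M. Y 0 \<omega> = X 0 \<omega>" using Z(2) by eventually_elim (simp add: Y_def)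
    ultimately have "cost_functional X u \<le> cost_functional Y v" using minimal by metis
    then show "(LINT \<omega>|M. (LINT t:{0..T}|lborel. f t \<omega> (X t \<omega>) (u t \<omega>)) + g \<omega> (X T \<omega>)) \<le>
      (LINT \<omega>|M. (LINT t:{0..T}|lborel. f t \<omega> (X t \<omega> + \<epsilon> * Z t \<omega>) (u t \<omega> + \<epsilon> * \<beta> t \<omega>)) + g \<omega> (X T \<omega> + \<epsilon> * Z T \<omega>))"
      by (simp add: cost_functional_def Y_def v_def)
  qed (use slopes N in \<open>auto intro: measurable_g X u p\<close>)
  \<comment> \<open>\<open>hu\<close> says that the derivative of the Hamiltonian in the control
    vanishes at \<open>u\<close>; by strong convexity \<open>u\<close> is then its only
    minimizer.\<close>
  show eq: "AE z in PM. flat u z = flat \<alpha> z"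
    using hu AE_space
  proof eventually_elim
    case (elim z)
    then have "fst z \<in> {0..T}" "snd z \<in> space M" by (auto simp: space_PM)
    from strongly_convex_the_minimizer(2)[OF hamiltonian_strongly_convex[OF this], of "flat p z" "\<lambda>i. flat (q i) z" "flat X z" "flat u z"]
      elim(1) \<alpha>[OF this]
    show ?case by simp
  qed
  have prog_\<alpha>: "progressive T F borel \<alpha>"
    by (rule progressive_cong[OF progressive_minimizer[OF prog(1,3,4)] \<alpha>[symmetric]])
  show "\<alpha> \<in> L2_proc M T F" by (rule L2_proc_AE_eq[OF u prog_\<alpha> eq])
  show "controlled X \<alpha>"
    unfolding controlled_def
  proof (rule ito_process_cong_AE[OF Xu[unfolded controlled_def]])
    show "AE z in PM. flat (\<lambda>t \<omega>. c t \<omega> (X t \<omega>) (u t \<omega>)) z = flat (\<lambda>t \<omega>. c t \<omega> (X t \<omega>) (\<alpha> t \<omega>)) z"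
      using eq by eventually_elim simp
    fix i assume i: "i < d"
    show ae: "AE z in PM. flat (\<lambda>t \<omega>. s i t \<omega> (X t \<omega>) (u t \<omega>)) z = flat (\<lambda>t \<omega>. s i t \<omega> (X t \<omega>) (\<alpha> t \<omega>)) z"
      using eq by eventually_elim simp
    have "(\<lambda>t \<omega>. s i t \<omega> (X t \<omega>) (u t \<omega>)) \<in> L2_proc M T F"
      using Xu i unfolding controlled_def ito_process_iff by (auto dest: ito_integralD(1))
    then show "(\<lambda>t \<omega>. s i t \<omega> (X t \<omega>) (\<alpha> t \<omega>)) \<in> L2_proc M T F"
      by (rule L2_proc_AE_eq[OF _ progressive_s[OF i prog(1) prog_\<alpha>] ae])
  qed (intro progressive_c prog prog_\<alpha>)+
  show "ito_process M T F p (\<lambda>t \<omega>. - deriv (\<lambda>y. H t \<omega> (p t \<omega>) (\<lambda>i. q i t \<omega>) y (\<alpha> t \<omega>)) (X t \<omega>)) (noise q)"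
  proof (rule ito_process_cong_AE[OF p_eq])
    show "AE z in PM. flat (\<lambda>t \<omega>. - deriv (\<lambda>y. H t \<omega> (p t \<omega>) (\<lambda>i. q i t \<omega>) y (u t \<omega>)) (X t \<omega>)) z =
        flat (\<lambda>t \<omega>. - deriv (\<lambda>y. H t \<omega> (p t \<omega>) (\<lambda>i. q i t \<omega>) y (\<alpha> t \<omega>)) (X t \<omega>)) z"
      using eq by eventually_elim simp
  qed (auto intro: q prog_drift prog prog_\<alpha>)
qed

end

section \<open>Coefficients\<close>

lemma return_P2: "return borel 0 \<in> P2"
  by (auto simp: P2_def space_prob_algebra prob_space_return integrable_iff_bounded nn_integral_return)

lemma space_P2_space [simp]: "space P2_space = P2"
  by (auto simp: P2_space_def space_restrict_space P2_def)

text \<open>The diagonal coupling. It extracts the Lipschitz bound in \<open>x\<close> from the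
  joint bound in \<open>(x, m)\<close>.\<close>

lemma W2_refl:
  assumes "m \<in> P2"
  shows "W2 m m \<le> 0"
proof -
  have m: "prob_space m" "sets m = sets borel" using assms by (auto simp: P2_def space_prob_algebra)
  define \<pi> where "\<pi> = distr m (borel \<Otimes>\<^sub>M borel) (\<lambda>x. (x, x) :: real \<times> real)"
  have [measurable]: "(\<lambda>x. (x, x)) \<in> measurable m (borel \<Otimes>\<^sub>M borel)"
    using m(2) by (auto simp: measurable_cong_sets[OF m(2) refl])
  have "distr m borel (\<lambda>x. x) = m" using m(2) by (intro distr_id2) simp
  then have "\<pi> \<in> couplings m m"
    using m(1) by (auto simp: couplings_def \<pi>_def distr_distr comp_def intro!: prob_space.prob_space_distr)
  moreover have "(LINT z|\<pi>. (fst z - snd z)\<^sup>2) = 0"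
    unfolding \<pi>_def by (subst integral_distr) auto
  ultimately have "(INF \<pi>\<in>couplings m m. (LINT z|\<pi>. (fst z - snd z)\<^sup>2)) \<le> 0"
    by (intro cINF_lower2[of _ _ \<pi>] bdd_belowI2[of _ 0]) (auto intro!: Bochner_Integration.integral_nonneg)
  then show ?thesis by (simp add: W2_def)
qed

lemma norm2_nonneg: "0 \<le> norm2 m"
  by (simp add: norm2_def)

text \<open>As a nonnegative integral the second moment is measurable on the space of probability
  measures.\<close>

lemma measurable_norm2: "norm2 \<in> borel_measurable P2_space"
proof -
  have "norm2 m = sqrt (enn2real (\<integral>\<^sup>+x. ennreal (x\<^sup>2) \<partial>m))" if "m \<in> P2" for m
    using that unfolding norm2_def
    by (subst integral_eq_nn_integral) (auto simp: P2_def dest: borel_measurable_integrable)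
  moreover have "(\<lambda>m. \<integral>\<^sup>+x. ennreal (x\<^sup>2) \<partial>m) \<in> borel_measurable P2_space"
    unfolding P2_space_def prob_algebra_def
    by (intro measurable_restrict_space1 nn_integral_measurable_subprob_algebra) auto
  ultimately show ?thesis by (subst measurable_cong[of P2_space norm2]) auto
qed

text \<open>\<open>H1\<close> asserts the slopes only existentially. Reading them off from the
  values of \<open>\<phi>\<close> at 0 and 1, with the point mass at 0 as measure, makes them
  measurable; the value 0 outside \<open>{0..T}\<close> makes the bounds global.\<close>

definition slope_x :: "real \<Rightarrow> (real \<Rightarrow> real \<Rightarrow> real \<Rightarrow> real measure \<Rightarrow> real) \<Rightarrow> real \<Rightarrow> real" where
  "slope_x T \<phi> t = (if t \<in> {0..T} then \<phi> t 1 0 (return borel 0) - \<phi> t 0 0 (return borel 0) else 0)"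

definition slope_u :: "real \<Rightarrow> (real \<Rightarrow> real \<Rightarrow> real \<Rightarrow> real measure \<Rightarrow> real) \<Rightarrow> real \<Rightarrow> real" where
  "slope_u T \<phi> t = (if t \<in> {0..T} then \<phi> t 0 1 (return borel 0) - \<phi> t 0 0 (return borel 0) else 0)"

lemma affine_coeff_slopes:
  assumes "affine_coeff T L K \<phi>" "0 \<le> L"
  shows "t \<in> {0..T} \<Longrightarrow> m \<in> P2 \<Longrightarrow> \<phi> t x u m = \<phi> t 0 0 m + slope_x T \<phi> t * x + slope_u T \<phi> t * u"
    and "\<bar>slope_x T \<phi> t\<bar> \<le> L" "\<bar>slope_u T \<phi> t\<bar> \<le> L"
proof -
  obtain \<phi>0 \<phi>1 \<phi>2 where \<phi>: "\<And>t m x u. t \<in> {0..T} \<Longrightarrow> m \<in> P2 \<Longrightarrow> \<phi> t x u m = \<phi>0 t m + \<phi>1 t * x + \<phi>2 t * u"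
    "\<And>t. t \<in> {0..T} \<Longrightarrow> \<bar>\<phi>1 t\<bar> \<le> L \<and> \<bar>\<phi>2 t\<bar> \<le> L"
    using assms(1) unfolding affine_coeff_def by blast
  have eq: "slope_x T \<phi> t = (if t \<in> {0..T} then \<phi>1 t else 0)" "slope_u T \<phi> t = (if t \<in> {0..T} then \<phi>2 t else 0)" for t
    unfolding slope_x_def slope_u_def by (simp_all add: \<phi>(1)[OF _ return_P2])
  show "\<phi> t x u m = \<phi> t 0 0 m + slope_x T \<phi> t * x + slope_u T \<phi> t * u" if "t \<in> {0..T}" "m \<in> P2"
    using that by (simp add: eq \<phi>(1)[OF that])
  show "\<bar>slope_x T \<phi> t\<bar> \<le> L" "\<bar>slope_u T \<phi> t\<bar> \<le> L"
    using \<phi>(2)[of t] assms(2) by (auto simp: eq)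
qed

lemma measurable_slopes:
  assumes [measurable]: "(\<lambda>(t, x, u, m). \<phi> t x u m) \<in> borel_measurable
      (restrict_space borel {0..T} \<Otimes>\<^sub>M borel \<Otimes>\<^sub>M borel \<Otimes>\<^sub>M P2_space)"
  shows "slope_x T \<phi> \<in> borel_measurable borel" "slope_u T \<phi> \<in> borel_measurable borel"
proof -
  have m: "(\<lambda>t. \<phi> t x u (return borel 0)) \<in> borel_measurable (restrict_space borel {0..T})" for x u
  proof -
    have "(\<lambda>t. (t, x, u, return borel 0)) \<in>
        measurable (restrict_space borel {0..T}) (restrict_space borel {0..T} \<Otimes>\<^sub>M borel \<Otimes>\<^sub>M borel \<Otimes>\<^sub>M P2_space)"
      using return_P2 by (intro measurable_Pair measurable_const measurable_ident_sets) auto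
    from measurable_compose[OF this assms] show ?thesis by simp
  qed
  have "(\<lambda>t. if t \<in> {0..T} then f t else 0) \<in> borel_measurable borel"
    if "f \<in> borel_measurable (restrict_space borel {0..T})" for f :: "real \<Rightarrow> real"
    using that by (subst measurable_If_restrict_space_iff) (simp_all only: Collect_mem_eq, auto)
  from this[OF borel_measurable_diff[OF m m]]
  show "slope_x T \<phi> \<in> borel_measurable borel" "slope_u T \<phi> \<in> borel_measurable borel"
    unfolding slope_x_def[abs_def] slope_u_def[abs_def] by blast+
qed

context filtered_space
begin

lemma progressive_compose_coeff:
  assumes X: "progressive T F N X"
    and f: "(\<lambda>(t, x). f t x) \<in> measurable (restrict_space borel {0..T} \<Otimes>\<^sub>M N) K"
  shows "progressive T F K (\<lambda>t \<omega>. f t (X t \<omega>))"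
proof (rule progressive_compose[OF X])
  fix t assume t: "t \<in> {0..T}"
  have "(\<lambda>s. s) \<in> measurable (restrict_space borel {0..t}) (restrict_space borel {0..T})"
    using t by (intro measurable_restrict_space3) auto
  then have "(\<lambda>z. (fst z, snd z)) \<in> measurable (restrict_space borel {0..t} \<Otimes>\<^sub>M N) (restrict_space borel {0..T} \<Otimes>\<^sub>M N)"
    by (intro measurable_Pair measurable_compose[OF measurable_fst]) auto
  from measurable_compose[OF this f] show "(\<lambda>z. f (fst z) (snd z)) \<in> measurable (restrict_space borel {0..t} \<Otimes>\<^sub>M N) K"
    by simp
qed

lemma progressive_coeff:
  assumes \<phi>: "(\<lambda>(t, x, u, m). \<phi> t x u m) \<in> borel_measurable
      (restrict_space borel {0..T} \<Otimes>\<^sub>M borel \<Otimes>\<^sub>M borel \<Otimes>\<^sub>M P2_space)"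
    and p: "progressive T F borel x" "progressive T F borel u" "progressive T F P2_space m"
  shows "progressive T F borel (\<lambda>t \<omega>. \<phi> t (x t \<omega>) (u t \<omega>) (m t \<omega>))"
  using progressive_compose_coeff[OF progressive_Pair[OF p(1) progressive_Pair[OF p(2,3)]],
      of "\<lambda>t (x, u, m). \<phi> t x u m" borel] \<phi> by simp

lemma progressive_coeff':
  assumes \<phi>: "(\<lambda>(t, x, u, m, y). \<phi> t x u m y) \<in> borel_measurable
      (restrict_space borel {0..T} \<Otimes>\<^sub>M borel \<Otimes>\<^sub>M borel \<Otimes>\<^sub>M P2_space \<Otimes>\<^sub>M borel)"
    and p: "progressive T F borel x" "progressive T F borel u" "progressive T F P2_space m" "progressive T F borel y"
  shows "progressive T F borel (\<lambda>t \<omega>. \<phi> t (x t \<omega>) (u t \<omega>) (m t \<omega>) (y t \<omega>))"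
  using progressive_compose_coeff[OF progressive_Pair[OF p(1) progressive_Pair[OF p(2) progressive_Pair[OF p(3,4)]]],
      of "\<lambda>t (x, u, m, y). \<phi> t x u m y" borel] \<phi> by simp

text \<open>The norm of the flow is part of \<open>R\<close> in \<open>affine_control\<close>, and
  membership in \<open>P2\<close> at every point is what allows the assumptions to be instantiated
  there.\<close>

lemma P2_flow_norm2:
  assumes "m \<in> P2_flow M T F"
  shows "(\<lambda>t \<omega>. norm2 (m t \<omega>)) \<in> S2_proc M T F" and "progressive T F P2_space m"
    and "t \<in> {0..T} \<Longrightarrow> \<omega> \<in> space M \<Longrightarrow> m t \<omega> \<in> P2"
proof -
  show m: "progressive T F P2_space m" using assms by (simp add: P2_flow_def)
  have "(\<lambda>(t, y). norm2 y) \<in> borel_measurable (restrict_space borel {0..T} \<Otimes>\<^sub>M P2_space)"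
    using measurable_compose[OF measurable_snd measurable_norm2] by (simp add: case_prod_beta')
  from progressive_compose_coeff[OF m this]
  show "(\<lambda>t \<omega>. norm2 (m t \<omega>)) \<in> S2_proc M T F" using assms by (simp add: S2_proc_def P2_flow_def)
  show "m t \<omega> \<in> P2" if "t \<in> {0..T}" "\<omega> \<in> space M"
    using measurable_space[OF progressive_measurable_M[OF m that(1)] that(2)] by simp
qed

end

text \<open>Peels off the fourteen conjuncts of \<open>H2\<close>, so that \<open>H2D(k)\<close> is
  the \<open>k\<close>-th in their order.\<close>

lemmas H2_1 = H2_def[THEN iffD1]
lemmas H2_2 = H2_1[THEN conjunct2]
lemmas H2_3 = H2_2[THEN conjunct2]
lemmas H2_4 = H2_3[THEN conjunct2]
lemmas H2_5 = H2_4[THEN conjunct2]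
lemmas H2_6 = H2_5[THEN conjunct2]
lemmas H2_7 = H2_6[THEN conjunct2]
lemmas H2_8 = H2_7[THEN conjunct2]
lemmas H2_9 = H2_8[THEN conjunct2]
lemmas H2_10 = H2_9[THEN conjunct2]
lemmas H2_11 = H2_10[THEN conjunct2]
lemmas H2_12 = H2_11[THEN conjunct2]
lemmas H2_13 = H2_12[THEN conjunct2]
lemmas H2_14 = H2_13[THEN conjunct2]
lemmas H2D = H2_1[THEN conjunct1, rule_format] H2_2[THEN conjunct1, rule_format] H2_3[THEN conjunct1, rule_format]
  H2_4[THEN conjunct1, rule_format] H2_5[THEN conjunct1, rule_format] H2_6[THEN conjunct1, rule_format]
  H2_7[THEN conjunct1, rule_format] H2_8[THEN conjunct1, rule_format] H2_9[THEN conjunct1, rule_format]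
  H2_10[THEN conjunct1, rule_format] H2_11[THEN conjunct1, rule_format] H2_12[THEN conjunct1, rule_format]
  H2_13[THEN conjunct1, rule_format] H2_14[rule_format]

section \<open>Regularity and convexity of the costs\<close>

lemma has_partial_derivatives:
  fixes \<psi> :: "real \<Rightarrow> real \<Rightarrow> real"
  assumes "(\<lambda>(x, u). \<psi> x u) differentiable (at (x, u))"
  shows "((\<lambda>y. \<psi> y u) has_real_derivative deriv (\<lambda>y. \<psi> y u) x) (at x)"
    and "((\<lambda>v. \<psi> x v) has_real_derivative deriv (\<lambda>v. \<psi> x v) u) (at u)"
proof -
  have "(\<lambda>y. (y, u)) differentiable (at x)" "(\<lambda>v. (x, v)) differentiable (at u)"
    unfolding differentiable_def by (auto intro!: exI derivative_eq_intros)
  then have "(\<lambda>(x, u). \<psi> x u) \<circ> (\<lambda>y. (y, u)) differentiable (at x)"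
    "(\<lambda>(x, u). \<psi> x u) \<circ> (\<lambda>v. (x, v)) differentiable (at u)"
    using assms by (auto intro!: differentiable_chain_at)
  then show "((\<lambda>y. \<psi> y u) has_real_derivative deriv (\<lambda>y. \<psi> y u) x) (at x)"
    "((\<lambda>v. \<psi> x v) has_real_derivative deriv (\<lambda>v. \<psi> x v) u) (at u)"
    by (auto simp: comp_def DERIV_deriv_iff_real_differentiable)
qed

lemma has_deriv:
  "(f :: real \<Rightarrow> real) differentiable (at x) \<Longrightarrow> (f has_real_derivative deriv f x) (at x)"
  by (simp add: DERIV_deriv_iff_real_differentiable)

lemma major_cost_regular:
  assumes H2: "H2 T L lm lx0 D" and L: "1 \<le> L" and m: "m \<in> P2"
  shows "t \<in> {0..T} \<Longrightarrow> quad_regular L (norm2 m) (\<lambda>x u. cf0 D t x u m) (\<lambda>x u. f0_x D t x u m) (\<lambda>x u. f0_u D t x u m)"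
    and "quad_regular L (norm2 m) (\<lambda>x u. cg0 D x m) (\<lambda>x u. g0_x D x m) (\<lambda>x u. 0)"
proof -
  have add: "L * a \<le> L * (a + b)" if "0 \<le> b" for a b using L that by (intro mult_left_mono) auto
  show "quad_regular L (norm2 m) (\<lambda>x u. cf0 D t x u m) (\<lambda>x u. f0_x D t x u m) (\<lambda>x u. f0_u D t x u m)"
    if t: "t \<in> {0..T}"
  proof -
    have d: "(\<lambda>(x, u). cf0 D t x u m) differentiable (at (x, u))" and b: "\<bar>cf0 D t 0 0 m\<bar> \<le> L * (1 + (norm2 m)\<^sup>2)" for x u
      by (intro H2D(3)[OF H2] H2D(1)[OF H2] t m)+
    have "\<bar>\<phi> t x u m\<bar> \<le> L * (1 + \<bar>x\<bar> + \<bar>u\<bar> + norm2 m)"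
      "\<bar>\<phi> t x u m - \<phi> t x' u' m\<bar> \<le> L * (\<bar>x - x'\<bar> + \<bar>u - u'\<bar>)" if "\<phi> \<in> {f0_x D, f0_u D}" for \<phi> x u x' u'
      using H2D(5)[OF H2 that t m m] by blast+
    from this[of "f0_x D"] this[of "f0_u D"] show ?thesis
      using has_partial_derivatives[OF d, folded f0_x_def f0_u_def] b unfolding quad_regular_def by blast
  qed
  have g: "(\<lambda>x. cg0 D x m) differentiable (at x)" "\<bar>cg0 D 0 m\<bar> \<le> L * (1 + (norm2 m)\<^sup>2)"
    "\<bar>g0_x D x m\<bar> \<le> L * (1 + \<bar>x\<bar> + norm2 m)" "\<bar>g0_x D x m - g0_x D x' m\<bar> \<le> L * \<bar>x - x'\<bar>" for x x'
    using H2D(2,4)[OF H2 m] H2D(6)[OF H2 m m] by blast+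
  have "\<bar>g0_x D x m\<bar> \<le> L * (1 + \<bar>x\<bar> + \<bar>u\<bar> + norm2 m)" "\<bar>g0_x D x m - g0_x D x' m\<bar> \<le> L * (\<bar>x - x'\<bar> + \<bar>u - u'\<bar>)" for x u x' u'
    using g(3)[of x] g(4)[of x x'] add[of "\<bar>u\<bar>" "1 + \<bar>x\<bar> + norm2 m"] add[of "\<bar>u - u'\<bar>" "\<bar>x - x'\<bar>"]
    by (simp_all add: algebra_simps)
  then show "quad_regular L (norm2 m) (\<lambda>x u. cg0 D x m) (\<lambda>x u. g0_x D x m) (\<lambda>x u. 0)"
    using g(2) has_deriv[OF g(1)] L norm2_nonneg[of m] by (simp add: quad_regular_def g0_x_def)
qed

text \<open>\<open>H3\<close> between points with the same state; the modulus is lowered to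
  \<open>inverse L\<close>, which does not depend on the existential witness.\<close>

lemma major_cost_convex:
  assumes H2: "H2 T L lm lx0 D" and H3: "H3 T L D" and L: "1 \<le> L" and t: "t \<in> {0..T}" and m: "m \<in> P2"
  shows "strongly_convex (inverse L) (\<lambda>v. cf0 D t x v m) (\<lambda>v. f0_u D t x v m)"
proof -
  obtain C where C: "inverse L \<le> C" "\<forall>t\<in>{0..T}. \<forall>m\<in>P2. \<forall>x1 x2 u1 u2. cf0 D t x2 u2 m - cf0 D t x1 u1 m
      - (f0_x D t x1 u1 m * (x2 - x1) + f0_u D t x1 u1 m * (u2 - u1)) \<ge> C * \<bar>u2 - u1\<bar>\<^sup>2"
    using H3 unfolding H3_def by blast
  have "inverse L * (w - v)\<^sup>2 \<le> cf0 D t x w m - cf0 D t x v m - f0_u D t x v m * (w - v)" for v w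
    using C(2)[rule_format, OF t m, of w v x x] mult_right_mono[OF C(1), of "(w - v)\<^sup>2"] by simp
  then show ?thesis
    using L major_cost_regular(1)[OF H2 L m t] by (auto simp: strongly_convex_def quad_regular_def)
qed

text \<open>The state derivative adds one part from \<open>f1\<close> and one from
  \<open>f2\<close>, each controlled with \<open>L\<close>; hence \<open>2 * L\<close>. The norms of
  the measure and of the major state \<open>y\<close> add up to the size parameter.\<close>

lemma minor_cost_regular:
  assumes H2: "H2 T L lm lx0 D" and L: "1 \<le> L" and m: "m \<in> P2"
  shows "t \<in> {0..T} \<Longrightarrow> quad_regular (2 * L) (norm2 m + \<bar>y\<bar>) (\<lambda>x u. cf D t x u m y)
      (\<lambda>x u. f1_x D t x u y + f2_x D t x m y) (\<lambda>x u. f1_u D t x u y)"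
    and "quad_regular (2 * L) (norm2 m + \<bar>y\<bar>) (\<lambda>x u. cg D x m y) (\<lambda>x u. g_x D x m y) (\<lambda>x u. 0)"
proof -
  have scale: "L * a \<le> 2 * L * b" if "a \<le> b" "0 \<le> b" for a b
  proof -
    have "L * a \<le> L * b" using L that by (intro mult_left_mono) auto
    also have "\<dots> \<le> 2 * L * b" using L that by (intro mult_right_mono) auto
    finally show ?thesis .
  qed
  have sum: "L * a + L * b \<le> 2 * L * c" if "a \<le> c" "b \<le> c" for a b c
  proof -
    have "L * a \<le> L * c" "L * b \<le> L * c" using L that by (intro mult_left_mono; simp)+
    then show ?thesis by simp
  qed
  note n = norm2_nonneg[of m]
  have sq: "1 + (norm2 m)\<^sup>2 + y\<^sup>2 \<le> 1 + (norm2 m + \<bar>y\<bar>)\<^sup>2"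
    using n by (simp add: power2_sum)
  have lin: "\<bar>\<phi> x m y\<bar> \<le> L * (1 + \<bar>x\<bar> + norm2 m + \<bar>y\<bar>)" "\<bar>\<phi> x m y - \<phi> x' m y\<bar> \<le> L * \<bar>x - x'\<bar>"
    if "\<phi> \<in> insert (g_x D) (f2_x D ` {0..T})" for \<phi> x x'
  proof -
    have "\<bar>\<phi> x m y\<bar> \<le> L * (1 + \<bar>x\<bar> + norm2 m + \<bar>y\<bar>) \<and> \<bar>\<phi> x m y - \<phi> x' m y\<bar> \<le> L * (\<bar>x - x'\<bar> + W2 m m)"
      using H2D(14)[OF H2 that m m] by blast
    moreover have "L * (\<bar>x - x'\<bar> + W2 m m) \<le> L * \<bar>x - x'\<bar>"
      using L W2_refl[OF m] by (intro mult_left_mono) auto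
    ultimately show "\<bar>\<phi> x m y\<bar> \<le> L * (1 + \<bar>x\<bar> + norm2 m + \<bar>y\<bar>)" "\<bar>\<phi> x m y - \<phi> x' m y\<bar> \<le> L * \<bar>x - x'\<bar>"
      by linarith+
  qed
  show "quad_regular (2 * L) (norm2 m + \<bar>y\<bar>) (\<lambda>x u. cf D t x u m y)
      (\<lambda>x u. f1_x D t x u y + f2_x D t x m y) (\<lambda>x u. f1_u D t x u y)" if t: "t \<in> {0..T}"
  proof -
    have d1: "(\<lambda>(x, u). cf1 D t x u y) differentiable (at (x, u))" and d2: "(\<lambda>x. cf2 D t x m y) differentiable (at x)"
      and f: "cf D t x u m y = cf1 D t x u y + cf2 D t x m y"
      and f0: "\<bar>cf D t 0 0 m y\<bar> \<le> L * (1 + (norm2 m)\<^sup>2 + y\<^sup>2)" for x u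
      by (intro H2D(10)[OF H2] H2D(11)[OF H2] H2D(9)[OF H2] H2D(7)[OF H2] t m)+
    have f1: "\<bar>\<phi> t x u y\<bar> \<le> L * (1 + \<bar>x\<bar> + \<bar>u\<bar> + \<bar>y\<bar>)"
      "\<bar>\<phi> t x u y - \<phi> t x' u' y\<bar> \<le> L * (\<bar>x - x'\<bar> + \<bar>u - u'\<bar>)" if "\<phi> \<in> {f1_x D, f1_u D}" for \<phi> x u x' u'
      using H2D(13)[OF H2 that t] by blast+
    note f2 = lin[of "f2_x D t"]
    show ?thesis
      unfolding quad_regular_def
    proof (intro conjI allI)
      show "\<bar>cf D t 0 0 m y\<bar> \<le> 2 * L * (1 + (norm2 m + \<bar>y\<bar>)\<^sup>2)"
        by (rule order_trans[OF f0 scale[OF sq]]) simp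
      fix x u x' u'
      show "((\<lambda>x. cf D t x u m y) has_real_derivative f1_x D t x u y + f2_x D t x m y) (at x)"
        unfolding f f1_x_def f2_x_def by (intro DERIV_add has_partial_derivatives d1 has_deriv d2)
      show "((\<lambda>u. cf D t x u m y) has_real_derivative f1_u D t x u y) (at u)"
        using DERIV_add[OF has_partial_derivatives(2)[OF d1] DERIV_const] unfolding f f1_u_def by simp
      have "\<bar>f1_x D t x u y + f2_x D t x m y\<bar> \<le> L * (1 + \<bar>x\<bar> + \<bar>u\<bar> + \<bar>y\<bar>) + L * (1 + \<bar>x\<bar> + norm2 m + \<bar>y\<bar>)"
        by (intro order_trans[OF abs_triangle_ineq] add_mono f1 f2) (use t in auto)
      also have "\<dots> \<le> 2 * L * (1 + \<bar>x\<bar> + \<bar>u\<bar> + (norm2 m + \<bar>y\<bar>))"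
        using n by (intro sum) auto
      finally show "\<bar>f1_x D t x u y + f2_x D t x m y\<bar> \<le> 2 * L * (1 + \<bar>x\<bar> + \<bar>u\<bar> + (norm2 m + \<bar>y\<bar>))" .
      have "\<bar>f1_u D t x u y\<bar> \<le> L * (1 + \<bar>x\<bar> + \<bar>u\<bar> + \<bar>y\<bar>)" by (intro f1) simp
      then show "\<bar>f1_u D t x u y\<bar> \<le> 2 * L * (1 + \<bar>x\<bar> + \<bar>u\<bar> + (norm2 m + \<bar>y\<bar>))"
        by (rule order_trans) (use n in \<open>auto intro!: scale\<close>)
      have "\<bar>f1_x D t x u y + f2_x D t x m y - (f1_x D t x' u' y + f2_x D t x' m y)\<bar>
          \<le> L * (\<bar>x - x'\<bar> + \<bar>u - u'\<bar>) + L * \<bar>x - x'\<bar>"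
        by (intro order_trans[OF abs_diff_triangle_ineq] add_mono f1 f2) (use t in auto)
      also have "\<dots> \<le> 2 * L * (\<bar>x - x'\<bar> + \<bar>u - u'\<bar>)" by (intro sum) auto
      finally show "\<bar>f1_x D t x u y + f2_x D t x m y - (f1_x D t x' u' y + f2_x D t x' m y)\<bar>
          \<le> 2 * L * (\<bar>x - x'\<bar> + \<bar>u - u'\<bar>)" .
      have "\<bar>f1_u D t x u y - f1_u D t x' u' y\<bar> \<le> L * (\<bar>x - x'\<bar> + \<bar>u - u'\<bar>)" by (intro f1) simp
      then show "\<bar>f1_u D t x u y - f1_u D t x' u' y\<bar> \<le> 2 * L * (\<bar>x - x'\<bar> + \<bar>u - u'\<bar>)"
        by (rule order_trans[OF _ scale[OF order_refl]]) simp
    qed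
  qed
  have g: "(\<lambda>x. cg D x m y) differentiable (at x)" "\<bar>cg D 0 m y\<bar> \<le> L * (1 + (norm2 m)\<^sup>2 + y\<^sup>2)" for x
    by (intro H2D(12)[OF H2] H2D(8)[OF H2] m)+
  show "quad_regular (2 * L) (norm2 m + \<bar>y\<bar>) (\<lambda>x u. cg D x m y) (\<lambda>x u. g_x D x m y) (\<lambda>x u. 0)"
    unfolding quad_regular_def
  proof (intro conjI allI)
    show "\<bar>cg D 0 m y\<bar> \<le> 2 * L * (1 + (norm2 m + \<bar>y\<bar>)\<^sup>2)"
      by (rule order_trans[OF g(2) scale[OF sq]]) simp
    fix x u x' u' :: real
    show "((\<lambda>x. cg D x m y) has_real_derivative g_x D x m y) (at x)"
      unfolding g_x_def by (rule has_deriv[OF g(1)])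
    show "((\<lambda>u. cg D x m y) has_real_derivative 0) (at u)" by simp
    show "\<bar>g_x D x m y\<bar> \<le> 2 * L * (1 + \<bar>x\<bar> + \<bar>u\<bar> + (norm2 m + \<bar>y\<bar>))"
      by (rule order_trans[OF lin(1)]) (use n in \<open>auto intro!: scale\<close>)
    show "\<bar>g_x D x m y - g_x D x' m y\<bar> \<le> 2 * L * (\<bar>x - x'\<bar> + \<bar>u - u'\<bar>)"
      by (rule order_trans[OF lin(2)]) (auto intro!: scale)
    show "\<bar>0 :: real\<bar> \<le> 2 * L * (1 + \<bar>x\<bar> + \<bar>u\<bar> + (norm2 m + \<bar>y\<bar>))" "\<bar>0 - 0 :: real\<bar> \<le> 2 * L * (\<bar>x - x'\<bar> + \<bar>u - u'\<bar>)"
      using n L by auto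
  qed
qed

lemma minor_cost_convex:
  assumes H2: "H2 T L lm lx0 D" and H3: "H3 T L D" and L: "1 \<le> L" and t: "t \<in> {0..T}" and m: "m \<in> P2"
  shows "strongly_convex (inverse L) (\<lambda>v. cf D t x v m y) (\<lambda>v. f1_u D t x v y)"
proof -
  obtain C where C: "inverse L \<le> C" "\<forall>t\<in>{0..T}. \<forall>x0 x1 x2 u1 u2. cf1 D t x2 u2 x0 - cf1 D t x1 u1 x0
      - (f1_x D t x1 u1 x0 * (x2 - x1) + f1_u D t x1 u1 x0 * (u2 - u1)) \<ge> C * \<bar>u2 - u1\<bar>\<^sup>2"
    using H3 unfolding H3_def by blast
  have "inverse L * (w - v)\<^sup>2 \<le> cf D t x w m y - cf D t x v m y - f1_u D t x v y * (w - v)" for v w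
    using C(2)[rule_format, OF t, of w v x y x] mult_right_mono[OF C(1), of "(w - v)\<^sup>2"] by (simp add: H2D(9)[OF H2 t m])
  then show ?thesis
    using L minor_cost_regular(1)[OF H2 L m t] by (auto simp: strongly_convex_def quad_regular_def)
qed

section \<open>The two control problems of the game\<close>

text \<open>The flow and the major state live on the smaller filtration but are data of the minor
  player's problem on \<open>filt\<close>.\<close>

lemma progressive_filt0_filt:
  assumes "progressive T (filt0 B) N X"
  shows "progressive T (filt B) N X"
  unfolding progressive_def
proof
  fix t assume t: "t \<in> {0..T}"
  have "(\<lambda>\<omega>. \<omega>) \<in> measurable (filt B t) (filt0 B t)"
    by (rule filt0_measurable_filt[OF measurable_ident_sets[OF refl]])
  then have "(\<lambda>z. (fst z, snd z)) \<in>
      measurable (restrict_space borel {0..t} \<Otimes>\<^sub>M filt B t) (restrict_space borel {0..t} \<Otimes>\<^sub>M filt0 B t)"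
    by (intro measurable_Pair measurable_compose[OF measurable_snd] measurable_fst)
  moreover have "(\<lambda>(s, \<omega>). X s \<omega>) \<in> measurable (restrict_space borel {0..t} \<Otimes>\<^sub>M filt0 B t) N"
    using assms t by (simp add: progressive_def)
  ultimately have "(\<lambda>z. case (fst z, snd z) of (s, \<omega>) \<Rightarrow> X s \<omega>) \<in> measurable (restrict_space borel {0..t} \<Otimes>\<^sub>M filt B t) N"
    by (rule measurable_compose)
  then show "(\<lambda>(s, \<omega>). X s \<omega>) \<in> measurable (restrict_space borel {0..t} \<Otimes>\<^sub>M filt B t) N"
    by (simp add: case_prod_beta')
qed

lemma S2_0_S2_F: "X \<in> S2_0 B \<Longrightarrow> X \<in> S2_F B"
  by (simp add: S2_proc_def progressive_filt0_filt)

lemma P2_flow_filt0_filt: "m \<in> P2_flow M T (filt0 B) \<Longrightarrow> m \<in> P2_flow M T (filt B)"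
  by (simp add: P2_flow_def progressive_filt0_filt)

lemma major_affine_control:
  fixes B :: "'a setting"
  assumes B: "valid_setting B" and L: "1 \<le> L" and meas: "measurable_coeffs (bT B) D"
    and H1: "H1 (bT B) L Lm lm D" and H2: "H2 (bT B) L lm lx0 D" and H3: "H3 (bT B) L D"
    and m: "m \<in> P2_flow (bM B) (bT B) (filt0 B)"
  shows "affine_control (bM B) (bT B) (filt0 B) 1 (\<lambda>i. bW0 B)
    (\<lambda>t \<omega> x v. cb0 D t x v (m t \<omega>)) (\<lambda>t \<omega> x v. cf0 D t x v (m t \<omega>))
    (\<lambda>t \<omega> x v. f0_x D t x v (m t \<omega>)) (\<lambda>t \<omega> x v. f0_u D t x v (m t \<omega>)) (\<lambda>i t \<omega> x v. cs0 D t x v (m t \<omega>))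
    (slope_x (bT B) (cb0 D)) (slope_u (bT B) (cb0 D)) (\<lambda>i. slope_x (bT B) (cs0 D)) (\<lambda>i. slope_u (bT B) (cs0 D))
    (\<lambda>\<omega> x. cg0 D x (m (bT B) \<omega>)) (\<lambda>\<omega> x. g0_x D x (m (bT B) \<omega>)) (\<lambda>t \<omega>. norm2 (m t \<omega>)) L (inverse L)"
proof -
  interpret brownian_basis "bM B" "bT B" "filt0 B" 1 "\<lambda>i. bW0 B" by (rule brownian_basis_filt0[OF B])
  note m_norm = P2_flow_norm2(1)[OF m] and m_prog = P2_flow_norm2(2)[OF m] and m_P2 = P2_flow_norm2(3)[OF m]
  have T: "bT B \<in> {0..bT B}" using T_pos by simp
  have aff: "affine_coeff (bT B) L lm (cb0 D)" "affine_coeff (bT B) L lm (cs0 D)" using H1 by (auto simp: H1_def)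
  have ms: "(\<lambda>(t, x, u, m). \<phi> t x u m) \<in> borel_measurable
      (restrict_space borel {0..bT B} \<Otimes>\<^sub>M borel \<Otimes>\<^sub>M borel \<Otimes>\<^sub>M P2_space)" if "\<phi> \<in> {cb0 D, cs0 D, cf0 D}" for \<phi>
    using meas that unfolding measurable_coeffs_def by blast
  have mg: "(\<lambda>(x, m). cg0 D x m) \<in> borel_measurable (borel \<Otimes>\<^sub>M P2_space)"
    using meas unfolding measurable_coeffs_def by blast
  have L0: "0 \<le> L" using L by simp
  note aff_bound = affine_coeff_slopes(2,3)[OF aff(1) L0] affine_coeff_slopes(2,3)[OF aff(2) L0]
  have slopes: "slope_x (bT B) \<phi> \<in> borel_measurable borel" "slope_u (bT B) \<phi> \<in> borel_measurable borel"
    if "\<phi> \<in> {cb0 D, cs0 D, cf0 D}" for \<phi> by (rule measurable_slopes[OF ms[OF that]])+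
  have prog: "progressive (bT B) (filt0 B) borel (\<lambda>t \<omega>. \<phi> t (x t \<omega>) (v t \<omega>) (m t \<omega>))"
    if "\<phi> \<in> {cb0 D, cs0 D, cf0 D}" "progressive (bT B) (filt0 B) borel x" "progressive (bT B) (filt0 B) borel v" for \<phi> x v
    by (rule progressive_coeff[OF ms[OF that(1)] that(2,3) m_prog])
  show ?thesis
  proof (intro affine_control.intro affine_control_axioms.intro brownian_basis_axioms)
    show "square_integrable PM (flat (\<lambda>t \<omega>. norm2 (m t \<omega>)))"
      using S2_proc_square_integrable(2)[OF m_norm] by (simp add: L2_proc_iff)
    show "square_integrable (bM B) (\<lambda>\<omega>. norm2 (m (bT B) \<omega>))"
      by (rule S2_proc_square_integrable(1)[OF m_norm T])
    show "(\<lambda>\<omega>. cg0 D (x \<omega>) (m (bT B) \<omega>)) \<in> borel_measurable (bM B)" if "x \<in> borel_measurable (bM B)" for x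
      using measurable_compose[OF measurable_Pair[OF that progressive_measurable_M[OF m_prog T]] mg] by simp
    show "cb0 D t x v (m t \<omega>) = cb0 D t 0 0 (m t \<omega>) + slope_x (bT B) (cb0 D) t * x + slope_u (bT B) (cb0 D) t * v"
      if "t \<in> {0..bT B}" "\<omega> \<in> space (bM B)" for t \<omega> x v
      by (rule affine_coeff_slopes(1)[OF aff(1) L0 that(1) m_P2[OF that]])
    show "cs0 D t x v (m t \<omega>) = cs0 D t 0 0 (m t \<omega>) + slope_x (bT B) (cs0 D) t * x + slope_u (bT B) (cs0 D) t * v"
      if "t \<in> {0..bT B}" "\<omega> \<in> space (bM B)" for t \<omega> x v
      by (rule affine_coeff_slopes(1)[OF aff(2) L0 that(1) m_P2[OF that]])
    show "quad_regular L (norm2 (m t \<omega>)) (\<lambda>x v. cf0 D t x v (m t \<omega>)) (\<lambda>x v. f0_x D t x v (m t \<omega>)) (\<lambda>x v. f0_u D t x v (m t \<omega>))"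
      if "t \<in> {0..bT B}" "\<omega> \<in> space (bM B)" for t \<omega>
      by (rule major_cost_regular(1)[OF H2 L m_P2[OF that] that(1)])
    show "quad_regular L (norm2 (m (bT B) \<omega>)) (\<lambda>x v. cg0 D x (m (bT B) \<omega>)) (\<lambda>x v. g0_x D x (m (bT B) \<omega>)) (\<lambda>x v. 0)"
      if "\<omega> \<in> space (bM B)" for \<omega>
      by (rule major_cost_regular(2)[OF H2 L m_P2[OF T that]])
    show "strongly_convex (inverse L) (\<lambda>v. cf0 D t x v (m t \<omega>)) (\<lambda>v. f0_u D t x v (m t \<omega>))"
      if "t \<in> {0..bT B}" "\<omega> \<in> space (bM B)" for t \<omega> x
      by (rule major_cost_convex[OF H2 H3 L that(1) m_P2[OF that]])
  qed (rule aff_bound L0 norm2_nonneg | rule slopes, simp | rule prog[of "cb0 D"] prog[of "cs0 D"] prog[of "cf0 D"], simp, assumption, assumption)+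
qed

text \<open>The major state enters as random data in the costs and in the size parameter;
  \<open>2 * L\<close> is the constant of \<open>minor_cost_regular\<close>, used for the slopes as
  well.\<close>

lemma minor_affine_control:
  fixes B :: "'a setting"
  assumes B: "valid_setting B" and L: "1 \<le> L" and meas: "measurable_coeffs (bT B) D"
    and H1: "H1 (bT B) L Lm lm D" and H2: "H2 (bT B) L lm lx0 D" and H3: "H3 (bT B) L D"
    and m: "m \<in> P2_flow (bM B) (bT B) (filt B)" and X0: "X0 \<in> S2_F B"
  shows "affine_control (bM B) (bT B) (filt B) 2 (\<lambda>i. if i = 0 then bW B else bW0 B)
    (\<lambda>t \<omega> x v. cb D t x v (m t \<omega>)) (\<lambda>t \<omega> x v. cf D t x v (m t \<omega>) (X0 t \<omega>))
    (\<lambda>t \<omega> x v. f1_x D t x v (X0 t \<omega>) + f2_x D t x (m t \<omega>) (X0 t \<omega>)) (\<lambda>t \<omega> x v. f1_u D t x v (X0 t \<omega>))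
    (\<lambda>i t \<omega> x v. (if i = 0 then cs D else cst D) t x v (m t \<omega>))
    (slope_x (bT B) (cb D)) (slope_u (bT B) (cb D))
    (\<lambda>i. slope_x (bT B) (if i = 0 then cs D else cst D)) (\<lambda>i. slope_u (bT B) (if i = 0 then cs D else cst D))
    (\<lambda>\<omega> x. cg D x (m (bT B) \<omega>) (X0 (bT B) \<omega>)) (\<lambda>\<omega> x. g_x D x (m (bT B) \<omega>) (X0 (bT B) \<omega>))
    (\<lambda>t \<omega>. norm2 (m t \<omega>) + \<bar>X0 t \<omega>\<bar>) (2 * L) (inverse L)"
proof -
  interpret brownian_basis "bM B" "bT B" "filt B" 2 "\<lambda>i. if i = 0 then bW B else bW0 B" by (rule brownian_basis_filt[OF B])
  note m_norm = P2_flow_norm2(1)[OF m] and m_prog = P2_flow_norm2(2)[OF m] and m_P2 = P2_flow_norm2(3)[OF m]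
  have T: "bT B \<in> {0..bT B}" using T_pos by simp
  have X0_prog: "progressive (bT B) (filt B) borel X0" using X0 by (simp add: S2_proc_def)
  have aff: "affine_coeff (bT B) L Lm \<phi>" if "\<phi> \<in> {cb D, cs D, cst D}" for \<phi> using H1 that by (auto simp: H1_def)
  have ms: "(\<lambda>(t, x, u, m). \<phi> t x u m) \<in> borel_measurable
      (restrict_space borel {0..bT B} \<Otimes>\<^sub>M borel \<Otimes>\<^sub>M borel \<Otimes>\<^sub>M P2_space)" if "\<phi> \<in> {cb D, cs D, cst D}" for \<phi>
    using meas that unfolding measurable_coeffs_def by blast
  have mf: "(\<lambda>(t, x, u, m, x0). cf D t x u m x0) \<in> borel_measurable
       (restrict_space borel {0..bT B} \<Otimes>\<^sub>M borel \<Otimes>\<^sub>M borel \<Otimes>\<^sub>M P2_space \<Otimes>\<^sub>M borel)"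
    and mg: "(\<lambda>(x, m, x0). cg D x m x0) \<in> borel_measurable (borel \<Otimes>\<^sub>M P2_space \<Otimes>\<^sub>M borel)"
    using meas unfolding measurable_coeffs_def by blast+
  have L0: "0 \<le> L" using L by simp
  have bound: "\<bar>slope_x (bT B) \<phi> t\<bar> \<le> 2 * L" "\<bar>slope_u (bT B) \<phi> t\<bar> \<le> 2 * L" if "\<phi> \<in> {cb D, cs D, cst D}" for \<phi> t
    using affine_coeff_slopes(2,3)[OF aff[OF that] L0, of t] L0 by linarith+
  have slopes: "slope_x (bT B) \<phi> \<in> borel_measurable borel" "slope_u (bT B) \<phi> \<in> borel_measurable borel"
    if "\<phi> \<in> {cb D, cs D, cst D}" for \<phi> by (rule measurable_slopes[OF ms[OF that]])+
  have prog: "progressive (bT B) (filt B) borel (\<lambda>t \<omega>. \<phi> t (x t \<omega>) (v t \<omega>) (m t \<omega>))"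
    if "\<phi> \<in> {cb D, cs D, cst D}" "progressive (bT B) (filt B) borel x" "progressive (bT B) (filt B) borel v" for \<phi> x v
    by (rule progressive_coeff[OF ms[OF that(1)] that(2,3) m_prog])
  have abs: "square_integrable N (\<lambda>z. \<bar>y z\<bar>)" if "square_integrable N y" for N :: "'c measure" and y
    using that by (auto simp: square_integrable_def)
  show ?thesis
  proof (intro affine_control.intro affine_control_axioms.intro brownian_basis_axioms)
    show "square_integrable PM (flat (\<lambda>t \<omega>. norm2 (m t \<omega>) + \<bar>X0 t \<omega>\<bar>))"
      using S2_proc_square_integrable(2)[OF m_norm] S2_proc_square_integrable(2)[OF X0]
      by (intro square_integrable_add abs) (simp_all add: L2_proc_iff)
    show "square_integrable (bM B) (\<lambda>\<omega>. norm2 (m (bT B) \<omega>) + \<bar>X0 (bT B) \<omega>\<bar>)"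
      using S2_proc_square_integrable(1)[OF m_norm T] S2_proc_square_integrable(1)[OF X0 T]
      by (intro square_integrable_add abs)
    show "(\<lambda>\<omega>. cg D (x \<omega>) (m (bT B) \<omega>) (X0 (bT B) \<omega>)) \<in> borel_measurable (bM B)" if "x \<in> borel_measurable (bM B)" for x
      using measurable_compose[OF measurable_Pair[OF that
            measurable_Pair[OF progressive_measurable_M[OF m_prog T] progressive_measurable_M[OF X0_prog T]]] mg] by simp
    show "cb D t x v (m t \<omega>) = cb D t 0 0 (m t \<omega>) + slope_x (bT B) (cb D) t * x + slope_u (bT B) (cb D) t * v"
      if "t \<in> {0..bT B}" "\<omega> \<in> space (bM B)" for t \<omega> x v
      by (rule affine_coeff_slopes(1)[OF aff L0 that(1) m_P2[OF that]]) simp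
    show "(if i = 0 then cs D else cst D) t x v (m t \<omega>) = (if i = 0 then cs D else cst D) t 0 0 (m t \<omega>)
        + slope_x (bT B) (if i = 0 then cs D else cst D) t * x + slope_u (bT B) (if i = 0 then cs D else cst D) t * v"
      if "t \<in> {0..bT B}" "\<omega> \<in> space (bM B)" for t \<omega> x v and i :: nat
      by (rule affine_coeff_slopes(1)[OF aff L0 that(1) m_P2[OF that]]) simp
    show "quad_regular (2 * L) (norm2 (m t \<omega>) + \<bar>X0 t \<omega>\<bar>) (\<lambda>x v. cf D t x v (m t \<omega>) (X0 t \<omega>))
        (\<lambda>x v. f1_x D t x v (X0 t \<omega>) + f2_x D t x (m t \<omega>) (X0 t \<omega>)) (\<lambda>x v. f1_u D t x v (X0 t \<omega>))"
      if "t \<in> {0..bT B}" "\<omega> \<in> space (bM B)" for t \<omega>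
      by (rule minor_cost_regular(1)[OF H2 L m_P2[OF that] that(1)])
    show "quad_regular (2 * L) (norm2 (m (bT B) \<omega>) + \<bar>X0 (bT B) \<omega>\<bar>) (\<lambda>x v. cg D x (m (bT B) \<omega>) (X0 (bT B) \<omega>))
        (\<lambda>x v. g_x D x (m (bT B) \<omega>) (X0 (bT B) \<omega>)) (\<lambda>x v. 0)" if "\<omega> \<in> space (bM B)" for \<omega>
      by (rule minor_cost_regular(2)[OF H2 L m_P2[OF T that]])
    show "strongly_convex (inverse L) (\<lambda>v. cf D t x v (m t \<omega>) (X0 t \<omega>)) (\<lambda>v. f1_u D t x v (X0 t \<omega>))"
      if "t \<in> {0..bT B}" "\<omega> \<in> space (bM B)" for t \<omega> x
      by (rule minor_cost_convex[OF H2 H3 L that(1) m_P2[OF that]])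
    show "0 \<le> norm2 (m t \<omega>) + \<bar>X0 t \<omega>\<bar>" for t \<omega> using norm2_nonneg[of "m t \<omega>"] by simp
    show "0 \<le> 2 * L" using L0 by simp
    fix x v :: "real \<Rightarrow> 'a \<Rightarrow> real"
    assume xv: "progressive (bT B) (filt B) borel x" "progressive (bT B) (filt B) borel v"
    show "progressive (bT B) (filt B) borel (\<lambda>t \<omega>. cb D t (x t \<omega>) (v t \<omega>) (m t \<omega>))"
      by (rule prog[OF _ xv]) simp
    show "progressive (bT B) (filt B) borel (\<lambda>t \<omega>. (if i = 0 then cs D else cst D) t (x t \<omega>) (v t \<omega>) (m t \<omega>))" for i :: nat
      by (rule prog[OF _ xv]) simp
    show "progressive (bT B) (filt B) borel (\<lambda>t \<omega>. cf D t (x t \<omega>) (v t \<omega>) (m t \<omega>) (X0 t \<omega>))"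
      by (rule progressive_coeff'[OF mf xv m_prog X0_prog])
  qed (rule bound slopes; simp)+
qed

text \<open>Increments of the Hamiltonian in \<open>v\<close> do not see \<open>m\<close>: the
  control slopes depend on time only and the measure part \<open>cf2\<close> of the cost contains no
  control. So all \<open>m\<close> share the same minimizers, and the one of the current flow may be
  used.\<close>

lemma argminF_eq:
  assumes H1: "H1 T L Lm lm D" and H2: "H2 T L lm lx0 D" and L: "0 \<le> L" and t: "t \<in> {0..T}" and m: "m \<in> P2"
  shows "argminF D t x p q qt y = (THE v. is_arg_min (\<lambda>v. ham D t x p q qt v m y) (\<lambda>_. True) v)"
proof -
  have aff: "affine_coeff T L Lm \<phi>" if "\<phi> \<in> {cb D, cs D, cst D}" for \<phi> using H1 that by (auto simp: H1_def)
  have coeff: "\<phi> t x v m' - \<phi> t x w m' = slope_u T \<phi> t * (v - w)" if "\<phi> \<in> {cb D, cs D, cst D}" "m' \<in> P2" for \<phi> v w m'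
    using affine_coeff_slopes(1)[OF aff[OF that(1)] L t that(2), of x v]
      affine_coeff_slopes(1)[OF aff[OF that(1)] L t that(2), of x w] by (simp add: algebra_simps)
  have diff: "ham D t x p q qt v m' y - ham D t x p q qt w m' y =
      (slope_u T (cb D) t * p + slope_u T (cs D) t * q + slope_u T (cst D) t * qt) * (v - w) + (cf1 D t x v y - cf1 D t x w y)"
    if "m' \<in> P2" for v w m'
  proof -
    have "ham D t x p q qt v m' y - ham D t x p q qt w m' y =
      (cb D t x v m' - cb D t x w m') * p + (cs D t x v m' - cs D t x w m') * q
        + (cst D t x v m' - cst D t x w m') * qt + (cf D t x v m' y - cf D t x w m' y)"
      by (simp add: ham_def algebra_simps)
    then show ?thesis
      using coeff[of "cb D" m' v w] coeff[of "cs D" m' v w] coeff[of "cst D" m' v w] that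
      by (simp add: H2D(9)[OF H2 t that] algebra_simps)
  qed
  have "is_arg_min (\<lambda>v. ham D t x p q qt v m' y) (\<lambda>_. True) v \<longleftrightarrow> is_arg_min (\<lambda>v. ham D t x p q qt v m y) (\<lambda>_. True) v"
    if "m' \<in> P2" for m' v
  proof -
    have "ham D t x p q qt w m' y < ham D t x p q qt v m' y \<longleftrightarrow> ham D t x p q qt w m y < ham D t x p q qt v m y" for w
      using diff[OF that, of w v] diff[OF m, of w v] by linarith
    then show ?thesis by (simp add: is_arg_min_def)
  qed
  then have "(\<forall>m\<in>P2. is_arg_min (\<lambda>v. ham D t x p q qt v m y) (\<lambda>_. True) v) \<longleftrightarrow>
      is_arg_min (\<lambda>v. ham D t x p q qt v m y) (\<lambda>_. True) v" for v using m by blast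
  then show ?thesis by (simp add: argminF_def)
qed

text \<open>The case \<open>d = 1\<close> of \<open>necessary_condition\<close>, after recognizing
  \<open>ham0\<close>, \<open>state0\<close> and \<open>cost0\<close> as instances of the abstract
  Hamiltonian, dynamics and cost.\<close>

lemma major_feedback:
  fixes B :: "'a setting"
  assumes B: "valid_setting B" and L: "1 \<le> L" and meas: "measurable_coeffs (bT B) D"
    and H1: "H1 (bT B) L Lm lm D" and H2: "H2 (bT B) L lm lx0 D" and H3: "H3 (bT B) L D"
    and m: "m \<in> P2_flow (bM B) (bT B) (filt0 B)"
    and u0: "u0 \<in> L2_0 B" and X0: "state0 B D u0 m X0"
    and minimal: "\<forall>v\<in>L2_0 B. \<forall>Y. state0 B D v m Y \<longrightarrow> cost0 B D m u0 X0 \<le> cost0 B D m v Y"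
    and p0: "adjoint0 B D u0 m X0 p0 q0"
  defines "\<alpha> \<equiv> feedback0 D X0 p0 q0 m"
  shows "eq_ae B u0 \<alpha>" and "\<alpha> \<in> L2_0 B" and "state0 B D \<alpha> m X0" and "adjoint0 B D \<alpha> m X0 p0 q0"
proof -
  interpret affine_control "bM B" "bT B" "filt0 B" 1 "\<lambda>i. bW0 B"
    "\<lambda>t \<omega> x v. cb0 D t x v (m t \<omega>)" "\<lambda>t \<omega> x v. cf0 D t x v (m t \<omega>)"
    "\<lambda>t \<omega> x v. f0_x D t x v (m t \<omega>)" "\<lambda>t \<omega> x v. f0_u D t x v (m t \<omega>)" "\<lambda>i t \<omega> x v. cs0 D t x v (m t \<omega>)"
    "slope_x (bT B) (cb0 D)" "slope_u (bT B) (cb0 D)" "\<lambda>i. slope_x (bT B) (cs0 D)" "\<lambda>i. slope_u (bT B) (cs0 D)"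
    "\<lambda>\<omega> x. cg0 D x (m (bT B) \<omega>)" "\<lambda>\<omega> x. g0_x D x (m (bT B) \<omega>)" "\<lambda>t \<omega>. norm2 (m t \<omega>)" L "inverse L"
    by (rule major_affine_control[OF B L meas H1 H2 H3 m])
  have H: "H t \<omega> P Q x v = ham0 D t x P (Q 0) v (m t \<omega>)" for t \<omega> P Q x v
    by (simp add: hamiltonian_def ham0_def)
  have noise: "noise h = [(h 0, bW0 B)]" for h by simp
  have controlled: "state0 B D v m Y \<longleftrightarrow> Y \<in> S2_0 B \<and> (AE \<omega> in bM B. Y 0 \<omega> = bxi0 B \<omega>) \<and> controlled Y v" for v Y
    by (simp only: state0_def controlled_def noise)
  have cost: "cost0 B D m v Y = cost_functional Y v" for v Y
    by (simp only: cost0_def cost_functional_def)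
  note X0' = X0[unfolded controlled]
  \<comment> \<open>Competitors of the abstract problem start from \<open>X0 0\<close>; this value
    is almost surely the initial datum, so they are competitors in (P).\<close>
  have min: "cost_functional X0 u0 \<le> cost_functional Y v"
    if "v \<in> L2_0 B" "Y \<in> S2_0 B" "AE \<omega> in bM B. Y 0 \<omega> = X0 0 \<omega>" "controlled Y v" for v Y
  proof -
    have "AE \<omega> in bM B. X0 0 \<omega> = bxi0 B \<omega>" using X0' by blast
    with that(3) have "AE \<omega> in bM B. Y 0 \<omega> = bxi0 B \<omega>" by eventually_elim simp
    then show ?thesis using minimal that(1,2,4) unfolding controlled cost by blast
  qed
  have p0': "p0 \<in> S2_0 B" "q0 \<in> L2_0 B" "AE \<omega> in bM B. p0 (bT B) \<omega> = g0_x D (X0 (bT B) \<omega>) (m (bT B) \<omega>)"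
    "ito_process (bM B) (bT B) (filt0 B) p0
       (\<lambda>t \<omega>. - ham0_x D t (X0 t \<omega>) (p0 t \<omega>) (q0 t \<omega>) (u0 t \<omega>) (m t \<omega>)) [(q0, bW0 B)]"
    using p0 by (auto simp: adjoint0_def)
  have \<alpha>: "\<alpha> t \<omega> = (THE v. is_arg_min (H t \<omega> (p0 t \<omega>) (\<lambda>i. q0 t \<omega>) (X0 t \<omega>)) (\<lambda>_. True) v)" for t \<omega>
    unfolding \<alpha>_def feedback0_def argmin0_def H[abs_def] ..
  note nc = necessary_condition[of X0 u0 p0 "\<lambda>i. q0" \<alpha>, unfolded H noise, folded ham0_x_def g0_x_def,
      OF _ u0 _ min p0'(1,2,4,3) \<alpha>[unfolded H]]
  show "eq_ae B u0 \<alpha>" unfolding eq_ae_def using nc(1) X0' by blast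
  show "\<alpha> \<in> L2_0 B" using nc(2) X0' by blast
  show "state0 B D \<alpha> m X0" unfolding controlled using nc(3) X0' by blast
  show "adjoint0 B D \<alpha> m X0 p0 q0" using nc(4) X0' p0' by (simp add: adjoint0_def)
qed

text \<open>The case \<open>d = 2\<close>, on the larger filtration and with the major state
  fixed.\<close>

lemma minor_feedback:
  fixes B :: "'a setting"
  assumes B: "valid_setting B" and L: "1 \<le> L" and meas: "measurable_coeffs (bT B) D"
    and H1: "H1 (bT B) L Lm lm D" and H2: "H2 (bT B) L lm lx0 D" and H3: "H3 (bT B) L D"
    and m: "m \<in> P2_flow (bM B) (bT B) (filt B)" and X0: "X0 \<in> S2_F B"
    and u: "u \<in> L2_F B" and X: "state B D u m X"
    and minimal: "\<forall>v\<in>L2_F B. \<forall>Y. state B D v m Y \<longrightarrow> cost B D X0 m u X \<le> cost B D X0 m v Y"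
    and p: "adjointF B D u m X0 X p q qt"
  defines "\<alpha> \<equiv> feedback D X p q qt X0"
  shows "eq_ae B u \<alpha>" and "\<alpha> \<in> L2_F B" and "state B D \<alpha> m X" and "adjointF B D \<alpha> m X0 X p q qt"
proof -
  interpret affine_control "bM B" "bT B" "filt B" 2 "\<lambda>i. if i = 0 then bW B else bW0 B"
    "\<lambda>t \<omega> x v. cb D t x v (m t \<omega>)" "\<lambda>t \<omega> x v. cf D t x v (m t \<omega>) (X0 t \<omega>)"
    "\<lambda>t \<omega> x v. f1_x D t x v (X0 t \<omega>) + f2_x D t x (m t \<omega>) (X0 t \<omega>)" "\<lambda>t \<omega> x v. f1_u D t x v (X0 t \<omega>)"
    "\<lambda>i t \<omega> x v. (if i = 0 then cs D else cst D) t x v (m t \<omega>)"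
    "slope_x (bT B) (cb D)" "slope_u (bT B) (cb D)"
    "\<lambda>i. slope_x (bT B) (if i = 0 then cs D else cst D)" "\<lambda>i. slope_u (bT B) (if i = 0 then cs D else cst D)"
    "\<lambda>\<omega> x. cg D x (m (bT B) \<omega>) (X0 (bT B) \<omega>)" "\<lambda>\<omega> x. g_x D x (m (bT B) \<omega>) (X0 (bT B) \<omega>)"
    "\<lambda>t \<omega>. norm2 (m t \<omega>) + \<bar>X0 t \<omega>\<bar>" "2 * L" "inverse L"
    by (rule minor_affine_control[OF B L meas H1 H2 H3 m X0])
  have L0: "0 \<le> L" using L by simp
  \<comment> \<open>The two integrands of the adjoint as one family, in the order of the noises:
    \<open>q\<close> for \<open>bW B\<close>, then \<open>qt\<close> for
    \<open>bW0 B\<close>.\<close>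
  define Q where "Q i = (if i = 0 then q else qt)" for i :: nat
  have H: "H t \<omega> P R x v = ham D t x P (R 0) (R 1) v (m t \<omega>) (X0 t \<omega>)" for t \<omega> P R x v
    by (simp add: hamiltonian_def ham_def numeral_2_eq_2 lessThan_Suc)
  have noise: "noise h = [(h 0, bW B), (h 1, bW0 B)]" for h by (simp add: numeral_2_eq_2)
  have controlled: "state B D v m Y \<longleftrightarrow> Y \<in> S2_F B \<and> (AE \<omega> in bM B. Y 0 \<omega> = bxi B \<omega>) \<and> controlled Y v" for v Y
    by (simp only: state_def controlled_def noise if_True zero_neq_one[symmetric] if_False simp_thms)
  have cost: "cost B D X0 m v Y = cost_functional Y v" for v Y
    by (simp only: cost_def cost_functional_def)
  note X' = X[unfolded controlled]
  have min: "cost_functional X u \<le> cost_functional Y v"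
    if "v \<in> L2_F B" "Y \<in> S2_F B" "AE \<omega> in bM B. Y 0 \<omega> = X 0 \<omega>" "controlled Y v" for v Y
  proof -
    have "AE \<omega> in bM B. X 0 \<omega> = bxi B \<omega>" using X' by blast
    with that(3) have "AE \<omega> in bM B. Y 0 \<omega> = bxi B \<omega>" by eventually_elim simp
    then show ?thesis using minimal that(1,2,4) unfolding controlled cost by blast
  qed
  have p': "p \<in> S2_F B" "q \<in> L2_F B" "qt \<in> L2_F B"
    "AE \<omega> in bM B. p (bT B) \<omega> = g_x D (X (bT B) \<omega>) (m (bT B) \<omega>) (X0 (bT B) \<omega>)"
    "ito_process (bM B) (bT B) (filt B) p
       (\<lambda>t \<omega>. - ham_x D t (X t \<omega>) (p t \<omega>) (q t \<omega>) (qt t \<omega>) (u t \<omega>) (m t \<omega>) (X0 t \<omega>)) [(q, bW B), (qt, bW0 B)]"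
    using p by (auto simp: adjointF_def)
  have Q: "Q 0 = q" "Q 1 = qt" "Q i \<in> L2_F B" for i using p' by (auto simp: Q_def)
  have \<alpha>: "\<alpha> t \<omega> = (THE v. is_arg_min (H t \<omega> (p t \<omega>) (\<lambda>i. Q i t \<omega>) (X t \<omega>)) (\<lambda>_. True) v)"
    if "t \<in> {0..bT B}" "\<omega> \<in> space (bM B)" for t \<omega>
    unfolding \<alpha>_def feedback_def argminF_eq[OF H1 H2 L0 that(1) P2_flow_norm2(3)[OF m that]] H[abs_def] Q ..
  note nc = necessary_condition[of X u p Q \<alpha>, unfolded H noise Q, folded ham_x_def g_x_def,
      OF _ u _ min p'(1) _ p'(5,4) \<alpha>[unfolded H Q]]
  show "eq_ae B u \<alpha>" unfolding eq_ae_def using nc(1) X' Q by blast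
  show "\<alpha> \<in> L2_F B" using nc(2) X' Q by blast
  show "state B D \<alpha> m X" unfolding controlled using nc(3) X' Q by blast
  show "adjointF B D \<alpha> m X0 X p q qt" using nc(4) X' p' Q by (simp add: adjointF_def)
qed

text \<open>Both players are treated with the flow \<open>m\<close> witnessing (P). Neither exchange
  of a control for its feedback alters the state processes, so \<open>m\<close> remains the flow of
  conditional laws and the two halves combine into (F).\<close>

theorem theorem3p4:
  fixes B :: "'a setting" and D :: coeffs and L Lm lm lx0 :: real
    and u0 u X0 X p0 q0 p q qt :: "real \<Rightarrow> 'a \<Rightarrow> real"
    and m :: "real \<Rightarrow> 'a \<Rightarrow> real measure"
  assumes "valid_setting B"
    and "L \<ge> 1" and "0 \<le> Lm" and "0 \<le> lm" and "0 \<le> lx0" and "Max {Lm, lm, lx0} \<le> L"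
    and "measurable_coeffs (bT B) D"
    and "H1 (bT B) L Lm lm D"
    and "H2 (bT B) L lm lx0 D"
    and "H3 (bT B) L D"
    and "solves_P B D u0 u m X0 X"
    and "adjoint0 B D u0 m X0 p0 q0"
    and "adjointF B D u m X0 X p q qt"
  shows "eq_ae B u0 (feedback0 D X0 p0 q0 m)
    \<and> eq_ae B u (feedback D X p q qt X0)
    \<and> solves_F B D m X0 p0 q0 X p q qt"
proof -
  have P: "u0 \<in> L2_0 B" "u \<in> L2_F B" "state0 B D u0 m X0" "state B D u m X"
    "\<forall>v\<in>L2_0 B. \<forall>Y. state0 B D v m Y \<longrightarrow> cost0 B D m u0 X0 \<le> cost0 B D m v Y"
    "\<forall>v\<in>L2_F B. \<forall>Y. state B D v m Y \<longrightarrow> cost B D X0 m u X \<le> cost B D X0 m v Y"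
    "cond_law_flow B X m"
    using assms(11) by (auto simp: solves_P_def)
  have m: "m \<in> P2_flow (bM B) (bT B) (filt0 B)" using P(7) by (simp add: cond_law_flow_def)
  have X0: "X0 \<in> S2_F B" using P(3) by (simp add: state0_def S2_0_S2_F)
  note major = major_feedback[OF assms(1,2,7-10) m P(1,3,5) assms(12)]
  note minor = minor_feedback[OF assms(1,2,7-10) P2_flow_filt0_filt[OF m] X0 P(2,4,6) assms(13)]
  show ?thesis using major minor P(7) by (simp add: solves_F_def)
qed

end
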